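(* Let $k\ge3$. For parameters $\alpha_2,\dots,\alpha_k\in[\frac12,1]$ let $F(x_1,\dots,x_k)=x_1^k+\alpha_2x_2^k+\cdots+\alpha_kx_k^k$, let $c=|\{x\in\mathbb R_+^k:\ F(x)\le1\}|$, and for $T>0$ and $a<b$ let $$R(a,b,T)=\frac1T\Big|\big\{(\bar m,\bar n)\in\mathbb Z_+^k\times\mathbb Z_+^k:\ \bar m\neq\bar n,\ F(\bar m)\le T,\ F(\bar n)\le T,\ F(\bar m)-F(\bar n)\in[a,b]\big\}\Big|.$$ Then there is some $\rho>0$ such that for Lebesgue-almost every $(\alpha_2,\dots,\alpha_k)\in[\frac12,1]^{k-1}$ the following holds: as $T\to\infty$, uniformly over $0<a<b$ with $b=O(1)$ and $b-a>T^{-\rho}$, $$R(a,b,T)\sim c^2(b-a),$$ i.e. for every constant $C>0$, $\sup\big|R(a,b,T)/(c^2(b-a))-1\big|\to0$ as $T\to\infty$, the supremum being over all $0<a<b\le C$ with $b-a>T^{-\rho}$.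
   Context: $\mathbb Z_+$ denotes the nonnegative integers and $\mathbb R_+$ the nonnegative reals; $|\cdot|$ denotes cardinality for finite sets of lattice points and Lebesgue measure for subsets of $\mathbb R^k$. The constant $c$ depends on $\alpha_2,\dots,\alpha_k$. *)

theory Defs
  imports "HOL-Analysis.Analysis"
begin

text \<open>
  Vectors indexed by \<open>{1..k}\<close> (or by \<open>{2..k}\<close>, for the parameters) are extensional functions, i.e.
  elements of \<open>{1..k} \<rightarrow>\<^sub>E UNIV\<close>, so that \<open>k\<close> can be an ordinary natural number and distinct
  functions are distinct vectors.  Lebesgue measure on them is the finite product of \<open>lborel\<close>; since
  only Borel sets and null sets matter, completing it would change nothing.
\<close>

definition F :: "nat \<Rightarrow> (nat \<Rightarrow> real) \<Rightarrow> (nat \<Rightarrow> real) \<Rightarrow> real" where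
  "F k \<alpha> x = x 1 ^ k + (\<Sum>i=2..k. \<alpha> i * x i ^ k)"

definition c :: "nat \<Rightarrow> (nat \<Rightarrow> real) \<Rightarrow> real" where
  "c k \<alpha> = measure (PiM {1..k} (\<lambda>_. lborel)) {x \<in> {1..k} \<rightarrow>\<^sub>E {0..}. F k \<alpha> x \<le> 1}"

text \<open>
  For \<open>\<alpha> i > 0\<close> the set counted here is finite, so \<open>card\<close> is the true cardinality.
\<close>

definition R :: "nat \<Rightarrow> (nat \<Rightarrow> real) \<Rightarrow> real \<Rightarrow> real \<Rightarrow> real \<Rightarrow> real" where
  "R k \<alpha> a b T = 1 / T * real (card
     {(m, n). m \<in> {1..k} \<rightarrow>\<^sub>E (UNIV :: nat set) \<and> n \<in> {1..k} \<rightarrow>\<^sub>E (UNIV :: nat set) \<and> m \<noteq> n \<and>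
        F k \<alpha> (\<lambda>i. real (m i)) \<le> T \<and> F k \<alpha> (\<lambda>i. real (n i)) \<le> T \<and>
        F k \<alpha> (\<lambda>i. real (m i)) - F k \<alpha> (\<lambda>i. real (n i)) \<in> {a..b}})"

end

theory Submission
  imports Defs "HOL-Computational_Algebra.Primes"
begin

text \<open>
  Write \<open>A i = m i ^ k - n i ^ k\<close> for a pair of lattice points, so that
  \<open>F m - F n = A 1 + (\<Sum>i=2..k. \<alpha> i * A i)\<close>.  On the coarse scale \<open>L = N powr (k - 1/2)\<close>, with \<open>N\<close>
  of order \<open>T powr (1/k)\<close>, the pairs whose difference lies in \<open>[0, L)\<close> are counted, for every
  \<open>\<alpha>\<close>, by comparing the number of lattice points in \<open>F \<le> t\<close> with the volume \<open>c * t\<close>.  To descend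
  to intervals of length \<open>N powr (-r)\<close> one bounds the second moment, over \<open>\<alpha>\<close>, of the difference
  between the fine and the coarse density.  Two pairs, with vectors \<open>A\<close> and \<open>A'\<close>, contribute as
  follows.

  If some minor \<open>A 2 * A' j - A' 2 * A j\<close> is large, then \<open>(\<alpha> 2, \<alpha> j)\<close> may be replaced by the two
  differences as variables of integration, and the contributions of the two scales agree up to
  the variation of a Lipschitz weight, hence cancel.  If all these minors are small, then \<open>A'\<close>
  lies in a thin tube around the line spanned by \<open>A\<close>, and such pairs are few; this needs
  non-trivial bounds for the number of solutions of \<open>m ^ k - n ^ k \<in> [X, X + w]\<close>.  Pairs with an
  abnormally small \<open>A i\<close> are discarded by a first moment estimate.

  All of these bounds save a power of \<open>N\<close>, so that they can be summed along \<open>T = (1 + h) ^ j\<close>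
  and over all cells of a grid, and hold for almost every \<open>\<alpha>\<close> simultaneously.  Replacing the
  condition \<open>F m \<le> T\<close> by one with a nearby rational coefficient vector makes the set of
  admissible \<open>m\<close> independent of \<open>\<alpha>\<close> in the second moment.
\<close>

section \<open>Divisors\<close>

text \<open>Only \<open>m\<close> has to be restricted: \<open>F m - F n \<ge> a > 0\<close> forces
  \<open>F n < F m\<close>, so \<open>m\<close> may range over any fixed set and \<open>n\<close>
  over a whole box. The decisive count is that of couples of pairs in a tube of width w: about
  N^(2k) * N^2 * s^(k-1), where s counts the points in a window of length about w. Each weighs about
  l^2 / (N^k * w), against a total of l^2 * N^(2k), so s^(k-1) must stay below N^(k-2-\<delta>) * w.
  At w = N the divisor bound s ~ w and the spacing bound s ~ N both give N^(k-1), with nothing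
  saved; hence the curvature bound there. The spacing bound saves nothing again at w = N^k, so the
  tube ends at N^(k-1/8). Outside it the Lipschitz error L * N^k / d^2, with L = N^(k-1/2) and d >=
  N^(2k-1/8-e), is N^(-2k-1/4+2e), still smaller than the density N^(-2k). Finally \<open>e\<close>
  is the loss allowed in the size of each \<open>A i\<close>, and r = e / (8 * k^2) is an eighth of
  the saving e / k^2 that the discarded pairs give, enough to pay for N^(2r) cells, for logarithms
  and for short intervals.\<close>

lemma card_divisors_prime_power_mult:
  fixes p u i :: nat
  assumes "prime p" "u > 0"
  shows "card {d. d dvd p ^ i * u} \<le> (i + 1) * card {d. d dvd u}"
proof -
  have "{d. d dvd p ^ i * u} \<subseteq> (\<lambda>(j, d'). p ^ j * d') ` ({..i} \<times> {d. d dvd u})"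
  proof
    fix d assume "d \<in> {d. d dvd p ^ i * u}"
    then obtain b c where bc: "d = b * c" "b dvd p ^ i" "c dvd u"
      using division_decomp by blast
    then obtain j where "j \<le> i" "b = p ^ j"
      using assms(1) divides_primepow_nat by blast
    then show "d \<in> (\<lambda>(j, d'). p ^ j * d') ` ({..i} \<times> {d. d dvd u})"
      using bc by force
  qed
  moreover have "finite ({..i} \<times> {d. d dvd u})" using assms(2) by simp
  ultimately have "card {d. d dvd p ^ i * u} \<le> card ({..i} \<times> {d. d dvd u})"
    using card_image_le[of _ "\<lambda>(j, d'). p ^ j * d'"] by (meson card_mono finite_imageI le_trans)
  then show ?thesis by (simp add: card_cartesian_product)
qed

text \<open>Strip a prime \<open>p\<close> with its full exponent \<open>i\<close>: the divisor
  count gains at most a factor \<open>i + 1\<close>. If p^e >= 2, this is at most 2^i <= p^(i*e).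
  The primes below \<open>P\<close> each cost an extra factor \<open>C0\<close>, and there are at
  most \<open>P\<close> of them, whatever \<open>v\<close> is.\<close>

lemma card_divisors_le_powr:
  fixes e :: real
  assumes "e > 0"
  shows "\<exists>C>0. \<forall>v::nat. v > 0 \<longrightarrow> real (card {d. d dvd v}) \<le> C * real v powr e"
proof -
  define P where "P = nat \<lceil>2 powr (1 / e)\<rceil>"
  \<comment> \<open>Chosen so that i + 1 <= C0 * (1 + e * ln 2 * i); the second factor is at most
    2^(e*i) by convexity of exp.\<close>
  define C0 where "C0 = 1 + 1 / (e * ln 2)"
  have lin: "real i + 1 \<le> C0 * 2 powr (e * real i)" for i
  proof -
    have "1 + e * ln 2 * real i \<le> exp (e * ln 2 * real i)" by (rule exp_ge_add_one_self)
    also have "\<dots> = 2 powr (e * real i)" by (simp add: powr_def mult_ac)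
    finally have a: "1 + e * ln 2 * real i \<le> 2 powr (e * real i)" .
    have "real i + 1 \<le> C0 * (1 + e * ln 2 * real i)"
      using assms by (simp add: C0_def field_simps)
    also have "\<dots> \<le> C0 * 2 powr (e * real i)"
      using a assms by (intro mult_left_mono) (auto simp: C0_def)
    finally show ?thesis .
  qed
  have C0: "C0 \<ge> 1" using assms by (simp add: C0_def)
  \<comment> \<open>The induction has to keep track of the small primes still present, since the
    constant is paid once for each of them.\<close>
  define f where "f v = card {p. p < P \<and> prime p \<and> p dvd v}" for v :: nat
  have main: "real (card {d. d dvd v}) \<le> C0 ^ f v * real v powr e" if "v > 0" for v
    using that
  proof (induction v rule: less_induct)
    case (less v)
    show ?case
    proof (cases "v = 1")
      case True
      then show ?thesis using C0 by simp
    next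
      case False
      then obtain p where p: "prime p" "p dvd v"
        using prime_factor_nat[of v] by auto
      define i where "i = multiplicity p v"
      obtain u where u: "v = p ^ i * u" "\<not> p dvd u"
        using multiplicity_decompose'[of v p] less.prems prime_gt_1_nat[OF p(1)] i_def by auto
      have i0: "i > 0" using p less.prems prime_gt_1_nat[OF p(1)] i_def
        by (simp add: multiplicity_gt_zero_iff)
      have u0: "u > 0" using u(1) less.prems by (cases u) auto
      have "1 < p ^ i" using i0 prime_gt_1_nat[OF p(1)] by (intro one_less_power)
      then have "u < v" using u(1) u0 by simp
      then have IH: "real (card {d. d dvd u}) \<le> C0 ^ f u * real u powr e"
        using less.IH u0 by blast
      have dv: "q dvd v \<longleftrightarrow> q = p \<or> q dvd u" if "prime q" for q
      proof
        assume "q dvd v"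
        then have "q dvd p ^ i \<or> q dvd u" unfolding u(1) using that by (simp add: prime_dvd_mult_iff)
        then show "q = p \<or> q dvd u"
          using prime_dvd_power[OF that, of p i] primes_dvd_imp_eq[OF that p(1)] by blast
      qed (use p(2) u(1) in auto)
      have pe: "(real i + 1) * C0 ^ f u \<le> C0 ^ f v * real (p ^ i) powr e"
      proof (cases "p < P")
        case True
        have eq: "{q. q < P \<and> prime q \<and> q dvd v} = insert p {q. q < P \<and> prime q \<and> q dvd u}"
          using True dv by (auto simp: p(1))
        have "f v = Suc (f u)" unfolding f_def eq using u(2) by (subst card_insert_disjoint) auto
        moreover have "real i + 1 \<le> C0 * real (p ^ i) powr e"
        proof -
          have "2 powr (e * real i) \<le> real p powr (e * real i)"
            using prime_ge_2_nat[OF p(1)] assms by (intro powr_mono2) auto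
          also have "\<dots> = real (p ^ i) powr e"
            using prime_gt_0_nat[OF p(1)]
            by (simp add: powr_powr powr_realpow[symmetric] mult.commute)
          finally have "C0 * 2 powr (e * real i) \<le> C0 * real (p ^ i) powr e"
            using C0 by (intro mult_left_mono) auto
          then show ?thesis using lin[of i] by linarith
        qed
        ultimately have "(real i + 1) * C0 ^ f u \<le> (C0 * real (p ^ i) powr e) * C0 ^ f u"
          using C0 by (intro mult_right_mono) auto
        then show ?thesis using \<open>f v = Suc (f u)\<close> by (simp add: mult_ac)
      next
        case False
        have eq: "{q. q < P \<and> prime q \<and> q dvd v} = {q. q < P \<and> prime q \<and> q dvd u}"
          using False dv by auto
        have "2 powr (1 / e) \<le> real p" using False unfolding P_def by linarith
        then have "(2 powr (1 / e)) powr e \<le> real p powr e"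
          using assms by (intro powr_mono2) auto
        then have "2 \<le> real p powr e" using assms by (simp add: powr_powr)
        then have "2 ^ i \<le> (real p powr e) ^ i" by (intro power_mono) auto
        also have "\<dots> = real (p ^ i) powr e"
          using prime_gt_0_nat[OF p(1)]
          by (simp add: powr_powr powr_realpow[symmetric] mult.commute)
        finally have "2 ^ i \<le> real (p ^ i) powr e" .
        moreover have "real i + 1 \<le> 2 ^ i" 
          using Bernoulli_inequality[of "1::real" i] by simp
        ultimately have "real i + 1 \<le> real (p ^ i) powr e" by linarith
        moreover have "f v = f u" unfolding f_def eq ..
        ultimately have "(real i + 1) * C0 ^ f u \<le> real (p ^ i) powr e * C0 ^ f u"
          using C0 by (intro mult_right_mono) auto
        then show ?thesis using \<open>f v = f u\<close> by (simp add: mult_ac)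
      qed
      have "real (card {d. d dvd v}) \<le> (real i + 1) * real (card {d. d dvd u})"
      proof -
        have "card {d. d dvd v} \<le> (i + 1) * card {d. d dvd u}"
          using card_divisors_prime_power_mult[OF p(1) u0, of i] by (simp only: u(1))
        then have "real (card {d. d dvd v}) \<le> real ((i + 1) * card {d. d dvd u})"
          by (simp only: of_nat_le_iff)
        then show ?thesis by (simp add: algebra_simps)
      qed
      also have "\<dots> \<le> (real i + 1) * (C0 ^ f u * real u powr e)"
        using IH by (intro mult_left_mono) auto
      also have "\<dots> = ((real i + 1) * C0 ^ f u) * real u powr e" by simp
      also have "\<dots> \<le> (C0 ^ f v * real (p ^ i) powr e) * real u powr e"
        using pe by (intro mult_right_mono) auto
      also have "\<dots> = C0 ^ f v * real v powr e"
        by (subst (2) u(1)) (simp add: powr_mult)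
      finally show ?thesis .
    qed
  qed
  have fP: "f v \<le> P" for v
    using card_mono[of "{..<P}" "{p. p < P \<and> prime p \<and> p dvd v}"] by (auto simp: f_def)
  have "real (card {d. d dvd v}) \<le> C0 ^ P * real v powr e" if "v > 0" for v
  proof -
    have "C0 ^ f v * real v powr e \<le> C0 ^ P * real v powr e"
      using power_increasing[OF fP[of v] C0] by (intro mult_right_mono) auto
    then show ?thesis using main[OF that] by linarith
  qed
  moreover have "C0 ^ P > 0" using C0 by simp
  ultimately show ?thesis by blast
qed

section \<open>Integer points close to the curve \<open>m ^ k - n ^ k = X\<close>\<close>

lemma power_diff_ge:
  fixes x y :: real
  assumes "0 \<le> x" "x \<le> y" "k \<ge> 1"
  shows "(y - x) * y ^ (k - 1) \<le> y ^ k - x ^ k"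
proof -
  obtain j where k: "k = Suc j" using assms(3) by (cases k) auto
  have "x * x ^ j \<le> x * y ^ j" using assms by (intro mult_left_mono power_mono) auto
  then show ?thesis by (simp add: k algebra_simps)
qed

lemma power_shift_mono:
  fixes a b s :: real
  assumes "0 \<le> b" "b \<le> a" "0 \<le> s"
  shows "(b + s) ^ k - b ^ k \<le> (a + s) ^ k - a ^ k"
proof (induction k)
  case (Suc k)
  have e: "(c + s) ^ Suc k - c ^ Suc k = (c + s) * ((c + s) ^ k - c ^ k) + s * c ^ k" for c :: real
    by (simp add: algebra_simps)
  have "0 \<le> (b + s) ^ k - b ^ k" using assms by (simp add: power_mono)
  then have "(b + s) * ((b + s) ^ k - b ^ k) \<le> (a + s) * ((a + s) ^ k - a ^ k)"
    using Suc assms by (intro mult_mono) auto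
  moreover have "s * b ^ k \<le> s * a ^ k" using assms by (intro mult_left_mono power_mono) auto
  ultimately show ?case unfolding e by linarith
qed simp

lemma card_le_if_close:
  fixes S :: "nat set"
  assumes "finite S" "d \<ge> 0" "\<And>x y. x \<in> S \<Longrightarrow> y \<in> S \<Longrightarrow> x < y \<Longrightarrow> real y - real x \<le> d"
  shows "real (card S) \<le> d + 1"
proof (cases "S = {}")
  case False
  have "S \<subseteq> {Min S..Min S + nat \<lfloor>d\<rfloor>}"
  proof
    fix y assume y: "y \<in> S"
    have m: "Min S \<in> S" "Min S \<le> y" using False assms(1) y by auto
    have "real y - real (Min S) \<le> d"
      using assms(2,3) m y by (cases "Min S = y") auto
    then have "y - Min S \<le> nat \<lfloor>d\<rfloor>" using m by linarith
    then show "y \<in> {Min S..Min S + nat \<lfloor>d\<rfloor>}" using m by auto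
  qed
  from card_mono[OF _ this] have "card S \<le> nat \<lfloor>d\<rfloor> + 1" by simp
  then show ?thesis using assms(2) by linarith
qed (use assms in auto)

text \<open>Integer points near the curve m^k - n^k = X. The floor \<open>y\<close> is kept apart
  from the window: the window may start anywhere, even below 0, and \<open>y\<close> alone keeps m^k
  large, which is what the spacing argument uses.\<close>

definition shell :: "nat \<Rightarrow> nat \<Rightarrow> real \<Rightarrow> real \<Rightarrow> real \<Rightarrow> (nat \<times> nat) set" where
  "shell k N y X w = {(m, n). m \<le> N \<and> n \<le> N \<and> y \<le> real m ^ k - real n ^ k \<and>
     X \<le> real m ^ k - real n ^ k \<and> real m ^ k - real n ^ k \<le> X + w}"

lemma finite_shell: "finite (shell k N y X w)"
  by (rule finite_subset[of _ "{..N} \<times> {..N}"]) (auto simp: shell_def)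

text \<open>Follows from m^k >= y and m <= N. Up to the factor k this is a lower bound for the
  derivative of m^k, so for fixed \<open>n\<close> the values m^k along the shell are at least y / N
  apart.\<close>

lemma shell_power_ge:
  assumes "(m, n) \<in> shell k N y X w" "k \<ge> 1" "N > 0"
  shows "y / real N \<le> real m ^ (k - 1)"
proof -
  obtain j where k: "k = Suc j" using assms(2) by (cases k) auto
  have "y \<le> real m ^ k" "real m \<le> real N" using assms(1) 
    by (auto simp: shell_def) (smt (verit) zero_le_power of_nat_0_le_iff)
  moreover have "real m ^ k \<le> real N * real m ^ j"
    unfolding k power_Suc using calculation by (intro mult_right_mono) auto
  ultimately show ?thesis using assms(3) by (simp add: k field_simps)
qed

lemma card_shell_fiber_le:
  assumes "k \<ge> 1" "N > 0" "y > 0" "w \<ge> 0"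
  shows "real (card {m. (m, n) \<in> shell k N y X w}) \<le> w / (y / real N) + 1"
proof (rule card_le_if_close)
  show "finite {m. (m, n) \<in> shell k N y X w}"
    by (rule finite_subset[of _ "{..N}"]) (auto simp: shell_def)
  show "0 \<le> w / (y / real N)" using assms by simp
  fix m m' assume m: "m \<in> {m. (m, n) \<in> shell k N y X w}" "m' \<in> {m. (m, n) \<in> shell k N y X w}" "m < m'"
  have Y: "y / real N > 0" using assms by simp
  have "(real m' - real m) * (y / real N) \<le> (real m' - real m) * real m' ^ (k - 1)"
    using m shell_power_ge[of m' n k N y X w] assms by (intro mult_left_mono) auto
  also have "\<dots> \<le> real m' ^ k - real m ^ k" using m assms by (intro power_diff_ge) auto
  also have "\<dots> \<le> w" using m by (auto simp: shell_def)
  finally show "real m' - real m \<le> w / (y / real N)" using Y by (simp only: pos_le_divide_eq)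
qed

lemma card_shell_le_spacing:
  assumes "k \<ge> 1" "N > 0" "y > 0" "w \<ge> 0"
  shows "real (card (shell k N y X w)) \<le> (real N + 1) * (w / (y / real N) + 1)"
proof -
  have "shell k N y X w \<subseteq> (\<Union>n\<in>{..N}. (\<lambda>m. (m, n)) ` {m. (m, n) \<in> shell k N y X w})"
    by (auto simp: shell_def)
  then have "card (shell k N y X w) \<le> card (\<Union>n\<in>{..N}. (\<lambda>m. (m, n)) ` {m. (m, n) \<in> shell k N y X w})"
  proof (rule card_mono[rotated])
    have "finite {m. (m, n) \<in> shell k N y X w}" for n
      by (rule finite_subset[of _ "{..N}"]) (auto simp: shell_def)
    then show "finite (\<Union>n\<in>{..N}. (\<lambda>m. (m, n)) ` {m. (m, n) \<in> shell k N y X w})" by simp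
  qed
  also have "\<dots> \<le> (\<Sum>n\<le>N. card ((\<lambda>m. (m, n)) ` {m. (m, n) \<in> shell k N y X w}))"
    by (rule card_UN_le) simp
  also have "\<dots> \<le> (\<Sum>n\<le>N. card {m. (m, n) \<in> shell k N y X w})"
  proof (intro sum_mono card_image_le)
    fix n show "finite {m. (m, n) \<in> shell k N y X w}"
      by (rule finite_subset[of _ "{..N}"]) (auto simp: shell_def)
  qed
  finally have "real (card (shell k N y X w)) \<le> (\<Sum>n\<le>N. real (card {m. (m, n) \<in> shell k N y X w}))"
    by (metis of_nat_le_iff of_nat_sum)
  also have "\<dots> \<le> (\<Sum>n\<le>N. w / (y / real N) + 1)"
    using assms by (intro sum_mono card_shell_fiber_le) auto
  finally show ?thesis by (simp add: algebra_simps)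
qed

text \<open>At most w + 1 integers \<open>v\<close> lie in the window, and a solution of m^k - n^k =
  v is determined by the divisor m - n of \<open>v\<close>.\<close>

lemma card_shell_le_divisors:
  assumes "k \<ge> 2" "y > 0" "w \<ge> 0" and D: "\<And>v::nat. 0 < v \<Longrightarrow> v \<le> N ^ k \<Longrightarrow> real (card {d. d dvd v}) \<le> D"
    and N: "N > 0"
  shows "real (card (shell k N y X w)) \<le> (w + 1) * D"
proof -
  define V where "V = {v::nat. 0 < v \<and> v \<le> N ^ k \<and> X \<le> real v \<and> real v \<le> X + w}"
  define f where "f v = {(m, n). (m, n) \<in> shell k N y X w \<and> m ^ k - n ^ k = v \<and> n < m}" for v
  have fV: "finite V" by (rule finite_subset[of _ "{..N ^ k}"]) (auto simp: V_def)
  have cV: "real (card V) \<le> w + 1"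
    by (rule card_le_if_close[OF fV assms(3)]) (auto simp: V_def)
  have sub: "shell k N y X w \<subseteq> (\<Union>v\<in>V. f v)"
  proof clarify
    fix m n assume a: "(m, n) \<in> shell k N y X w"
    then have h: "m \<le> N" "real n ^ k < real m ^ k" "X \<le> real m ^ k - real n ^ k" "real m ^ k - real n ^ k \<le> X + w"
      using assms(2) by (auto simp: shell_def)
    have nm: "n < m" using h(2) by (rule power_less_imp_less_base[of "real n" k "real m", simplified])
    have "n ^ k < m ^ k" using h(2) by (metis of_nat_less_iff of_nat_power)
    then have "real (m ^ k - n ^ k) = real m ^ k - real n ^ k" by (simp add: of_nat_diff)
    moreover have "m ^ k \<le> N ^ k" using h(1) by (simp add: power_mono)
    ultimately have "m ^ k - n ^ k \<in> V" using h \<open>n ^ k < m ^ k\<close> unfolding V_def by auto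
    then show "(m, n) \<in> (\<Union>v\<in>V. f v)" using a nm by (auto simp: f_def)
  qed
  have finf: "finite (f v)" for v
    by (rule finite_subset[OF _ finite_shell[of k N y X w]]) (auto simp: f_def)
  have D0: "D \<ge> 0" using D[of 1] N by simp
  have cf: "real (card (f v)) \<le> D" if "v \<in> V" for v
  proof -
    have inj: "inj_on (\<lambda>(m, n). m - n) (f v)"
    proof (rule inj_onI, clarify)
      fix m n m' n' :: nat
      assume a: "(m, n) \<in> f v" "(m', n') \<in> f v" and d: "m - n = m' - n'"
      have r: "n < m" "n' < m'" "m ^ k - n ^ k = v" "m' ^ k - n' ^ k = v" using a by (auto simp: f_def)
      \<comment> \<open>For k \<ge> 2 the increment of the k-th power over a fixed step grows
        strictly with the base point, so m - n and \<open>v\<close> together determine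
        \<open>n\<close>.\<close>
      have strict: "(p + d) ^ k - p ^ k < (q + d) ^ k - q ^ k" if "p < q" "d > 0" for p q d :: nat
      proof -
        define j where "j = k - 2"
        have k: "k = Suc (Suc j)" using assms(1) by (simp add: j_def)
        have e: "(real c + real d) ^ Suc (Suc j) - real c ^ Suc (Suc j)
           = (real c + real d) * ((real c + real d) ^ Suc j - real c ^ Suc j) + real d * real c ^ Suc j" for c
          by (simp add: algebra_simps)
        have m1: "(real p + real d) ^ Suc j - real p ^ Suc j \<le> (real q + real d) ^ Suc j - real q ^ Suc j"
          using that by (intro power_shift_mono) auto
        have m0: "0 < (real p + real d) ^ Suc j - real p ^ Suc j"
          using that power_strict_mono[of "real p" "real p + real d" "Suc j"] by simp
        have "(real p + real d) * ((real p + real d) ^ Suc j - real p ^ Suc j) < (real q + real d) * ((real q + real d) ^ Suc j - real q ^ Suc j)"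
          using that m1 m0 by (intro mult_less_le_imp_less) auto
        moreover have "real d * real p ^ Suc j \<le> real d * real q ^ Suc j"
          using that by (intro mult_left_mono power_mono) auto
        ultimately have "(real p + real d) ^ k - real p ^ k < (real q + real d) ^ k - real q ^ k"
          unfolding k e by linarith
        moreover have "real ((c + d) ^ k - c ^ k) = (real c + real d) ^ k - real c ^ k" for c
          by (simp add: of_nat_diff power_mono)
        ultimately show ?thesis by (metis of_nat_less_iff)
      qed
      define e where "e = m - n"
      have "e > 0" "m = n + e" "m' = n' + e" using r d by (auto simp: e_def)
      then have "n = n'" using strict[of n n' e] strict[of n' n e] r
        by (metis less_irrefl linorder_neqE_nat)
      then show "m = m' \<and> n = n'" using \<open>m = n + e\<close> \<open>m' = n' + e\<close> by simp
    qed
    have "(\<lambda>(m, n). m - n) ` f v \<subseteq> {d. d dvd v}"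
    proof clarify
      fix m n assume "(m, n) \<in> f v"
      then have h: "n < m" "m ^ k - n ^ k = v" by (auto simp: f_def)
      have "(int m - int n) dvd (int m ^ k - int n ^ k)"
        by (subst power_diff_sumr2) simp
      moreover have "int m - int n = int (m - n)" "int m ^ k - int n ^ k = int v"
        using h by (auto simp: of_nat_diff power_mono less_imp_le)
      ultimately show "m - n dvd v" by (metis int_dvd_int_iff)
    qed
    then have "card (f v) \<le> card {d. d dvd v}"
      using card_inj_on_le[OF inj] that by (auto simp: V_def)
    also have "real \<dots> \<le> D" using D that by (auto simp: V_def)
    finally show ?thesis by simp
  qed
  have "card (shell k N y X w) \<le> card (\<Union>v\<in>V. f v)"
    using sub fV finf by (intro card_mono) auto
  also have "\<dots> \<le> (\<Sum>v\<in>V. card (f v))" using fV by (rule card_UN_le)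
  finally have "real (card (shell k N y X w)) \<le> (\<Sum>v\<in>V. real (card (f v)))"
    by (metis of_nat_le_iff of_nat_sum)
  also have "\<dots> \<le> (\<Sum>v\<in>V. D)" using cf by (intro sum_mono) auto
  also have "\<dots> \<le> (w + 1) * D" using cV D0 by (simp add: mult_right_mono)
  finally show ?thesis .
qed

text \<open>
  In the critical range of \<open>w\<close> a small saving over the trivial bound comes from Jarnik's
  observation: close lattice points on a strictly convex curve are joined by short integer
  vectors, and each vector occurs as a chord at essentially one place of the curve.
\<close>

lemma card_le_close_pairs:
  fixes S :: "nat set" and \<mu> :: "nat \<Rightarrow> nat"
  assumes S: "S \<subseteq> {..N}" and H: "H > 0"
    and r: "\<And>n s. n \<in> S \<Longrightarrow> n + s \<in> S \<Longrightarrow> 0 < s \<Longrightarrow> s < H \<Longrightarrow>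
        int (\<mu> (n + s)) - int (\<mu> n) \<in> {-1..int H}"
    and Q: "\<And>s r. 0 < s \<Longrightarrow> s < H \<Longrightarrow>
        real (card {n \<in> S. n + s \<in> S \<and> int (\<mu> (n + s)) - int (\<mu> n) = r}) \<le> Q"
    and Q0: "Q \<ge> 0"
  shows "real (card S) \<le> real N / real H + 1 + real H * (real H + 2) * Q"
proof -
  have fS: "finite S" using S finite_subset by blast
  \<comment> \<open>The interval {0..N} is cut into blocks of length \<open>H\<close>. A point
    outside \<open>S1\<close> is the last one of \<open>S\<close> in its block, which leaves at most
    N / H + 1 of them; a point of \<open>S1\<close> has a later point of \<open>S\<close> at a
    distance below \<open>H\<close>.\<close>
  define S1 where "S1 = {n \<in> S. \<exists>n'\<in>S. n < n' \<and> n' div H = n div H}"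
  have "inj_on (\<lambda>n. n div H) (S - S1)"
  proof (rule inj_onI)
    fix x y assume "x \<in> S - S1" "y \<in> S - S1" "x div H = y div H"
    then show "x = y" by (cases x y rule: linorder_cases) (auto simp: S1_def)
  qed
  moreover have "(\<lambda>n. n div H) ` (S - S1) \<subseteq> {..N div H}"
    using S by (auto intro!: div_le_mono)
  ultimately have "card (S - S1) \<le> card {..N div H}" by (rule card_inj_on_le) simp
  then have a: "real (card (S - S1)) \<le> real N / real H + 1"
    using of_nat_div_le_of_nat[of N H, where ?'a = real] by simp
  \<comment> \<open>Points of \<open>S1\<close> sorted by chord vector (s, r): fewer than H values
    of \<open>s\<close> and H + 2 values of \<open>r\<close>.\<close>
  define f where "f = (\<lambda>(s, r). {n \<in> S. n + s \<in> S \<and> int (\<mu> (n + s)) - int (\<mu> n) = r})"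
  have "S1 \<subseteq> (\<Union>p\<in>{1..<H} \<times> {-1..int H}. f p)"
  proof
    fix n assume "n \<in> S1"
    then obtain n' where n': "n \<in> S" "n' \<in> S" "n < n'" "n' div H = n div H" by (auto simp: S1_def)
    define s where "s = n' - n"
    have s: "n' = n + s" "s > 0" using n' by (auto simp: s_def)
    have "n' div H * H + n' mod H = n'" "n' mod H < H" "n div H * H \<le> n" using H by auto
    then have "n' < n + H" unfolding n'(4) by linarith
    then have "s < H" using s by simp
    then show "n \<in> (\<Union>p\<in>{1..<H} \<times> {-1..int H}. f p)"
      using r[of n s] n' s by (force simp: f_def)
  qed
  moreover have "finite (\<Union>p\<in>{1..<H} \<times> {-1..int H}. f p)"
    using fS by (auto simp: f_def)
  ultimately have "card S1 \<le> card (\<Union>p\<in>{1..<H} \<times> {-1..int H}. f p)" by (intro card_mono)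
  also have "\<dots> \<le> (\<Sum>p\<in>{1..<H} \<times> {-1..int H}. card (f p))"
    by (intro card_UN_le) simp
  finally have "card S1 \<le> (\<Sum>p\<in>{1..<H} \<times> {-1..int H}. card (f p))" .
  then have "real (card S1) \<le> (\<Sum>p\<in>{1..<H} \<times> {-1..int H}. real (card (f p)))"
    by (metis of_nat_le_iff of_nat_sum)
  also have "\<dots> \<le> (\<Sum>p\<in>{1..<H} \<times> {-1..int H}. Q)"
    using Q by (intro sum_mono) (auto simp: f_def)
  also have "\<dots> = real (H - 1) * (real H + 2) * Q" by (simp add: card_cartesian_product)
  also have "\<dots> \<le> real H * (real H + 2) * Q" using Q0 by (intro mult_right_mono) auto
  finally have b: "real (card S1) \<le> real H * (real H + 2) * Q" .
  have "card S = card (S - S1) + card S1"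
    using fS by (simp add: S1_def card_Diff_subset card_mono)
  then show ?thesis using a b by simp
qed

text \<open>The expression bounding \<gamma> is the second derivative of \<open>g\<close>. The mean
  value theorem is applied twice: to t -> g(t + s) - g(t) between \<open>x\<close> and
  \<open>y\<close>, then to g' between the intermediate point \<xi> and \<xi> + s.\<close>

lemma root_curve_second_difference:
  fixes X s x y \<gamma> :: real and k :: nat
  defines "g \<equiv> \<lambda>t. (X + t ^ k) powr (1 / real k)"
  assumes k: "k \<ge> 2" and X: "X > 0" and x: "0 < x" "x < y" and s: "s > 0"
    and \<gamma>: "\<And>t. x \<le> t \<Longrightarrow> t \<le> y + s \<Longrightarrow>
        \<gamma> \<le> (real k - 1) * X * t ^ (k - 2) * (X + t ^ k) powr (1 / real k - 2)"
  shows "s * (y - x) * \<gamma> \<le> (g (y + s) - g y) - (g (x + s) - g x)"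
proof -
  define j where "j = k - 2"
  have kj: "k = Suc (Suc j)" using k by (simp add: j_def)
  define g1 where "g1 t = t ^ (k - 1) * (X + t ^ k) powr (1 / real k - 1)" for t
  define g2 where "g2 t = (real k - 1) * X * t ^ (k - 2) * (X + t ^ k) powr (1 / real k - 2)" for t
  have pos: "X + t ^ k > 0" if "t > 0" for t using X that by (simp add: add_pos_pos)
  have d1: "(g has_real_derivative g1 t) (at t)" if "t > 0" for t
  proof -
    have "(g has_real_derivative (1 / real k) * (X + t ^ k) powr (1 / real k - 1) * (real k * t ^ (k - 1))) (at t)"
      unfolding g_def using pos[OF that] by (auto intro!: derivative_eq_intros)
    then show ?thesis using k by (simp add: g1_def mult_ac)
  qed
  have d2: "(g1 has_real_derivative g2 t) (at t)" if "t > 0" for t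
  proof -
    have "(g1 has_real_derivative (real (k - 1) * t ^ (k - 2)) * (X + t ^ k) powr (1 / real k - 1) 
        + t ^ (k - 1) * ((1 / real k - 1) * (X + t ^ k) powr (1 / real k - 2) * (real k * t ^ (k - 1)))) (at t)"
      unfolding g1_def using pos[OF that] by (auto intro!: derivative_eq_intros simp: numeral_2_eq_2)
    moreover have "(X + t ^ k) powr (1 / real k - 1) = (X + t ^ k) * (X + t ^ k) powr (1 / real k - 2)"
      using pos[OF that] powr_add[of "X + t ^ k" 1 "1 / real k - 2"] by (simp add: algebra_simps)
    \<comment> \<open>The terms in t^(2k-2) cancel and leave the factor \<open>X\<close>: without
      the constant term the curve would be a straight line.\<close>
    moreover have "(real (k - 1) * t ^ (k - 2)) * ((X + t ^ k) * P) + t ^ (k - 1) * ((1 / real k - 1) * P * (real k * t ^ (k - 1)))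
        = (real k - 1) * X * t ^ (k - 2) * P" for P
      by (simp add: kj field_simps)
    ultimately show ?thesis unfolding g2_def by metis
  qed
  obtain \<xi> where \<xi>: "x < \<xi>" "\<xi> < y"
    "(g (y + s) - g y) - (g (x + s) - g x) = (y - x) * (g1 (\<xi> + s) - g1 \<xi>)"
  proof -
    have "\<exists>z>x. z < y \<and> (\<lambda>t. g (t + s) - g t) y - (\<lambda>t. g (t + s) - g t) x = (y - x) * (g1 (z + s) - g1 z)"
    proof (rule MVT2[OF x(2)])
      fix t assume "x \<le> t" "t \<le> y"
      then have "t > 0" using x by simp
      then show "((\<lambda>t. g (t + s) - g t) has_real_derivative g1 (t + s) - g1 t) (at t)"
        using d1[of "t + s"] d1[of t] s
        by (auto intro!: derivative_eq_intros DERIV_chain'[where f = "\<lambda>t. t + s" and g = g and E = "g1 (t + s)"]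
              intro: DERIV_diff simp: DERIV_shift)
    qed
    then show ?thesis using that by blast
  qed
  obtain \<zeta> where \<zeta>: "\<xi> < \<zeta>" "\<zeta> < \<xi> + s" "g1 (\<xi> + s) - g1 \<xi> = s * g2 \<zeta>"
    using MVT2[of \<xi> "\<xi> + s" g1 g2] d2 s \<xi> x by force
  have "\<gamma> \<le> g2 \<zeta>" unfolding g2_def using \<gamma> \<zeta> \<xi> by auto
  then have "(y - x) * (s * \<gamma>) \<le> (y - x) * (s * g2 \<zeta>)"
    using s x by (intro mult_left_mono) auto
  then show ?thesis using \<xi>(3) \<zeta>(3) by (simp add: mult_ac)
qed

text \<open>Solved for \<open>m\<close>, the shell lies within \<eta> above the convex curve m =
  g(n). If one chord vector (s, r) occurs at a < b, the second difference of \<open>g\<close> is at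
  most 2\<eta>, while convexity makes it at least s * (b - a) * \<gamma>; so all occurrences lie
  within 2\<eta> / \<gamma>. The values n < n0, where the curvature may degenerate, are counted
  trivially. The outer factor 2 bounds the number of \<open>m\<close> for one
  \<open>n\<close>.\<close>

lemma card_shell_le_curve:
  fixes k N n0 H :: nat and y X w :: real
  defines "\<eta> \<equiv> w / (y / real N)"
  defines "\<gamma> \<equiv> y * real n0 ^ (k - 2) * (real N / real N ^ (2 * k))"
  assumes k: "k \<ge> 2" and N: "N > 0" and y: "y > 0" "X \<ge> y" and w: "w \<ge> 0" "w \<le> y / real N"
    and H: "H > 0" and n0: "n0 > 0"
  shows "real (card (shell k N y X w)) \<le>
     2 * (real n0 + (real N / real H + 1 + real H * (real H + 2) * (2 * \<eta> / \<gamma> + 1)))"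
proof -
  define S0 where "S0 = {n. \<exists>m. (m, n) \<in> shell k N y X w}"
  define S where "S = S0 \<inter> {n0..}"
  define \<mu> where "\<mu> n = (SOME m. (m, n) \<in> shell k N y X w)" for n
  define g where "g t = (X + t ^ k) powr (1 / real k)" for t :: real
  have Y: "y / real N > 0" using y N by simp
  have \<eta>: "0 \<le> \<eta>" "\<eta> \<le> 1" unfolding \<eta>_def using w pos_divide_le_eq[OF Y, of w 1] Y
    by (auto simp del: divide_divide_eq_right)
  have \<gamma>: "\<gamma> > 0" using y n0 N by (simp add: \<gamma>_def)
  have fS0: "finite S0" "S0 \<subseteq> {..N}"
    using finite_subset[of S0 "{..N}"] by (auto simp: S0_def shell_def)
  have \<mu>: "(\<mu> n, n) \<in> shell k N y X w" if "n \<in> S0" for n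
    using that unfolding S0_def \<mu>_def by (auto intro: someI)
  have gk: "g t ^ k = X + t ^ k" "g t \<ge> 0" if "t \<ge> 0" for t
  proof -
    have p: "X + t ^ k > 0" using that y by (simp add: add_pos_nonneg)
    then have "g t ^ k = g t powr real k" unfolding g_def by (subst powr_realpow) auto
    also have "\<dots> = X + t ^ k" using p k by (simp add: g_def powr_powr)
    finally show "g t ^ k = X + t ^ k" .
  qed (simp add: g_def)
  have g\<mu>: "g (real n) \<le> real (\<mu> n)" "real (\<mu> n) \<le> g (real n) + \<eta>" "X + real n ^ k \<le> real N ^ k" if n: "n \<in> S0" for n
  proof -
    have h: "X + real n ^ k \<le> real (\<mu> n) ^ k" "real (\<mu> n) ^ k \<le> X + real n ^ k + w" "\<mu> n \<le> N"
      using \<mu>[OF n] by (auto simp: shell_def)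
    show a: "g (real n) \<le> real (\<mu> n)"
      using h(1) gk[of "real n"] power_mono_iff[of "g (real n)" "real (\<mu> n)" k] k by simp
    have "(real (\<mu> n) - g (real n)) * (y / real N) \<le> (real (\<mu> n) - g (real n)) * real (\<mu> n) ^ (k - 1)"
      using a shell_power_ge[OF \<mu>[OF n]] k N by (intro mult_left_mono) auto
    also have "\<dots> \<le> real (\<mu> n) ^ k - g (real n) ^ k"
      using a gk[of "real n"] k by (intro power_diff_ge) auto
    also have "\<dots> \<le> w" using h(2) gk[of "real n"] by simp
    finally have "real (\<mu> n) - g (real n) \<le> \<eta>" unfolding \<eta>_def using Y by (simp only: pos_le_divide_eq)
    then show "real (\<mu> n) \<le> g (real n) + \<eta>" by simp
    show "X + real n ^ k \<le> real N ^ k" using h(1,3) power_mono[of "real (\<mu> n)" "real N" k] by simp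
  qed
  \<comment> \<open>The slope of \<open>g\<close> lies between 0 and 1; together with \<eta> \<le> 1
    this confines the height \<open>r\<close> of a chord to {-1..H}.\<close>
  have gs: "g (real n) \<le> g (real n + real s)" "g (real n + real s) \<le> g (real n) + real s" for n s
  proof -
    have gn: "real n \<le> g (real n)"
    proof (rule ccontr)
      assume "\<not> ?thesis"
      then have "g (real n) ^ k < real n ^ k" using gk[of "real n"] k by (intro power_strict_mono) auto
      then show False using gk[of "real n"] y by simp
    qed
    show "g (real n) \<le> g (real n + real s)"
      unfolding g_def using y by (intro powr_mono2) (auto intro!: power_mono add_nonneg_nonneg)
    have "(real n + real s) ^ k - real n ^ k \<le> (g (real n) + real s) ^ k - g (real n) ^ k"
      using gn by (intro power_shift_mono) auto
    then have "g (real n + real s) ^ k \<le> (g (real n) + real s) ^ k"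
      using gk[of "real n"] gk[of "real n + real s"] by simp
    then show "g (real n + real s) \<le> g (real n) + real s"
      using k gk[of "real n"] gk[of "real n + real s"]
        power_mono_iff[of "g (real n + real s)" "g (real n) + real s" k] by simp
  qed
  have "real (card S) \<le> real N / real H + 1 + real H * (real H + 2) * (2 * \<eta> / \<gamma> + 1)"
  proof (rule card_le_close_pairs[where \<mu> = \<mu>])
    show "S \<subseteq> {..N}" using fS0 by (auto simp: S_def)
    show "0 \<le> 2 * \<eta> / \<gamma> + 1" using \<eta> \<gamma> by simp
  next
    fix n s assume a: "n \<in> S" "n + s \<in> S" "0 < s" "s < H"
    have "real (\<mu> (n + s)) - real (\<mu> n) \<le> real H" "-1 \<le> real (\<mu> (n + s)) - real (\<mu> n)"
      using g\<mu>[of n] g\<mu>[of "n + s"] gs[of n s] a \<eta> by (auto simp: S_def)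
    then show "int (\<mu> (n + s)) - int (\<mu> n) \<in> {-1..int H}" by auto
  next
    fix s :: nat and r :: int assume s: "0 < s" "s < H"
    show "real (card {n \<in> S. n + s \<in> S \<and> int (\<mu> (n + s)) - int (\<mu> n) = r}) \<le> 2 * \<eta> / \<gamma> + 1"
    proof (rule card_le_if_close)
      show "finite {n \<in> S. n + s \<in> S \<and> int (\<mu> (n + s)) - int (\<mu> n) = r}"
        using fS0 by (auto simp: S_def)
      show "0 \<le> 2 * \<eta> / \<gamma>" using \<eta> \<gamma> by simp
      fix a b assume a: "a \<in> {n \<in> S. n + s \<in> S \<and> int (\<mu> (n + s)) - int (\<mu> n) = r}"
        and b: "b \<in> {n \<in> S. n + s \<in> S \<and> int (\<mu> (n + s)) - int (\<mu> n) = r}" and ab: "a < b"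
      have ra: "real (\<mu> (a + s)) = real (\<mu> a) + of_int r" "real (\<mu> (b + s)) = real (\<mu> b) + of_int r"
        using a b by auto
      have "real s * (real b - real a) * \<gamma> \<le>
         ((X + (real b + real s) ^ k) powr (1 / real k) - (X + real b ^ k) powr (1 / real k)) -
         ((X + (real a + real s) ^ k) powr (1 / real k) - (X + real a ^ k) powr (1 / real k))"
      proof (rule root_curve_second_difference)
        fix t assume t: "real a \<le> t" "t \<le> real b + real s"
        have tn: "real n0 \<le> t" using a t by (auto simp: S_def)
        have X: "X > 0" using y by simp
        have Nk: "X + t ^ k \<le> real N ^ k"
        proof -
          have "t ^ k \<le> real (b + s) ^ k" using t by (intro power_mono) auto
          then show ?thesis using g\<mu>(3)[of "b + s"] b by (auto simp: S_def)
        qed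
        \<comment> \<open>The last factor of \<gamma>: the exponent 1/k - 2 is negative, so the
          worst case is the largest value of X + t^k, which is at most N^k.\<close>
        have "real N / real N ^ (2 * k) = (real N ^ k) powr (1 / real k - 2)"
        proof -
          have "(real N ^ k) powr (1 / real k - 2) = real N powr (real k * (1 / real k - 2))"
            using N by (simp add: powr_powr flip: powr_realpow)
          also have "real k * (1 / real k - 2) = 1 - real (2 * k)" using k by (simp add: field_simps)
          also have "real N powr (1 - real (2 * k)) = real N / real N ^ (2 * k)"
            using N by (simp add: powr_diff powr_realpow[symmetric])
          finally show ?thesis by simp
        qed
        also have "\<dots> \<le> (X + t ^ k) powr (1 / real k - 2)"
          using Nk X t k by (intro powr_mono2') (auto simp: field_simps intro!: add_pos_nonneg)
        finally have p: "real N / real N ^ (2 * k) \<le> (X + t ^ k) powr (1 / real k - 2)" .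
        have "\<gamma> \<le> X * t ^ (k - 2) * (X + t ^ k) powr (1 / real k - 2)"
          unfolding \<gamma>_def using y tn p by (intro mult_mono power_mono) auto
        also have "\<dots> \<le> (real k - 1) * (X * t ^ (k - 2) * (X + t ^ k) powr (1 / real k - 2))"
        proof -
          have "0 \<le> X * t ^ (k - 2) * (X + t ^ k) powr (1 / real k - 2)" using X tn by simp
          from mult_right_mono[OF _ this, of 1 "real k - 1"] show ?thesis using k by simp
        qed
        finally show "\<gamma> \<le> (real k - 1) * X * t ^ (k - 2) * (X + t ^ k) powr (1 / real k - 2)"
          by (simp add: mult_ac)
      qed (use k y a b ab s n0 in \<open>auto simp: S_def\<close>)
      also have "\<dots> = (g (real (b + s)) - g (real b)) - (g (real (a + s)) - g (real a))"
        by (simp add: g_def)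
      \<comment> \<open>Each \<mu> lies between \<open>g\<close> and g + \<eta>, and both chords
        have height \<open>r\<close>; of the four errors two have the favourable sign.\<close>
      also have "\<dots> \<le> 2 * \<eta>"
        using g\<mu>[of a] g\<mu>[of b] g\<mu>[of "a + s"] g\<mu>[of "b + s"] a b ra by (auto simp: S_def)
      finally have "real s * ((real b - real a) * \<gamma>) \<le> 2 * \<eta>" by (simp add: mult_ac)
      moreover have "1 * ((real b - real a) * \<gamma>) \<le> real s * ((real b - real a) * \<gamma>)"
        using s ab \<gamma> by (intro mult_right_mono) auto
      ultimately have "(real b - real a) * \<gamma> \<le> 2 * \<eta>" by simp
      then show "real b - real a \<le> 2 * \<eta> / \<gamma>" using \<gamma> by (simp only: pos_le_divide_eq)
    qed
  qed (use H in auto)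
  moreover have "card S0 \<le> n0 + card S"
  proof -
    have "S0 \<subseteq> {..<n0} \<union> S" by (auto simp: S_def)
    then have "card S0 \<le> card ({..<n0} \<union> S)" using fS0 by (intro card_mono) (auto simp: S_def)
    also have "\<dots> \<le> n0 + card S" using card_Un_le[of "{..<n0}" S] by simp
    finally show ?thesis .
  qed
  moreover have "real (card (shell k N y X w)) \<le> 2 * real (card S0)"
  proof -
    have fin: "finite {m. (m, n) \<in> shell k N y X w}" for n
      by (rule finite_subset[of _ "{..N}"]) (auto simp: shell_def)
    have "shell k N y X w \<subseteq> (\<Union>n\<in>S0. (\<lambda>m. (m, n)) ` {m. (m, n) \<in> shell k N y X w})"
      by (auto simp: S0_def)
    then have "card (shell k N y X w) \<le> card (\<Union>n\<in>S0. (\<lambda>m. (m, n)) ` {m. (m, n) \<in> shell k N y X w})"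
      using fin fS0 by (intro card_mono) auto
    also have "\<dots> \<le> (\<Sum>n\<in>S0. card ((\<lambda>m. (m, n)) ` {m. (m, n) \<in> shell k N y X w}))"
      using fS0 by (intro card_UN_le) auto
    also have "\<dots> \<le> (\<Sum>n\<in>S0. card {m. (m, n) \<in> shell k N y X w})"
      using fin by (intro sum_mono card_image_le) auto
    finally have "real (card (shell k N y X w)) \<le> (\<Sum>n\<in>S0. real (card {m. (m, n) \<in> shell k N y X w}))"
      by (metis of_nat_le_iff of_nat_sum)
    also have "\<dots> \<le> (\<Sum>n\<in>S0. 2)"
    proof (intro sum_mono)
      fix n
      have "real (card {m. (m, n) \<in> shell k N y X w}) \<le> w / (y / real N) + 1"
        using k N y w by (intro card_shell_fiber_le) auto
      then show "real (card {m. (m, n) \<in> shell k N y X w}) \<le> 2" using \<eta> by (simp add: \<eta>_def)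
    qed
    finally show ?thesis by simp
  qed
  ultimately show ?thesis by simp
qed

text \<open>
  The three ranges of \<open>w\<close> are treated by the divisor bound, the curvature bound and the spacing
  bound, respectively.
\<close>

lemma card_shell_power_le:
  fixes k :: nat and e :: real
  assumes k: "k \<ge> 3" and e: "0 < e" "e * real k \<le> 1 / 1000"
  shows "\<exists>C>0. \<forall>N X w. N > 0 \<longrightarrow> 1 \<le> w \<longrightarrow> w \<le> real N powr (real k - 1 / 10) \<longrightarrow>
     real (card (shell k N (real N powr (real k - e)) X w)) ^ (k - 1) \<le> C * real N powr (real k - 2 - 1 / 40) * w"
proof -
  obtain C1 where C1: "C1 > 0" "\<And>v::nat. v > 0 \<Longrightarrow> real (card {d. d dvd v}) \<le> C1 * real v powr (e / real k)"
    using card_divisors_le_powr[of "e / real k"] e k by auto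
  define C where "C = (2 * C1 + 56) ^ (k - 1)"
  have C: "C > 0" using C1 by (simp add: C_def)
  have small: "e * (real k - 1) \<le> 1 / 1000" "e \<le> 1 / 1000"
  proof -
    show "e * (real k - 1) \<le> 1 / 1000" using e by (simp add: algebra_simps)
    have "e * 1 \<le> e * real k" using e k by (intro mult_left_mono) auto
    then show "e \<le> 1 / 1000" using e(2) by linarith
  qed
  have k3: "real k \<ge> 3" using k by simp
  \<comment> \<open>Exponents for the divisor range w \<le> N powr (19/20): k - 2 of the factors
    \<open>w\<close> are replaced by that threshold and one is kept.\<close>
  have ex1: "(real k - 2) * (19 / 20) + e * (real k - 1) \<le> real k - 2 - 1 / 40"
  proof -
    have "(r - 2) * (19 / 20) + q \<le> r - 2 - 1 / 40" if "3 \<le> r" "q \<le> 1 / 1000" for r q :: real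
      using that by (simp add: field_simps)
    then show ?thesis using small(1) k3 by blast
  qed
  \<comment> \<open>Exponents for the spacing bound up to w = N powr (k - 1/10): the saving (k - 2)
    / 10 is at least 1/10 as k \<ge> 3.\<close>
  have ex2: "real k - 2 - (real k - 2) / 10 + e * (real k - 1) \<le> real k - 2 - 1 / 40"
  proof -
    have "r - 2 - (r - 2) / 10 + q \<le> r - 2 - 1 / 40" if "3 \<le> r" "q \<le> 1 / 1000" for r q :: real
      using that by (simp add: field_simps)
    then show ?thesis using small(1) k3 by blast
  qed
  have kk: "real (k - 1) = real k - 1" "real (k - 2) = real k - 2" using k by auto
  have "real (card (shell k N (real N powr (real k - e)) X w)) ^ (k - 1) \<le> C * real N powr (real k - 2 - 1 / 40) * w"
    if N: "N > 0" and w: "1 \<le> w" "w \<le> real N powr (real k - 1 / 10)" for N X w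
  proof -
    define x where "x = real N"
    have x: "x \<ge> 1" using N by (simp add: x_def)
    define y where "y = x powr (real k - e)"
    define c where "c = real (card (shell k N y X w))"
    have y0: "y > 0" using x by (simp add: y_def)
    have Y: "y / x = x powr (real k - 1 - e)" using x by (simp add: y_def powr_diff powr_add field_simps)
    have c0: "c \<ge> 0" by (simp add: c_def)
    have w_split: "w ^ (k - 1) = w ^ (k - 2) * w"
    proof -
      have "k - 1 = Suc (k - 2)" using k by simp
      then show ?thesis by (simp only: power_Suc2)
    qed
    have powx: "(x powr a) ^ j = x powr (real j * a)" for a and j :: nat
      using x by (simp add: powr_powr mult.commute flip: powr_realpow)
    have mono: "x powr a \<le> x powr b" if "a \<le> b" for a b using x that by (intro powr_mono) auto
    have bound: "B ^ (k - 1) \<le> C" if "0 \<le> B" "B \<le> 2 * C1 + 56" for B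
      unfolding C_def using that by (intro power_mono) auto
    have fin: "c ^ (k - 1) \<le> C * x powr (real k - 2 - 1 / 40) * w"
      if "c \<le> B * z" "0 \<le> B" "B \<le> 2 * C1 + 56" "0 \<le> z" "z ^ (k - 1) \<le> x powr (real k - 2 - 1 / 40) * w" for B z
    proof -
      have "c ^ (k - 1) \<le> (B * z) ^ (k - 1)" using that c0 by (intro power_mono) auto
      also have "\<dots> = B ^ (k - 1) * z ^ (k - 1)" by (rule power_mult_distrib)
      also have "\<dots> \<le> C * (x powr (real k - 2 - 1 / 40) * w)"
        using that bound[of B] C by (intro mult_mono) auto
      finally show ?thesis by simp
    qed
    \<comment> \<open>The divisor and spacing bounds both lose their saving exactly at w = N; a
      margin of 1/20 in the exponent on either side is left to the curvature bound.\<close>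
    consider (a) "w \<le> x powr (19 / 20)" | (b) "x powr (19 / 20) < w" "w \<le> x powr (21 / 20)"
      | (c) "x powr (21 / 20) < w" by linarith
    then have "c ^ (k - 1) \<le> C * x powr (real k - 2 - 1 / 40) * w"
    proof cases
      case a
      have "c \<le> (w + 1) * (C1 * x powr e)"
        unfolding c_def
      proof (rule card_shell_le_divisors)
        fix v :: nat assume v: "0 < v" "v \<le> N ^ k"
        have "real v powr (e / real k) \<le> (x ^ k) powr (e / real k)"
          using v e unfolding x_def by (intro powr_mono2) (auto simp flip: of_nat_power)
        also have "\<dots> = x powr e" using x k by (simp add: powr_powr flip: powr_realpow)
        finally show "real (card {d. d dvd v}) \<le> C1 * x powr e"
          using C1(2)[OF v(1)] C1(1) by (meson mult_left_mono less_imp_le order_trans)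
      qed (use k y0 w N in auto)
      also have "\<dots> \<le> (2 * w) * (C1 * x powr e)" using w C1 by (intro mult_right_mono) auto
      finally have 1: "c \<le> (2 * C1) * (w * x powr e)" by (simp add: mult_ac)
      have "w ^ (k - 2) \<le> (x powr (19 / 20)) ^ (k - 2)" using a w by (intro power_mono) auto
      then have "w ^ (k - 2) * w * x powr (e * (real k - 1)) \<le> x powr ((real k - 2) * (19 / 20)) * w * x powr (e * (real k - 1))"
        using w by (intro mult_right_mono) (auto simp: powx kk)
      also have "\<dots> = x powr ((real k - 2) * (19 / 20) + e * (real k - 1)) * w"
        by (simp add: powr_add mult_ac)
      also have "\<dots> \<le> x powr (real k - 2 - 1 / 40) * w"
        using w ex1 by (intro mult_right_mono mono) auto
      finally have "(w * x powr e) ^ (k - 1) \<le> x powr (real k - 2 - 1 / 40) * w"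
        unfolding power_mult_distrib w_split powx kk by (simp add: mult_ac)
      from fin[OF 1 _ _ _ this] show ?thesis using C1 w by simp
    next
      case b
      \<comment> \<open>Omitting n < n0 costs just the bound aimed at, N powr (19/20); N / H is at
        most N powr (9/10), and the chord term is at most of order H^2 * N powr (1/2), that is N
        powr (7/10).\<close>
      define n0 where "n0 = nat \<lceil>x powr (19 / 20)\<rceil>"
      define H where "H = nat \<lceil>x powr (1 / 10)\<rceil>"
      have p1: "1 \<le> x powr a" if "a \<ge> 0" for a using mono[of 0 a] that x by simp
      have n0: "x powr (19 / 20) \<le> real n0" "real n0 \<le> 2 * x powr (19 / 20)" "n0 > 0"
        using p1[of "19 / 20"] unfolding n0_def by linarith+
      have H: "x powr (1 / 10) \<le> real H" "real H \<le> 2 * x powr (1 / 10)" "H > 0"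
        using p1[of "1 / 10"] unfolding H_def by linarith+
      \<comment> \<open>Raising the start of the window to \<open>y\<close> loses no point and
        supplies the hypothesis X \<ge> y of the curvature bound.\<close>
      define X' where "X' = max X y"
      have "c \<le> real (card (shell k N y X' w))"
        unfolding c_def by (intro of_nat_mono card_mono finite_shell) (auto simp: shell_def X'_def)
      also have "\<dots> \<le> 2 * (real n0 + (real N / real H + 1 + real H * (real H + 2) *
          (2 * (w / (y / real N)) / (y * real n0 ^ (k - 2) * (real N / real N ^ (2 * k))) + 1)))"
      proof (rule card_shell_le_curve)
        have "w \<le> x powr (21 / 20)" by (rule b)
        also have "\<dots> \<le> x powr (real k - 1 - e)" using k3 small(2) by (intro mono) (auto simp: field_simps)
        finally show "w \<le> y / real N" using Y by (simp add: x_def)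
      qed (use k N y0 w n0 H in \<open>auto simp: X'_def\<close>)
      also have "\<dots> \<le> 2 * (2 * x powr (19 / 20) + (x powr (19 / 20) + x powr (19 / 20) + 24 * x powr (19 / 20)))"
      proof -
        have "x / real H \<le> x / x powr (1 / 10)"
          using x H p1[of "1 / 10"] by (intro divide_left_mono) auto
        also have "\<dots> = x powr (9 / 10)" using x powr_diff[of x 1 "1 / 10"] by simp
        also have "\<dots> \<le> x powr (19 / 20)" by (intro mono) auto
        finally have t1: "real N / real H \<le> x powr (19 / 20)" by (simp add: x_def)
        have t2: "1 \<le> x powr (19 / 20)" by (rule p1) simp
        have q: "2 * (w / (y / real N)) / (y * real n0 ^ (k - 2) * (real N / real N ^ (2 * k))) \<le> 2 * x powr (1 / 2)"
        proof -
          have g: "x powr (real k - e + (real k - 2) * (19 / 20) + 1 - 2 * real k) \<le> y * real n0 ^ (k - 2) * (x / x ^ (2 * k))"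
          proof -
            have "x powr (real k - e + (real k - 2) * (19 / 20) + 1 - 2 * real k)
              = y * (x powr (19 / 20)) ^ (k - 2) * (x / x ^ (2 * k))"
            proof -
              have "x powr (A + B + 1 - 2 * real k) = x powr A * x powr B * (x / x powr (2 * real k))" for A B
                using x by (simp add: powr_add powr_diff)
              moreover have "x ^ (2 * k) = x powr (2 * real k)" using x powr_realpow[of x "2 * k"] by simp
              ultimately show ?thesis unfolding y_def powx kk by (simp only:)
            qed
            also have "\<dots> \<le> y * real n0 ^ (k - 2) * (x / x ^ (2 * k))"
              using x y0 n0 by (intro mult_right_mono mult_left_mono power_mono) auto
            finally show ?thesis .
          qed
          have g0: "x powr (real k - e + (real k - 2) * (19 / 20) + 1 - 2 * real k) > 0" using x by simp
          have "w / (y / x) \<le> x powr (21 / 20) / x powr (real k - 1 - e)"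
            unfolding Y using b by (intro divide_right_mono) auto
          also have "\<dots> = x powr (21 / 20 - (real k - 1 - e))" by (rule powr_diff[symmetric])
          finally have "2 * (w / (y / x)) / (y * real n0 ^ (k - 2) * (x / x ^ (2 * k)))
            \<le> 2 * x powr (21 / 20 - (real k - 1 - e)) / x powr (real k - e + (real k - 2) * (19 / 20) + 1 - 2 * real k)"
            using g g0 by (intro frac_le) auto
          also have "\<dots> = 2 * x powr (21 / 20 - (real k - 1 - e) - (real k - e + (real k - 2) * (19 / 20) + 1 - 2 * real k))"
            by (subst times_divide_eq_right[symmetric], subst powr_diff[symmetric], rule refl)
          also have "\<dots> \<le> 2 * x powr (1 / 2)"
            using small(2) k3 by (intro mult_left_mono mono) (auto simp: field_simps)
          finally show ?thesis by (simp add: x_def)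
        qed
        have hh: "real H * (real H + 2) \<le> (2 * x powr (1 / 10)) * (4 * x powr (1 / 10))"
          using H p1[of "1 / 10"] by (intro mult_mono) auto
        have qq: "2 * (w / (y / real N)) / (y * real n0 ^ (k - 2) * (real N / real N ^ (2 * k))) + 1 \<le> 3 * x powr (1 / 2)"
          using q p1[of "1 / 2"] by linarith
        have q0: "0 \<le> 2 * (w / (y / real N)) / (y * real n0 ^ (k - 2) * (real N / real N ^ (2 * k))) + 1"
          using w y0 by auto
        have "real H * (real H + 2) * (2 * (w / (y / real N)) / (y * real n0 ^ (k - 2) * (real N / real N ^ (2 * k))) + 1)
           \<le> ((2 * x powr (1 / 10)) * (4 * x powr (1 / 10))) * (3 * x powr (1 / 2))"
          by (rule mult_mono[OF hh qq _ q0]) simp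
        also have "\<dots> = 24 * (x powr (1 / 10) * x powr (1 / 10) * x powr (1 / 2))" by simp
        also have "\<dots> = 24 * x powr (7 / 10)" by (simp flip: powr_add)
        also have "\<dots> \<le> 24 * x powr (19 / 20)" by (intro mult_left_mono mono) auto
        finally show ?thesis
          by (intro mult_left_mono add_mono) (assumption | rule n0 t1 t2 | simp)+
      qed
      finally have 1: "c \<le> 56 * x powr (19 / 20)" by simp
      have "(x powr (19 / 20)) ^ (k - 1) = x powr ((real k - 2) * (19 / 20)) * x powr (19 / 20)"
        unfolding powx kk powr_add[symmetric] by (rule arg_cong[where f = "\<lambda>a. x powr a"]) (simp add: field_simps)
      also have "\<dots> \<le> x powr (real k - 2 - 1 / 40) * w"
        using b k by (intro mult_mono mono) auto
      finally show ?thesis using fin[OF 1] C1 by simp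
    next
      case c
      have "c \<le> (real N + 1) * (w / (y / real N) + 1)"
        unfolding c_def using k N y0 w by (intro card_shell_le_spacing) auto
      also have "\<dots> \<le> (2 * x) * (w / (y / x) + 1)"
        using x w y0 by (intro mult_mono) (auto simp: x_def)
      finally have cx: "c \<le> (2 * x) * (w / (y / x) + 1)" .
      \<comment> \<open>Up to w = y / N a fibre has at most two points, so the count is O(N); beyond
        it the count grows like w * N powr (2 - k + e).\<close>
      show ?thesis
      proof (cases "w \<le> y / x")
        case True
        then have "w / (y / x) + 1 \<le> 2" using y0 x by (simp add: divide_simps)
        then have "(2 * x) * (w / (y / x) + 1) \<le> (2 * x) * 2" using x by (intro mult_left_mono) auto
        then have 1: "c \<le> 4 * x" using cx by simp
        have "x ^ (k - 1) = x powr (real k - 2 - 1 / 20) * x powr (21 / 20)"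
          using x unfolding powr_add[symmetric] by (simp add: kk flip: powr_realpow del: One_nat_def)
        also have "\<dots> \<le> x powr (real k - 2 - 1 / 40) * w"
          using c by (intro mult_mono mono) auto
        finally show ?thesis using fin[OF 1] C1 x by simp
      next
        case False
        then have "w / (y / x) + 1 \<le> 2 * (w / (y / x))" using y0 x by (simp add: divide_simps)
        then have "(2 * x) * (w / (y / x) + 1) \<le> (2 * x) * (2 * (w / (y / x)))" using x by (intro mult_left_mono) auto
        then have "c \<le> 4 * (x * (w / (y / x)))" using cx by simp
        also have "x * (w / (y / x)) = w * x powr (2 - real k + e)"
          unfolding Y using x powr_diff[of x 1 "real k - 1 - e"] by (simp add: algebra_simps)
        finally have 1: "c \<le> 4 * (w * x powr (2 - real k + e))" .
        have "w ^ (k - 2) \<le> (x powr (real k - 1 / 10)) ^ (k - 2)"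
          using w by (intro power_mono) (auto simp: x_def)
        then have "w ^ (k - 2) * w * x powr ((real k - 1) * (2 - real k + e))
           \<le> x powr ((real k - 2) * (real k - 1 / 10)) * w * x powr ((real k - 1) * (2 - real k + e))"
          using w by (intro mult_right_mono) (auto simp: powx kk)
        also have "\<dots> = x powr ((real k - 2) * (real k - 1 / 10) + (real k - 1) * (2 - real k + e)) * w"
          by (simp add: powr_add mult_ac)
        also have "(real k - 2) * (real k - 1 / 10) + (real k - 1) * (2 - real k + e)
           = real k - 2 - (real k - 2) / 10 + e * (real k - 1)" by (simp add: field_simps)
        also have "x powr (real k - 2 - (real k - 2) / 10 + e * (real k - 1)) * w \<le> x powr (real k - 2 - 1 / 40) * w"
          using w ex2 by (intro mult_right_mono mono) auto
        finally have "(w * x powr (2 - real k + e)) ^ (k - 1) \<le> x powr (real k - 2 - 1 / 40) * w"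
          unfolding power_mult_distrib w_split powx kk by (simp add: mult_ac)
        from fin[OF 1 _ _ _ this] show ?thesis using C1 w by simp
      qed
    qed
    then show ?thesis by (simp add: c_def y_def x_def)
  qed
  with C show ?thesis by blast
qed

section \<open>Integration over the coefficients\<close>

definition lin :: "nat \<Rightarrow> (nat \<Rightarrow> real) \<Rightarrow> (nat \<Rightarrow> real) \<Rightarrow> real" where
  "lin k A \<alpha> = A 1 + (\<Sum>i=2..k. \<alpha> i * A i)"

text \<open>A trapezoid: 1 on [1/2, 1], 0 outside (1/4, 5/4), with slopes 4 and -4. It replaces the
  indicator of the parameter interval because the comparison of two scales needs a Lipschitz weight;
  being 1 on [1/2, 1] it dominates that indicator.\<close>

definition tent :: "real \<Rightarrow> real" where
  "tent x = max 0 (min 1 (min (4 * x - 1) (5 - 4 * x)))"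

lemma tent_bounds [simp]: "0 \<le> tent x" "tent x \<le> 1"
  by (auto simp: tent_def)

lemma tent_eq_1: "1 / 2 \<le> x \<Longrightarrow> x \<le> 1 \<Longrightarrow> tent x = 1"
  by (auto simp: tent_def)

lemma tent_nonzero: "tent x \<noteq> 0 \<Longrightarrow> 1 / 4 < x \<and> x < 5 / 4"
  by (auto simp: tent_def max_def min_def split: if_splits)

lemma tent_lipschitz: "\<bar>tent x - tent y\<bar> \<le> 4 * \<bar>x - y\<bar>"
  unfolding tent_def by (simp add: max_def min_def abs_if)

lemma borel_measurable_tent [measurable]: "tent \<in> borel_measurable borel"
  unfolding tent_def by measurable

lemma nn_integral_tent_le: "(\<integral>\<^sup>+x. ennreal (tent x) \<partial>lborel) \<le> 1"
proof -
  have "(\<integral>\<^sup>+x. ennreal (tent x) \<partial>lborel) \<le> (\<integral>\<^sup>+x. indicator {1/4..5/4::real} x \<partial>lborel)"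
  proof (rule nn_integral_mono)
    fix x show "ennreal (tent x) \<le> indicator {1/4..5/4::real} x"
      using tent_nonzero[of x] by (cases "tent x = 0") (auto simp: indicator_def)
  qed
  then show ?thesis by simp
qed

definition wt :: "nat set \<Rightarrow> (nat \<Rightarrow> real) \<Rightarrow> real" where
  "wt J \<alpha> = (\<Prod>i\<in>J. tent (\<alpha> i))"

lemma wt_bounds [simp]: "0 \<le> wt J \<alpha>" "wt J \<alpha> \<le> 1"
  by (auto simp: wt_def intro: prod_nonneg prod_le_1)

lemma borel_measurable_wt [measurable]: 
  "finite J \<Longrightarrow> wt J \<in> borel_measurable (PiM J (\<lambda>_. lborel))"
  unfolding wt_def by measurable

lemma borel_measurable_lin [measurable]: 
  "lin k A \<in> borel_measurable (PiM {2..k} (\<lambda>_. lborel))"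
  unfolding lin_def by measurable

lemma nn_integral_wt_le:
  assumes "finite J"
  shows "(\<integral>\<^sup>+\<alpha>. ennreal (wt J \<alpha>) \<partial>PiM J (\<lambda>_. lborel)) \<le> 1"
proof -
  interpret product_sigma_finite "\<lambda>_::nat. lborel :: real measure" ..
  have "(\<integral>\<^sup>+\<alpha>. ennreal (wt J \<alpha>) \<partial>PiM J (\<lambda>_. lborel)) 
     = (\<integral>\<^sup>+\<alpha>. (\<Prod>i\<in>J. ennreal (tent (\<alpha> i))) \<partial>PiM J (\<lambda>_. lborel))"
    by (simp add: wt_def prod_ennreal)
  also have "\<dots> = (\<Prod>i\<in>J. \<integral>\<^sup>+x. ennreal (tent x) \<partial>lborel)"
    using assms by (intro product_nn_integral_prod) auto
  also have "\<dots> \<le> 1" using nn_integral_tent_le by (intro prod_le_1) auto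
  finally show ?thesis .
qed

section \<open>Values of one or two linear forms as variables of integration\<close>

lemma nn_integral_affine:
  fixes f :: "real \<Rightarrow> ennreal" and a c :: real
  assumes "f \<in> borel_measurable borel" "a \<noteq> 0"
  shows "(\<integral>\<^sup>+x. f (c + a * x) \<partial>lborel) = ennreal (1 / \<bar>a\<bar>) * (\<integral>\<^sup>+x. f x \<partial>lborel)"
proof -
  have "(\<integral>\<^sup>+x. f x \<partial>lborel) = ennreal \<bar>a\<bar> * (\<integral>\<^sup>+x. f (c + a * x) \<partial>lborel)"
    using assms by (rule nn_integral_real_affine)
  moreover have "ennreal (1 / \<bar>a\<bar>) * ennreal \<bar>a\<bar> = 1"
    using assms(2) by (simp flip: ennreal_mult)
  ultimately show ?thesis by (simp add: mult.assoc[symmetric])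
qed

text \<open>Fubini and two substitutions in one variable: first x -> u at fixed \<open>y\<close>,
  after which the second argument is affine in \<open>y\<close> with slope d / a. The Jacobians |a|
  and |d / a| multiply to |d|.\<close>

lemma nn_integral_linear_2D:
  fixes H :: "real \<times> real \<Rightarrow> ennreal" and a b a' b' e e' :: real
  defines "d \<equiv> a * b' - a' * b"
  assumes [measurable]: "H \<in> borel_measurable borel" and a: "a \<noteq> 0" and d: "d \<noteq> 0"
  shows "(\<integral>\<^sup>+x. \<integral>\<^sup>+y. H (e + x * a + y * b, e' + x * a' + y * b') \<partial>lborel \<partial>lborel)
     = ennreal (1 / \<bar>d\<bar>) * (\<integral>\<^sup>+u. \<integral>\<^sup>+v. H (u, v) \<partial>lborel \<partial>lborel)"
proof -
  have "(\<integral>\<^sup>+x. \<integral>\<^sup>+y. H (e + x * a + y * b, e' + x * a' + y * b') \<partial>lborel \<partial>lborel)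
     = (\<integral>\<^sup>+y. \<integral>\<^sup>+x. H (e + x * a + y * b, e' + x * a' + y * b') \<partial>lborel \<partial>lborel)"
    by (rule lborel_pair.Fubini'[symmetric]) measurable
  also have "\<dots> = (\<integral>\<^sup>+y. ennreal (1 / \<bar>a\<bar>) * (\<integral>\<^sup>+u. H (u, e' + a' * ((u - e) / a) + d / a * y) \<partial>lborel) \<partial>lborel)"
  proof (intro nn_integral_cong)
    fix y
    have "(\<integral>\<^sup>+x. H (e + x * a + y * b, e' + x * a' + y * b') \<partial>lborel)
       = (\<integral>\<^sup>+x. (\<lambda>u. H (u, e' + a' * ((u - e) / a) + d / a * y)) ((e + y * b) + a * x) \<partial>lborel)"
    proof (intro nn_integral_cong)
      fix x
      have "e' + x * a' + y * b' = e' + a' * (((e + y * b) + a * x - e) / a) + d / a * y"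
        using a by (simp add: d_def field_simps)
      then show "H (e + x * a + y * b, e' + x * a' + y * b') = 
         (\<lambda>u. H (u, e' + a' * ((u - e) / a) + d / a * y)) ((e + y * b) + a * x)"
        by (simp add: algebra_simps)
    qed
    also have "\<dots> = ennreal (1 / \<bar>a\<bar>) * (\<integral>\<^sup>+u. H (u, e' + a' * ((u - e) / a) + d / a * y) \<partial>lborel)"
      using a by (intro nn_integral_affine) measurable
    finally show "(\<integral>\<^sup>+x. H (e + x * a + y * b, e' + x * a' + y * b') \<partial>lborel) = \<dots>" .
  qed
  also have "\<dots> = ennreal (1 / \<bar>a\<bar>) * (\<integral>\<^sup>+y. \<integral>\<^sup>+u. H (u, e' + a' * ((u - e) / a) + d / a * y) \<partial>lborel \<partial>lborel)"
    by (intro nn_integral_cmult) measurable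
  also have "(\<integral>\<^sup>+y. \<integral>\<^sup>+u. H (u, e' + a' * ((u - e) / a) + d / a * y) \<partial>lborel \<partial>lborel)
     = (\<integral>\<^sup>+u. \<integral>\<^sup>+y. H (u, e' + a' * ((u - e) / a) + d / a * y) \<partial>lborel \<partial>lborel)"
    by (rule lborel_pair.Fubini') measurable
  also have "\<dots> = (\<integral>\<^sup>+u. ennreal (1 / \<bar>d / a\<bar>) * (\<integral>\<^sup>+v. H (u, v) \<partial>lborel) \<partial>lborel)"
    using a d by (intro nn_integral_cong nn_integral_affine[where f = "\<lambda>v. H (_, v)"]) auto
  also have "\<dots> = ennreal (1 / \<bar>d / a\<bar>) * (\<integral>\<^sup>+u. \<integral>\<^sup>+v. H (u, v) \<partial>lborel \<partial>lborel)"
    by (intro nn_integral_cmult) measurable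
  finally show ?thesis
    using a d by (simp add: mult.assoc[symmetric] ennreal_mult[symmetric])
qed

lemma lin_upd:
  assumes "j \<in> {2..k}"
  shows "lin k A (x(j := z)) = (A 1 + (\<Sum>r\<in>{2..k} - {j}. x r * A r)) + z * A j"
proof -
  have "(\<Sum>i=2..k. (x(j := z)) i * A i) = z * A j + (\<Sum>r\<in>{2..k} - {j}. (x(j := z)) r * A r)"
    using assms by (subst sum.remove[of _ j]) auto
  also have "(\<Sum>r\<in>{2..k} - {j}. (x(j := z)) r * A r) = (\<Sum>r\<in>{2..k} - {j}. x r * A r)"
    by (intro sum.cong) auto
  finally show ?thesis by (simp add: lin_def)
qed

lemma lin_upd2:
  assumes "i \<in> {2..k}" "j \<in> {2..k}" "i \<noteq> j"
  shows "lin k A (x(i := y, j := z)) = (A 1 + (\<Sum>r\<in>{2..k} - {j} - {i}. x r * A r)) + y * A i + z * A j"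
proof -
  have "(\<Sum>r\<in>{2..k} - {j}. (x(i := y)) r * A r) = y * A i + (\<Sum>r\<in>{2..k} - {j} - {i}. (x(i := y)) r * A r)"
    using assms by (subst sum.remove[of _ i]) auto
  also have "(\<Sum>r\<in>{2..k} - {j} - {i}. (x(i := y)) r * A r) = (\<Sum>r\<in>{2..k} - {j} - {i}. x r * A r)"
    by (intro sum.cong) auto
  finally show ?thesis using lin_upd[OF assms(2), of A "x(i := y)" z] by simp
qed

lemma wt_upd:
  assumes "finite J" "j \<in> J"
  shows "wt J (x(j := z)) = wt (J - {j}) x * tent z"
proof -
  have "wt J (x(j := z)) = tent z * (\<Prod>i\<in>J - {j}. tent ((x(j := z)) i))"
    unfolding wt_def using assms by (subst prod.remove[of _ j]) auto
  also have "(\<Prod>i\<in>J - {j}. tent ((x(j := z)) i)) = wt (J - {j}) x"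
    unfolding wt_def by (intro prod.cong) auto
  finally show ?thesis by (simp only: mult.commute)
qed

lemma nn_integral_PiM_split:
  fixes f :: "(nat \<Rightarrow> real) \<Rightarrow> ennreal"
  assumes "finite J" "j \<in> J" "f \<in> borel_measurable (PiM J (\<lambda>_. lborel))"
  shows "(\<integral>\<^sup>+\<alpha>. f \<alpha> \<partial>PiM J (\<lambda>_. lborel)) = 
    (\<integral>\<^sup>+x. \<integral>\<^sup>+z. f (x(j := z)) \<partial>lborel \<partial>PiM (J - {j}) (\<lambda>_. lborel))"
proof -
  interpret product_sigma_finite "\<lambda>_::nat. lborel :: real measure" ..
  have J: "J = insert j (J - {j})" using assms by auto
  show ?thesis
    by (subst J, rule product_nn_integral_insert) (use assms J in auto)
qed

text \<open>Integration over coordinate \<open>j\<close> alone already gives the bound: the tent in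
  that coordinate is at most 1, and the remaining weights have total mass at most 1.\<close>

lemma nn_integral_lin_le:
  assumes I: "I \<in> sets borel" and j: "j \<in> {2..k}" "A j \<noteq> 0"
  shows "(\<integral>\<^sup>+\<alpha>. ennreal (wt {2..k} \<alpha>) * indicator I (lin k A \<alpha>) \<partial>PiM {2..k} (\<lambda>_. lborel))
     \<le> ennreal (1 / \<bar>A j\<bar>) * emeasure lborel I"
proof -
  have [measurable]: "I \<in> sets borel" by fact
  let ?R = "{2..k} - {j}"
  have "(\<integral>\<^sup>+\<alpha>. ennreal (wt {2..k} \<alpha>) * indicator I (lin k A \<alpha>) \<partial>PiM {2..k} (\<lambda>_. lborel))
     = (\<integral>\<^sup>+x. \<integral>\<^sup>+z. ennreal (wt {2..k} (x(j := z))) * indicator I (lin k A (x(j := z))) \<partial>lborel \<partial>PiM ?R (\<lambda>_. lborel))"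
    using j by (intro nn_integral_PiM_split) auto
  also have "\<dots> \<le> (\<integral>\<^sup>+x. ennreal (wt ?R x) * (ennreal (1 / \<bar>A j\<bar>) * emeasure lborel I) \<partial>PiM ?R (\<lambda>_. lborel))"
  proof (rule nn_integral_mono)
    fix x :: "nat \<Rightarrow> real"
    have "(\<integral>\<^sup>+z. ennreal (wt {2..k} (x(j := z))) * indicator I (lin k A (x(j := z))) \<partial>lborel)
      \<le> (\<integral>\<^sup>+z. ennreal (wt ?R x) * indicator I ((A 1 + (\<Sum>r\<in>?R. x r * A r)) + A j * z) \<partial>lborel)"
    proof (rule nn_integral_mono)
      fix z
      have "ennreal (wt ?R x * tent z) \<le> ennreal (wt ?R x)"
        by (intro ennreal_leI mult_left_le) auto
      then show "ennreal (wt {2..k} (x(j := z))) * indicator I (lin k A (x(j := z)))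
         \<le> ennreal (wt ?R x) * indicator I ((A 1 + (\<Sum>r\<in>?R. x r * A r)) + A j * z)"
        using j by (simp add: wt_upd lin_upd mult.commute[of _ z] mult_right_mono)
    qed
    also have "\<dots> = ennreal (wt ?R x) * (\<integral>\<^sup>+z. indicator I ((A 1 + (\<Sum>r\<in>?R. x r * A r)) + A j * z) \<partial>lborel)"
      by (rule nn_integral_cmult) measurable
    also have "(\<integral>\<^sup>+z. indicator I ((A 1 + (\<Sum>r\<in>?R. x r * A r)) + A j * z) \<partial>lborel)
       = ennreal (1 / \<bar>A j\<bar>) * (\<integral>\<^sup>+z. indicator I z \<partial>lborel)"
      using j by (intro nn_integral_affine) auto
    finally show "(\<integral>\<^sup>+z. ennreal (wt {2..k} (x(j := z))) * indicator I (lin k A (x(j := z))) \<partial>lborel)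
       \<le> ennreal (wt ?R x) * (ennreal (1 / \<bar>A j\<bar>) * emeasure lborel I)"
      using I by (simp only: nn_integral_indicator sets_lborel)
  qed
  also have "\<dots> = (\<integral>\<^sup>+x. ennreal (wt ?R x) \<partial>PiM ?R (\<lambda>_. lborel)) * (ennreal (1 / \<bar>A j\<bar>) * emeasure lborel I)"
    by (rule nn_integral_multc) measurable
  also have "\<dots> \<le> 1 * (ennreal (1 / \<bar>A j\<bar>) * emeasure lborel I)"
    by (intro mult_right_mono nn_integral_wt_le) auto
  finally show ?thesis by simp
qed

text \<open>
  By Cramer's rule, \<open>p\<close> being the pair of values of \<open>lin k A\<close> and \<open>lin k A'\<close>, the arguments of
  the two tents are the coordinates \<open>i\<close> and \<open>j\<close>, the other coordinates being those of \<open>x\<close>.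
\<close>

definition tent_at_preimage :: "nat \<Rightarrow> nat \<Rightarrow> nat \<Rightarrow> (nat \<Rightarrow> real) \<Rightarrow> (nat \<Rightarrow> real) \<Rightarrow> (nat \<Rightarrow> real) \<Rightarrow> real \<times> real \<Rightarrow> real" where
  "tent_at_preimage k i j A A' x p = 
     (let e = A 1 + (\<Sum>r\<in>{2..k} - {j} - {i}. x r * A r);
          e' = A' 1 + (\<Sum>r\<in>{2..k} - {j} - {i}. x r * A' r)
      in tent (((fst p - e) * A' j - (snd p - e') * A j) / (A i * A' j - A' i * A j)) *
         tent (((snd p - e') * A i - (fst p - e) * A' i) / (A i * A' j - A' i * A j)))"

text \<open>With the other coordinates fixed, (\<alpha> i, \<alpha> j) is exchanged for the values
  of the two forms. The Jacobian is the minor \<open>d i j\<close>, and the two tents turn into the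
  factor \<open>tent_at_preimage\<close>.\<close>

lemma nn_integral_lin2_eq:
  fixes A A' :: "nat \<Rightarrow> real"
  defines "d \<equiv> \<lambda>i j. A i * A' j - A' i * A j"
  assumes I: "I \<in> sets borel" "I' \<in> sets borel" and ij: "i \<in> {2..k}" "j \<in> {2..k}" "i \<noteq> j"
    and d: "d i j \<noteq> 0" and Ai: "A i \<noteq> 0"
  shows "(\<integral>\<^sup>+\<alpha>. ennreal (wt {2..k} \<alpha>) * (indicator I (lin k A \<alpha>) * indicator I' (lin k A' \<alpha>)) \<partial>PiM {2..k} (\<lambda>_. lborel))
     = (\<integral>\<^sup>+x. ennreal (wt ({2..k} - {j} - {i}) x) * (ennreal (1 / \<bar>d i j\<bar>) *
         (\<integral>\<^sup>+u. \<integral>\<^sup>+v. indicator I u * indicator I' v * ennreal (tent_at_preimage k i j A A' x (u, v)) \<partial>lborel \<partial>lborel))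
         \<partial>PiM ({2..k} - {j} - {i}) (\<lambda>_. lborel))"
proof -
  have [measurable]: "I \<in> sets borel" "I' \<in> sets borel" by fact+
  let ?S = "{2..k} - {j}"
  let ?R = "{2..k} - {j} - {i}"
  let ?f = "\<lambda>\<alpha>. ennreal (wt {2..k} \<alpha>) * (indicator I (lin k A \<alpha>) * indicator I' (lin k A' \<alpha>))"
  have f [measurable]: "?f \<in> borel_measurable (PiM {2..k} (\<lambda>_. lborel))" by measurable
  have [measurable]: "(\<lambda>x. \<integral>\<^sup>+z. ?f (x(j := z)) \<partial>lborel) \<in> borel_measurable (PiM ?S (\<lambda>_. lborel))"
  proof -
    have ins: "insert j ?S = {2..k}" using ij by auto
    have "(\<lambda>(x, z). x(j := z)) \<in> measurable (PiM ?S (\<lambda>_. lborel) \<Otimes>\<^sub>M lborel) (PiM (insert j ?S) (\<lambda>_. lborel :: real measure))"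
      by (rule measurable_add_dim)
    then have "(\<lambda>(x, z). ?f (x(j := z))) \<in> borel_measurable (PiM ?S (\<lambda>_. lborel) \<Otimes>\<^sub>M lborel)"
      unfolding ins using measurable_compose[OF _ f] by (simp add: case_prod_beta' cong: measurable_cong)
    then show ?thesis by (intro lborel.borel_measurable_nn_integral) (simp add: case_prod_beta')
  qed
  have "(\<integral>\<^sup>+\<alpha>. ?f \<alpha> \<partial>PiM {2..k} (\<lambda>_. lborel)) = 
     (\<integral>\<^sup>+x. \<integral>\<^sup>+z. ?f (x(j := z)) \<partial>lborel \<partial>PiM ?S (\<lambda>_. lborel))"
    using ij by (intro nn_integral_PiM_split f) auto
  also have "\<dots> = (\<integral>\<^sup>+x. \<integral>\<^sup>+y. \<integral>\<^sup>+z. ?f (x(i := y, j := z)) \<partial>lborel \<partial>lborel \<partial>PiM ?R (\<lambda>_. lborel))"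
    using ij by (subst nn_integral_PiM_split[of ?S i]) auto
  also have "\<dots> = (\<integral>\<^sup>+x. ennreal (wt ?R x) * (ennreal (1 / \<bar>d i j\<bar>) *
         (\<integral>\<^sup>+u. \<integral>\<^sup>+v. indicator I u * indicator I' v * ennreal (tent_at_preimage k i j A A' x (u, v)) \<partial>lborel \<partial>lborel))
         \<partial>PiM ?R (\<lambda>_. lborel))"
  proof (rule nn_integral_cong)
    fix x :: "nat \<Rightarrow> real"
    define e where "e = A 1 + (\<Sum>r\<in>?R. x r * A r)"
    define e' where "e' = A' 1 + (\<Sum>r\<in>?R. x r * A' r)"
    define H where "H p = indicator I (fst p) * indicator I' (snd p) * ennreal (tent_at_preimage k i j A A' x p)" for p
    have "H \<in> borel_measurable (borel \<Otimes>\<^sub>M borel)"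
      unfolding H_def tent_at_preimage_def Let_def by measurable
    then have [measurable]: "H \<in> borel_measurable borel" by (simp add: borel_prod)
    have "(\<integral>\<^sup>+y. \<integral>\<^sup>+z. ?f (x(i := y, j := z)) \<partial>lborel \<partial>lborel)
      = (\<integral>\<^sup>+y. \<integral>\<^sup>+z. ennreal (wt ?R x) * H (e + y * A i + z * A j, e' + y * A' i + z * A' j) \<partial>lborel \<partial>lborel)"
    proof (intro nn_integral_cong)
      fix y z
      \<comment> \<open>Cramer's rule: the numerators are y * d and z * d, so the weight at the
        image point is \<open>tent y * tent z\<close>.\<close>
      have 1: "((e + y * A i + z * A j - e) * A' j - (e' + y * A' i + z * A' j - e') * A j) = y * d i j"
        "((e' + y * A' i + z * A' j - e') * A i - (e + y * A i + z * A j - e) * A' i) = z * d i j"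
        by (simp_all add: d_def algebra_simps)
      have s: "tent_at_preimage k i j A A' x (e + y * A i + z * A j, e' + y * A' i + z * A' j) = tent y * tent z"
        unfolding tent_at_preimage_def Let_def fst_conv snd_conv e_def[symmetric] e'_def[symmetric] 1
        using d by (simp add: d_def)
      have w: "wt {2..k} (x(i := y, j := z)) = wt ?R x * (tent y * tent z)"
        using ij by (simp add: wt_upd mult_ac)
      show "?f (x(i := y, j := z)) = ennreal (wt ?R x) * H (e + y * A i + z * A j, e' + y * A' i + z * A' j)"
        unfolding H_def s w lin_upd2[OF ij] fst_conv snd_conv e_def[symmetric] e'_def[symmetric]
        by (simp add: ennreal_mult mult_ac)
    qed
    also have "\<dots> = ennreal (wt ?R x) * (\<integral>\<^sup>+y. \<integral>\<^sup>+z. H (e + y * A i + z * A j, e' + y * A' i + z * A' j) \<partial>lborel \<partial>lborel)"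
      by (simp add: nn_integral_cmult)
    also have "(\<integral>\<^sup>+y. \<integral>\<^sup>+z. H (e + y * A i + z * A j, e' + y * A' i + z * A' j) \<partial>lborel \<partial>lborel) = 
      ennreal (1 / \<bar>d i j\<bar>) * (\<integral>\<^sup>+u. \<integral>\<^sup>+v. H (u, v) \<partial>lborel \<partial>lborel)"
      unfolding d_def using Ai d by (intro nn_integral_linear_2D) (auto simp: d_def)
    finally show "(\<integral>\<^sup>+y. \<integral>\<^sup>+z. ?f (x(i := y, j := z)) \<partial>lborel \<partial>lborel) = ennreal (wt ?R x) * (ennreal (1 / \<bar>d i j\<bar>) *
         (\<integral>\<^sup>+u. \<integral>\<^sup>+v. indicator I u * indicator I' v * ennreal (tent_at_preimage k i j A A' x (u, v)) \<partial>lborel \<partial>lborel))"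
      unfolding H_def fst_conv snd_conv .
  qed
  finally show ?thesis .
qed

lemma tent_at_preimage_bounds [simp]: "0 \<le> tent_at_preimage k i j A A' x p" "tent_at_preimage k i j A A' x p \<le> 1"
  by (auto simp: tent_at_preimage_def Let_def intro: mult_le_one)

lemma nn_integral_const_rectangle:
  assumes "I \<in> sets borel" "I' \<in> sets borel" "emeasure lborel I = ennreal l" "emeasure lborel I' = ennreal l'"
    "0 \<le> l" "0 \<le> l'"
  shows "(\<integral>\<^sup>+u. \<integral>\<^sup>+v. indicator I u * indicator I' v * z \<partial>lborel \<partial>lborel) = ennreal (l * l') * z"
proof -
  have [measurable]: "I \<in> sets borel" "I' \<in> sets borel" by fact+
  have "(\<integral>\<^sup>+u. \<integral>\<^sup>+v. indicator I u * indicator I' v * z \<partial>lborel \<partial>lborel)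
    = (\<integral>\<^sup>+u. indicator I u * (\<integral>\<^sup>+v. indicator I' v * z \<partial>lborel) \<partial>lborel)"
    by (simp add: mult.assoc nn_integral_cmult)
  also have "\<dots> = (\<integral>\<^sup>+u. indicator I u \<partial>lborel) * ((\<integral>\<^sup>+v. indicator I' v \<partial>lborel) * z)"
    by (simp add: nn_integral_multc)
  also have "\<dots> = ennreal (l * l') * z"
    using assms by (simp add: ennreal_mult mult.assoc)
  finally show ?thesis .
qed

text \<open>The transported weight is at most 1, so only the Jacobian remains.\<close>

lemma nn_integral_lin2_le:
  fixes A A' :: "nat \<Rightarrow> real"
  defines "d \<equiv> \<lambda>i j. A i * A' j - A' i * A j"
  assumes I: "I \<in> sets borel" "I' \<in> sets borel" "emeasure lborel I = ennreal l" "emeasure lborel I' = ennreal l'"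
    "0 \<le> l" "0 \<le> l'"
    and ij: "i \<in> {2..k}" "j \<in> {2..k}" "i \<noteq> j" and d: "d i j \<noteq> 0" and Ai: "A i \<noteq> 0"
  shows "(\<integral>\<^sup>+\<alpha>. ennreal (wt {2..k} \<alpha>) * (indicator I (lin k A \<alpha>) * indicator I' (lin k A' \<alpha>)) \<partial>PiM {2..k} (\<lambda>_. lborel))
     \<le> ennreal (l * l' / \<bar>d i j\<bar>)"
proof -
  let ?R = "{2..k} - {j} - {i}"
  have "(\<integral>\<^sup>+\<alpha>. ennreal (wt {2..k} \<alpha>) * (indicator I (lin k A \<alpha>) * indicator I' (lin k A' \<alpha>)) \<partial>PiM {2..k} (\<lambda>_. lborel))
    = (\<integral>\<^sup>+x. ennreal (wt ?R x) * (ennreal (1 / \<bar>d i j\<bar>) *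
         (\<integral>\<^sup>+u. \<integral>\<^sup>+v. indicator I u * indicator I' v * ennreal (tent_at_preimage k i j A A' x (u, v)) \<partial>lborel \<partial>lborel))
         \<partial>PiM ?R (\<lambda>_. lborel))"
    unfolding d_def using I ij d Ai by (intro nn_integral_lin2_eq) (auto simp: d_def)
  also have "\<dots> \<le> (\<integral>\<^sup>+x. ennreal (wt ?R x) * (ennreal (1 / \<bar>d i j\<bar>) *
         (\<integral>\<^sup>+u. \<integral>\<^sup>+v. indicator I u * indicator I' v * 1 \<partial>lborel \<partial>lborel)) \<partial>PiM ?R (\<lambda>_. lborel))"
  proof (intro nn_integral_mono mult_left_mono)
    show "ennreal (tent_at_preimage k i j A A' x (u, v)) \<le> 1" for x u v
      using ennreal_leI[OF tent_at_preimage_bounds(2)] by simp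
  qed auto
  also have "\<dots> = (\<integral>\<^sup>+x. ennreal (wt ?R x) \<partial>PiM ?R (\<lambda>_. lborel)) * (ennreal (1 / \<bar>d i j\<bar>) * (ennreal (l * l') * 1))"
    unfolding nn_integral_const_rectangle[OF I] by (rule nn_integral_multc) measurable
  also have "\<dots> \<le> 1 * (ennreal (1 / \<bar>d i j\<bar>) * (ennreal (l * l') * 1))"
    by (intro mult_right_mono nn_integral_wt_le) auto
  also have "\<dots> = ennreal (l * l' / \<bar>d i j\<bar>)" using I by (simp add: ennreal_mult[symmetric])
  finally show ?thesis .
qed

text \<open>Moving the pair of values within [0, L]^2 moves each recovered coordinate by at most 2 *
  L * K / |d|; each of the two tents then changes by at most 4 times that.\<close>

lemma tent_at_preimage_lipschitz:
  fixes A A' :: "nat \<Rightarrow> real" and i j :: nat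
  defines "d \<equiv> A i * A' j - A' i * A j"
  assumes d: "d \<noteq> 0" and K: "\<bar>A i\<bar> \<le> K" "\<bar>A j\<bar> \<le> K" "\<bar>A' i\<bar> \<le> K" "\<bar>A' j\<bar> \<le> K"
    and uv: "0 \<le> u" "u \<le> L" "0 \<le> v" "v \<le> L"
  shows "\<bar>tent_at_preimage k i j A A' x (u, v) - tent_at_preimage k i j A A' x (0, 0)\<bar> \<le> 16 * L * K / \<bar>d\<bar>"
proof -
  define e where "e = A 1 + (\<Sum>r\<in>{2..k} - {j} - {i}. x r * A r)"
  define e' where "e' = A' 1 + (\<Sum>r\<in>{2..k} - {j} - {i}. x r * A' r)"
  define a where "a u v = ((u - e) * A' j - (v - e') * A j) / d" for u v
  define b where "b u v = ((v - e') * A i - (u - e) * A' i) / d" for u v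
  have s: "tent_at_preimage k i j A A' x (u, v) = tent (a u v) * tent (b u v)" for u v
    by (simp add: tent_at_preimage_def Let_def a_def b_def e_def e'_def d_def)
  have bd: "\<bar>u * s1 - v * s2\<bar> \<le> 2 * L * K" if "\<bar>s1\<bar> \<le> K" "\<bar>s2\<bar> \<le> K" for s1 s2
  proof -
    have "\<bar>u * s1\<bar> \<le> L * K" "\<bar>v * s2\<bar> \<le> L * K"
      using that uv by (auto simp: abs_mult intro!: mult_mono)
    then show ?thesis by linarith
  qed
  have "a u v - a 0 0 = (u * A' j - v * A j) / d" "b u v - b 0 0 = - ((u * A' i - v * A i) / d)"
    using d by (simp_all add: a_def b_def field_simps)
  then have ab: "\<bar>a u v - a 0 0\<bar> \<le> 2 * L * K / \<bar>d\<bar>" "\<bar>b u v - b 0 0\<bar> \<le> 2 * L * K / \<bar>d\<bar>"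
    using bd[OF K(4,2)] bd[OF K(3,1)] by (auto simp: intro!: divide_right_mono)
  have "\<bar>tent (a u v) * tent (b u v) - tent (a 0 0) * tent (b 0 0)\<bar>
     = \<bar>tent (a u v) * (tent (b u v) - tent (b 0 0)) + tent (b 0 0) * (tent (a u v) - tent (a 0 0))\<bar>"
    by (simp add: algebra_simps)
  also have "\<dots> \<le> \<bar>tent (a u v)\<bar> * \<bar>tent (b u v) - tent (b 0 0)\<bar> + \<bar>tent (b 0 0)\<bar> * \<bar>tent (a u v) - tent (a 0 0)\<bar>"
    by (metis abs_mult abs_triangle_ineq)
  also have "\<dots> \<le> 1 * \<bar>tent (b u v) - tent (b 0 0)\<bar> + 1 * \<bar>tent (a u v) - tent (a 0 0)\<bar>"
    by (intro add_mono mult_right_mono) auto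
  also have "\<dots> \<le> 4 * \<bar>b u v - b 0 0\<bar> + 4 * \<bar>a u v - a 0 0\<bar>"
    using tent_lipschitz[of "b u v" "b 0 0"] tent_lipschitz[of "a u v" "a 0 0"] by simp
  also have "\<dots> \<le> 4 * (2 * L * K / \<bar>d\<bar>) + 4 * (2 * L * K / \<bar>d\<bar>)"
    by (intro add_mono mult_left_mono ab) auto
  also have "\<dots> = 16 * L * K / \<bar>d\<bar>" by simp
  finally show ?thesis by (simp add: s)
qed

text \<open>One number \<open>e\<close> serves all \<open>I\<close> and \<open>I'\<close> inside
  [0, L]: it is the joint density of the two forms at the origin. This independence of the intervals
  is what lets the two scales cancel. The error is the Lipschitz bound of the weight, divided once
  more by the Jacobian |d|.\<close>

lemma nn_integral_lin2_asymp:
  fixes A A' :: "nat \<Rightarrow> real" and i j :: nat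
  defines "d \<equiv> A i * A' j - A' i * A j"
  assumes ij: "i \<in> {2..k}" "j \<in> {2..k}" "i \<noteq> j" and d: "d \<noteq> 0" and Ai: "A i \<noteq> 0"
    and K: "\<bar>A i\<bar> \<le> K" "\<bar>A j\<bar> \<le> K" "\<bar>A' i\<bar> \<le> K" "\<bar>A' j\<bar> \<le> K" and L: "L \<ge> 0"
  obtains e where "0 \<le> e" and
    "\<And>I I' l l'. \<lbrakk>I \<in> sets borel; I' \<in> sets borel; emeasure lborel I = ennreal l; emeasure lborel I' = ennreal l';
       0 \<le> l; 0 \<le> l'; I \<subseteq> {0..L}; I' \<subseteq> {0..L}\<rbrakk> \<Longrightarrow>
     (\<integral>\<^sup>+\<alpha>. ennreal (wt {2..k} \<alpha>) * (indicator I (lin k A \<alpha>) * indicator I' (lin k A' \<alpha>)) \<partial>PiM {2..k} (\<lambda>_. lborel))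
       \<le> ennreal (l * l' * (e + 16 * L * K / d\<^sup>2)) \<and>
     ennreal (l * l' * e) \<le>
     (\<integral>\<^sup>+\<alpha>. ennreal (wt {2..k} \<alpha>) * (indicator I (lin k A \<alpha>) * indicator I' (lin k A' \<alpha>)) \<partial>PiM {2..k} (\<lambda>_. lborel))
       + ennreal (l * l' * (16 * L * K / d\<^sup>2))"
proof -
  let ?R = "{2..k} - {j} - {i}"
  let ?M = "PiM ?R (\<lambda>_. lborel :: real measure)"
  define \<eta> where "\<eta> = 16 * L * K / \<bar>d\<bar>"
  have \<eta>: "\<eta> \<ge> 0" using K L by (auto simp: \<eta>_def)
  define s where "s x p = tent_at_preimage k i j A A' x p" for x p
  have s01: "0 \<le> s x p" "s x p \<le> 1" for x p by (simp_all add: s_def)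
  have [measurable]: "(\<lambda>x. s x (0, 0)) \<in> borel_measurable ?M"
    unfolding s_def tent_at_preimage_def Let_def by measurable
  \<comment> \<open>The joint density at (0, 0); it is at most 1 / |d|, hence a real number.\<close>
  define E where "E = (\<integral>\<^sup>+x. ennreal (wt ?R x) * (ennreal (1 / \<bar>d\<bar>) * ennreal (s x (0, 0))) \<partial>?M)"
  have W: "(\<integral>\<^sup>+x. ennreal (wt ?R x) * z \<partial>?M) \<le> z" for z
  proof -
    have "(\<integral>\<^sup>+x. ennreal (wt ?R x) * z \<partial>?M) = (\<integral>\<^sup>+x. ennreal (wt ?R x) \<partial>?M) * z"
      by (rule nn_integral_multc) measurable
    also have "\<dots> \<le> 1 * z" by (intro mult_right_mono nn_integral_wt_le) auto
    finally show ?thesis by simp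
  qed
  have "E \<le> (\<integral>\<^sup>+x. ennreal (wt ?R x) * (ennreal (1 / \<bar>d\<bar>) * 1) \<partial>?M)"
    unfolding E_def using ennreal_leI[OF s01(2)] by (intro nn_integral_mono mult_left_mono) auto
  also have "\<dots> \<le> ennreal (1 / \<bar>d\<bar>)" using W[of "ennreal (1 / \<bar>d\<bar>) * 1"] by simp
  finally have "E \<noteq> top" by (auto simp: top_unique)
  then obtain e where e: "0 \<le> e" "E = ennreal e" by (cases E) auto
  have ed: "1 / \<bar>d\<bar> * \<eta> = 16 * L * K / d\<^sup>2" by (simp add: \<eta>_def power2_eq_square abs_mult_self_eq field_simps)
  show ?thesis
  proof (rule that[OF e(1)], intro conjI)
    fix I I' l l' assume I: "I \<in> sets borel" "I' \<in> sets borel" "emeasure lborel I = ennreal l" "emeasure lborel I' = ennreal l'"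
       "0 \<le> l" "0 \<le> l'" and IL: "I \<subseteq> {0..L}" "I' \<subseteq> {0..L}"
    have [measurable]: "I \<in> sets borel" "I' \<in> sets borel" by fact+
    let ?Z = "\<lambda>x. \<integral>\<^sup>+u. \<integral>\<^sup>+v. indicator I u * indicator I' v * ennreal (s x (u, v)) \<partial>lborel \<partial>lborel"
    let ?E = "\<integral>\<^sup>+\<alpha>. ennreal (wt {2..k} \<alpha>) * (indicator I (lin k A \<alpha>) * indicator I' (lin k A' \<alpha>)) \<partial>PiM {2..k} (\<lambda>_. lborel)"
    have Eeq: "?E = (\<integral>\<^sup>+x. ennreal (wt ?R x) * (ennreal (1 / \<bar>d\<bar>) * ?Z x) \<partial>?M)"
      unfolding d_def s_def using I ij d Ai by (intro nn_integral_lin2_eq) (auto simp: d_def)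
    have lip: "\<bar>s x (u, v) - s x (0, 0)\<bar> \<le> \<eta>" if "u \<in> I" "v \<in> I'" for x u v
      unfolding s_def \<eta>_def d_def using that IL K d by (intro tent_at_preimage_lipschitz) (auto simp: d_def)
    have Z1: "?Z x \<le> ennreal (l * l') * (ennreal (s x (0, 0)) + ennreal \<eta>)" for x
    proof -
      have "?Z x \<le> (\<integral>\<^sup>+u. \<integral>\<^sup>+v. indicator I u * indicator I' v * (ennreal (s x (0, 0)) + ennreal \<eta>) \<partial>lborel \<partial>lborel)"
      proof (intro nn_integral_mono)
        fix u v
        show "indicator I u * indicator I' v * ennreal (s x (u, v)) \<le> indicator I u * indicator I' v * (ennreal (s x (0, 0)) + ennreal \<eta>)"
        proof (cases "u \<in> I \<and> v \<in> I'")
          case True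
          then have "s x (u, v) \<le> s x (0, 0) + \<eta>" using lip[of u v x] by linarith
          then have "ennreal (s x (u, v)) \<le> ennreal (s x (0, 0)) + ennreal \<eta>"
            using \<eta> s01 by (simp flip: ennreal_plus)
          then show ?thesis using True by simp
        qed auto
      qed
      then show ?thesis by (simp only: nn_integral_const_rectangle[OF I])
    qed
    have Z2: "ennreal (l * l') * ennreal (s x (0, 0)) \<le> ?Z x + ennreal (l * l') * ennreal \<eta>" for x
    proof -
      have m: "(\<lambda>(u, v). ennreal (s x (u, v))) \<in> borel_measurable (borel \<Otimes>\<^sub>M borel)"
        unfolding s_def tent_at_preimage_def Let_def by measurable
      have [measurable]: "(\<lambda>p. ennreal (s x p)) \<in> borel_measurable borel"
        using m by (simp add: borel_prod case_prod_beta')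
      have "ennreal (l * l') * ennreal (s x (0, 0)) = (\<integral>\<^sup>+u. \<integral>\<^sup>+v. indicator I u * indicator I' v * ennreal (s x (0, 0)) \<partial>lborel \<partial>lborel)"
        by (simp only: nn_integral_const_rectangle[OF I])
      also have "\<dots> \<le> (\<integral>\<^sup>+u. \<integral>\<^sup>+v. indicator I u * indicator I' v * ennreal (s x (u, v)) + indicator I u * indicator I' v * ennreal \<eta> \<partial>lborel \<partial>lborel)"
      proof (intro nn_integral_mono)
        fix u v
        show "indicator I u * indicator I' v * ennreal (s x (0, 0)) \<le> indicator I u * indicator I' v * ennreal (s x (u, v)) + indicator I u * indicator I' v * ennreal \<eta>"
        proof (cases "u \<in> I \<and> v \<in> I'")
          case True
          then have "s x (0, 0) \<le> s x (u, v) + \<eta>" using lip[of u v x] by linarith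
          then have "ennreal (s x (0, 0)) \<le> ennreal (s x (u, v)) + ennreal \<eta>"
            using \<eta> s01 by (simp flip: ennreal_plus)
          then show ?thesis using True by simp
        qed auto
      qed
      also have "\<dots> = ?Z x + (\<integral>\<^sup>+u. \<integral>\<^sup>+v. indicator I u * indicator I' v * ennreal \<eta> \<partial>lborel \<partial>lborel)"
        by (simp add: nn_integral_add)
      finally show ?thesis by (simp only: nn_integral_const_rectangle[OF I])
    qed
    let ?c = "ennreal (l * l')"
    have scale: "(\<integral>\<^sup>+x. ennreal (wt ?R x) * (ennreal (1 / \<bar>d\<bar>) * (?c * ennreal (s x (0, 0)))) \<partial>?M) = ?c * E"
      unfolding E_def by (subst nn_integral_cmult[symmetric]) (auto simp: mult_ac)
    have rest: "(\<integral>\<^sup>+x. ennreal (wt ?R x) * (ennreal (1 / \<bar>d\<bar>) * (?c * ennreal \<eta>)) \<partial>?M) \<le> ennreal (l * l' * (16 * L * K / d\<^sup>2))"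
    proof -
      have "ennreal (1 / \<bar>d\<bar>) * (?c * ennreal \<eta>) = ennreal (l * l' * (1 / \<bar>d\<bar> * \<eta>))"
        using I \<eta> by (simp add: ennreal_mult[symmetric] mult_ac)
      then show ?thesis using W[of "ennreal (1 / \<bar>d\<bar>) * (?c * ennreal \<eta>)"] by (simp only: ed)
    qed
    have "?E \<le> (\<integral>\<^sup>+x. ennreal (wt ?R x) * (ennreal (1 / \<bar>d\<bar>) * (?c * ennreal (s x (0, 0)))) + ennreal (wt ?R x) * (ennreal (1 / \<bar>d\<bar>) * (?c * ennreal \<eta>)) \<partial>?M)"
      unfolding Eeq distrib_left[symmetric] by (intro nn_integral_mono mult_left_mono Z1) auto
    also have "\<dots> = ?c * E + (\<integral>\<^sup>+x. ennreal (wt ?R x) * (ennreal (1 / \<bar>d\<bar>) * (?c * ennreal \<eta>)) \<partial>?M)"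
      unfolding scale[symmetric] by (rule nn_integral_add) measurable
    also have "\<dots> \<le> ?c * E + ennreal (l * l' * (16 * L * K / d\<^sup>2))" by (intro add_left_mono rest)
    also have "\<dots> = ennreal (l * l' * (e + 16 * L * K / d\<^sup>2))"
      unfolding e(2) using e(1) I \<eta> K L by (simp add: ennreal_mult[symmetric] distrib_left flip: ennreal_plus)
    finally show "?E \<le> ennreal (l * l' * (e + 16 * L * K / d\<^sup>2))" .
    have Zm: "(\<lambda>x. ?Z x) \<in> borel_measurable ?M"
      unfolding s_def tent_at_preimage_def Let_def by measurable
    have "ennreal (l * l' * e) = ?c * E" unfolding e(2) using e(1) I by (simp add: ennreal_mult)
    also have "\<dots> \<le> (\<integral>\<^sup>+x. ennreal (wt ?R x) * (ennreal (1 / \<bar>d\<bar>) * ?Z x) + ennreal (wt ?R x) * (ennreal (1 / \<bar>d\<bar>) * (?c * ennreal \<eta>)) \<partial>?M)"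
      unfolding scale[symmetric] distrib_left[symmetric] by (intro nn_integral_mono mult_left_mono Z2) auto
    also have "\<dots> = ?E + (\<integral>\<^sup>+x. ennreal (wt ?R x) * (ennreal (1 / \<bar>d\<bar>) * (?c * ennreal \<eta>)) \<partial>?M)"
      unfolding Eeq using Zm by (intro nn_integral_add) auto
    also have "\<dots> \<le> ?E + ennreal (l * l' * (16 * L * K / d\<^sup>2))" by (intro add_left_mono rest)
    finally show "ennreal (l * l' * e) \<le> ?E + ennreal (l * l' * (16 * L * K / d\<^sup>2))" .
  qed
qed

section \<open>The second moment\<close>

definition corr :: "nat \<Rightarrow> (nat \<Rightarrow> real) \<Rightarrow> (nat \<Rightarrow> real) \<Rightarrow> real set \<Rightarrow> real set \<Rightarrow> real" where
  "corr k A A' I I' = enn2real (\<integral>\<^sup>+\<alpha>. ennreal (wt {2..k} \<alpha>) *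
     (indicator I (lin k A \<alpha>) * indicator I' (lin k A' \<alpha>)) \<partial>PiM {2..k} (\<lambda>_. lborel))"

lemma corr_nonneg [simp]: "0 \<le> corr k A A' I I'"
  by (simp add: corr_def)

lemma nn_integral_eq_corr:
  "(\<integral>\<^sup>+\<alpha>. ennreal (wt {2..k} \<alpha>) * (indicator I (lin k A \<alpha>) * indicator I' (lin k A' \<alpha>)) \<partial>PiM {2..k} (\<lambda>_. lborel))
    = ennreal (corr k A A' I I')" (is "?E = _")
proof -
  have "?E \<le> (\<integral>\<^sup>+\<alpha>. ennreal (wt {2..k} \<alpha>) * 1 \<partial>PiM {2..k} (\<lambda>_. lborel))"
    by (intro nn_integral_mono mult_left_mono) (auto simp: indicator_def)
  also have "\<dots> \<le> 1" using nn_integral_wt_le[of "{2..k}"] by simp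
  finally have "?E \<noteq> top" by (auto simp: top_unique)
  then show ?thesis unfolding corr_def by (simp add: less_top)
qed

lemma nn_integral_product_of_sums:
  fixes A :: "'b \<Rightarrow> nat \<Rightarrow> real"
  assumes "finite P" and [measurable]: "I \<in> sets borel" "I' \<in> sets borel" and l: "0 < l" "0 < l'"
  shows "(\<integral>\<^sup>+\<alpha>. ennreal (wt {2..k} \<alpha> * (((\<Sum>p\<in>P. indicator I (lin k (A p) \<alpha>)) / l) * ((\<Sum>p\<in>P. indicator I' (lin k (A p) \<alpha>)) / l')))
       \<partial>PiM {2..k} (\<lambda>_. lborel))
     = ennreal (\<Sum>p\<in>P. \<Sum>q\<in>P. corr k (A p) (A q) I I' / (l * l'))"
proof -
  let ?M = "PiM {2..k} (\<lambda>_. lborel :: real measure)"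
  have "(\<integral>\<^sup>+\<alpha>. ennreal (wt {2..k} \<alpha> * (((\<Sum>p\<in>P. indicator I (lin k (A p) \<alpha>)) / l) * ((\<Sum>p\<in>P. indicator I' (lin k (A p) \<alpha>)) / l'))) \<partial>?M)
    = (\<integral>\<^sup>+\<alpha>. (\<Sum>p\<in>P. \<Sum>q\<in>P. ennreal (wt {2..k} \<alpha>) * (indicator I (lin k (A p) \<alpha>) * indicator I' (lin k (A q) \<alpha>)) * ennreal (1 / (l * l'))) \<partial>?M)"
  proof (intro nn_integral_cong)
    fix \<alpha>
    have em: "ennreal (w * (indicator I x * indicator I' y) * z) = ennreal w * (indicator I x * indicator I' y) * ennreal z"
      if "0 \<le> w" "0 \<le> z" for w x y z :: real
      using that by (auto simp: indicator_def ennreal_mult)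
    have eq: "wt {2..k} \<alpha> * (((\<Sum>p\<in>P. indicator I (lin k (A p) \<alpha>)) / l) * ((\<Sum>p\<in>P. indicator I' (lin k (A p) \<alpha>)) / l'))
      = (\<Sum>p\<in>P. \<Sum>q\<in>P. wt {2..k} \<alpha> * (indicator I (lin k (A p) \<alpha>) * indicator I' (lin k (A q) \<alpha>)) * (1 / (l * l')))"
    proof -
      have "(a / l) * (b / l') = (a * b) * (1 / (l * l'))" for a b by simp
      then show ?thesis by (simp only: sum_product sum_distrib_left sum_distrib_right mult.assoc) (rule sum.swap)
    qed
    have "ennreal (\<Sum>p\<in>P. \<Sum>q\<in>P. wt {2..k} \<alpha> * (indicator I (lin k (A p) \<alpha>) * indicator I' (lin k (A q) \<alpha>)) * (1 / (l * l')))
      = (\<Sum>p\<in>P. \<Sum>q\<in>P. ennreal (wt {2..k} \<alpha> * (indicator I (lin k (A p) \<alpha>) * indicator I' (lin k (A q) \<alpha>)) * (1 / (l * l'))))"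
      using l by (simp add: sum_nonneg flip: sum_ennreal)
    also have "\<dots> = (\<Sum>p\<in>P. \<Sum>q\<in>P. ennreal (wt {2..k} \<alpha>) * (indicator I (lin k (A p) \<alpha>) * indicator I' (lin k (A q) \<alpha>)) * ennreal (1 / (l * l')))"
      using l by (intro sum.cong refl em) auto
    finally show "ennreal (wt {2..k} \<alpha> * (((\<Sum>p\<in>P. indicator I (lin k (A p) \<alpha>)) / l) * ((\<Sum>p\<in>P. indicator I' (lin k (A p) \<alpha>)) / l')))
      = (\<Sum>p\<in>P. \<Sum>q\<in>P. ennreal (wt {2..k} \<alpha>) * (indicator I (lin k (A p) \<alpha>) * indicator I' (lin k (A q) \<alpha>)) * ennreal (1 / (l * l')))"
      by (simp only: eq)
  qed
  also have "\<dots> = (\<Sum>p\<in>P. \<Sum>q\<in>P. ennreal (corr k (A p) (A q) I I') * ennreal (1 / (l * l')))"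
    by (simp add: nn_integral_sum nn_integral_multc nn_integral_eq_corr)
  also have "\<dots> = (\<Sum>p\<in>P. \<Sum>q\<in>P. ennreal (corr k (A p) (A q) I I' / (l * l')))"
    using l by (intro sum.cong refl) (simp flip: ennreal_mult)
  also have "\<dots> = ennreal (\<Sum>p\<in>P. \<Sum>q\<in>P. corr k (A p) (A q) I I' / (l * l'))"
    using l by (simp add: sum_nonneg)
  finally show ?thesis .
qed

text \<open>The identity (U - V)^2 + 2UV = U^2 + V^2 is integrated term by term. The cross term
  stays on the left, because subtraction of extended nonnegative reals is truncated; only after all
  totals are known to be finite is it moved across.\<close>

lemma nn_integral_square_difference_le:
  fixes A :: "'b \<Rightarrow> nat \<Rightarrow> real"
  assumes "finite P" and [measurable]: "I \<in> sets borel" "I' \<in> sets borel" and l: "0 < l" "0 < l'"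
    and y: "(\<Sum>p\<in>P. \<Sum>q\<in>P. corr k (A p) (A q) I I / (l * l) + corr k (A p) (A q) I' I' / (l' * l')
       - 2 * (corr k (A p) (A q) I I' / (l * l'))) \<le> y"
  shows "(\<integral>\<^sup>+\<alpha>. ennreal (wt {2..k} \<alpha> * ((\<Sum>p\<in>P. indicator I (lin k (A p) \<alpha>)) / l - (\<Sum>p\<in>P. indicator I' (lin k (A p) \<alpha>)) / l')\<^sup>2)
       \<partial>PiM {2..k} (\<lambda>_. lborel)) \<le> ennreal y"
proof -
  let ?M = "PiM {2..k} (\<lambda>_. lborel :: real measure)"
  define U where "U \<alpha> = (\<Sum>p\<in>P. indicator I (lin k (A p) \<alpha>)) / l" for \<alpha>
  define V where "V \<alpha> = (\<Sum>p\<in>P. indicator I' (lin k (A p) \<alpha>)) / l'" for \<alpha>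
  have UV: "U \<alpha> \<ge> 0" "V \<alpha> \<ge> 0" for \<alpha> using l by (auto simp: U_def V_def sum_nonneg)
  have [measurable]: "U \<in> borel_measurable ?M" "V \<in> borel_measurable ?M"
    unfolding U_def V_def by measurable
  define S where "S = (\<lambda>I I' l l'. \<Sum>p\<in>P. \<Sum>q\<in>P. corr k (A p) (A q) I I' / (l * l'))"
  have S0: "S I I l l \<ge> 0" "S I I' l l' \<ge> 0" "S I' I' l' l' \<ge> 0" using l by (auto simp: S_def intro!: sum_nonneg)
  let ?X = "\<integral>\<^sup>+\<alpha>. ennreal (wt {2..k} \<alpha> * (U \<alpha> - V \<alpha>)\<^sup>2) \<partial>?M"
  have "?X + (ennreal (S I I' l l') + ennreal (S I I' l l')) = 
     (\<integral>\<^sup>+\<alpha>. ennreal (wt {2..k} \<alpha> * (U \<alpha> - V \<alpha>)\<^sup>2) + (ennreal (wt {2..k} \<alpha> * (U \<alpha> * V \<alpha>)) + ennreal (wt {2..k} \<alpha> * (U \<alpha> * V \<alpha>))) \<partial>?M)"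
    unfolding S_def nn_integral_product_of_sums[OF assms(1-5), symmetric] U_def[symmetric] V_def[symmetric]
    by (simp add: nn_integral_add)
  also have "\<dots> = (\<integral>\<^sup>+\<alpha>. ennreal (wt {2..k} \<alpha> * (U \<alpha> * U \<alpha>)) + ennreal (wt {2..k} \<alpha> * (V \<alpha> * V \<alpha>)) \<partial>?M)"
  proof (intro nn_integral_cong)
    fix \<alpha>
    have "wt {2..k} \<alpha> * (U \<alpha> - V \<alpha>)\<^sup>2 + (wt {2..k} \<alpha> * (U \<alpha> * V \<alpha>) + wt {2..k} \<alpha> * (U \<alpha> * V \<alpha>)) 
      = wt {2..k} \<alpha> * (U \<alpha> * U \<alpha>) + wt {2..k} \<alpha> * (V \<alpha> * V \<alpha>)"
      by (simp add: power2_eq_square algebra_simps)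
    then show "ennreal (wt {2..k} \<alpha> * (U \<alpha> - V \<alpha>)\<^sup>2) + (ennreal (wt {2..k} \<alpha> * (U \<alpha> * V \<alpha>)) + ennreal (wt {2..k} \<alpha> * (U \<alpha> * V \<alpha>)))
      = ennreal (wt {2..k} \<alpha> * (U \<alpha> * U \<alpha>)) + ennreal (wt {2..k} \<alpha> * (V \<alpha> * V \<alpha>))"
      using UV by (simp flip: ennreal_plus)
  qed
  also have "\<dots> = ennreal (S I I l l) + ennreal (S I' I' l' l')"
    unfolding S_def nn_integral_product_of_sums[OF assms(1,2,2,4,4), symmetric] 
      nn_integral_product_of_sums[OF assms(1,3,3,5,5), symmetric] U_def[symmetric] V_def[symmetric]
    by (rule nn_integral_add) measurable
  finally have eq: "?X + (ennreal (S I I' l l') + ennreal (S I I' l l')) = ennreal (S I I l l) + ennreal (S I' I' l' l')" .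
  have y': "S I I l l + S I' I' l' l' \<le> y + (S I I' l l' + S I I' l l')"
    using y unfolding S_def sum.distrib sum_subtractf sum_distrib_left[symmetric] by linarith
  have "?X + ennreal (S I I' l l' + S I I' l l') = ennreal (S I I l l + S I' I' l' l')"
    using eq S0 by (simp only: ennreal_plus)
  then have "?X \<noteq> top" by auto
  then obtain r where r: "r \<ge> 0" "?X = ennreal r" by (cases ?X) auto
  have "ennreal (r + (S I I' l l' + S I I' l l')) = ennreal (S I I l l + S I' I' l' l')"
    using eq r(1) S0 unfolding r(2) by (simp only: ennreal_plus add_nonneg_nonneg)
  then have "r + (S I I' l l' + S I I' l l') = S I I l l + S I' I' l' l'"
    using r S0 by (subst (asm) ennreal_inj) auto
  then have "r \<le> y" using y' by linarith
  then show ?thesis using r unfolding U_def V_def by (simp add: ennreal_leI)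
qed

text \<open>Dyadic decomposition. On the level \<open>h x = l\<close> the maximum lies between 2^l *
  \<Lambda> and 2^(l+1) * \<Lambda>, so there are at most B * 2^(l+1) * \<Lambda> points, each
  contributing at most 1 / (2^l * \<Lambda>): every level gives at most 2 * B. The top level is the
  reason why the count is assumed up to 2 * W.\<close>

lemma sum_inverse_max_le:
  fixes f :: "'b \<Rightarrow> real"
  assumes "finite S" and \<Lambda>: "0 < \<Lambda>" "\<Lambda> \<le> W" and f: "\<And>x. x \<in> S \<Longrightarrow> f x \<le> W"
    and B: "\<And>w. \<Lambda> \<le> w \<Longrightarrow> w \<le> 2 * W \<Longrightarrow> real (card {x \<in> S. f x \<le> w}) \<le> B * w"
  shows "(\<Sum>x\<in>S. 1 / max (f x) \<Lambda>) \<le> 2 * B * (log 2 (W / \<Lambda>) + 1)"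
proof -
  define K where "K = nat \<lfloor>log 2 (W / \<Lambda>)\<rfloor>"
  define h where "h x = nat \<lfloor>log 2 (max (f x) \<Lambda> / \<Lambda>)\<rfloor>" for x
  have B0: "B \<ge> 0"
    using B[of W] \<Lambda> by (smt (verit) mult_neg_pos of_nat_0_le_iff)
  have h: "2 ^ h x * \<Lambda> \<le> max (f x) \<Lambda>" "max (f x) \<Lambda> < 2 ^ Suc (h x) * \<Lambda>" for x
  proof -
    define z where "z = max (f x) \<Lambda> / \<Lambda>"
    have z: "z \<ge> 1" using \<Lambda> by (simp add: z_def)
    then have l0: "log 2 z \<ge> 0" by simp
    have "real (h x) \<le> log 2 z" "log 2 z < real (h x) + 1"
      using l0 unfolding h_def z_def[symmetric] by linarith+
    then have "2 powr real (h x) \<le> 2 powr log 2 z" "2 powr log 2 z < 2 powr (real (h x) + 1)"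
      by simp_all
    then have "2 ^ h x \<le> z" "z < 2 ^ Suc (h x)"
      using z by (simp_all add: powr_realpow powr_add)
    then show "2 ^ h x * \<Lambda> \<le> max (f x) \<Lambda>" "max (f x) \<Lambda> < 2 ^ Suc (h x) * \<Lambda>"
      using \<Lambda> by (simp_all add: z_def field_simps)
  qed
  have hK: "h x \<le> K" if "x \<in> S" for x
  proof -
    have "max (f x) \<Lambda> / \<Lambda> \<le> W / \<Lambda>" using f[OF that] \<Lambda> by (intro divide_right_mono) auto
    then have "log 2 (max (f x) \<Lambda> / \<Lambda>) \<le> log 2 (W / \<Lambda>)" using \<Lambda> by (simp add: divide_pos_pos)
    then show ?thesis unfolding h_def K_def by (intro nat_mono floor_mono)
  qed
  have "(\<Sum>x\<in>S. 1 / max (f x) \<Lambda>) = (\<Sum>l\<in>{..K}. \<Sum>x\<in>{x\<in>S. h x = l}. 1 / max (f x) \<Lambda>)"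
    using assms(1) hK by (subst sum.group) auto
  also have "\<dots> \<le> (\<Sum>l\<in>{..K}. 2 * B)"
  proof (rule sum_mono)
    fix l assume "l \<in> {..K}"
    show "(\<Sum>x\<in>{x\<in>S. h x = l}. 1 / max (f x) \<Lambda>) \<le> 2 * B"
    proof (cases "{x\<in>S. h x = l} = {}")
      case True
      then show ?thesis using B0 by (simp only: sum.empty)
    next
      case False
      then obtain x0 where x0: "x0 \<in> S" "h x0 = l" by auto
      have "2 ^ l * \<Lambda> \<le> W" using h(1)[of x0] f[OF x0(1)] x0 \<Lambda> by auto
      then have le: "2 ^ Suc l * \<Lambda> \<le> 2 * W" by simp
      have ge: "\<Lambda> \<le> 2 ^ Suc l * \<Lambda>" using \<Lambda> by (simp add: mult_le_cancel_right1 del: power_Suc)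
      have "(\<Sum>x\<in>{x\<in>S. h x = l}. 1 / max (f x) \<Lambda>) \<le> (\<Sum>x\<in>{x\<in>S. h x = l}. 1 / (2 ^ l * \<Lambda>))"
      proof (rule sum_mono)
        fix x assume "x \<in> {x \<in> S. h x = l}"
        then show "1 / max (f x) \<Lambda> \<le> 1 / (2 ^ l * \<Lambda>)" using h(1)[of x] \<Lambda> by (intro divide_left_mono) auto
      qed
      also have "\<dots> = real (card {x\<in>S. h x = l}) / (2 ^ l * \<Lambda>)" by simp
      also have "\<dots> \<le> real (card {x\<in>S. f x \<le> 2 ^ Suc l * \<Lambda>}) / (2 ^ l * \<Lambda>)"
      proof (intro divide_right_mono of_nat_mono card_mono subsetI)
        fix x assume "x \<in> {x \<in> S. h x = l}"
        then show "x \<in> {x\<in>S. f x \<le> 2 ^ Suc l * \<Lambda>}" using h(2)[of x] by auto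
      qed (use assms(1) \<Lambda> in auto)
      also have "\<dots> \<le> (B * (2 ^ Suc l * \<Lambda>)) / (2 ^ l * \<Lambda>)"
        using B[OF ge le] \<Lambda> by (intro divide_right_mono) auto
      also have "\<dots> = 2 * B" using \<Lambda> by simp
      finally show ?thesis .
    qed
  qed
  also have "\<dots> = (real K + 1) * (2 * B)" by (simp add: algebra_simps)
  also have "\<dots> \<le> (log 2 (W / \<Lambda>) + 1) * (2 * B)"
  proof -
    have "log 2 (W / \<Lambda>) \<ge> 0" using \<Lambda> by simp
    then show ?thesis unfolding K_def using B0 by (intro mult_right_mono) auto
  qed
  finally show ?thesis by (simp add: mult_ac)
qed

section \<open>Good pairs and the tube around a given one\<close>

definition box :: "nat \<Rightarrow> nat \<Rightarrow> (nat \<Rightarrow> nat) set" where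
  "box k N = ({1..k} \<rightarrow>\<^sub>E {..N})"

definition diff :: "nat \<Rightarrow> (nat \<Rightarrow> nat) \<times> (nat \<Rightarrow> nat) \<Rightarrow> nat \<Rightarrow> real" where
  "diff k p i = real (fst p i) ^ k - real (snd p i) ^ k"

text \<open>Every entry of \<open>diff\<close> is within a factor N powr e of the maximal size N^k.
  Hence quotients of entries are at most N powr e, and the shell counts apply with floor N powr (k -
  e).\<close>

definition good :: "nat \<Rightarrow> nat \<Rightarrow> real \<Rightarrow> ((nat \<Rightarrow> nat) \<times> (nat \<Rightarrow> nat)) set" where
  "good k N e = {p \<in> box k N \<times> box k N. \<forall>i\<in>{1..k}. real N powr (real k - e) \<le> \<bar>diff k p i\<bar>}"

lemma finite_box: "finite (box k N)"
  by (simp add: box_def finite_PiE)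

lemma card_box: "card (box k N) = (N + 1) ^ k"
  by (simp add: box_def card_PiE)

lemma finite_good: "finite (good k N e)"
  using finite_box by (auto simp: good_def intro: finite_subset[of _ "box k N \<times> box k N"])

lemma card_good_le: "card (good k N e) \<le> (N + 1) ^ (2 * k)"
proof -
  have "card (good k N e) \<le> card (box k N \<times> box k N)"
    using finite_box by (intro card_mono) (auto simp: good_def)
  then show ?thesis by (simp add: card_cartesian_product card_box power_add mult_2)
qed

lemma F_diff_eq_lin: 
  "F k \<alpha> (\<lambda>i. real (m i)) - F k \<alpha> (\<lambda>i. real (n i)) = lin k (diff k (m, n)) \<alpha>"
  by (simp add: F_def lin_def diff_def sum_subtractf algebra_simps)

lemma abs_diff_le:
  assumes "p \<in> box k N \<times> box k N" "i \<in> {1..k}"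
  shows "\<bar>diff k p i\<bar> \<le> real N ^ k"
proof -
  have "fst p i \<le> N" "snd p i \<le> N" using assms by (auto simp: box_def PiE_iff)
  then have "real (fst p i) ^ k \<le> real N ^ k" "real (snd p i) ^ k \<le> real N ^ k"
    by (auto intro!: power_mono)
  then show ?thesis unfolding diff_def by (smt (verit) of_nat_0_le_iff zero_le_power)
qed

text \<open>In the application \<open>A\<close> is the vector of one pair and \<open>T\<close> the
  factor that matches entry 2. Once entry 2 of \<open>q\<close> is chosen, in (N + 1)^2 ways, every
  other entry is confined to a window of length 2 * w, which costs two shells, one for each sign.
  The hypothesis bounds the (k-1)-st power of a shell count since exactly k - 1 entries
  remain.\<close>

lemma card_neighbours_le:
  fixes k N :: nat and e C w t :: real and A :: "nat \<Rightarrow> real" and T :: "real \<Rightarrow> real"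
  assumes k: "k \<ge> 3" and N: "N > 0" and w: "w \<ge> 0"
    and C: "\<And>X. real (card (shell k N (real N powr (real k - e)) X (2 * w))) ^ (k - 1) \<le> C"
  shows "real (card {q \<in> good k N e. \<forall>j\<in>{1..k} - {2}. \<bar>diff k q j - T (diff k q 2) * A j\<bar> \<le> w})
     \<le> (real N + 1)\<^sup>2 * (2 ^ (k - 1) * C)"
proof -
  define y where "y = real N powr (real k - e)"
  define Q where "Q = {q \<in> good k N e. \<forall>j\<in>{1..k} - {2}. \<bar>diff k q j - T (diff k q 2) * A j\<bar> \<le> w}"
  \<comment> \<open>The hypothesis bounds a power; \<open>b\<close> is the resulting bound for a
    single shell.\<close>
  define b where "b = C powr (1 / real (k - 1))"
  have C0: "C \<ge> 0" using C[of 0] by (meson of_nat_0_le_iff order_trans zero_le_power)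
  have bk: "b ^ (k - 1) = C"
  proof (cases "C = 0")
    case True
    then show ?thesis using k by (simp add: b_def)
  next
    case False
    then have "C > 0" using C0 by simp
    then have "b ^ (k - 1) = b powr real (k - 1)" unfolding b_def by (subst powr_realpow) auto
    then show ?thesis using k \<open>C > 0\<close> by (simp add: b_def powr_powr)
  qed
  have b0: "b \<ge> 0" by (simp add: b_def)
  have sh: "real (card (shell k N y X (2 * w))) \<le> b" for X
    using C[of X] k b0 power_mono_iff[of "real (card (shell k N y X (2 * w)))" b "k - 1"]
    unfolding bk[symmetric] y_def by simp
  define D where "D v i = {(a, b). a \<le> N \<and> b \<le> N \<and> y \<le> \<bar>real a ^ k - real b ^ k\<bar> \<and>
      \<bar>real a ^ k - real b ^ k - T (real (fst v) ^ k - real (snd v) ^ k) * A i\<bar> \<le> w}" for v :: "nat \<times> nat" and i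
  have fD: "finite (D v i)" for v i
    by (rule finite_subset[of _ "{..N} \<times> {..N}"]) (auto simp: D_def)
  have cD: "real (card (D v i)) \<le> 2 * b" for v i
  proof -
    define z where "z = T (real (fst v) ^ k - real (snd v) ^ k) * A i"
    \<comment> \<open>A shell contains only positive differences; a negative one is a shell point
      with its two components exchanged.\<close>
    have "D v i \<subseteq> shell k N y (z - w) (2 * w) \<union> prod.swap ` shell k N y (- z - w) (2 * w)"
    proof
      fix u assume "u \<in> D v i"
      then obtain a c where u: "u = (a, c)" "a \<le> N" "c \<le> N" "y \<le> \<bar>real a ^ k - real c ^ k\<bar>"
        "\<bar>real a ^ k - real c ^ k - z\<bar> \<le> w" by (auto simp: D_def z_def)
      show "u \<in> shell k N y (z - w) (2 * w) \<union> prod.swap ` shell k N y (- z - w) (2 * w)"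
      proof (cases "real a ^ k - real c ^ k \<ge> 0")
        case True
        then show ?thesis using u by (auto simp: shell_def abs_if split: if_splits)
      next
        case False
        then have "(c, a) \<in> shell k N y (- z - w) (2 * w)" using u by (auto simp: shell_def abs_if split: if_splits)
        then show ?thesis using u(1) by (force simp: image_iff)
      qed
    qed
    then have "card (D v i) \<le> card (shell k N y (z - w) (2 * w) \<union> prod.swap ` shell k N y (- z - w) (2 * w))"
      by (intro card_mono) (auto simp: finite_shell)
    also have "\<dots> \<le> card (shell k N y (z - w) (2 * w)) + card (prod.swap ` shell k N y (- z - w) (2 * w))"
      by (rule card_Un_le)
    also have "\<dots> \<le> card (shell k N y (z - w) (2 * w)) + card (shell k N y (- z - w) (2 * w))"
      by (intro add_left_mono card_image_le finite_shell)
    finally have "real (card (D v i)) \<le> real (card (shell k N y (z - w) (2 * w))) + real (card (shell k N y (- z - w) (2 * w)))"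
      by (metis of_nat_add of_nat_le_iff)
    then show ?thesis using sh[of "z - w"] sh[of "- z - w"] by linarith
  qed
  let ?J = "{1..k} - {2}"
  \<comment> \<open>Index 2 is split off because the admissible sets \<open>D v i\<close> of all
    other indices depend on it.\<close>
  define \<phi> where "\<phi> q = ((fst q 2, snd q 2), \<lambda>i\<in>?J. (fst q i, snd q i))" for q :: "(nat \<Rightarrow> nat) \<times> (nat \<Rightarrow> nat)"
  define Z where "Z = (SIGMA v:{..N} \<times> {..N}. PiE ?J (D v))"
  have fZ: "finite Z" unfolding Z_def using fD by (intro finite_SigmaI finite_PiE) auto
  have "inj_on \<phi> Q"
  proof (rule inj_onI)
    fix q q' assume q: "q \<in> Q" "q' \<in> Q" and eq: "\<phi> q = \<phi> q'"
    have e2: "fst q 2 = fst q' 2" "snd q 2 = snd q' 2" using eq by (auto simp: \<phi>_def)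
    have ei: "(\<lambda>i\<in>?J. (fst q i, snd q i)) i = (\<lambda>i\<in>?J. (fst q' i, snd q' i)) i" for i
      using eq by (simp add: \<phi>_def)
    have ej: "fst q i = fst q' i \<and> snd q i = snd q' i" if "i \<in> ?J" for i
      using ei[of i] that by (simp only: restrict_apply' prod.inject)
    have all: "fst q i = fst q' i \<and> snd q i = snd q' i" if "i \<in> {1..k}" for i
      using ej[of i] e2 that by (cases "i = 2") auto
    have b: "fst q \<in> box k N" "fst q' \<in> box k N" "snd q \<in> box k N" "snd q' \<in> box k N"
      using q by (auto simp: Q_def good_def)
    have "fst q = fst q'"
      by (rule PiE_ext[OF b(1,2)[unfolded box_def]]) (use all in blast)
    moreover have "snd q = snd q'"
      by (rule PiE_ext[OF b(3,4)[unfolded box_def]]) (use all in blast)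
    ultimately show "q = q'" by (simp add: prod_eq_iff)
  qed
  moreover have "\<phi> ` Q \<subseteq> Z"
  proof (rule image_subsetI)
    fix q assume q0: "q \<in> Q"
    obtain m n where mn: "q = (m, n)" by (cases q)
    have q: "(m, n) \<in> Q" using q0 mn by simp
    have b: "m i \<le> N" "n i \<le> N" if "i \<in> {1..k}" for i
      using q that by (auto simp: Q_def good_def box_def PiE_iff)
    have "(m i, n i) \<in> D (m 2, n 2) i" if i: "i \<in> ?J" for i
      using q b[of i] i by (auto simp: D_def Q_def good_def diff_def y_def)
    then show "\<phi> q \<in> Z" unfolding mn using b[of 2] k by (auto simp: \<phi>_def Z_def)
  qed
  ultimately have "card Q \<le> card Z" using fZ by (rule card_inj_on_le)
  also have "card Z = (\<Sum>v\<in>{..N} \<times> {..N}. card (PiE ?J (D v)))"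
    unfolding Z_def using fD by (intro card_SigmaI) (auto intro!: finite_PiE)
  finally have "real (card Q) \<le> (\<Sum>v\<in>{..N} \<times> {..N}. real (card (PiE ?J (D v))))"
    by (metis of_nat_le_iff of_nat_sum)
  also have "\<dots> \<le> (\<Sum>v\<in>{..N} \<times> {..N}. (2 * b) ^ (k - 1))"
  proof (rule sum_mono)
    fix v
    have "real (card (PiE ?J (D v))) = (\<Prod>i\<in>?J. real (card (D v i)))"
      by (simp add: card_PiE)
    also have "\<dots> \<le> (\<Prod>i\<in>?J. 2 * b)" using cD by (intro prod_mono) auto
    also have "\<dots> = (2 * b) ^ (k - 1)" using k by (simp add: card_Diff_subset)
    finally show "real (card (PiE ?J (D v))) \<le> (2 * b) ^ (k - 1)" .
  qed
  also have "\<dots> = (real N + 1)\<^sup>2 * (2 ^ (k - 1) * C)"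
    using bk by (simp add: card_cartesian_product power2_eq_square power_mult_distrib algebra_simps)
  finally show ?thesis by (simp add: Q_def)
qed

lemma real_le_sum_nat: "n \<le> (\<Sum>a\<in>A. f a) \<Longrightarrow> real n \<le> (\<Sum>a\<in>A. real (f a))"
  by (simp flip: of_nat_sum)

text \<open>Distance, in the maximum norm over the indices 3..k, of the second vector from the
  multiple of the first that agrees with it at index 2. Times |diff k p 2| this is the largest minor
  involving index 2, that is, the best available Jacobian. Index 1 is left out because no \<alpha>
  belongs to it.\<close>

definition skew :: "nat \<Rightarrow> (nat \<Rightarrow> nat) \<times> (nat \<Rightarrow> nat) \<Rightarrow> (nat \<Rightarrow> nat) \<times> (nat \<Rightarrow> nat) \<Rightarrow> real" where
  "skew k p q = Max ((\<lambda>j. \<bar>diff k q j - diff k q 2 / diff k p 2 * diff k p j\<bar>) ` {3..k})"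

lemma skew_ge: "j \<in> {3..k} \<Longrightarrow> \<bar>diff k q j - diff k q 2 / diff k p 2 * diff k p j\<bar> \<le> skew k p q"
  unfolding skew_def by (intro Max_ge) auto

lemma skew_attained:
  assumes "k \<ge> 3"
  obtains j where "j \<in> {3..k}" "skew k p q = \<bar>diff k q j - diff k q 2 / diff k p 2 * diff k p j\<bar>"
proof -
  have "skew k p q \<in> (\<lambda>j. \<bar>diff k q j - diff k q 2 / diff k p 2 * diff k p j\<bar>) ` {3..k}"
    unfolding skew_def using assms by (intro Max_in) auto
  then show ?thesis using that by auto
qed

lemma skew_minor:
  assumes "k \<ge> 3" "diff k p 2 \<noteq> 0"
  obtains j where "j \<in> {3..k}"
    "\<bar>diff k p 2 * diff k q j - diff k q 2 * diff k p j\<bar> = \<bar>diff k p 2\<bar> * skew k p q"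
proof -
  obtain j where j: "j \<in> {3..k}" "skew k p q = \<bar>diff k q j - diff k q 2 / diff k p 2 * diff k p j\<bar>"
    using skew_attained[OF assms(1)] by blast
  have "diff k p 2 * diff k q j - diff k q 2 * diff k p j = diff k p 2 * (diff k q j - diff k q 2 / diff k p 2 * diff k p j)"
    using assms(2) by (simp add: field_simps)
  then show ?thesis using that[OF j(1)] j(2) by (simp add: abs_mult)
qed

lemma goodD:
  assumes "p \<in> good k N e" "i \<in> {1..k}" "N > 0"
  shows "real N powr (real k - e) \<le> \<bar>diff k p i\<bar>" "diff k p i \<noteq> 0" "\<bar>diff k p i\<bar> \<le> real N ^ k"
proof -
  show a: "real N powr (real k - e) \<le> \<bar>diff k p i\<bar>" using assms by (auto simp: good_def)
  have "0 < real N powr (real k - e)" using assms by simp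
  with a show "diff k p i \<noteq> 0" by linarith
  show "\<bar>diff k p i\<bar> \<le> real N ^ k" using assms abs_diff_le[of p k N i] by (auto simp: good_def)
qed

lemma corr_nonzeroD:
  assumes "corr k A A' I I' \<noteq> 0"
  obtains \<alpha> where "\<And>i. i \<in> {2..k} \<Longrightarrow> 1 / 4 < \<alpha> i \<and> \<alpha> i < 5 / 4" "lin k A \<alpha> \<in> I" "lin k A' \<alpha> \<in> I'"
proof -
  have "\<exists>\<alpha>. ennreal (wt {2..k} \<alpha>) * (indicator I (lin k A \<alpha>) * indicator I' (lin k A' \<alpha>)) \<noteq> 0"
  proof (rule ccontr)
    assume "\<not> ?thesis"
    then have "\<And>\<alpha>. ennreal (wt {2..k} \<alpha>) * (indicator I (lin k A \<alpha>) * indicator I' (lin k A' \<alpha>)) = 0" by blast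
    then have "corr k A A' I I' = 0" unfolding corr_def by (simp only: nn_integral_const) simp
    then show False using assms by simp
  qed
  then obtain \<alpha> where \<alpha>: "ennreal (wt {2..k} \<alpha>) * (indicator I (lin k A \<alpha>) * indicator I' (lin k A' \<alpha>)) \<noteq> 0" by blast
  then have w: "wt {2..k} \<alpha> \<noteq> 0" and I: "lin k A \<alpha> \<in> I" "lin k A' \<alpha> \<in> I'"
    by (auto simp: indicator_def split: if_splits)
  have "tent (\<alpha> i) \<noteq> 0" if "i \<in> {2..k}" for i
    using w that by (auto simp: wt_def)
  then show ?thesis using that[of \<alpha>] I tent_nonzero by blast
qed

text \<open>Some \<alpha> puts both forms into \<open>I\<close>, so the form of the vector A' - t0 *
  A is O(E * \<Lambda>) there, where t0 is the quotient of the entries at 2. This vector vanishes at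
  2 and is at most \<open>w\<close> at 3..k; hence its entry at 1 is small too, which brings the
  remaining index into the tube.\<close>

lemma corr_first_coordinate_le:
  assumes c: "corr k (diff k p) (diff k q) I I \<noteq> 0" and I: "I \<subseteq> {0..\<Lambda>}" and k: "k \<ge> 3"
    and p: "diff k p 2 \<noteq> 0" and t: "\<bar>diff k q 2 / diff k p 2\<bar> \<le> E" "1 \<le> E" and w: "skew k p q \<le> w" "\<Lambda> \<le> w"
  shows "\<bar>diff k q 1 - diff k q 2 / diff k p 2 * diff k p 1\<bar> \<le> (2 * real k + 2) * E * w"
proof -
  define t0 where "t0 = diff k q 2 / diff k p 2"
  obtain \<alpha> where \<alpha>: "\<And>i. i \<in> {2..k} \<Longrightarrow> 1 / 4 < \<alpha> i \<and> \<alpha> i < 5 / 4"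
    "lin k (diff k p) \<alpha> \<in> I" "lin k (diff k q) \<alpha> \<in> I"
    using corr_nonzeroD[OF c] by metis
  have \<Lambda>: "0 \<le> \<Lambda>" using \<alpha>(2) I by auto
  then have w0: "0 \<le> w" using w by simp
  have "lin k (diff k q) \<alpha> - t0 * lin k (diff k p) \<alpha>
     = (diff k q 1 - t0 * diff k p 1) + (\<Sum>i=2..k. \<alpha> i * (diff k q i - t0 * diff k p i))"
    by (simp add: lin_def algebra_simps sum_distrib_left sum_subtractf)
  then have "\<bar>diff k q 1 - t0 * diff k p 1\<bar> \<le> \<bar>lin k (diff k q) \<alpha>\<bar> + \<bar>t0 * lin k (diff k p) \<alpha>\<bar>
     + \<bar>\<Sum>i=2..k. \<alpha> i * (diff k q i - t0 * diff k p i)\<bar>" by linarith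
  moreover have "\<bar>lin k (diff k q) \<alpha>\<bar> \<le> w" using \<alpha>(3) I w by auto
  moreover have "\<bar>t0 * lin k (diff k p) \<alpha>\<bar> \<le> E * w"
    unfolding abs_mult using \<alpha>(2) I w t by (intro mult_mono) (auto simp: t0_def)
  moreover have "\<bar>\<Sum>i=2..k. \<alpha> i * (diff k q i - t0 * diff k p i)\<bar> \<le> real k * (2 * w)"
  proof -
    have "\<bar>\<Sum>i=2..k. \<alpha> i * (diff k q i - t0 * diff k p i)\<bar> \<le> (\<Sum>i=2..k. \<bar>\<alpha> i * (diff k q i - t0 * diff k p i)\<bar>)"
      by (rule sum_abs)
    also have "\<dots> \<le> (\<Sum>i=2..k. 2 * w)"
    proof (rule sum_mono)
      fix i assume i: "i \<in> {2..k}"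
      have "\<bar>diff k q i - t0 * diff k p i\<bar> \<le> w"
      proof (cases "i = 2")
        case True
        then show ?thesis using p w0 by (simp add: t0_def)
      next
        case False
        then have "i \<in> {3..k}" using i by auto
        then show ?thesis using skew_ge[of i k q p] w unfolding t0_def by linarith
      qed
      then show "\<bar>\<alpha> i * (diff k q i - t0 * diff k p i)\<bar> \<le> 2 * w"
        unfolding abs_mult using \<alpha>(1)[OF i] by (intro mult_mono) auto
    qed
    also have "\<dots> \<le> real k * (2 * w)" using w0 by (simp add: mult_right_mono)
    finally show ?thesis .
  qed
  moreover have "w \<le> E * w" using t(2) w0 by (simp add: mult_le_cancel_right1)
  moreover have "real k * (2 * w) \<le> real k * (2 * (E * w))" using t(2) w0 by (intro mult_left_mono) (auto simp: mult_le_cancel_right1)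
  ultimately have "\<bar>diff k q 1 - t0 * diff k p 1\<bar> \<le> E * w + E * w + real k * (2 * (E * w))" by linarith
  then show ?thesis by (simp add: t0_def algebra_simps)
qed

text \<open>For skew above \<Lambda> the two-variable bound gives l^2 / (|A 2| * skew). For smaller
  skew one of the two forms is ignored, which gives l / |A 2|, and \<Lambda> \<le> l * N powr e
  brings this into the same shape with \<Lambda> in place of the skew.\<close>

lemma corr_near_le:
  assumes k: "k \<ge> 3" and N: "N > 0" and pq: "p \<in> good k N e" "q \<in> good k N e"
    and I: "I \<in> sets borel" "emeasure lborel I = ennreal l"
    and l: "real N powr (- e) * \<Lambda> \<le> l" "\<Lambda> > 0" and e: "e \<ge> 0"
  shows "corr k (diff k p) (diff k q) I I \<le> l\<^sup>2 * real N powr (2 * e - real k) * (1 / max (skew k p q) \<Lambda>)"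
proof -
  define y where "y = real N powr (real k - e)"
  have y0: "y > 0" using N by (simp add: y_def)
  have two: "2 \<in> {1..k}" "2 \<in> {2..k}" using k by auto
  have A2: "y \<le> \<bar>diff k p 2\<bar>" "diff k p 2 \<noteq> 0" using goodD[OF pq(1) two(1) N] by (auto simp: y_def)
  have l0: "l > 0"
  proof -
    have "0 < real N powr (- e) * \<Lambda>" using N l by simp
    then show ?thesis using l by linarith
  qed
  have ex: "real N powr (2 * e - real k) = (1 / y) * real N powr e"
  proof -
    have "2 * e - real k = - (real k - e) + e" by simp
    then show ?thesis unfolding y_def by (simp only: powr_add powr_minus_divide)
  qed
  show ?thesis
  proof (cases "skew k p q \<le> \<Lambda>")
    case True
    have "ennreal (corr k (diff k p) (diff k q) I I) \<le>
      (\<integral>\<^sup>+\<alpha>. ennreal (wt {2..k} \<alpha>) * indicator I (lin k (diff k p) \<alpha>) \<partial>PiM {2..k} (\<lambda>_. lborel))"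
      unfolding nn_integral_eq_corr[symmetric]
      by (intro nn_integral_mono mult_left_mono) (auto simp: indicator_def)
    also have "\<dots> \<le> ennreal (1 / \<bar>diff k p 2\<bar>) * emeasure lborel I"
      using I two A2 by (intro nn_integral_lin_le) auto
    also have "\<dots> = ennreal (1 / \<bar>diff k p 2\<bar> * l)" unfolding I(2) using l0 by (subst ennreal_mult) auto
    finally have "corr k (diff k p) (diff k q) I I \<le> 1 / \<bar>diff k p 2\<bar> * l" using l0 by simp
    also have "\<dots> \<le> 1 / y * l" using A2 y0 l0 by (intro mult_right_mono divide_left_mono) auto
    also have "\<dots> \<le> 1 / y * (l * (l * real N powr e / \<Lambda>))"
    proof -
      have "\<Lambda> \<le> l * real N powr e" using l(1) N by (simp add: powr_minus field_simps)
      then have "1 \<le> l * real N powr e / \<Lambda>" using l by simp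
      then have "l * 1 \<le> l * (l * real N powr e / \<Lambda>)" using l0 by (intro mult_left_mono) auto
      then show ?thesis using y0 by (intro mult_left_mono) auto
    qed
    finally show ?thesis unfolding ex using True by (simp add: power2_eq_square max_def field_simps)
  next
    case False
    then have f: "skew k p q > \<Lambda>" "skew k p q > 0" using l by auto
    obtain j where j: "j \<in> {3..k}" "\<bar>diff k p 2 * diff k q j - diff k q 2 * diff k p j\<bar> = \<bar>diff k p 2\<bar> * skew k p q"
      by (rule skew_minor[OF k A2(2)])
    have dz: "diff k p 2 * diff k q j - diff k q 2 * diff k p j \<noteq> 0"
    proof
      assume "diff k p 2 * diff k q j - diff k q 2 * diff k p j = 0"
      then show False using j(2) f(2) A2(2) by simp
    qed
    have "ennreal (corr k (diff k p) (diff k q) I I) \<le> ennreal (l * l / \<bar>diff k p 2 * diff k q j - diff k q 2 * diff k p j\<bar>)"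
      unfolding nn_integral_eq_corr[symmetric]
      using I l0 two j A2 dz by (intro nn_integral_lin2_le) auto
    then have "corr k (diff k p) (diff k q) I I \<le> l * l / (\<bar>diff k p 2\<bar> * skew k p q)"
      using l0 f by (simp add: j(2))
    also have "\<dots> \<le> l * l / (y * skew k p q)"
      using A2 y0 f l0 by (intro divide_left_mono mult_right_mono) auto
    also have "\<dots> = l\<^sup>2 * (1 / y) * (1 / skew k p q) * 1" by (simp add: power2_eq_square)
    also have "\<dots> \<le> l\<^sup>2 * (1 / y) * (1 / skew k p q) * (real N powr e)" 
      using e N y0 f ge_one_powr_ge_zero[of "real N" e] by (intro mult_left_mono) auto
    finally show ?thesis unfolding ex using f by (simp add: max_def mult_ac)
  qed
qed

lemma exponent_small:
  fixes e :: real
  assumes "k \<ge> 3" "0 < e" "e * real k \<le> 1 / 1000"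
  shows "e \<le> 1 / 1000"
proof -
  have "e * 1 \<le> e * real k" using assms by (intro mult_left_mono) auto
  then show ?thesis using assms(3) by linarith
qed

text \<open>The first pair is free, with O(N^(2k)) choices. The second lies in a tube of width w' =
  (2k + 2) * N powr e * w, index 1 included, and \<open>card_neighbours_le\<close> with the shell
  bound allows O(N^2 * N powr (k - 2 - 1/40) * w') of those.\<close>

lemma card_near_pairs_le:
  fixes k :: nat and e :: real
  assumes k: "k \<ge> 3" and e: "0 < e" "e * real k \<le> 1 / 1000"
  shows "\<exists>C>0. \<forall>N I \<Lambda> w. real N \<ge> (8 * real k + 8) ^ 50 \<longrightarrow> I \<subseteq> {0..\<Lambda>} \<longrightarrow> 1 \<le> \<Lambda> \<longrightarrow> \<Lambda> \<le> w \<longrightarrow>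
     w \<le> 2 * real N powr (real k - 1 / 8) \<longrightarrow>
     real (card {(p, q) \<in> good k N e \<times> good k N e. corr k (diff k p) (diff k q) I I \<noteq> 0 \<and> skew k p q \<le> w})
       \<le> C * real N powr (3 * real k - 1 / 40 + e) * w"
proof -
  obtain C1 where C1: "C1 > 0" "\<And>N X w. N > 0 \<Longrightarrow> 1 \<le> w \<Longrightarrow> w \<le> real N powr (real k - 1 / 10) \<Longrightarrow>
     real (card (shell k N (real N powr (real k - e)) X w)) ^ (k - 1) \<le> C1 * real N powr (real k - 2 - 1 / 40) * w"
    using card_shell_power_le[OF k e] by blast
  define C where "C = 2 ^ (2 * k + 2) * 2 ^ (k - 1) * C1 * (4 * real k + 4)"
  have C0: "C > 0" using C1 by (simp add: C_def)
  have e1: "e \<le> 1 / 1000" using k e by (rule exponent_small)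
  have "real (card {(p, q) \<in> good k N e \<times> good k N e. corr k (diff k p) (diff k q) I I \<noteq> 0 \<and> skew k p q \<le> w})
       \<le> C * real N powr (3 * real k - 1 / 40 + e) * w"
    if N: "real N \<ge> (8 * real k + 8) ^ 50" and I: "I \<subseteq> {0..\<Lambda>}" and w: "1 \<le> \<Lambda>" "\<Lambda> \<le> w" "w \<le> 2 * real N powr (real k - 1 / 8)" for N I \<Lambda> w
  proof -
    define x where "x = real N"
    have x: "x \<ge> 1" using N one_le_power[of "8 * real k + 8" 50] unfolding x_def by linarith
    have N0: "N > 0" using x by (auto simp: x_def)
    have mono: "x powr a \<le> x powr b" if "a \<le> b" for a b using x that by (intro powr_mono) auto
    define E where "E = x powr e"
    have E: "1 \<le> E" using mono[of 0 e] e x by (simp add: E_def)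
    define w' where "w' = (2 * real k + 2) * E * w"
    have w'w: "w \<le> w'"
    proof -
      have "1 * 1 * w \<le> (2 * real k + 2) * E * w" using E w by (intro mult_mono) auto
      then show ?thesis by (simp add: w'_def)
    qed
    have w'1: "1 \<le> 2 * w'" using w w'w by linarith
    \<comment> \<open>The lower bound on \<open>N\<close> means 8k + 8 \<le> N powr (1/50). As 1/50
      + e - 1/8 < -1/10, the window length stays in the range of the shell bound.\<close>
    have w'2: "2 * w' \<le> x powr (real k - 1 / 10)"
    proof -
      have "8 * real k + 8 \<le> x powr (1 / 50)"
      proof -
        have "((8 * real k + 8) ^ 50) powr (1 / 50) \<le> x powr (1 / 50)"
          using N by (intro powr_mono2) (auto simp: x_def)
        moreover have "((8 * real k + 8) ^ 50) powr (1 / 50) = 8 * real k + 8"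
        proof -
          have "(z ^ 50) powr (1 / 50) = z" if "z > 0" for z :: real
          proof -
            have "z ^ 50 = z powr real 50" using that by (rule powr_realpow[symmetric])
            then show ?thesis using that by (simp only: powr_powr) simp
          qed
          then show ?thesis by (simp add: add_nonneg_pos)
        qed
        ultimately show ?thesis by simp
      qed
      then have "(8 * real k + 8) * (E * x powr (real k - 1 / 8)) \<le> x powr (1 / 50) * (E * x powr (real k - 1 / 8))"
        using E by (intro mult_right_mono) auto
      also have "\<dots> = x powr (1 / 50 + (e + (real k - 1 / 8)))" by (simp only: E_def powr_add)
      also have "\<dots> \<le> x powr (real k - 1 / 10)" using e1 by (intro mono) (simp add: field_simps)
      finally have a: "(8 * real k + 8) * (E * x powr (real k - 1 / 8)) \<le> x powr (real k - 1 / 10)" .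
      have "2 * w' = (4 * real k + 4) * E * w" by (simp add: w'_def algebra_simps)
      also have "\<dots> \<le> (4 * real k + 4) * E * (2 * x powr (real k - 1 / 8))"
        using w E by (intro mult_left_mono) (auto simp: x_def)
      also have "\<dots> = (8 * real k + 8) * (E * x powr (real k - 1 / 8))" by (simp add: algebra_simps)
      finally show ?thesis using a by linarith
    qed
    let ?S = "{(p, q) \<in> good k N e \<times> good k N e. corr k (diff k p) (diff k q) I I \<noteq> 0 \<and> skew k p q \<le> w}"
    define Q where "Q p = {q \<in> good k N e. \<forall>j\<in>{1..k} - {2}. \<bar>diff k q j - (\<lambda>d. d / diff k p 2) (diff k q 2) * diff k p j\<bar> \<le> w'}" for p
    have fQ: "finite (Q p)" for p using finite_good by (auto simp: Q_def)
    have sub: "?S \<subseteq> (SIGMA p:good k N e. Q p)"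
    proof clarify
      fix p q assume p: "p \<in> good k N e" and q: "q \<in> good k N e" and c: "corr k (diff k p) (diff k q) I I \<noteq> 0" and s: "skew k p q \<le> w"
      have two: "2 \<in> {1..k}" using k by auto
      have A2: "x powr (real k - e) \<le> \<bar>diff k p 2\<bar>" "diff k p 2 \<noteq> 0" using goodD[OF p two N0] by (auto simp: x_def)
      have "\<bar>diff k q 2 / diff k p 2\<bar> \<le> x ^ k / x powr (real k - e)"
        unfolding abs_divide using A2 goodD(3)[OF q two N0] x by (intro frac_le) (auto simp: x_def)
      also have "\<dots> = E" using x powr_diff[of x "real k" "real k - e"] by (simp add: E_def powr_realpow)
      finally have t: "\<bar>diff k q 2 / diff k p 2\<bar> \<le> E" .
      have "\<bar>diff k q j - diff k q 2 / diff k p 2 * diff k p j\<bar> \<le> w'" if j: "j \<in> {1..k} - {2}" for j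
      proof (cases "j = 1")
        case True
        show ?thesis unfolding True w'_def
          by (rule corr_first_coordinate_le[OF c I k A2(2) t E s w(2)])
      next
        case False
        then have "j \<in> {3..k}" using j by auto
        then show ?thesis using skew_ge[of j k q p] s w'w by linarith
      qed
      then show "q \<in> Q p" using q by (simp add: Q_def)
    qed
    have cQ: "real (card (Q p)) \<le> (x + 1)\<^sup>2 * (2 ^ (k - 1) * (C1 * x powr (real k - 2 - 1 / 40) * (2 * w')))" for p
      unfolding Q_def x_def using k N0 w'1 w'2 w w'w
      by (intro card_neighbours_le C1(2)) (auto simp: x_def)
    have "card ?S \<le> card (SIGMA p:good k N e. Q p)"
      using sub fQ finite_good by (intro card_mono) auto
    also have "\<dots> = (\<Sum>p\<in>good k N e. card (Q p))" using fQ finite_good by (intro card_SigmaI) auto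
    finally have "real (card ?S) \<le> (\<Sum>p\<in>good k N e. real (card (Q p)))"
      by (rule real_le_sum_nat)
    also have "\<dots> \<le> (\<Sum>p\<in>good k N e. (x + 1)\<^sup>2 * (2 ^ (k - 1) * (C1 * x powr (real k - 2 - 1 / 40) * (2 * w'))))"
      by (intro sum_mono cQ)
    also have "\<dots> = real (card (good k N e)) * ((x + 1)\<^sup>2 * (2 ^ (k - 1) * (C1 * x powr (real k - 2 - 1 / 40) * (2 * w'))))"
      by simp
    also have "\<dots> \<le> (2 * x) ^ (2 * k) * ((2 * x)\<^sup>2 * (2 ^ (k - 1) * (C1 * x powr (real k - 2 - 1 / 40) * (2 * w'))))"
    proof (rule mult_mono)
      have "real (card (good k N e)) \<le> real ((N + 1) ^ (2 * k))" by (intro of_nat_mono card_good_le)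
      also have "\<dots> = (x + 1) ^ (2 * k)" by (simp add: x_def add.commute)
      also have "\<dots> \<le> (2 * x) ^ (2 * k)" using x by (intro power_mono) auto
      finally show "real (card (good k N e)) \<le> (2 * x) ^ (2 * k)" .
      show "(x + 1)\<^sup>2 * (2 ^ (k - 1) * (C1 * x powr (real k - 2 - 1 / 40) * (2 * w'))) \<le>
        (2 * x)\<^sup>2 * (2 ^ (k - 1) * (C1 * x powr (real k - 2 - 1 / 40) * (2 * w')))"
        using x C1 w'1 by (intro mult_right_mono power_mono) auto
    qed (use x C1 w'1 in auto)
    also have "\<dots> = C * (x ^ (2 * k) * x ^ 2 * x powr (real k - 2 - 1 / 40) * x powr e) * w"
    proof -
      have alg: "(a * u) * ((b * v) * (d * (C1 * P * (2 * ((2 * r + 2) * E * w))))) = (a * b * d * C1 * (4 * r + 4)) * (u * v * P * E) * w"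
        for a u b v d P r E w C1 :: real by (simp add: algebra_simps)
      show ?thesis unfolding C_def w'_def E_def power_mult_distrib power_add by (rule alg)
    qed
    also have "x ^ (2 * k) * x ^ 2 * x powr (real k - 2 - 1 / 40) * x powr e = x powr (real (2 * k) + real 2 + (real k - 2 - 1 / 40) + e)"
    proof -
      have "x > 0" using x by simp
      then show ?thesis by (simp only: powr_add powr_realpow)
    qed
    also have "real (2 * k) + real 2 + (real k - 2 - 1 / 40) + e = 3 * real k - 1 / 40 + e" by simp
    finally show ?thesis by (simp add: x_def)
  qed
  then show ?thesis using C0 by blast
qed

text \<open>The weights l^2 * N powr (2e - k) / max skew \<Lambda> are summed dyadically against the
  count of near pairs. The number of levels is logarithmic and costs a further N powr e; in total
  1/40 - 4e is still larger than 1/50.\<close>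

lemma sum_corr_near_le:
  fixes k :: nat and e :: real
  assumes k: "k \<ge> 3" and e: "0 < e" "e * real k \<le> 1 / 1000"
  shows "\<exists>C>0. \<forall>N I l \<Lambda>. real N \<ge> (8 * real k + 8) ^ 50 \<longrightarrow> I \<in> sets borel \<longrightarrow> emeasure lborel I = ennreal l \<longrightarrow>
     I \<subseteq> {0..\<Lambda>} \<longrightarrow> 1 \<le> \<Lambda> \<longrightarrow> \<Lambda> \<le> real N powr (real k - 1 / 2) \<longrightarrow> real N powr (- e) * \<Lambda> \<le> l \<longrightarrow>
     (\<Sum>(p, q)\<in>{(p, q) \<in> good k N e \<times> good k N e. skew k p q \<le> real N powr (real k - 1 / 8)}.
        corr k (diff k p) (diff k q) I I) \<le> C * l\<^sup>2 * real N powr (2 * real k - 1 / 50)"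
proof -
  obtain C1 where C1: "C1 > 0" "\<And>N I \<Lambda> w. real N \<ge> (8 * real k + 8) ^ 50 \<Longrightarrow> I \<subseteq> {0..\<Lambda>} \<Longrightarrow> 1 \<le> \<Lambda> \<Longrightarrow> \<Lambda> \<le> w \<Longrightarrow>
     w \<le> 2 * real N powr (real k - 1 / 8) \<Longrightarrow>
     real (card {(p, q) \<in> good k N e \<times> good k N e. corr k (diff k p) (diff k q) I I \<noteq> 0 \<and> skew k p q \<le> w})
       \<le> C1 * real N powr (3 * real k - 1 / 40 + e) * w"
    using card_near_pairs_le[OF k e] by blast
  define C where "C = 2 * C1 * (real k / (e * ln 2) + 1)"
  have C0: "C > 0" using C1 e by (simp add: C_def add_nonneg_pos)
  have e1: "e \<le> 1 / 1000" using k e by (rule exponent_small)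
  have "(\<Sum>(p, q)\<in>{(p, q) \<in> good k N e \<times> good k N e. skew k p q \<le> real N powr (real k - 1 / 8)}.
        corr k (diff k p) (diff k q) I I) \<le> C * l\<^sup>2 * real N powr (2 * real k - 1 / 50)"
    if N: "real N \<ge> (8 * real k + 8) ^ 50" and I: "I \<in> sets borel" "emeasure lborel I = ennreal l" "I \<subseteq> {0..\<Lambda>}"
      and \<Lambda>: "1 \<le> \<Lambda>" "\<Lambda> \<le> real N powr (real k - 1 / 2)" "real N powr (- e) * \<Lambda> \<le> l" for N I l \<Lambda>
  proof -
    define x where "x = real N"
    have x: "x \<ge> 1" using N one_le_power[of "8 * real k + 8" 50] unfolding x_def by linarith
    have N0: "N > 0" using x by (auto simp: x_def)
    have mono: "x powr a \<le> x powr b" if "a \<le> b" for a b using x that by (intro powr_mono) auto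
    define W where "W = x powr (real k - 1 / 8)"
    have W: "\<Lambda> \<le> W" using \<Lambda>(2) mono[of "real k - 1 / 2" "real k - 1 / 8"] unfolding W_def x_def by linarith
    let ?T = "{(p, q) \<in> good k N e \<times> good k N e. skew k p q \<le> W}"
    \<comment> \<open>The count of near pairs covers only those with nonzero correlation; the others
      contribute nothing to the sum.\<close>
    define S where "S = {s \<in> ?T. corr k (diff k (fst s)) (diff k (snd s)) I I \<noteq> 0}"
    have fT: "finite ?T"
      by (rule finite_subset[of _ "good k N e \<times> good k N e"]) (blast, simp add: finite_good)
    then have fS: "finite S" by (simp add: S_def)
    define D where "D = l\<^sup>2 * x powr (2 * e - real k)"
    have D0: "D \<ge> 0" by (simp add: D_def)
    have "(\<Sum>(p, q)\<in>?T. corr k (diff k p) (diff k q) I I) = (\<Sum>s\<in>?T. corr k (diff k (fst s)) (diff k (snd s)) I I)"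
      by (intro sum.cong) auto
    also have "\<dots> = (\<Sum>s\<in>S. corr k (diff k (fst s)) (diff k (snd s)) I I)"
      using fT by (intro sum.mono_neutral_right) (auto simp: S_def)
    also have "\<dots> \<le> (\<Sum>s\<in>S. D * (1 / max (skew k (fst s) (snd s)) \<Lambda>))"
    proof (rule sum_mono)
      fix s assume "s \<in> S"
      then show "corr k (diff k (fst s)) (diff k (snd s)) I I \<le> D * (1 / max (skew k (fst s) (snd s)) \<Lambda>)"
        unfolding D_def x_def using k N0 I \<Lambda> e by (intro corr_near_le) (auto simp: S_def)
    qed
    also have "\<dots> = D * (\<Sum>s\<in>S. 1 / max (skew k (fst s) (snd s)) \<Lambda>)" by (simp only: sum_distrib_left)
    also have "\<dots> \<le> D * (2 * (C1 * x powr (3 * real k - 1 / 40 + e)) * (log 2 (W / \<Lambda>) + 1))"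
    proof (intro mult_left_mono D0 sum_inverse_max_le fS W)
      fix s assume "s \<in> S"
      then show "skew k (fst s) (snd s) \<le> W" by (auto simp: S_def)
    next
      fix w assume w: "\<Lambda> \<le> w" "w \<le> 2 * W"
      have "card {s \<in> S. skew k (fst s) (snd s) \<le> w} \<le>
        card {(p, q) \<in> good k N e \<times> good k N e. corr k (diff k p) (diff k q) I I \<noteq> 0 \<and> skew k p q \<le> w}"
      proof (rule card_mono)
        show "finite {(p, q) \<in> good k N e \<times> good k N e. corr k (diff k p) (diff k q) I I \<noteq> 0 \<and> skew k p q \<le> w}"
          by (rule finite_subset[of _ "good k N e \<times> good k N e"]) (blast, simp add: finite_good)
        show "{s \<in> S. skew k (fst s) (snd s) \<le> w} \<subseteq>
          {(p, q) \<in> good k N e \<times> good k N e. corr k (diff k p) (diff k q) I I \<noteq> 0 \<and> skew k p q \<le> w}"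
        proof
          fix s assume "s \<in> {s \<in> S. skew k (fst s) (snd s) \<le> w}"
          then show "s \<in> {(p, q) \<in> good k N e \<times> good k N e. corr k (diff k p) (diff k q) I I \<noteq> 0 \<and> skew k p q \<le> w}"
            by (cases s) (simp add: S_def)
        qed
      qed
      also have "real \<dots> \<le> C1 * x powr (3 * real k - 1 / 40 + e) * w"
        unfolding x_def using N I \<Lambda> w by (intro C1(2)) (auto simp: W_def x_def)
      finally show "real (card {s \<in> S. skew k (fst s) (snd s) \<le> w}) \<le> C1 * x powr (3 * real k - 1 / 40 + e) * w" by simp
    qed (use \<Lambda> in auto)
    also have "\<dots> \<le> D * (2 * (C1 * x powr (3 * real k - 1 / 40 + e)) * ((real k / (e * ln 2) + 1) * x powr e))"
    proof (intro mult_left_mono)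
      have W0: "0 < W" using x by (simp add: W_def)
      have "W / \<Lambda> \<le> W / 1" using W0 \<Lambda> by (intro divide_left_mono) auto
      also have "\<dots> \<le> x powr real k" unfolding W_def div_by_1 by (intro mono) simp
      finally have "log 2 (W / \<Lambda>) \<le> log 2 (x powr real k)"
        using W0 \<Lambda> by (intro log_mono) auto
      also have "\<dots> = real k * ln x / ln 2" using x by (simp add: log_def ln_powr)
      also have "\<dots> \<le> real k * (x powr e / e) / ln 2"
        using ln_powr_bound[OF x e(1)] by (intro divide_right_mono mult_left_mono) auto
      finally have "log 2 (W / \<Lambda>) \<le> real k / (e * ln 2) * x powr e" by simp
      moreover have "1 \<le> x powr e" using mono[of 0 e] e x by simp
      ultimately show "log 2 (W / \<Lambda>) + 1 \<le> (real k / (e * ln 2) + 1) * x powr e"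
        by (simp add: algebra_simps)
    qed (use C1 D0 in auto)
    also have "\<dots> = C * l\<^sup>2 * (x powr (2 * e - real k) * x powr (3 * real k - 1 / 40 + e) * x powr e)"
      unfolding C_def D_def by (simp only: mult_ac)
    also have "x powr (2 * e - real k) * x powr (3 * real k - 1 / 40 + e) * x powr e = x powr (2 * real k - 1 / 40 + 4 * e)"
      unfolding powr_add[symmetric] by (rule arg_cong[where f = "\<lambda>a. x powr a"]) simp
    also have "C * l\<^sup>2 * x powr (2 * real k - 1 / 40 + 4 * e) \<le> C * l\<^sup>2 * x powr (2 * real k - 1 / 50)"
      using C0 e1 by (intro mult_left_mono mono) auto
    finally show ?thesis by (simp add: x_def W_def)
  qed
  then show ?thesis using C0 by blast
qed

text \<open>The first two normalised correlations are at most E + \<eta> and the mixed one is at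
  least E - \<eta>, with the same density \<open>E\<close>, so the combination 1 + 1 - 2 cancels it
  and leaves 4\<eta>. Since the minor is at least N powr (2k - 1/8 - e), \<eta> is at most 16 * N
  powr (-2k - 1/4 + 2e).\<close>

lemma corr_generic_le:
  assumes k: "k \<ge> 3" and N: "N > 0" and e: "0 < e" "e \<le> 1 / 1000" 
    and pq: "p \<in> good k N e" "q \<in> good k N e" and s: "skew k p q > real N powr (real k - 1 / 8)"
    and I: "I \<in> sets borel" "emeasure lborel I = ennreal l" "0 < l" "I \<subseteq> {0..real N powr (real k - 1 / 2)}"
    and I': "I' \<in> sets borel" "emeasure lborel I' = ennreal l'" "0 < l'" "I' \<subseteq> {0..real N powr (real k - 1 / 2)}"
  shows "corr k (diff k p) (diff k q) I I / (l * l) + corr k (diff k p) (diff k q) I' I' / (l' * l')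
       - 2 * (corr k (diff k p) (diff k q) I I' / (l * l')) \<le> 64 * real N powr (- 2 * real k - 1 / 5)"
proof -
  define x where "x = real N"
  have x: "x \<ge> 1" using N by (simp add: x_def)
  have two: "2 \<in> {1..k}" "2 \<in> {2..k}" using k by auto
  have A2: "x powr (real k - e) \<le> \<bar>diff k p 2\<bar>" "diff k p 2 \<noteq> 0" using goodD[OF pq(1) two(1) N] by (auto simp: x_def)
  obtain j where j: "j \<in> {3..k}" "\<bar>diff k p 2 * diff k q j - diff k q 2 * diff k p j\<bar> = \<bar>diff k p 2\<bar> * skew k p q"
    by (rule skew_minor[OF k A2(2)])
  define d where "d = diff k p 2 * diff k q j - diff k q 2 * diff k p j"
  define L where "L = x powr (real k - 1 / 2)"
  have d: "x powr (real k - e) * x powr (real k - 1 / 8) \<le> \<bar>d\<bar>"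
    unfolding d_def j(2) using A2 s by (intro mult_mono) (auto simp: x_def)
  then have dl: "x powr (2 * real k - 1 / 8 - e) \<le> \<bar>d\<bar>"
    by (simp add: algebra_simps flip: powr_add)
  have "0 < x powr (2 * real k - 1 / 8 - e)" using x by simp
  then have d0: "d \<noteq> 0" using dl by linarith
  have jk: "2 \<in> {2..k}" "j \<in> {2..k}" "2 \<noteq> j" "j \<in> {1..k}" using j k by auto
  obtain E where E: "0 \<le> E" and bnd: "\<And>I I' l l'. \<lbrakk>I \<in> sets borel; I' \<in> sets borel; emeasure lborel I = ennreal l; emeasure lborel I' = ennreal l';
       0 \<le> l; 0 \<le> l'; I \<subseteq> {0..L}; I' \<subseteq> {0..L}\<rbrakk> \<Longrightarrow>
     ennreal (corr k (diff k p) (diff k q) I I') \<le> ennreal (l * l' * (E + 16 * L * x ^ k / d\<^sup>2)) \<and>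
     ennreal (l * l' * E) \<le> ennreal (corr k (diff k p) (diff k q) I I') + ennreal (l * l' * (16 * L * x ^ k / d\<^sup>2))"
    using nn_integral_lin2_asymp[OF jk(1-3) d0[unfolded d_def] A2(2), where K = "x ^ k" and L = L]
      goodD(3)[OF pq(1) two(1) N] goodD(3)[OF pq(1) jk(4) N] goodD(3)[OF pq(2) two(1) N] goodD(3)[OF pq(2) jk(4) N]
    unfolding nn_integral_eq_corr d_def[symmetric] by (auto simp: x_def L_def)
  define \<eta> where "\<eta> = 16 * L * x ^ k / d\<^sup>2"
  have \<eta>0: "\<eta> \<ge> 0" using x by (simp add: \<eta>_def L_def)
  have IL: "I \<subseteq> {0..L}" "I' \<subseteq> {0..L}" using I I' by (simp_all add: L_def x_def)
  have up: "corr k (diff k p) (diff k q) J J / (m * m) \<le> E + \<eta>"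
    if "J \<in> sets borel" "emeasure lborel J = ennreal m" "0 < m" "J \<subseteq> {0..L}" for J m
  proof -
    have "corr k (diff k p) (diff k q) J J \<le> m * m * (E + \<eta>)"
      using bnd[of J J m m] that E \<eta>0 by (simp add: \<eta>_def[symmetric])
    then show ?thesis using that by (simp add: field_simps)
  qed
  have lo: "E - \<eta> \<le> corr k (diff k p) (diff k q) I I' / (l * l')"
  proof -
    have "ennreal (l * l' * E) \<le> ennreal (corr k (diff k p) (diff k q) I I' + l * l' * \<eta>)"
      using bnd[of I I' l l'] I I' IL E \<eta>0 by (simp add: \<eta>_def[symmetric] flip: ennreal_plus)
    then have "l * l' * E \<le> corr k (diff k p) (diff k q) I I' + l * l' * \<eta>"
      using I I' \<eta>0 by (subst (asm) ennreal_le_iff) auto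
    then show ?thesis using I I' by (simp add: field_simps)
  qed
  have "\<eta> \<le> 16 * L * x ^ k / (x powr (2 * real k - 1 / 8 - e))\<^sup>2"
    unfolding \<eta>_def using dl d0 x by (intro divide_left_mono) (auto simp: L_def abs_le_square_iff[symmetric])
  also have "\<dots> = 16 * (x powr (real k - 1 / 2) * x powr real k / x powr (2 * (2 * real k - 1 / 8 - e)))"
  proof -
    have sq: "(x powr a)\<^sup>2 = x powr (2 * a)" for a by (simp add: power2_eq_square flip: powr_add)
    show ?thesis using x unfolding sq L_def by (simp add: powr_realpow)
  qed
  also have "\<dots> = 16 * x powr (real k - 1 / 2 + real k - 2 * (2 * real k - 1 / 8 - e))"
    by (simp only: powr_add powr_diff)
  also have "\<dots> \<le> 16 * x powr (- 2 * real k - 1 / 5)"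
    using x e by (intro mult_left_mono powr_mono) auto
  finally have "4 * \<eta> \<le> 64 * x powr (- 2 * real k - 1 / 5)" by simp
  then show ?thesis using up[OF I(1-3) IL(1)] up[OF I'(1-3) IL(2)] lo unfolding x_def by linarith
qed

text \<open>The O(N^(4k)) generic couples contribute O(N powr (-2k - 1/5)) each. For near couples
  the cross term is dropped and the two squares are summed over the tube, on both scales. The set
  \<open>P\<close> is an arbitrary set of good pairs, since later it will depend on a rational form
  and on a scale.\<close>

lemma second_moment_le:
  fixes k :: nat and e :: real
  assumes k: "k \<ge> 3" and e: "0 < e" "e * real k \<le> 1 / 1000"
  shows "\<exists>C>0. \<forall>N I l \<Lambda> P. real N \<ge> (8 * real k + 8) ^ 50 \<longrightarrow> I \<in> sets borel \<longrightarrow> emeasure lborel I = ennreal l \<longrightarrow>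
     I \<subseteq> {0..\<Lambda>} \<longrightarrow> 1 \<le> \<Lambda> \<longrightarrow> \<Lambda> \<le> real N powr (real k - 1 / 2) \<longrightarrow> real N powr (- e) * \<Lambda> \<le> l \<longrightarrow> P \<subseteq> good k N e \<longrightarrow>
     (\<integral>\<^sup>+\<alpha>. ennreal (wt {2..k} \<alpha> * ((\<Sum>p\<in>P. indicator I (lin k (diff k p) \<alpha>)) / l -
        (\<Sum>p\<in>P. indicator {0..<real N powr (real k - 1 / 2)} (lin k (diff k p) \<alpha>)) / real N powr (real k - 1 / 2))\<^sup>2)
       \<partial>PiM {2..k} (\<lambda>_. lborel)) \<le> ennreal (C * real N powr (2 * real k - 1 / 50))"
proof -
  obtain C1 where C1: "C1 > 0" "\<And>N I l \<Lambda>. real N \<ge> (8 * real k + 8) ^ 50 \<Longrightarrow> I \<in> sets borel \<Longrightarrow> emeasure lborel I = ennreal l \<Longrightarrow>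
     I \<subseteq> {0..\<Lambda>} \<Longrightarrow> 1 \<le> \<Lambda> \<Longrightarrow> \<Lambda> \<le> real N powr (real k - 1 / 2) \<Longrightarrow> real N powr (- e) * \<Lambda> \<le> l \<Longrightarrow>
     (\<Sum>(p, q)\<in>{(p, q) \<in> good k N e \<times> good k N e. skew k p q \<le> real N powr (real k - 1 / 8)}.
        corr k (diff k p) (diff k q) I I) \<le> C1 * l\<^sup>2 * real N powr (2 * real k - 1 / 50)"
    using sum_corr_near_le[OF k e] by blast
  define C where "C = 2 ^ (4 * k) * 64 + 2 * C1"
  have C0: "C > 0" using C1 by (simp add: C_def add_pos_pos)
  have e1: "e \<le> 1 / 1000" using k e by (rule exponent_small)
  have "(\<integral>\<^sup>+\<alpha>. ennreal (wt {2..k} \<alpha> * ((\<Sum>p\<in>P. indicator I (lin k (diff k p) \<alpha>)) / l -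
        (\<Sum>p\<in>P. indicator {0..<real N powr (real k - 1 / 2)} (lin k (diff k p) \<alpha>)) / real N powr (real k - 1 / 2))\<^sup>2)
       \<partial>PiM {2..k} (\<lambda>_. lborel)) \<le> ennreal (C * real N powr (2 * real k - 1 / 50))"
    if N: "real N \<ge> (8 * real k + 8) ^ 50" and I: "I \<in> sets borel" "emeasure lborel I = ennreal l" "I \<subseteq> {0..\<Lambda>}"
      and \<Lambda>: "1 \<le> \<Lambda>" "\<Lambda> \<le> real N powr (real k - 1 / 2)" "real N powr (- e) * \<Lambda> \<le> l" and P: "P \<subseteq> good k N e" for N I l \<Lambda> P
  proof -
    define x where "x = real N"
    have x: "x \<ge> 1" using N one_le_power[of "8 * real k + 8" 50] unfolding x_def by linarith
    have N0: "N > 0" using x by (auto simp: x_def)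
    have mono: "x powr a \<le> x powr b" if "a \<le> b" for a b using x that by (intro powr_mono) auto
    define L where "L = x powr (real k - 1 / 2)"
    define J where "J = {0..<L}"
    have L1: "1 \<le> L" using mono[of 0 "real k - 1 / 2"] k x by (simp add: L_def)
    have J: "J \<in> sets borel" "emeasure lborel J = ennreal L" "J \<subseteq> {0..L}" using L1 by (auto simp: J_def)
    have l0: "l > 0"
    proof -
      have "0 < real N powr (- e) * \<Lambda>" using N0 \<Lambda> by simp
      then show ?thesis using \<Lambda> by linarith
    qed
    have IL: "I \<subseteq> {0..L}" using I(3) \<Lambda>(2) by (auto simp: L_def x_def)
    define g where "g s = corr k (diff k (fst s)) (diff k (snd s)) I I / (l * l) + corr k (diff k (fst s)) (diff k (snd s)) J J / (L * L)
       - 2 * (corr k (diff k (fst s)) (diff k (snd s)) I J / (l * L))" for s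
    define h where "h s = corr k (diff k (fst s)) (diff k (snd s)) I I / (l * l) + corr k (diff k (fst s)) (diff k (snd s)) J J / (L * L)" for s
    define G where "G = good k N e \<times> good k N e"
    define Nr where "Nr = {s \<in> G. skew k (fst s) (snd s) \<le> x powr (real k - 1 / 8)}"
    have fG: "finite G" by (simp add: G_def finite_good)
    have fP: "finite P" using P finite_good finite_subset by blast
    have PG: "P \<times> P \<subseteq> G" using P by (auto simp: G_def)
    have near: "(\<Sum>s\<in>Nr. corr k (diff k (fst s)) (diff k (snd s)) A A / (m * m)) \<le> C1 * x powr (2 * real k - 1 / 50)"
      if A: "A \<in> sets borel" "emeasure lborel A = ennreal m" "A \<subseteq> {0..M}" "1 \<le> M" "M \<le> L" "x powr (- e) * M \<le> m" for A m M
    proof -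
      have m0: "m > 0"
      proof -
        have "0 < x powr (- e) * M" using x A by simp
        then show ?thesis using A by linarith
      qed
      have "(\<Sum>s\<in>Nr. corr k (diff k (fst s)) (diff k (snd s)) A A) =
        (\<Sum>(p, q)\<in>{(p, q) \<in> good k N e \<times> good k N e. skew k p q \<le> real N powr (real k - 1 / 8)}. corr k (diff k p) (diff k q) A A)"
        by (intro sum.cong) (auto simp: Nr_def G_def x_def)
      also have "\<dots> \<le> C1 * m\<^sup>2 * x powr (2 * real k - 1 / 50)"
        unfolding x_def using A N by (intro C1(2)) (auto simp: x_def L_def)
      finally have "(\<Sum>s\<in>Nr. corr k (diff k (fst s)) (diff k (snd s)) A A) / (m * m) \<le> (C1 * m\<^sup>2 * x powr (2 * real k - 1 / 50)) / (m * m)"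
        using m0 by (intro divide_right_mono) auto
      also have "\<dots> = C1 * x powr (2 * real k - 1 / 50)" using m0 by (simp add: power2_eq_square)
      finally show ?thesis by (simp add: sum_divide_distrib)
    qed
    have "(\<Sum>s\<in>Nr. h s) = (\<Sum>s\<in>Nr. corr k (diff k (fst s)) (diff k (snd s)) I I / (l * l)) + (\<Sum>s\<in>Nr. corr k (diff k (fst s)) (diff k (snd s)) J J / (L * L))"
      by (simp add: h_def sum.distrib)
    also have "\<dots> \<le> C1 * x powr (2 * real k - 1 / 50) + C1 * x powr (2 * real k - 1 / 50)"
    proof (rule add_mono)
      show "(\<Sum>s\<in>Nr. corr k (diff k (fst s)) (diff k (snd s)) I I / (l * l)) \<le> C1 * x powr (2 * real k - 1 / 50)"
        using near[of I l \<Lambda>] I \<Lambda> by (simp add: L_def x_def)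
      have "x powr (- e) \<le> 1" using mono[of "- e" 0] e x by simp
      then have "x powr (- e) * L \<le> L" using L1 by (simp add: mult_le_cancel_right1)
      then show "(\<Sum>s\<in>Nr. corr k (diff k (fst s)) (diff k (snd s)) J J / (L * L)) \<le> C1 * x powr (2 * real k - 1 / 50)"
        using near[of J L L] J L1 by simp
    qed
    finally have hN: "(\<Sum>s\<in>Nr. h s) \<le> 2 * C1 * x powr (2 * real k - 1 / 50)" by simp
    have gle: "g s \<le> (if s \<in> Nr then h s else 0) + 64 * x powr (- 2 * real k - 1 / 5)" if s: "s \<in> G" for s
    proof (cases "s \<in> Nr")
      case True
      have "g s \<le> h s" using l0 L1 by (simp add: g_def h_def)
      then show ?thesis using True x by (simp add: add_increasing2)
    next
      case False
      have "g s \<le> 64 * real N powr (- 2 * real k - 1 / 5)"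
        unfolding g_def
      proof (rule corr_generic_le[OF k N0 e(1) e1 _ _ _ I(1,2) l0 _ J(1,2)])
        show "fst s \<in> good k N e" "snd s \<in> good k N e" using s unfolding G_def by (simp_all add: mem_Times_iff)
        show "real N powr (real k - 1 / 8) < skew k (fst s) (snd s)" using s False unfolding Nr_def x_def by simp
        show "I \<subseteq> {0..real N powr (real k - 1 / 2)}" using IL by (simp add: L_def x_def)
        show "J \<subseteq> {0..real N powr (real k - 1 / 2)}" using J(3) by (simp add: L_def x_def)
        show "0 < L" using L1 by simp
      qed
      then show ?thesis using False by (simp add: x_def)
    qed
    have "(\<Sum>p\<in>P. \<Sum>q\<in>P. corr k (diff k p) (diff k q) I I / (l * l) + corr k (diff k p) (diff k q) J J / (L * L)
       - 2 * (corr k (diff k p) (diff k q) I J / (l * L))) = (\<Sum>s\<in>P \<times> P. g s)"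
      by (simp add: g_def sum.cartesian_product case_prod_beta')
    also have "\<dots> \<le> (\<Sum>s\<in>P \<times> P. (if s \<in> Nr then h s else 0) + 64 * x powr (- 2 * real k - 1 / 5))"
    proof (rule sum_mono)
      fix s assume "s \<in> P \<times> P"
      then show "g s \<le> (if s \<in> Nr then h s else 0) + 64 * x powr (- 2 * real k - 1 / 5)"
        using PG by (intro gle) blast
    qed
    \<comment> \<open>The majorants, unlike \<open>g\<close>, are nonnegative, so the sum may be
      extended from P \<times> P to all couples of good pairs; this makes the bound uniform in
      \<open>P\<close>.\<close>
    also have "\<dots> \<le> (\<Sum>s\<in>G. (if s \<in> Nr then h s else 0) + 64 * x powr (- 2 * real k - 1 / 5))"
      using PG fG l0 L1 by (intro sum_mono2) (auto simp: h_def intro!: add_nonneg_nonneg)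
    also have "\<dots> = (\<Sum>s\<in>Nr. h s) + real (card G) * (64 * x powr (- 2 * real k - 1 / 5))"
    proof -
      have "(\<Sum>s\<in>G. (if s \<in> Nr then h s else 0)) = (\<Sum>s\<in>Nr. h s)"
        using fG by (subst sum.inter_restrict[symmetric]) (auto simp: Nr_def intro!: sum.cong)
      then show ?thesis by (simp add: sum.distrib)
    qed
    also have "\<dots> \<le> 2 * C1 * x powr (2 * real k - 1 / 50) + (2 ^ (4 * k) * x ^ (4 * k)) * (64 * x powr (- 2 * real k - 1 / 5))"
    proof (intro add_mono hN mult_right_mono)
      have "real (card G) = real (card (good k N e)) * real (card (good k N e))" by (simp add: G_def card_cartesian_product)
      also have "\<dots> \<le> real ((N + 1) ^ (2 * k)) * real ((N + 1) ^ (2 * k))"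
        by (intro mult_mono of_nat_mono card_good_le) auto
      also have "\<dots> = (x + 1) ^ (4 * k)" by (simp add: x_def add.commute flip: power_add) 
      also have "\<dots> \<le> (2 * x) ^ (4 * k)" using x by (intro power_mono) auto
      finally show "real (card G) \<le> 2 ^ (4 * k) * x ^ (4 * k)" by (simp add: power_mult_distrib)
    qed auto
    also have "(2 ^ (4 * k) * x ^ (4 * k)) * (64 * x powr (- 2 * real k - 1 / 5)) = 2 ^ (4 * k) * 64 * (x powr real (4 * k) * x powr (- 2 * real k - 1 / 5))"
    proof -
      have "x ^ (4 * k) = x powr real (4 * k)" using x by (intro powr_realpow[symmetric]) auto
      then show ?thesis by (simp only: mult_ac)
    qed
    also have "x powr real (4 * k) * x powr (- 2 * real k - 1 / 5) = x powr (real (4 * k) + (- 2 * real k - 1 / 5))"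
      by (rule powr_add[symmetric])
    also have "2 * C1 * x powr (2 * real k - 1 / 50) + 2 ^ (4 * k) * 64 * x powr (real (4 * k) + (- 2 * real k - 1 / 5))
       \<le> 2 * C1 * x powr (2 * real k - 1 / 50) + 2 ^ (4 * k) * 64 * x powr (2 * real k - 1 / 50)"
      by (intro add_left_mono mult_left_mono mono) auto
    also have "\<dots> = C * x powr (2 * real k - 1 / 50)" by (simp add: C_def algebra_simps)
    finally show ?thesis
      using fP I J l0 L1 unfolding x_def[symmetric] L_def[symmetric] J_def[symmetric]
      by (intro nn_integral_square_difference_le) auto
  qed
  then show ?thesis using C0 by blast
qed

section \<open>Degenerate pairs\<close>

lemma sum_box_prod:
  fixes f :: "nat \<Rightarrow> nat \<Rightarrow> nat \<Rightarrow> real"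
  shows "(\<Sum>p\<in>box k N \<times> box k N. \<Prod>j\<in>{1..k}. f j (fst p j) (snd p j)) = (\<Prod>j\<in>{1..k}. \<Sum>a\<le>N. \<Sum>b\<le>N. f j a b)"
proof -
  have "(\<Sum>p\<in>box k N \<times> box k N. \<Prod>j\<in>{1..k}. f j (fst p j) (snd p j))
     = (\<Sum>m\<in>box k N. \<Sum>n\<in>box k N. \<Prod>j\<in>{1..k}. f j (m j) (n j))"
    by (simp add: sum.cartesian_product case_prod_beta')
  also have "\<dots> = (\<Sum>m\<in>box k N. \<Prod>j\<in>{1..k}. \<Sum>b\<le>N. f j (m j) b)"
    unfolding box_def by (intro sum.cong refl prod_sum_PiE[symmetric]) auto
  also have "\<dots> = (\<Prod>j\<in>{1..k}. \<Sum>a\<le>N. \<Sum>b\<le>N. f j a b)"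
    unfolding box_def by (intro prod_sum_PiE[symmetric]) auto
  finally show ?thesis .
qed

text \<open>Products of such factors will majorise 1 / max |A j|. Unlike the maximum they factor
  over the coordinates, so that a sum over pairs of lattice points becomes a product of
  two-dimensional sums.\<close>

definition negpow :: "nat \<Rightarrow> real \<Rightarrow> nat \<Rightarrow> nat \<Rightarrow> real" where
  "negpow k \<theta> a b = (if a = b then 0 else \<bar>real a ^ k - real b ^ k\<bar> powr (- \<theta>))"

lemma negpow_nonneg [simp]: "0 \<le> negpow k \<theta> a b"
  by (simp add: negpow_def)

definition lg :: "nat \<Rightarrow> real" where "lg N = 1 + ln (real N)"

lemma lg_ge_1: "N > 0 \<Longrightarrow> 1 \<le> lg N"
  by (simp add: lg_def)

text \<open>Write x powr (-g) as x powr (1 - g) times 1 / x: the first factor is at most N powr max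
  0 (1 - g), and the harmonic sum is at most \<open>lg N\<close>.\<close>

lemma sum_inverse_powr_le:
  assumes N: "N > 0"
  shows "(\<Sum>x=1..N. real x powr (- g)) \<le> real N powr (max 0 (1 - g)) * lg N"
proof -
  have h: "(\<Sum>x=1..N. 1 / real x) \<le> lg N"
  proof -
    obtain n where n: "N = Suc n" using N by (cases N) auto
    have "harm (Suc n) - ln (real (Suc n)) \<le> harm (Suc 0) - ln (real (Suc 0))"
      by (rule decseqD[OF decseq_harm_diff_ln]) simp
    then show ?thesis by (simp add: n lg_def harm_def inverse_eq_divide)
  qed
  have "(\<Sum>x=1..N. real x powr (- g)) \<le> (\<Sum>x=1..N. real N powr (max 0 (1 - g)) * (1 / real x))"
  proof (rule sum_mono)
    fix x assume x: "x \<in> {1..N}"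
    have "real x powr (- g) = real x powr (1 - g) * (1 / real x)"
      using x by (simp add: powr_diff powr_minus field_simps)
    also have "\<dots> \<le> real N powr (max 0 (1 - g)) * (1 / real x)"
    proof (rule mult_right_mono)
      have "real x powr (1 - g) \<le> real x powr (max 0 (1 - g))" using x by (intro powr_mono) auto
      also have "\<dots> \<le> real N powr (max 0 (1 - g))" using x by (intro powr_mono2) auto
      finally show "real x powr (1 - g) \<le> real N powr (max 0 (1 - g))" .
    qed simp
    finally show "real x powr (- g) \<le> real N powr (max 0 (1 - g)) * (1 / real x)" .
  qed
  also have "\<dots> = real N powr (max 0 (1 - g)) * (\<Sum>x=1..N. 1 / real x)" by (simp only: sum_distrib_left)
  also have "\<dots> \<le> real N powr (max 0 (1 - g)) * lg N" using h by (intro mult_left_mono) auto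
  finally show ?thesis .
qed

text \<open>The lower bound (a - b) * a^(k-1) is weakened to the symmetric form ((a - b) * a)^(k/2),
  which is possible since a - b \<le> a. Then a - b and a enter as independent variables with equal
  exponents.\<close>

lemma power_diff_ge_powr:
  fixes a b :: nat
  assumes "b < a" "k \<ge> 2"
  shows "(real (a - b) * real a) powr (real k / 2) \<le> real a ^ k - real b ^ k"
proof -
  have d: "real (a - b) = real a - real b" using assms by (simp add: of_nat_diff)
  have d0: "real (a - b) > 0" "real (a - b) \<le> real a" using assms by auto
  have a0: "real a > 0" using assms by simp
  have "(real (a - b) * real a) powr (real k / 2) = real (a - b) * real (a - b) powr (real k / 2 - 1) * real a powr (real k / 2)"
    using d0 by (simp add: powr_mult powr_diff)
  also have "\<dots> \<le> real (a - b) * real a powr (real k / 2 - 1) * real a powr (real k / 2)"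
    using d0 assms by (intro mult_right_mono mult_left_mono powr_mono2) auto
  also have "\<dots> = real (a - b) * real a powr (real k - 1)"
    by (simp add: algebra_simps flip: powr_add)
  also have "\<dots> = (real a - real b) * real a ^ (k - 1)"
  proof -
    have "real k - 1 = real (k - 1)" using assms by simp
    then show ?thesis using a0 by (simp only: d powr_realpow)
  qed
  also have "\<dots> \<le> real a ^ k - real b ^ k" using assms by (intro power_diff_ge) auto
  finally show ?thesis .
qed

text \<open>For b < a the summand is at most a powr (-g) * (a - b) powr (-g) with g = k * \<theta> /
  2, so this triangle is bounded by the square of a one-dimensional sum. The other triangle is its
  mirror image, and the diagonal is 0.\<close>

lemma sum_negpow_le:
  assumes N: "N > 0" and k: "k \<ge> 2" and t: "\<theta> \<ge> 0"
  shows "(\<Sum>a\<le>N. \<Sum>b\<le>N. negpow k \<theta> a b) \<le> 2 * real N powr (max 0 (2 - real k * \<theta>)) * (lg N)\<^sup>2"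
proof -
  define g where "g = real k * \<theta> / 2"
  define s where "s = (\<Sum>x=1..N. real x powr (- g))"
  have s0: "s \<ge> 0" by (simp add: s_def sum_nonneg)
  have tri: "(\<Sum>a\<le>N. \<Sum>b\<in>{b. b \<le> N \<and> b < a}. negpow k \<theta> a b) \<le> s * s"
  proof -
    have "(\<Sum>a\<le>N. \<Sum>b\<in>{b. b \<le> N \<and> b < a}. negpow k \<theta> a b) = (\<Sum>a=1..N. \<Sum>b\<in>{b. b \<le> N \<and> b < a}. negpow k \<theta> a b)"
      by (rule sum.mono_neutral_right) (auto simp: not_le)
    also have "\<dots> \<le> (\<Sum>a=1..N. real a powr (- g) * s)"
    proof (rule sum_mono)
      fix a assume a: "a \<in> {1..N}"
      have "(\<Sum>b\<in>{b. b \<le> N \<and> b < a}. negpow k \<theta> a b) \<le> (\<Sum>b\<in>{b. b \<le> N \<and> b < a}. real a powr (- g) * real (a - b) powr (- g))"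
      proof (rule sum_mono)
        fix b assume b: "b \<in> {b. b \<le> N \<and> b < a}"
        have pos: "0 < (real (a - b) * real a) powr (real k / 2)" using b by auto
        have le: "(real (a - b) * real a) powr (real k / 2) \<le> real a ^ k - real b ^ k"
          using b k by (intro power_diff_ge_powr) auto
        have "negpow k \<theta> a b = (real a ^ k - real b ^ k) powr (- \<theta>)"
          using b power_mono[of "real b" "real a" k] by (auto simp: negpow_def)
        also have "\<dots> \<le> ((real (a - b) * real a) powr (real k / 2)) powr (- \<theta>)"
          using pos le t by (intro powr_mono2') auto
        also have "\<dots> = real a powr (- g) * real (a - b) powr (- g)"
          using b by (simp add: powr_powr powr_mult g_def mult_ac)
        finally show "negpow k \<theta> a b \<le> real a powr (- g) * real (a - b) powr (- g)" .
      qed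
      also have "\<dots> = real a powr (- g) * (\<Sum>b\<in>{b. b \<le> N \<and> b < a}. real (a - b) powr (- g))"
        by (simp only: sum_distrib_left)
      also have "(\<Sum>b\<in>{b. b \<le> N \<and> b < a}. real (a - b) powr (- g)) = (\<Sum>x=1..a. real x powr (- g))"
        using a by (intro sum.reindex_bij_witness[where i = "\<lambda>x. a - x" and j = "\<lambda>b. a - b"]) auto
      also have "\<dots> \<le> s" unfolding s_def using a by (intro sum_mono2) auto
      finally show "(\<Sum>b\<in>{b. b \<le> N \<and> b < a}. negpow k \<theta> a b) \<le> real a powr (- g) * s"
        by (simp add: mult_left_mono)
    qed
    also have "\<dots> = s * s" by (simp add: s_def sum_distrib_right)
    finally show ?thesis .
  qed
  have sym: "negpow k \<theta> a b = negpow k \<theta> b a" for a b by (simp add: negpow_def abs_minus_commute)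
  have "(\<Sum>a\<le>N. \<Sum>b\<le>N. negpow k \<theta> a b) = (\<Sum>a\<le>N. (\<Sum>b\<in>{b. b \<le> N \<and> b < a}. negpow k \<theta> a b) + (\<Sum>b\<in>{b. b \<le> N \<and> a < b}. negpow k \<theta> a b))"
  proof (intro sum.cong refl)
    fix a assume a: "a \<in> {..N}"
    have "{..N} = insert a ({b. b \<le> N \<and> b < a} \<union> {b. b \<le> N \<and> a < b})" using a by auto
    then have "(\<Sum>b\<le>N. negpow k \<theta> a b) = negpow k \<theta> a a + (\<Sum>b\<in>{b. b \<le> N \<and> b < a} \<union> {b. b \<le> N \<and> a < b}. negpow k \<theta> a b)"
      by (simp only:) (subst sum.insert, auto)
    also have "(\<Sum>b\<in>{b. b \<le> N \<and> b < a} \<union> {b. b \<le> N \<and> a < b}. negpow k \<theta> a b) = (\<Sum>b\<in>{b. b \<le> N \<and> b < a}. negpow k \<theta> a b) + (\<Sum>b\<in>{b. b \<le> N \<and> a < b}. negpow k \<theta> a b)"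
      by (rule sum.union_disjoint) auto
    finally show "(\<Sum>b\<le>N. negpow k \<theta> a b) = (\<Sum>b\<in>{b. b \<le> N \<and> b < a}. negpow k \<theta> a b) + (\<Sum>b\<in>{b. b \<le> N \<and> a < b}. negpow k \<theta> a b)"
      by (simp add: negpow_def)
  qed
  also have "\<dots> = (\<Sum>a\<le>N. \<Sum>b\<in>{b. b \<le> N \<and> b < a}. negpow k \<theta> a b) + (\<Sum>a\<le>N. \<Sum>b\<in>{b. b \<le> N \<and> a < b}. negpow k \<theta> a b)"
    by (rule sum.distrib)
  also have "(\<Sum>a\<le>N. \<Sum>b\<in>{b. b \<le> N \<and> a < b}. negpow k \<theta> a b) = (\<Sum>b\<le>N. \<Sum>a\<in>{a. a \<le> N \<and> a < b}. negpow k \<theta> a b)"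
    using sum.swap_restrict[of "{..N}" "{..N}" "\<lambda>a b. negpow k \<theta> a b" "\<lambda>a b. a < b"] by simp
  also have "\<dots> = (\<Sum>a\<le>N. \<Sum>b\<in>{b. b \<le> N \<and> b < a}. negpow k \<theta> a b)"
    by (intro sum.cong refl) (rule sym)
  finally have "(\<Sum>a\<le>N. \<Sum>b\<le>N. negpow k \<theta> a b) \<le> 2 * (s * s)" using tri by simp
  also have "s * s \<le> (real N powr (max 0 (1 - g)) * lg N) * (real N powr (max 0 (1 - g)) * lg N)"
    using sum_inverse_powr_le[OF N, of g] s0 unfolding s_def[symmetric] by (intro mult_mono) auto
  also have "\<dots> = (real N powr (max 0 (1 - g)) * real N powr (max 0 (1 - g))) * (lg N)\<^sup>2"
    by (simp add: power2_eq_square)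
  also have "real N powr (max 0 (1 - g)) * real N powr (max 0 (1 - g)) = real N powr (max 0 (2 - real k * \<theta>))"
    unfolding powr_add[symmetric] by (rule arg_cong[where f = "\<lambda>a. real N powr a"]) (auto simp: max_def g_def)
  finally show ?thesis by simp
qed

text \<open>Rankin's trick: below the threshold \<open>Y\<close> a factor (Y / z) powr \<tau> \<ge>
  1 may be inserted, after which the restriction is dropped.\<close>

lemma sum_negpow_trunc_le:
  assumes N: "N > 0" and k: "k \<ge> 2" and t: "\<theta> \<ge> 0" "\<tau> \<ge> 0" and Y: "Y > 0"
  shows "(\<Sum>a\<le>N. \<Sum>b\<le>N. if \<bar>real a ^ k - real b ^ k\<bar> < Y then negpow k \<theta> a b else 0)
    \<le> Y powr \<tau> * (2 * real N powr (max 0 (2 - real k * (\<theta> + \<tau>))) * (lg N)\<^sup>2)"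
proof -
  have "(\<Sum>a\<le>N. \<Sum>b\<le>N. if \<bar>real a ^ k - real b ^ k\<bar> < Y then negpow k \<theta> a b else 0)
    \<le> (\<Sum>a\<le>N. \<Sum>b\<le>N. Y powr \<tau> * negpow k (\<theta> + \<tau>) a b)"
  proof (intro sum_mono)
    fix a b
    define z where "z = \<bar>real a ^ k - real b ^ k\<bar>"
    show "(if \<bar>real a ^ k - real b ^ k\<bar> < Y then negpow k \<theta> a b else 0) \<le> Y powr \<tau> * negpow k (\<theta> + \<tau>) a b"
    proof (cases "z < Y \<and> a \<noteq> b")
      case True
      have "real a ^ k \<noteq> real b ^ k" using True k by (simp add: power_eq_iff_eq_base)
      then have z0: "z > 0" by (simp add: z_def)
      have "z powr (- \<theta>) = z powr \<tau> * z powr (- (\<theta> + \<tau>))"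
        unfolding powr_add[symmetric] by simp
      also have "\<dots> \<le> Y powr \<tau> * z powr (- (\<theta> + \<tau>))"
        using True z0 t by (intro mult_right_mono powr_mono2) auto
      finally show ?thesis using True by (simp add: negpow_def z_def)
    qed (auto simp: z_def negpow_def)
  qed
  also have "\<dots> = Y powr \<tau> * (\<Sum>a\<le>N. \<Sum>b\<le>N. negpow k (\<theta> + \<tau>) a b)" by (simp only: sum_distrib_left)
  also have "\<dots> \<le> Y powr \<tau> * (2 * real N powr (max 0 (2 - real k * (\<theta> + \<tau>))) * (lg N)\<^sup>2)"
    using N k t by (intro mult_left_mono sum_negpow_le) auto
  finally show ?thesis .
qed

section \<open>First moments over degenerate pairs\<close>

lemma nn_integral_sum_lin:
  fixes A :: "'b \<Rightarrow> nat \<Rightarrow> real"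
  assumes [measurable]: "I \<in> sets borel" 
  shows "(\<integral>\<^sup>+\<alpha>. ennreal (wt {2..k} \<alpha> * (\<Sum>p\<in>P. indicator I (lin k (A p) \<alpha>))) \<partial>PiM {2..k} (\<lambda>_. lborel))
    = (\<Sum>p\<in>P. \<integral>\<^sup>+\<alpha>. ennreal (wt {2..k} \<alpha>) * indicator I (lin k (A p) \<alpha>) \<partial>PiM {2..k} (\<lambda>_. lborel))"
proof -
  have "(\<integral>\<^sup>+\<alpha>. ennreal (wt {2..k} \<alpha> * (\<Sum>p\<in>P. indicator I (lin k (A p) \<alpha>))) \<partial>PiM {2..k} (\<lambda>_. lborel))
    = (\<integral>\<^sup>+\<alpha>. (\<Sum>p\<in>P. ennreal (wt {2..k} \<alpha>) * indicator I (lin k (A p) \<alpha>)) \<partial>PiM {2..k} (\<lambda>_. lborel))"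
  proof (intro nn_integral_cong)
    fix \<alpha>
    have "ennreal (wt {2..k} \<alpha> * (\<Sum>p\<in>P. indicator I (lin k (A p) \<alpha>))) = ennreal (wt {2..k} \<alpha>) * ennreal (\<Sum>p\<in>P. indicator I (lin k (A p) \<alpha>))"
      by (rule ennreal_mult) (auto intro: sum_nonneg)
    also have "ennreal (\<Sum>p\<in>P. indicator I (lin k (A p) \<alpha>)) = (\<Sum>p\<in>P. indicator I (lin k (A p) \<alpha>))"
      by (subst sum_ennreal[symmetric]) (auto simp: ennreal_indicator)
    finally show "ennreal (wt {2..k} \<alpha> * (\<Sum>p\<in>P. indicator I (lin k (A p) \<alpha>))) = (\<Sum>p\<in>P. ennreal (wt {2..k} \<alpha>) * indicator I (lin k (A p) \<alpha>))"
      by (simp only: sum_distrib_left)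
  qed
  also have "\<dots> = (\<Sum>p\<in>P. \<integral>\<^sup>+\<alpha>. ennreal (wt {2..k} \<alpha>) * indicator I (lin k (A p) \<alpha>) \<partial>PiM {2..k} (\<lambda>_. lborel))"
    by (rule nn_integral_sum) measurable
  finally show ?thesis .
qed

text \<open>Together with \<open>good\<close> and the pairs with m = n, the sets
  \<open>offaxis\<close> and \<open>onaxis\<close> exhaust the pairs in the box. They are separated
  because a vanishing entry of \<open>diff\<close> cannot take part in a product of negative
  powers.\<close>

definition offaxis :: "nat \<Rightarrow> nat \<Rightarrow> real \<Rightarrow> ((nat \<Rightarrow> nat) \<times> (nat \<Rightarrow> nat)) set" where
  "offaxis k N e = {p \<in> box k N \<times> box k N. (\<forall>i\<in>{1..k}. fst p i \<noteq> snd p i) \<and> p \<notin> good k N e}"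

definition onaxis :: "nat \<Rightarrow> nat \<Rightarrow> ((nat \<Rightarrow> nat) \<times> (nat \<Rightarrow> nat)) set" where
  "onaxis k N = {p \<in> box k N \<times> box k N. (\<exists>i\<in>{1..k}. fst p i = snd p i) \<and> fst p \<noteq> snd p}"

lemma finite_offaxis: "finite (offaxis k N e)" and finite_onaxis: "finite (onaxis k N)"
  by (rule finite_subset[of _ "box k N \<times> box k N"], force simp: offaxis_def onaxis_def, simp add: finite_box)+

lemma diff_eq_0_iff: "k > 0 \<Longrightarrow> diff k p i = 0 \<longleftrightarrow> fst p i = snd p i"
  by (simp add: diff_def power_eq_iff_eq_base)

text \<open>Integrate over the coordinate with the largest |A j| = M. As M is at least the geometric
  mean of the |A j|, 1 / M is at most the product of their powers with exponent -1 / (k -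
  1).\<close>

lemma nn_integral_wt_lin_le_prod:
  assumes k: "k \<ge> 3" and A: "\<And>i. i \<in> {2..k} \<Longrightarrow> A i \<noteq> 0" and l: "\<Lambda> \<ge> 0"
  shows "(\<integral>\<^sup>+\<alpha>. ennreal (wt {2..k} \<alpha>) * indicator {0..\<Lambda>} (lin k A \<alpha>) \<partial>PiM {2..k} (\<lambda>_. lborel))
     \<le> ennreal (\<Lambda> * (\<Prod>j\<in>{2..k}. \<bar>A j\<bar> powr (- (1 / (real k - 1)))))"
proof -
  define M where "M = Max ((\<lambda>j. \<bar>A j\<bar>) ` {2..k})"
  have "M \<in> (\<lambda>j. \<bar>A j\<bar>) ` {2..k}" unfolding M_def using k by (intro Max_in) auto
  then obtain j where j: "j \<in> {2..k}" "M = \<bar>A j\<bar>" by auto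
  have M: "\<bar>A i\<bar> \<le> M" if "i \<in> {2..k}" for i unfolding M_def using that by (intro Max_ge) auto
  have M0: "M > 0" using j A by auto
  have "(\<Prod>i\<in>{2..k}. M powr (- (1 / (real k - 1)))) \<le> (\<Prod>i\<in>{2..k}. \<bar>A i\<bar> powr (- (1 / (real k - 1))))"
    using M A k by (intro prod_mono) (auto intro!: powr_mono2')
  also have "(\<Prod>i\<in>{2..k}. M powr (- (1 / (real k - 1)))) = 1 / M"
  proof -
    have "real (card {2..k}) = real k - 1" using k by simp
    then have "(M powr (- (1 / (real k - 1)))) ^ card {2..k} = M powr (- (1 / (real k - 1)) * (real k - 1))"
      using M0 by (subst powr_realpow[symmetric]) (auto simp: powr_powr)
    also have "- (1 / (real k - 1)) * (real k - 1) = - 1" using k by simp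
    also have "M powr (- 1) = 1 / M" using M0 by (simp add: powr_minus_divide)
    finally show ?thesis by simp
  qed
  finally have P: "1 / M \<le> (\<Prod>i\<in>{2..k}. \<bar>A i\<bar> powr (- (1 / (real k - 1))))" .
  have "(\<integral>\<^sup>+\<alpha>. ennreal (wt {2..k} \<alpha>) * indicator {0..\<Lambda>} (lin k A \<alpha>) \<partial>PiM {2..k} (\<lambda>_. lborel))
    \<le> ennreal (1 / \<bar>A j\<bar>) * emeasure lborel {0..\<Lambda>}"
    using j A by (intro nn_integral_lin_le) auto
  also have "\<dots> = ennreal (\<Lambda> * (1 / M))" using l M0 by (simp add: j(2)[symmetric] ennreal_mult[symmetric] mult.commute)
  also have "\<dots> \<le> ennreal (\<Lambda> * (\<Prod>j\<in>{2..k}. \<bar>A j\<bar> powr (- (1 / (real k - 1)))))"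
    using P l by (intro ennreal_leI mult_left_mono) auto
  finally show ?thesis .
qed

lemma prod_le_powr_sum:
  fixes S a :: "nat \<Rightarrow> real"
  assumes "N > 0" "finite J" "\<And>j. j \<in> J \<Longrightarrow> 0 \<le> S j" "\<And>j. j \<in> J \<Longrightarrow> S j \<le> b * real N powr a j"
  shows "(\<Prod>j\<in>J. S j) \<le> b ^ card J * real N powr (\<Sum>j\<in>J. a j)"
proof -
  have "(\<Prod>j\<in>J. S j) \<le> (\<Prod>j\<in>J. b * real N powr a j)" using assms by (intro prod_mono) auto
  also have "\<dots> = b ^ card J * real N powr (\<Sum>j\<in>J. a j)"
    using assms by (simp add: prod.distrib powr_sum)
  finally show ?thesis .
qed

text \<open>Without truncation, index 1 contributes N^2 and each of the other k - 1 indices N powr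
  \<sigma> up to logarithms, in total N powr (2 + (k - 1) * \<sigma>) = N^k, the order of the main
  term. But some index \<open>i\<close> carries the condition |A i| < N powr (k - e), which saves
  2e/k in the exponent if i = 1 and e * \<tau> otherwise, at least e/k^2 in either case.\<close>

lemma offaxis_first_moment_le:
  fixes k :: nat and e :: real
  assumes k: "k \<ge> 3" and e: "0 < e"
  shows "\<exists>C>0. \<forall>N \<Lambda>. N > 0 \<longrightarrow> 0 \<le> \<Lambda> \<longrightarrow>
     (\<integral>\<^sup>+\<alpha>. ennreal (wt {2..k} \<alpha> * (\<Sum>p\<in>offaxis k N e. indicator {0..\<Lambda>} (lin k (diff k p) \<alpha>))) \<partial>PiM {2..k} (\<lambda>_. lborel))
      \<le> ennreal (C * \<Lambda> * lg N ^ (2 * k) * real N powr (real k - e / (real k)\<^sup>2))"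
proof -
  define \<theta> where "\<theta> = 1 / (real k - 1)"
  \<comment> \<open>With \<theta> + \<tau> = 2/k the sum that remains after Rankin's trick has
    exponent 0, so its whole size sits in the power of the threshold.\<close>
  define \<tau> where "\<tau> = 2 / real k - \<theta>"
  define \<sigma> where "\<sigma> = 2 - real k / (real k - 1)"
  have k3: "real k \<ge> 3" using k by simp
  have \<theta>: "\<theta> \<ge> 0" using k3 by (simp add: \<theta>_def)
  have \<tau>: "\<tau> = (real k - 2) / (real k * (real k - 1))" using k3 by (simp add: \<tau>_def \<theta>_def field_simps)
  have \<tau>0: "\<tau> \<ge> 0" unfolding \<tau> using k3 by simp
  have \<tau>1: "1 / (real k)\<^sup>2 \<le> \<tau>"
  proof -
    have "1 / (real k)\<^sup>2 = ((real k - 1) / real k) / (real k * (real k - 1))"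
      using k3 by (simp add: power2_eq_square)
    also have "\<dots> \<le> (real k - 2) / (real k * (real k - 1))"
    proof (rule divide_right_mono)
      have "(real k - 1) / real k \<le> 1" using k3 by simp
      then show "(real k - 1) / real k \<le> real k - 2" using k3 by linarith
    qed (use k3 in auto)
    finally show ?thesis by (simp only: \<tau>)
  qed
  have \<sigma>: "real k * \<tau> = \<sigma>" "2 - real k * \<theta> = \<sigma>" "\<sigma> \<ge> 0" "(real k - 1) * \<sigma> = real k - 2"
    using k3 by (simp_all add: \<tau>_def \<sigma>_def \<theta>_def field_simps)
  define C where "C = real k * 4 ^ k"
  have "(\<integral>\<^sup>+\<alpha>. ennreal (wt {2..k} \<alpha> * (\<Sum>p\<in>offaxis k N e. indicator {0..\<Lambda>} (lin k (diff k p) \<alpha>))) \<partial>PiM {2..k} (\<lambda>_. lborel))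
      \<le> ennreal (C * \<Lambda> * lg N ^ (2 * k) * real N powr (real k - e / (real k)\<^sup>2))"
    if N: "N > 0" and l: "0 \<le> \<Lambda>" for N \<Lambda>
  proof -
    define Y where "Y = real N powr (real k - e)"
    have Y: "Y > 0" using N by (simp add: Y_def)
    have lgN: "1 \<le> lg N" "1 \<le> (lg N)\<^sup>2" using lg_ge_1[OF N] by (auto simp: one_le_power)
    define tr where "tr t a b = (if \<bar>real a ^ k - real b ^ k\<bar> < Y then negpow k t a b else 0)" for t a b
    \<comment> \<open>The factor of index \<open>j\<close> when \<open>i\<close> is the small index.
      Index 1 carries no negative power, as there is no integration over it.\<close>
    define f where "f i j a b = (if j = 1 then (if i = 1 then tr 0 a b else 1) else if j = i then tr \<theta> a b else negpow k \<theta> a b)" for i j a b :: nat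
    have f0: "0 \<le> f i j a b" for i j a b by (simp add: f_def tr_def)
    have trm: "(\<Prod>j\<in>{2..k}. \<bar>diff k p j\<bar> powr (- \<theta>)) \<le> (\<Sum>i\<in>{1..k}. \<Prod>j\<in>{1..k}. f i j (fst p j) (snd p j))"
      if p: "p \<in> offaxis k N e" for p
    proof -
      have nz: "fst p j \<noteq> snd p j" if "j \<in> {1..k}" for j using p that by (auto simp: offaxis_def)
      obtain i where i: "i \<in> {1..k}" "\<bar>diff k p i\<bar> < Y"
        using p by (auto simp: offaxis_def good_def Y_def not_le)
      have ins: "{1..k} = insert 1 {2..k}" using k by auto
      have "(\<Prod>j\<in>{1..k}. f i j (fst p j) (snd p j)) = f i 1 (fst p 1) (snd p 1) * (\<Prod>j\<in>{2..k}. f i j (fst p j) (snd p j))"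
        unfolding ins by (subst prod.insert) auto
      also have "f i 1 (fst p 1) (snd p 1) = 1"
        using i nz[of 1] k by (auto simp: f_def tr_def negpow_def diff_def power_eq_iff_eq_base)
      also have "(\<Prod>j\<in>{2..k}. f i j (fst p j) (snd p j)) = (\<Prod>j\<in>{2..k}. \<bar>diff k p j\<bar> powr (- \<theta>))"
        using i nz by (intro prod.cong) (auto simp: f_def tr_def negpow_def diff_def)
      finally have "(\<Prod>j\<in>{2..k}. \<bar>diff k p j\<bar> powr (- \<theta>)) = (\<Prod>j\<in>{1..k}. f i j (fst p j) (snd p j))" by simp
      also have "\<dots> \<le> (\<Sum>i\<in>{1..k}. \<Prod>j\<in>{1..k}. f i j (fst p j) (snd p j))"
        using i f0 by (intro member_le_sum) (auto intro: prod_nonneg)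
      finally show ?thesis .
    qed
    have one: "(\<Prod>j\<in>{1..k}. \<Sum>a\<le>N. \<Sum>b\<le>N. f i j a b) \<le> 4 ^ k * lg N ^ (2 * k) * real N powr (real k - e / (real k)\<^sup>2)"
      if i: "i \<in> {1..k}" for i
    proof -
      define s where "s = (if i = 1 then 2 * e / real k else e * \<tau>)"
      define a where "a j = (if j = 1 then 2 else \<sigma>) - (if j = i then s else 0)" for j :: nat
      have "(\<Prod>j\<in>{1..k}. \<Sum>a\<le>N. \<Sum>b\<le>N. f i j a b) \<le> (4 * (lg N)\<^sup>2) ^ card {1..k} * real N powr (\<Sum>j\<in>{1..k}. a j)"
      proof (rule prod_le_powr_sum[OF N])
        fix j assume j: "j \<in> {1..k}"
        show "0 \<le> (\<Sum>a\<le>N. \<Sum>b\<le>N. f i j a b)" using f0 by (intro sum_nonneg) auto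
        have trY: "(\<Sum>a\<le>N. \<Sum>b\<le>N. tr t a b) \<le> 2 * (lg N)\<^sup>2 * real N powr ((real k - e) * (2 / real k - t))"
          if t: "0 \<le> t" "t \<le> 2 / real k" for t
        proof -
          have "(\<Sum>a\<le>N. \<Sum>b\<le>N. tr t a b) \<le> Y powr (2 / real k - t) * (2 * real N powr (max 0 (2 - real k * (t + (2 / real k - t)))) * (lg N)\<^sup>2)"
            unfolding tr_def using N k t Y by (intro sum_negpow_trunc_le) auto
          also have "max 0 (2 - real k * (t + (2 / real k - t))) = 0" using k by simp
          also have "Y powr (2 / real k - t) = real N powr ((real k - e) * (2 / real k - t))"
            by (simp add: Y_def powr_powr)
          finally show ?thesis using N by (simp add: mult_ac)
        qed
        have L24: "2 * (lg N)\<^sup>2 * z \<le> 4 * (lg N)\<^sup>2 * z" if "z \<ge> 0" for z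
          using that by (intro mult_right_mono) auto
        consider (1) "j = 1" "i = 1" | (2) "j = 1" "i \<noteq> 1" | (3) "j \<noteq> 1" "j = i" | (4) "j \<noteq> 1" "j \<noteq> i" by blast
        then show "(\<Sum>a\<le>N. \<Sum>b\<le>N. f i j a b) \<le> 4 * (lg N)\<^sup>2 * real N powr a j"
        proof cases
          case 1
          have aj: "a j = (real k - e) * (2 / real k - 0)" using 1 k by (simp add: a_def s_def field_simps)
          have "(\<Sum>a\<le>N. \<Sum>b\<le>N. f i j a b) = (\<Sum>a\<le>N. \<Sum>b\<le>N. tr 0 a b)" using 1 by (simp add: f_def)
          also have "\<dots> \<le> 2 * (lg N)\<^sup>2 * real N powr a j" unfolding aj by (intro trY) auto
          also have "\<dots> \<le> 4 * (lg N)\<^sup>2 * real N powr a j" by (rule L24) simp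
          finally show ?thesis .
        next
          case 2
          have "(\<Sum>a\<le>N. \<Sum>b\<le>N. f i j a b) = (real N + 1) * (real N + 1)" using 2 by (simp add: f_def algebra_simps)
          also have "\<dots> \<le> (2 * real N) * (2 * real N)" using N by (intro mult_mono) auto
          also have "\<dots> = 4 * 1 * real N powr 2" using N by (simp add: powr_numeral power2_eq_square)
          also have "\<dots> \<le> 4 * (lg N)\<^sup>2 * real N powr 2" using lgN by (intro mult_right_mono mult_left_mono) auto
          finally show ?thesis using 2 by (simp add: a_def)
        next
          case 3
          have aj: "a j = (real k - e) * (2 / real k - \<theta>)"
            using 3 \<sigma>(1) by (simp add: a_def s_def \<tau>_def[symmetric] algebra_simps)
          have "(\<Sum>a\<le>N. \<Sum>b\<le>N. f i j a b) = (\<Sum>a\<le>N. \<Sum>b\<le>N. tr \<theta> a b)" using 3 by (simp add: f_def)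
          also have "\<dots> \<le> 2 * (lg N)\<^sup>2 * real N powr a j" unfolding aj using \<theta> \<tau>0 by (intro trY) (auto simp: \<tau>_def)
          also have "\<dots> \<le> 4 * (lg N)\<^sup>2 * real N powr a j" by (rule L24) simp
          finally show ?thesis .
        next
          case 4
          have "(\<Sum>a\<le>N. \<Sum>b\<le>N. negpow k \<theta> a b) \<le> 2 * real N powr (max 0 (2 - real k * \<theta>)) * (lg N)\<^sup>2"
            using N k \<theta> by (intro sum_negpow_le) auto
          then have "(\<Sum>a\<le>N. \<Sum>b\<le>N. negpow k \<theta> a b) \<le> 2 * (lg N)\<^sup>2 * real N powr \<sigma>"
            using \<sigma> by (simp add: max_def mult_ac)
          also have "\<dots> \<le> 4 * (lg N)\<^sup>2 * real N powr \<sigma>" by (rule L24) simp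
          finally show ?thesis using 4 by (simp add: f_def a_def)
        qed
      qed simp
      also have "(\<Sum>j\<in>{1..k}. a j) = real k - s"
      proof -
        have ins: "{1..k} = insert 1 {2..k}" using k by auto
        have "(\<Sum>j\<in>{1..k}. if j = 1 then 2 else \<sigma>) = 2 + (\<Sum>j\<in>{2..k}. if j = 1 then 2 else \<sigma>)"
          unfolding ins by (subst sum.insert) auto
        also have "(\<Sum>j\<in>{2..k}. if j = 1 then 2 else \<sigma>) = (\<Sum>j\<in>{2..k}. \<sigma>)" by (intro sum.cong) auto
        also have "\<dots> = real k - 2" using k \<sigma>(4) by (simp add: of_nat_diff)
        finally have "(\<Sum>j\<in>{1..k}. if j = 1 then 2 else \<sigma>) = real k" by simp
        then show ?thesis using i by (simp add: a_def sum_subtractf)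
      qed
      also have "(4 * (lg N)\<^sup>2) ^ card {1..k} = 4 ^ k * lg N ^ (2 * k)" by (simp add: power_mult_distrib power_mult)
      also have "4 ^ k * lg N ^ (2 * k) * real N powr (real k - s) \<le> 4 ^ k * lg N ^ (2 * k) * real N powr (real k - e / (real k)\<^sup>2)"
      proof -
        have "e / (real k)\<^sup>2 \<le> s"
        proof (cases "i = 1")
          case True
          have "e / (real k)\<^sup>2 \<le> e / real k" using e k3 by (intro divide_left_mono) (auto simp: power2_eq_square)
          also have "\<dots> \<le> 2 * e / real k" using e by (intro divide_right_mono) auto
          finally show ?thesis using True by (simp add: s_def)
        next
          case False
          have "e * (1 / (real k)\<^sup>2) \<le> e * \<tau>" using \<tau>1 e by (intro mult_left_mono) auto
          then show ?thesis using False by (simp add: s_def)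
        qed
        then show ?thesis using N lgN by (intro mult_left_mono powr_mono) auto
      qed
      finally show ?thesis .
    qed
    have "(\<Sum>p\<in>offaxis k N e. \<Prod>j\<in>{2..k}. \<bar>diff k p j\<bar> powr (- \<theta>)) \<le> (\<Sum>p\<in>offaxis k N e. \<Sum>i\<in>{1..k}. \<Prod>j\<in>{1..k}. f i j (fst p j) (snd p j))"
      by (intro sum_mono trm)
    also have "\<dots> \<le> (\<Sum>p\<in>box k N \<times> box k N. \<Sum>i\<in>{1..k}. \<Prod>j\<in>{1..k}. f i j (fst p j) (snd p j))"
      using f0 by (intro sum_mono2) (auto simp: offaxis_def finite_box intro!: sum_nonneg prod_nonneg)
    also have "\<dots> = (\<Sum>i\<in>{1..k}. \<Sum>p\<in>box k N \<times> box k N. \<Prod>j\<in>{1..k}. f i j (fst p j) (snd p j))"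
      by (rule sum.swap)
    also have "\<dots> = (\<Sum>i\<in>{1..k}. \<Prod>j\<in>{1..k}. \<Sum>a\<le>N. \<Sum>b\<le>N. f i j a b)"
      by (intro sum.cong refl sum_box_prod)
    also have "\<dots> \<le> (\<Sum>i\<in>{1..k}. 4 ^ k * lg N ^ (2 * k) * real N powr (real k - e / (real k)\<^sup>2))"
      by (intro sum_mono one)
    also have "\<dots> = C * lg N ^ (2 * k) * real N powr (real k - e / (real k)\<^sup>2)" by (simp add: C_def)
    finally have S: "(\<Sum>p\<in>offaxis k N e. \<Prod>j\<in>{2..k}. \<bar>diff k p j\<bar> powr (- \<theta>)) \<le> C * lg N ^ (2 * k) * real N powr (real k - e / (real k)\<^sup>2)" .
    have "(\<integral>\<^sup>+\<alpha>. ennreal (wt {2..k} \<alpha> * (\<Sum>p\<in>offaxis k N e. indicator {0..\<Lambda>} (lin k (diff k p) \<alpha>))) \<partial>PiM {2..k} (\<lambda>_. lborel))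
      = (\<Sum>p\<in>offaxis k N e. \<integral>\<^sup>+\<alpha>. ennreal (wt {2..k} \<alpha>) * indicator {0..\<Lambda>} (lin k (diff k p) \<alpha>) \<partial>PiM {2..k} (\<lambda>_. lborel))"
      by (rule nn_integral_sum_lin) simp
    also have "\<dots> \<le> (\<Sum>p\<in>offaxis k N e. ennreal (\<Lambda> * (\<Prod>j\<in>{2..k}. \<bar>diff k p j\<bar> powr (- \<theta>))))"
      unfolding \<theta>_def using k l by (intro sum_mono nn_integral_wt_lin_le_prod) (auto simp: offaxis_def diff_eq_0_iff)
    also have "\<dots> = ennreal (\<Lambda> * (\<Sum>p\<in>offaxis k N e. \<Prod>j\<in>{2..k}. \<bar>diff k p j\<bar> powr (- \<theta>)))"
      using l by (subst sum_ennreal) (auto simp: sum_distrib_left intro!: mult_nonneg_nonneg prod_nonneg)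
    also have "\<dots> \<le> ennreal (C * \<Lambda> * lg N ^ (2 * k) * real N powr (real k - e / (real k)\<^sup>2))"
      using mult_left_mono[OF S l] by (intro ennreal_leI) (simp add: mult_ac)
    finally show ?thesis .
  qed
  moreover have "C > 0" using k by (simp add: C_def)
  ultimately show ?thesis by blast
qed

text \<open>\<open>Z\<close> is the support of the vector. Index 1 cannot be integrated over, yet it
  must appear in the product: summed freely it would cost N^2. Where the form is at most \<Lambda>,
  |A 1| is O(\<Lambda> * M), with \<open>M\<close> the largest of 1 and the other entries in
  absolute value. So the bound \<Lambda> / M can be compared with the geometric mean over all of
  \<open>Z\<close>, at the price of one more factor \<Lambda>.\<close>

lemma nn_integral_wt_lin_le_prod_support:
  assumes k: "k \<ge> 3" and Z: "Z \<subseteq> {1..k}" "Z \<noteq> {}" and A: "\<And>i. i \<in> Z \<Longrightarrow> \<bar>A i\<bar> \<ge> 1" "\<And>i. i \<in> {1..k} - Z \<Longrightarrow> A i = 0"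
    and l: "\<Lambda> \<ge> 1"
  shows "(\<integral>\<^sup>+\<alpha>. ennreal (wt {2..k} \<alpha>) * indicator {0..\<Lambda>} (lin k A \<alpha>) \<partial>PiM {2..k} (\<lambda>_. lborel))
     \<le> ennreal ((2 * real k + 1) * \<Lambda>\<^sup>2 * (\<Prod>j\<in>Z. \<bar>A j\<bar> powr (- (1 / real (card Z)))))"
proof -
  \<comment> \<open>Writing the indicator as its own square makes the integral a
    \<open>corr\<close>, whose nonvanishing supplies a point \<alpha>.\<close>
  have "indicator {0..\<Lambda>} z = indicator {0..\<Lambda>} z * (indicator {0..\<Lambda>} z :: ennreal)" for z by (simp add: indicator_def)
  then have E: "(\<integral>\<^sup>+\<alpha>. ennreal (wt {2..k} \<alpha>) * indicator {0..\<Lambda>} (lin k A \<alpha>) \<partial>PiM {2..k} (\<lambda>_. lborel)) = ennreal (corr k A A {0..\<Lambda>} {0..\<Lambda>})"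
    unfolding nn_integral_eq_corr[symmetric] by metis
  have fZ: "finite Z" using Z finite_subset by blast
  have cZ: "card Z > 0" using fZ Z by (simp add: card_gt_0_iff)
  define prd where "prd = (\<Prod>j\<in>Z. \<bar>A j\<bar> powr (- (1 / real (card Z))))"
  have prd0: "prd \<ge> 0" by (auto simp: prd_def intro: prod_nonneg)
  have low: "1 / B \<le> prd" if "B > 0" "\<And>i. i \<in> Z \<Longrightarrow> \<bar>A i\<bar> \<le> B" for B
  proof -
    have "(\<Prod>i\<in>Z. B powr (- (1 / real (card Z)))) \<le> prd"
      unfolding prd_def
    proof (intro prod_mono conjI)
      fix i assume i: "i \<in> Z"
      have "0 < \<bar>A i\<bar>" using A(1)[OF i] by linarith
      then show "B powr (- (1 / real (card Z))) \<le> \<bar>A i\<bar> powr (- (1 / real (card Z)))"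
        using that(2)[OF i] by (intro powr_mono2') auto
    qed simp
    moreover have "(\<Prod>i\<in>Z. B powr (- (1 / real (card Z)))) = 1 / B"
    proof -
      have "(B powr (- (1 / real (card Z)))) ^ card Z = B powr (- (1 / real (card Z)) * real (card Z))"
        using that by (subst powr_realpow[symmetric]) (auto simp: powr_powr)
      also have "- (1 / real (card Z)) * real (card Z) = - 1" using cZ by simp
      also have "B powr (- 1) = 1 / B" using that by (simp add: powr_minus_divide)
      finally show ?thesis by simp
    qed
    ultimately show ?thesis by simp
  qed
  have "corr k A A {0..\<Lambda>} {0..\<Lambda>} \<le> (2 * real k + 1) * \<Lambda>\<^sup>2 * prd"
  proof (cases "corr k A A {0..\<Lambda>} {0..\<Lambda>} = 0")
    case True
    then show ?thesis using prd0 l by simp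
  next
    case False
    obtain \<alpha> where \<alpha>: "\<And>i. i \<in> {2..k} \<Longrightarrow> 1 / 4 < \<alpha> i \<and> \<alpha> i < 5 / 4" "lin k A \<alpha> \<in> {0..\<Lambda>}"
      using corr_nonzeroD[OF False] by metis
    \<comment> \<open>The inserted 1 covers the case Z = {1}, where no entry from 2 on is
      nonzero.\<close>
    define M where "M = Max (insert 1 ((\<lambda>j. \<bar>A j\<bar>) ` (Z \<inter> {2..k})))"
    have M1: "1 \<le> M" unfolding M_def using fZ by (intro Max_ge) auto
    have M: "\<bar>A i\<bar> \<le> M" if "i \<in> {2..k}" for i
    proof (cases "i \<in> Z")
      case True
      then show ?thesis unfolding M_def using that fZ by (intro Max_ge) auto
    next
      case False
      then show ?thesis using A(2)[of i] that M1 by auto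
    qed
    have A1: "\<bar>A 1\<bar> \<le> (2 * real k + 1) * \<Lambda> * M"
    proof -
      have "\<bar>\<Sum>i=2..k. \<alpha> i * A i\<bar> \<le> (\<Sum>i=2..k. \<bar>\<alpha> i * A i\<bar>)" by (rule sum_abs)
      also have "\<dots> \<le> (\<Sum>i=2..k. 2 * M)"
      proof (rule sum_mono)
        fix i assume i: "i \<in> {2..k}"
        show "\<bar>\<alpha> i * A i\<bar> \<le> 2 * M" unfolding abs_mult using \<alpha>(1)[OF i] M[OF i] by (intro mult_mono) auto
      qed
      also have "\<dots> \<le> real k * (2 * M)" using M1 by (simp add: mult_right_mono)
      finally have "\<bar>A 1\<bar> \<le> \<Lambda> + real k * (2 * M)" using \<alpha>(2) unfolding lin_def by auto
      also have "\<Lambda> \<le> \<Lambda> * M" using M1 l by (simp add: mult_le_cancel_left1)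
      also have "\<Lambda> * M + real k * (2 * M) \<le> \<Lambda> * M + real k * (2 * (\<Lambda> * M))"
        using M1 l by (intro add_left_mono mult_left_mono) (auto simp: mult_le_cancel_right1)
      finally show ?thesis by (simp add: algebra_simps)
    qed
    have B: "\<bar>A i\<bar> \<le> (2 * real k + 1) * \<Lambda> * M" if "i \<in> Z" for i
    proof (cases "i = 1")
      case True
      then show ?thesis using A1 by simp
    next
      case False
      then have "i \<in> {2..k}" using that Z by auto
      then have "\<bar>A i\<bar> \<le> 1 * M" using M by simp
      also have "\<dots> \<le> (2 * real k + 1) * \<Lambda> * M"
      proof (rule mult_right_mono)
        have "1 * 1 \<le> (2 * real k + 1) * \<Lambda>" using l by (intro mult_mono) auto
        then show "1 \<le> (2 * real k + 1) * \<Lambda>" by simp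
      qed (use M1 in auto)
      finally show ?thesis .
    qed
    have P: "1 / ((2 * real k + 1) * \<Lambda> * M) \<le> prd" using l M1 by (intro low B) auto
    have "corr k A A {0..\<Lambda>} {0..\<Lambda>} \<le> \<Lambda> / M"
    \<comment> \<open>For M = 1 there may be no coordinate to integrate over; the total mass 1
      suffices because \<Lambda> \<ge> 1.\<close>
    proof (cases "M = 1")
      case True
      have "ennreal (corr k A A {0..\<Lambda>} {0..\<Lambda>}) \<le> (\<integral>\<^sup>+\<alpha>. ennreal (wt {2..k} \<alpha>) * 1 \<partial>PiM {2..k} (\<lambda>_. lborel))"
        unfolding E[symmetric] by (intro nn_integral_mono mult_left_mono) (auto simp: indicator_def)
      also have "\<dots> \<le> 1" using nn_integral_wt_le[of "{2..k}"] by simp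
      finally show ?thesis using True l by simp
    next
      case False
      have "M \<in> insert 1 ((\<lambda>j. \<bar>A j\<bar>) ` (Z \<inter> {2..k}))" unfolding M_def using fZ by (intro Max_in) auto
      then obtain j where j: "j \<in> {2..k}" "M = \<bar>A j\<bar>" using False by auto
      have "ennreal (corr k A A {0..\<Lambda>} {0..\<Lambda>}) \<le> ennreal (1 / \<bar>A j\<bar>) * emeasure lborel {0..\<Lambda>}"
        unfolding E[symmetric] using j M1 by (intro nn_integral_lin_le) auto
      also have "\<dots> = ennreal (\<Lambda> / M)" using l M1 by (simp add: j(2)[symmetric] ennreal_mult[symmetric])
      finally show ?thesis using l M1 by simp
    qed
    also have "\<Lambda> / M = (2 * real k + 1) * \<Lambda>\<^sup>2 * (1 / ((2 * real k + 1) * \<Lambda> * M))"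
    proof -
      have "2 * real k + 1 \<noteq> 0" by linarith
      then show ?thesis using l M1 by (simp add: power2_eq_square)
    qed
    also have "\<dots> \<le> (2 * real k + 1) * \<Lambda>\<^sup>2 * prd" using P by (intro mult_left_mono) auto
    finally show ?thesis .
  qed
  then show ?thesis unfolding E prd_def by (rule ennreal_leI)
qed

text \<open>Let z be the number of entries that differ. Each of them gives N powr max 0 (2 - k/z) up
  to logarithms and each coincident one gives N, in total N powr max (k - z) z, at most N powr (k -
  1) because 1 \<le> z < k. The at most 2^k supports are summed up.\<close>

lemma onaxis_first_moment_le:
  fixes k :: nat
  assumes k: "k \<ge> 3"
  shows "\<exists>C>0. \<forall>N \<Lambda>. N > 0 \<longrightarrow> 1 \<le> \<Lambda> \<longrightarrow>
     (\<integral>\<^sup>+\<alpha>. ennreal (wt {2..k} \<alpha> * (\<Sum>p\<in>onaxis k N. indicator {0..\<Lambda>} (lin k (diff k p) \<alpha>))) \<partial>PiM {2..k} (\<lambda>_. lborel))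
      \<le> ennreal (C * \<Lambda>\<^sup>2 * lg N ^ (2 * k) * real N powr (real k - 1))"
proof -
  define C where "C = (2 * real k + 1) * 2 ^ k * 2 ^ k"
  have "(\<integral>\<^sup>+\<alpha>. ennreal (wt {2..k} \<alpha> * (\<Sum>p\<in>onaxis k N. indicator {0..\<Lambda>} (lin k (diff k p) \<alpha>))) \<partial>PiM {2..k} (\<lambda>_. lborel))
      \<le> ennreal (C * \<Lambda>\<^sup>2 * lg N ^ (2 * k) * real N powr (real k - 1))"
    if N: "N > 0" and l: "1 \<le> \<Lambda>" for N \<Lambda>
  proof -
    define ZZ where "ZZ = {Z. Z \<subseteq> {1..k} \<and> Z \<noteq> {} \<and> Z \<noteq> {1..k}}"
    have fZZ: "finite ZZ" by (rule finite_subset[of _ "Pow {1..k}"]) (auto simp: ZZ_def)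
    have cZZ: "card ZZ \<le> 2 ^ k" 
      using card_mono[of "Pow {1..k}" ZZ] by (auto simp: ZZ_def card_Pow)
    define f where "f Z j a b = (if j \<in> Z then negpow k (1 / real (card Z)) a b else if a = b then 1 else 0)" for Z and j a b :: nat
    have f0: "0 \<le> f Z j a b" for Z j a b by (simp add: f_def)
    have lgN: "1 \<le> lg N" "1 \<le> (lg N)\<^sup>2" using lg_ge_1[OF N] by (auto simp: one_le_power)
    have trm: "(\<integral>\<^sup>+\<alpha>. ennreal (wt {2..k} \<alpha>) * indicator {0..\<Lambda>} (lin k (diff k p) \<alpha>) \<partial>PiM {2..k} (\<lambda>_. lborel))
       \<le> ennreal ((2 * real k + 1) * \<Lambda>\<^sup>2 * (\<Sum>Z\<in>ZZ. \<Prod>j\<in>{1..k}. f Z j (fst p j) (snd p j)))"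
      if p: "p \<in> onaxis k N" for p
    proof -
      define Z where "Z = {i\<in>{1..k}. fst p i \<noteq> snd p i}"
      have Zne: "Z \<noteq> {}"
      proof
        assume "Z = {}"
        then have "fst p i = snd p i" if "i \<in> {1..k}" for i using that by (auto simp: Z_def)
        moreover have "fst p \<in> {1..k} \<rightarrow>\<^sub>E {..N}" "snd p \<in> {1..k} \<rightarrow>\<^sub>E {..N}" using p by (auto simp: onaxis_def box_def)
        ultimately have "fst p = snd p" by (intro PiE_ext) auto
        then show False using p by (auto simp: onaxis_def)
      qed
      have Z: "Z \<in> ZZ" using p Zne by (auto simp: ZZ_def onaxis_def Z_def)
      have "1 \<le> \<bar>diff k p i\<bar>" if "i \<in> Z" for i
      proof -
        have "diff k p i = of_int (int (fst p i) ^ k - int (snd p i) ^ k)" by (simp add: diff_def)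
        moreover have "int (fst p i) ^ k - int (snd p i) ^ k \<noteq> 0"
          using that k power_eq_iff_eq_base[of k "int (fst p i)" "int (snd p i)"] by (auto simp: Z_def)
        then have "1 \<le> \<bar>int (fst p i) ^ k - int (snd p i) ^ k\<bar>" by linarith
        ultimately show ?thesis by (metis of_int_1_le_iff of_int_abs)
      qed
      then have "(\<integral>\<^sup>+\<alpha>. ennreal (wt {2..k} \<alpha>) * indicator {0..\<Lambda>} (lin k (diff k p) \<alpha>) \<partial>PiM {2..k} (\<lambda>_. lborel))
        \<le> ennreal ((2 * real k + 1) * \<Lambda>\<^sup>2 * (\<Prod>j\<in>Z. \<bar>diff k p j\<bar> powr (- (1 / real (card Z)))))"
        using k l Zne by (intro nn_integral_wt_lin_le_prod_support) (auto simp: Z_def diff_eq_0_iff)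
      also have "(\<Prod>j\<in>Z. \<bar>diff k p j\<bar> powr (- (1 / real (card Z)))) = (\<Prod>j\<in>{1..k}. f Z j (fst p j) (snd p j))"
        by (rule prod.mono_neutral_cong_left) (auto simp: Z_def f_def negpow_def diff_def)
      also have "ennreal ((2 * real k + 1) * \<Lambda>\<^sup>2 * (\<Prod>j\<in>{1..k}. f Z j (fst p j) (snd p j)))
        \<le> ennreal ((2 * real k + 1) * \<Lambda>\<^sup>2 * (\<Sum>Z\<in>ZZ. \<Prod>j\<in>{1..k}. f Z j (fst p j) (snd p j)))"
      proof (intro ennreal_leI mult_left_mono)
        show "(\<Prod>j\<in>{1..k}. f Z j (fst p j) (snd p j)) \<le> (\<Sum>Z\<in>ZZ. \<Prod>j\<in>{1..k}. f Z j (fst p j) (snd p j))"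
          by (rule member_le_sum[of Z ZZ "\<lambda>Z. \<Prod>j\<in>{1..k}. f Z j (fst p j) (snd p j)"])
            (use Z fZZ f0 in \<open>auto intro: prod_nonneg\<close>)
      qed auto
      finally show ?thesis .
    qed
    have one: "(\<Prod>j\<in>{1..k}. \<Sum>a\<le>N. \<Sum>b\<le>N. f Z j a b) \<le> 2 ^ k * lg N ^ (2 * k) * real N powr (real k - 1)"
      if Z: "Z \<in> ZZ" for Z
    proof -
      define z where "z = card Z"
      have fZ: "finite Z" "Z \<subseteq> {1..k}" "Z \<noteq> {}" using Z finite_subset by (auto simp: ZZ_def)
      have z1: "1 \<le> z" using fZ by (simp add: z_def Suc_le_eq card_gt_0_iff)
      have zk: "z < k"
        using psubset_card_mono[of "{1..k}" Z] Z by (auto simp: z_def ZZ_def)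
      define m where "m = max 0 (2 - real k * (1 / real z))"
      define a where "a j = (if j \<in> Z then m else 1)" for j :: nat
      have "(\<Prod>j\<in>{1..k}. \<Sum>a\<le>N. \<Sum>b\<le>N. f Z j a b) \<le> (2 * (lg N)\<^sup>2) ^ card {1..k} * real N powr (\<Sum>j\<in>{1..k}. a j)"
      proof (rule prod_le_powr_sum[OF N])
        fix j assume j: "j \<in> {1..k}"
        show "0 \<le> (\<Sum>a\<le>N. \<Sum>b\<le>N. f Z j a b)" using f0 by (intro sum_nonneg) auto
        show "(\<Sum>a\<le>N. \<Sum>b\<le>N. f Z j a b) \<le> 2 * (lg N)\<^sup>2 * real N powr a j"
        proof (cases "j \<in> Z")
          case True
          have "(\<Sum>a\<le>N. \<Sum>b\<le>N. negpow k (1 / real z) a b) \<le> 2 * real N powr m * (lg N)\<^sup>2"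
            unfolding m_def using N k by (intro sum_negpow_le) auto
          then show ?thesis using True by (simp add: f_def a_def z_def mult_ac)
        next
          case False
          have "(\<Sum>a\<le>N. \<Sum>b\<le>N. f Z j a b) = real N + 1" using False by (simp add: f_def)
          also have "\<dots> \<le> 2 * 1 * real N powr 1" using N by simp
          also have "\<dots> \<le> 2 * (lg N)\<^sup>2 * real N powr 1" using lgN by (intro mult_right_mono mult_left_mono) auto
          finally show ?thesis using False by (simp add: a_def)
        qed
      qed simp
      also have "(\<Sum>j\<in>{1..k}. a j) = real z * m + (real k - real z)"
      proof -
        have "(\<Sum>j\<in>{1..k}. a j) = (\<Sum>j\<in>{1..k} - Z. a j) + (\<Sum>j\<in>Z. a j)"
          using fZ by (intro sum.subset_diff) auto
        also have "\<dots> = (\<Sum>j\<in>{1..k} - Z. 1) + (\<Sum>j\<in>Z. m)" by (intro arg_cong2[where f = "(+)"] sum.cong) (auto simp: a_def)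
        finally show ?thesis using fZ zk by (simp add: z_def card_Diff_subset of_nat_diff)
      qed
      also have "(2 * (lg N)\<^sup>2) ^ card {1..k} = 2 ^ k * lg N ^ (2 * k)" by (simp add: power_mult_distrib power_mult)
      also have "2 ^ k * lg N ^ (2 * k) * real N powr (real z * m + (real k - real z)) \<le> 2 ^ k * lg N ^ (2 * k) * real N powr (real k - 1)"
      proof -
        have "real z * m = max 0 (2 * real z - real k)"
          unfolding m_def using z1 by (auto simp: max_def field_simps)
        then have "real z * m + (real k - real z) \<le> real k - 1"
          using z1 zk by (auto simp: max_def)
        then show ?thesis using N lgN by (intro mult_left_mono powr_mono) auto
      qed
      finally show ?thesis .
    qed
    define G where "G p = (\<Sum>Z\<in>ZZ. \<Prod>j\<in>{1..k}. f Z j (fst p j) (snd p j))" for p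
    have G0: "G p \<ge> 0" for p using f0 by (auto simp: G_def intro!: sum_nonneg prod_nonneg)
    have "(\<Sum>p\<in>onaxis k N. G p) \<le> (\<Sum>p\<in>box k N \<times> box k N. G p)"
      using G0 by (intro sum_mono2) (auto simp: onaxis_def finite_box)
    also have "\<dots> = (\<Sum>Z\<in>ZZ. \<Sum>p\<in>box k N \<times> box k N. \<Prod>j\<in>{1..k}. f Z j (fst p j) (snd p j))"
      unfolding G_def by (rule sum.swap)
    also have "\<dots> = (\<Sum>Z\<in>ZZ. \<Prod>j\<in>{1..k}. \<Sum>a\<le>N. \<Sum>b\<le>N. f Z j a b)"
      by (intro sum.cong refl sum_box_prod)
    also have "\<dots> \<le> (\<Sum>Z\<in>ZZ. 2 ^ k * lg N ^ (2 * k) * real N powr (real k - 1))"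
      by (intro sum_mono one)
    also have "\<dots> = real (card ZZ) * (2 ^ k * lg N ^ (2 * k) * real N powr (real k - 1))" by simp
    also have "\<dots> \<le> 2 ^ k * (2 ^ k * lg N ^ (2 * k) * real N powr (real k - 1))"
    proof (intro mult_right_mono)
      have "real (card ZZ) \<le> real (2 ^ k)" using cZZ by (rule of_nat_mono)
      then show "real (card ZZ) \<le> 2 ^ k" by simp
    qed (use lgN in auto)
    finally have S: "(\<Sum>p\<in>onaxis k N. G p) \<le> 2 ^ k * (2 ^ k * lg N ^ (2 * k) * real N powr (real k - 1))" .
    have "(\<integral>\<^sup>+\<alpha>. ennreal (wt {2..k} \<alpha> * (\<Sum>p\<in>onaxis k N. indicator {0..\<Lambda>} (lin k (diff k p) \<alpha>))) \<partial>PiM {2..k} (\<lambda>_. lborel))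
      = (\<Sum>p\<in>onaxis k N. \<integral>\<^sup>+\<alpha>. ennreal (wt {2..k} \<alpha>) * indicator {0..\<Lambda>} (lin k (diff k p) \<alpha>) \<partial>PiM {2..k} (\<lambda>_. lborel))"
      by (rule nn_integral_sum_lin) simp
    also have "\<dots> \<le> (\<Sum>p\<in>onaxis k N. ennreal ((2 * real k + 1) * \<Lambda>\<^sup>2 * G p))"
      unfolding G_def by (intro sum_mono trm)
    also have "\<dots> = ennreal ((2 * real k + 1) * \<Lambda>\<^sup>2 * (\<Sum>p\<in>onaxis k N. G p))"
      using G0 by (subst sum_ennreal) (auto simp: sum_distrib_left)
    also have "\<dots> \<le> ennreal ((2 * real k + 1) * \<Lambda>\<^sup>2 * (2 ^ k * (2 ^ k * lg N ^ (2 * k) * real N powr (real k - 1))))"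
      using S by (intro ennreal_leI mult_left_mono) auto
    also have "\<dots> = ennreal (C * \<Lambda>\<^sup>2 * lg N ^ (2 * k) * real N powr (real k - 1))"
      by (simp add: C_def mult_ac)
    finally show ?thesis .
  qed
  moreover have "C > 0" by (simp add: C_def add_nonneg_pos)
  ultimately show ?thesis by blast
qed

section \<open>Lattice points in the solid \<open>F \<le> t\<close>\<close>

lemma nn_integral_PiM_scale:
  fixes f :: "(nat \<Rightarrow> real) \<Rightarrow> ennreal" and s :: real
  assumes "finite J" "s > 0" "f \<in> borel_measurable (PiM J (\<lambda>_. lborel))"
  shows "(\<integral>\<^sup>+x. f (\<lambda>i\<in>J. s * x i) \<partial>PiM J (\<lambda>_. lborel)) = ennreal ((1 / s) ^ card J) * (\<integral>\<^sup>+x. f x \<partial>PiM J (\<lambda>_. lborel))"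
  using assms(1,3)
proof (induction J arbitrary: f rule: finite_induct)
  case empty
  interpret product_sigma_finite "\<lambda>_::nat. lborel :: real measure" ..
  show ?case by (simp add: nn_integral_empty restrict_def space_PiM_empty)
next
  case (insert i J)
  interpret product_sigma_finite "\<lambda>_::nat. lborel :: real measure" ..
  let ?M = "\<lambda>J. PiM J (\<lambda>_. lborel :: real measure)"
  note f[measurable] = insert.prems
  have add [measurable]: "(\<lambda>(x, y). x(i := y)) \<in> measurable (?M J \<Otimes>\<^sub>M lborel) (?M (insert i J))"
    by (rule measurable_add_dim)
  have G: "(\<lambda>x. \<integral>\<^sup>+y. f (x(i := y)) \<partial>lborel) \<in> borel_measurable (?M J)"
  proof -
    have "(\<lambda>(x, y). f (x(i := y))) \<in> borel_measurable (?M J \<Otimes>\<^sub>M lborel)"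
      using measurable_compose[OF add f] by (simp add: case_prod_beta')
    then show ?thesis by (intro lborel.borel_measurable_nn_integral) (simp add: case_prod_beta')
  qed
  have sc: "(\<lambda>x. \<lambda>j\<in>insert i J. s * x j) \<in> measurable (?M (insert i J)) (?M (insert i J))"
    by (rule measurable_restrict) measurable
  have "(\<integral>\<^sup>+x. f (\<lambda>j\<in>insert i J. s * x j) \<partial>?M (insert i J)) = (\<integral>\<^sup>+x. \<integral>\<^sup>+y. f (\<lambda>j\<in>insert i J. s * (x(i := y)) j) \<partial>lborel \<partial>?M J)"
    using insert.hyps measurable_compose[OF sc f] by (intro product_nn_integral_insert) auto
  also have "\<dots> = (\<integral>\<^sup>+x. ennreal (1 / s) * (\<integral>\<^sup>+y. f ((\<lambda>j\<in>J. s * x j)(i := y)) \<partial>lborel) \<partial>?M J)"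
  proof (intro nn_integral_cong)
    fix x :: "nat \<Rightarrow> real"
    have upd: "(\<lambda>j\<in>insert i J. s * (x(i := y)) j) = (\<lambda>j\<in>J. s * x j)(i := s * y)" for y
      using insert.hyps by (auto simp: restrict_def fun_eq_iff)
    have "(\<lambda>j\<in>J. s * x j) \<in> space (?M J)" by (simp add: space_PiM)
    then have m: "(\<lambda>y. f ((\<lambda>j\<in>J. s * x j)(i := y))) \<in> borel_measurable borel"
      using measurable_compose[OF _ f, of "\<lambda>y. (\<lambda>j\<in>J. s * x j)(i := y)" lborel]
        measurable_component_update[of "\<lambda>j\<in>J. s * x j" J "\<lambda>_. lborel :: real measure" i] insert.hyps by simp
    have "(\<integral>\<^sup>+y. f ((\<lambda>j\<in>J. s * x j)(i := 0 + s * y)) \<partial>lborel) = ennreal (1 / \<bar>s\<bar>) * (\<integral>\<^sup>+y. f ((\<lambda>j\<in>J. s * x j)(i := y)) \<partial>lborel)"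
      using assms(2) by (intro nn_integral_affine m) auto
    then show "(\<integral>\<^sup>+y. f (\<lambda>j\<in>insert i J. s * (x(i := y)) j) \<partial>lborel) = ennreal (1 / s) * (\<integral>\<^sup>+y. f ((\<lambda>j\<in>J. s * x j)(i := y)) \<partial>lborel)"
      unfolding upd using assms(2) by simp
  qed
  also have "\<dots> = ennreal (1 / s) * (\<integral>\<^sup>+x. (\<integral>\<^sup>+y. f ((\<lambda>j\<in>J. s * x j)(i := y)) \<partial>lborel) \<partial>?M J)"
  proof (rule nn_integral_cmult)
    have "(\<lambda>x. \<lambda>j\<in>J. s * x j) \<in> measurable (?M J) (?M J)"
      by (rule measurable_restrict) measurable
    from measurable_compose[OF this G] show "(\<lambda>x. \<integral>\<^sup>+y. f ((\<lambda>j\<in>J. s * x j)(i := y)) \<partial>lborel) \<in> borel_measurable (?M J)" .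
  qed
  also have "(\<integral>\<^sup>+x. (\<integral>\<^sup>+y. f ((\<lambda>j\<in>J. s * x j)(i := y)) \<partial>lborel) \<partial>?M J) = ennreal ((1 / s) ^ card J) * (\<integral>\<^sup>+x. (\<integral>\<^sup>+y. f (x(i := y)) \<partial>lborel) \<partial>?M J)"
    by (rule insert.IH[OF G])
  also have "(\<integral>\<^sup>+x. (\<integral>\<^sup>+y. f (x(i := y)) \<partial>lborel) \<partial>?M J) = (\<integral>\<^sup>+x. f x \<partial>?M (insert i J))"
    using insert.hyps f by (intro product_nn_integral_insert[symmetric]) auto
  finally show ?case
    using insert.hyps assms(2) by (simp add: mult.assoc[symmetric] ennreal_mult[symmetric])
qed

definition solid :: "nat \<Rightarrow> (nat \<Rightarrow> real) \<Rightarrow> real \<Rightarrow> (nat \<Rightarrow> real) set" where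
  "solid k \<alpha> t = {x \<in> {1..k} \<rightarrow>\<^sub>E {0..}. F k \<alpha> x \<le> t}"

definition lattice :: "nat \<Rightarrow> (nat \<Rightarrow> real) \<Rightarrow> real \<Rightarrow> (nat \<Rightarrow> nat) set" where
  "lattice k \<alpha> t = {n \<in> {1..k} \<rightarrow>\<^sub>E UNIV. F k \<alpha> (\<lambda>i. real (n i)) \<le> t}"

lemma F_mono:
  assumes "\<And>i. i \<in> {2..k} \<Longrightarrow> 0 \<le> \<alpha> i" "\<And>i. i \<in> {1..k} \<Longrightarrow> 0 \<le> x i \<and> x i \<le> y i" "k \<ge> 1"
  shows "F k \<alpha> x \<le> F k \<alpha> y"
  unfolding F_def using assms by (intro add_mono sum_mono mult_left_mono power_mono) auto

lemma F_mono_coeff: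
  assumes "\<And>i. i \<in> {2..k} \<Longrightarrow> \<alpha> i \<le> \<beta> i" "\<And>i. i \<in> {1..k} \<Longrightarrow> 0 \<le> x i"
  shows "F k \<alpha> x \<le> F k \<beta> x"
  unfolding F_def using assms by (intro add_left_mono sum_mono mult_right_mono) auto

lemma F_ge_coord:
  assumes "\<And>i. i \<in> {2..k} \<Longrightarrow> b \<le> \<alpha> i" "0 \<le> b" "b \<le> 1" "\<And>i. i \<in> {1..k} \<Longrightarrow> 0 \<le> x i" "j \<in> {1..k}"
  shows "b * x j ^ k \<le> F k \<alpha> x"
proof (cases "j = 1")
  case True
  have "b * x 1 ^ k \<le> 1 * x 1 ^ k" using assms True by (intro mult_right_mono) auto
  moreover have "0 \<le> (\<Sum>i=2..k. \<alpha> i * x i ^ k)" 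
  proof (rule sum_nonneg)
    fix i assume i: "i \<in> {2..k}"
    then have "0 \<le> \<alpha> i" using assms(1)[OF i] assms(2) by simp
    then show "0 \<le> \<alpha> i * x i ^ k" using assms(4)[of i] i by auto
  qed
  ultimately show ?thesis using True by (simp add: F_def)
next
  case False
  then have j: "j \<in> {2..k}" using assms by auto
  have "b * x j ^ k \<le> \<alpha> j * x j ^ k" using assms j by (intro mult_right_mono) auto
  also have "\<dots> \<le> (\<Sum>i=2..k. \<alpha> i * x i ^ k)"
  proof (rule member_le_sum[OF j])
    fix i assume i: "i \<in> {2..k} - {j}"
    then have "0 \<le> \<alpha> i" using assms(1)[of i] assms(2) by simp
    then show "0 \<le> \<alpha> i * x i ^ k" using assms(4)[of i] i by auto
  qed simp
  also have "\<dots> \<le> F k \<alpha> x" using assms j by (simp add: F_def)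
  finally show ?thesis .
qed

lemma borel_measurable_F [measurable]: "k \<ge> 1 \<Longrightarrow> F k \<alpha> \<in> borel_measurable (PiM {1..k} (\<lambda>_. lborel))"
proof -
  assume k: "k \<ge> 1"
  have comp: "(\<lambda>x. x i) \<in> borel_measurable (PiM {1..k} (\<lambda>_. lborel :: real measure))" if "i \<in> {1..k}" for i
    using measurable_component_singleton[OF that, of "\<lambda>_. lborel :: real measure"] by simp
  show ?thesis unfolding F_def
    using k by (intro borel_measurable_add borel_measurable_power borel_measurable_sum borel_measurable_times borel_measurable_const comp) auto
qed

lemma solid_sets [measurable]: "k \<ge> 1 \<Longrightarrow> solid k \<alpha> t \<in> sets (PiM {1..k} (\<lambda>_. lborel))"
proof -
  assume k: "k \<ge> 1"
  let ?M = "PiM {1..k} (\<lambda>_. lborel :: real measure)"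
  have "solid k \<alpha> t = ({1..k} \<rightarrow>\<^sub>E {0..}) \<inter> {x \<in> space ?M. F k \<alpha> x \<le> t}"
    by (auto simp: solid_def space_PiM PiE_def extensional_def Pi_def)
  moreover have "({1..k} \<rightarrow>\<^sub>E {0..}) \<in> sets ?M" by (intro sets_PiM_I_finite) auto
  moreover have "{x \<in> space ?M. F k \<alpha> x \<le> t} \<in> sets ?M"
    using borel_measurable_F[OF k] by measurable
  ultimately show ?thesis by simp
qed

lemma emeasure_PiE_interval:
  fixes k :: nat and a b :: "nat \<Rightarrow> real"
  assumes "\<And>i. i \<in> {1..k} \<Longrightarrow> a i \<le> b i"
  shows "emeasure (PiM {1..k} (\<lambda>_. lborel)) (PiE {1..k} (\<lambda>i. {a i..<b i})) = ennreal (\<Prod>i\<in>{1..k}. b i - a i)"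
proof -
  interpret product_sigma_finite "\<lambda>_::nat. lborel :: real measure" ..
  have "emeasure (PiM {1..k} (\<lambda>_. lborel)) (PiE {1..k} (\<lambda>i. {a i..<b i})) = (\<Prod>i\<in>{1..k}. emeasure lborel {a i..<b i})"
    by (subst emeasure_PiM) auto
  also have "\<dots> = (\<Prod>i\<in>{1..k}. ennreal (b i - a i))" using assms by (intro prod.cong) auto
  also have "\<dots> = ennreal (\<Prod>i\<in>{1..k}. b i - a i)" using assms by (intro prod_ennreal) auto
  finally show ?thesis .
qed

text \<open>The solid lies in a cube of side 3, as x j ^ k / 2 \<le> 1, and contains one of side 1 /
  k. Finiteness makes \<open>measure\<close> the true volume instead of its default value 0.\<close>

lemma solid_1_finite:
  assumes k: "k \<ge> 1" and \<alpha>: "\<And>i. i \<in> {2..k} \<Longrightarrow> 1 / 2 \<le> \<alpha> i \<and> \<alpha> i \<le> 1"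
  shows "emeasure (PiM {1..k} (\<lambda>_. lborel)) (solid k \<alpha> 1) = ennreal (c k \<alpha>)" "c k \<alpha> > 0"
proof -
  let ?M = "PiM {1..k} (\<lambda>_. lborel :: real measure)"
  have "solid k \<alpha> 1 \<subseteq> PiE {1..k} (\<lambda>i. {0..<3})"
  proof
    fix x assume x: "x \<in> solid k \<alpha> 1"
    have "x j < 3" if j: "j \<in> {1..k}" for j
    proof (rule ccontr)
      assume "\<not> x j < 3"
      then have "3 ^ k \<le> x j ^ k" by (intro power_mono) auto
      moreover have "(3::real) ^ 1 \<le> 3 ^ k" using k by (intro power_increasing) auto
      moreover have "1 / 2 * x j ^ k \<le> F k \<alpha> x" using x j \<alpha> by (intro F_ge_coord) (auto simp: solid_def PiE_iff)
      ultimately show False using x by (auto simp: solid_def)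
    qed
    then show "x \<in> PiE {1..k} (\<lambda>i. {0..<3})" using x by (auto simp: solid_def PiE_iff)
  qed
  then have "emeasure ?M (solid k \<alpha> 1) \<le> emeasure ?M (PiE {1..k} (\<lambda>i. {0..<3}))"
    by (intro emeasure_mono sets_PiM_I_finite) auto
  also have "\<dots> = ennreal (\<Prod>i\<in>{1..k}. 3 - 0)" by (rule emeasure_PiE_interval) simp
  finally have fin: "emeasure ?M (solid k \<alpha> 1) \<noteq> top" by (auto simp: top_unique)
  then show eq: "emeasure ?M (solid k \<alpha> 1) = ennreal (c k \<alpha>)"
    unfolding c_def solid_def by (simp add: emeasure_eq_ennreal_measure)
  have "PiE {1..k} (\<lambda>i. {0..<1 / real k}) \<subseteq> solid k \<alpha> 1"
  proof
    fix x assume x: "x \<in> PiE {1..k} (\<lambda>i. {0..<1 / real k})"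
    have xb: "0 \<le> x i" "x i \<le> 1 / real k" if "i \<in> {1..k}" for i
      using x that by (auto simp: PiE_iff dest!: bspec[of _ _ i] intro: less_imp_le)
    have pw: "x i ^ k \<le> 1 / real k" if i: "i \<in> {1..k}" for i
    proof -
      have "x i ^ k \<le> x i ^ 1" using xb[OF i] k by (intro power_decreasing) (auto intro: order_trans)
      then show ?thesis using xb[OF i] by simp
    qed
    have "F k \<alpha> x \<le> 1 / real k + (\<Sum>i=2..k. 1 / real k)"
      unfolding F_def
    proof (intro add_mono sum_mono pw)
      fix i assume i: "i \<in> {2..k}"
      have "\<alpha> i * x i ^ k \<le> 1 * x i ^ k" using \<alpha>[OF i] xb[of i] i by (intro mult_right_mono) auto
      then show "\<alpha> i * x i ^ k \<le> 1 / real k" using pw[of i] i by auto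
    qed (use k in auto)
    also have "\<dots> = 1" using k by (simp add: field_simps of_nat_diff)
    finally show "x \<in> solid k \<alpha> 1" using x xb by (auto simp: solid_def PiE_iff)
  qed
  then have "emeasure ?M (PiE {1..k} (\<lambda>i. {0..<1 / real k})) \<le> emeasure ?M (solid k \<alpha> 1)"
    using k by (intro emeasure_mono solid_sets) auto
  also have "emeasure ?M (PiE {1..k} (\<lambda>i. {0..<1 / real k})) = ennreal (\<Prod>i\<in>{1..k}. 1 / real k - 0)"
    by (rule emeasure_PiE_interval) simp
  finally have "ennreal ((1 / real k) ^ k) \<le> ennreal (c k \<alpha>)" unfolding eq by simp
  then have "(1 / real k) ^ k \<le> c k \<alpha>" unfolding c_def by (subst (asm) ennreal_le_iff) auto
  moreover have "0 < (1 / real k) ^ k" using k by simp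
  ultimately show "c k \<alpha> > 0" by linarith
qed

text \<open>\<open>F\<close> is homogeneous of degree k in k variables: scaling the variables by t
  powr (-1/k) divides \<open>F\<close> by t and volumes by t as well.\<close>

lemma emeasure_solid:
  assumes k: "k \<ge> 1" and \<alpha>: "\<And>i. i \<in> {2..k} \<Longrightarrow> 1 / 2 \<le> \<alpha> i \<and> \<alpha> i \<le> 1" and t: "t > 0"
  shows "emeasure (PiM {1..k} (\<lambda>_. lborel)) (solid k \<alpha> t) = ennreal (c k \<alpha> * t)"
proof -
  let ?M = "PiM {1..k} (\<lambda>_. lborel :: real measure)"
  define s where "s = t powr (- 1 / real k)"
  have s: "s > 0" using t by (simp add: s_def)
  have sk: "s ^ k = 1 / t"
  proof -
    have "s ^ k = s powr real k" using s by (rule powr_realpow[symmetric])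
    also have "\<dots> = t powr (- 1)" using k by (simp add: s_def powr_powr)
    finally show ?thesis using t by (simp add: powr_minus_divide)
  qed
  have Fs: "F k \<alpha> (\<lambda>i\<in>{1..k}. s * x i) = F k \<alpha> x / t" for x
  proof -
    have "(\<Sum>i=2..k. \<alpha> i * (\<lambda>i\<in>{1..k}. s * x i) i ^ k) = (\<Sum>i=2..k. \<alpha> i * x i ^ k / t)"
      by (intro sum.cong refl) (auto simp: power_mult_distrib sk)
    moreover have "(\<lambda>i\<in>{1..k}. s * x i) 1 ^ k = x 1 ^ k / t" using k by (simp add: power_mult_distrib sk)
    ultimately show ?thesis unfolding F_def by (simp add: sum_divide_distrib add_divide_distrib)
  qed
  have eqv: "(\<lambda>i\<in>{1..k}. s * x i) \<in> solid k \<alpha> 1 \<longleftrightarrow> x \<in> solid k \<alpha> t" if "x \<in> space ?M" for x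
    using that s t unfolding solid_def mem_Collect_eq Fs by (auto simp: space_PiM PiE_iff zero_le_mult_iff)
  have "emeasure ?M (solid k \<alpha> t) = (\<integral>\<^sup>+x. indicator (solid k \<alpha> t) x \<partial>?M)"
    using k by (intro nn_integral_indicator[symmetric] solid_sets)
  also have "\<dots> = (\<integral>\<^sup>+x. indicator (solid k \<alpha> 1) (\<lambda>i\<in>{1..k}. s * x i) \<partial>?M)"
    using eqv by (intro nn_integral_cong) (auto simp: indicator_def)
  also have "\<dots> = ennreal ((1 / s) ^ card {1..k}) * (\<integral>\<^sup>+x. indicator (solid k \<alpha> 1) x \<partial>?M)"
    using s k by (intro nn_integral_PiM_scale borel_measurable_indicator solid_sets) auto
  also have "(\<integral>\<^sup>+x. indicator (solid k \<alpha> 1) x \<partial>?M) = ennreal (c k \<alpha>)"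
  proof -
    have "emeasure ?M (solid k \<alpha> 1) = ennreal (c k \<alpha>)" using k \<alpha> by (intro solid_1_finite(1)) auto
    then show ?thesis using solid_sets[OF k] by (simp only: nn_integral_indicator)
  qed
  also have "(1 / s) ^ card {1..k} = t" using sk t by (simp add: power_one_over)
  moreover have "c k \<alpha> > 0" using k \<alpha> by (intro solid_1_finite(2)) auto
  ultimately show ?thesis using t by (simp add: ennreal_mult mult.commute)
qed

section \<open>Counting lattice points and pairs by unit cubes\<close>

lemma lattice_subset_box:
  assumes k: "k \<ge> 1" and b: "\<And>i. i \<in> {2..k} \<Longrightarrow> b \<le> \<alpha> i" "0 < b" "b \<le> 1" and t: "t \<le> b * real N ^ k"
  shows "lattice k \<alpha> t \<subseteq> box k N"
proof
  fix n assume n: "n \<in> lattice k \<alpha> t"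
  have "n j \<le> N" if j: "j \<in> {1..k}" for j
  proof -
    have "b * real (n j) ^ k \<le> F k \<alpha> (\<lambda>i. real (n i))" using j b by (intro F_ge_coord) auto
    also have "\<dots> \<le> b * real N ^ k" using n t by (auto simp: lattice_def)
    finally have "real (n j) ^ k \<le> real N ^ k" using b by simp
    then have "n j ^ k \<le> N ^ k" by (metis of_nat_le_iff of_nat_power)
    then show ?thesis using k power_mono_iff[of "n j" N k] by simp
  qed
  then show "n \<in> box k N" using n by (auto simp: lattice_def box_def PiE_iff)
qed

text \<open>Each lattice point is the lowest corner of a unit cube. Rounding down does not increase
  \<open>F\<close>, so the cubes cover the solid. Conversely they lie in F \<le> t + E, because each
  of the k powers grows by at most k * (N + 1)^(k-1) within a cube and the coefficients are at most
  1.\<close>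

lemma card_lattice_bounds:
  assumes k: "k \<ge> 1" and \<alpha>: "\<And>i. i \<in> {2..k} \<Longrightarrow> 1 / 2 \<le> \<alpha> i \<and> \<alpha> i \<le> 1" and t: "t \<ge> 0" "t \<le> 1 / 2 * real N ^ k"
  shows "c k \<alpha> * t \<le> real (card (lattice k \<alpha> t))"
    "real (card (lattice k \<alpha> t)) \<le> c k \<alpha> * (t + (real k)\<^sup>2 * (real N + 1) ^ (k - 1))"
proof -
  let ?M = "PiM {1..k} (\<lambda>_. lborel :: real measure)"
  define E where "E = (real k)\<^sup>2 * (real N + 1) ^ (k - 1)"
  have E0: "E > 0" using k by (simp add: E_def)
  have c0: "c k \<alpha> > 0" by (rule solid_1_finite(2)[OF k \<alpha>])
  define Q where "Q n = PiE {1..k} (\<lambda>i. {real (n i)..<real (n i) + 1})" for n :: "nat \<Rightarrow> nat"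
  have Qs: "Q n \<in> sets ?M" for n unfolding Q_def by (intro sets_PiM_I_finite) auto
  have Qm: "emeasure ?M (Q n) = 1" for n
    unfolding Q_def by (subst emeasure_PiE_interval) auto
  have sub: "lattice k \<alpha> t \<subseteq> box k N" using k \<alpha> t by (intro lattice_subset_box[of k "1 / 2"]) auto
  have fin: "finite (lattice k \<alpha> t)" using sub finite_box finite_subset by blast
  have disj: "disjoint_family_on Q (lattice k \<alpha> t)"
  proof (unfold disjoint_family_on_def, intro ballI impI)
    fix m n assume mn: "m \<in> lattice k \<alpha> t" "n \<in> lattice k \<alpha> t" "m \<noteq> n"
    show "Q m \<inter> Q n = {}"
    proof (rule ccontr)
      assume "Q m \<inter> Q n \<noteq> {}"
      then obtain x where x: "x \<in> Q m" "x \<in> Q n" by blast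
      have "m i = n i" if i: "i \<in> {1..k}" for i
      proof -
        have "real (m i) \<le> x i" "x i < real (m i) + 1" "real (n i) \<le> x i" "x i < real (n i) + 1"
          using x i by (auto simp: Q_def PiE_iff)
        then show ?thesis by linarith
      qed
      then have "m = n" using mn by (intro PiE_ext[of m "{1..k}" "\<lambda>_. UNIV" n]) (auto simp: lattice_def)
      then show False using mn by simp
    qed
  qed
  have U: "emeasure ?M (\<Union>n\<in>lattice k \<alpha> t. Q n) = ennreal (real (card (lattice k \<alpha> t)))"
  proof -
    have "(\<Sum>n\<in>lattice k \<alpha> t. emeasure ?M (Q n)) = emeasure ?M (\<Union>n\<in>lattice k \<alpha> t. Q n)"
      using fin disj Qs by (intro sum_emeasure) auto
    then show ?thesis unfolding Qm by (simp add: ennreal_of_nat_eq_real_of_nat)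
  qed
  have UM: "(\<Union>n\<in>lattice k \<alpha> t. Q n) \<in> sets ?M" using fin Qs by auto
  show "c k \<alpha> * t \<le> real (card (lattice k \<alpha> t))"
  proof (cases "t = 0")
    case True
    then show ?thesis by simp
  next
    case False
    then have t0: "t > 0" using t by simp
    have "solid k \<alpha> t \<subseteq> (\<Union>n\<in>lattice k \<alpha> t. Q n)"
    proof
      fix x assume x: "x \<in> solid k \<alpha> t"
      define n where "n = (\<lambda>i\<in>{1..k}. nat \<lfloor>x i\<rfloor>)"
      have x0: "0 \<le> x i" if "i \<in> {1..k}" for i using x that by (auto simp: solid_def PiE_iff)
      have ni: "real (n i) \<le> x i" "x i < real (n i) + 1" if "i \<in> {1..k}" for i
      proof -
        have "n i = nat \<lfloor>x i\<rfloor>" using that by (simp add: n_def)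
        then show "real (n i) \<le> x i" "x i < real (n i) + 1" using x0[OF that] by linarith+
      qed
      have "F k \<alpha> (\<lambda>i. real (n i)) \<le> F k \<alpha> x"
        using k \<alpha> ni by (intro F_mono) (auto intro: order_trans[of 0 "1/2"])
      then have "n \<in> lattice k \<alpha> t" using x by (auto simp: lattice_def solid_def n_def)
      moreover have "x \<in> Q n" using x ni by (auto simp: Q_def solid_def PiE_iff)
      ultimately show "x \<in> (\<Union>n\<in>lattice k \<alpha> t. Q n)" by blast
    qed
    then have "emeasure ?M (solid k \<alpha> t) \<le> emeasure ?M (\<Union>n\<in>lattice k \<alpha> t. Q n)"
      using UM by (intro emeasure_mono)
    then have "ennreal (c k \<alpha> * t) \<le> ennreal (real (card (lattice k \<alpha> t)))"
    proof -
      have "emeasure ?M (solid k \<alpha> t) = ennreal (c k \<alpha> * t)" using k \<alpha> t0 by (intro emeasure_solid) auto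
      then show ?thesis using \<open>emeasure ?M (solid k \<alpha> t) \<le> emeasure ?M (\<Union>n\<in>lattice k \<alpha> t. Q n)\<close>
        by (simp only: U)
    qed
    then show ?thesis by simp
  qed
  have "(\<Union>n\<in>lattice k \<alpha> t. Q n) \<subseteq> solid k \<alpha> (t + E)"
  proof
    fix x assume "x \<in> (\<Union>n\<in>lattice k \<alpha> t. Q n)"
    then obtain n where n: "n \<in> lattice k \<alpha> t" "x \<in> Q n" by blast
    have nN: "n i \<le> N" if "i \<in> {1..k}" for i using n sub that by (auto simp: box_def PiE_iff)
    have xi: "real (n i) \<le> x i" "x i < real (n i) + 1" if "i \<in> {1..k}" for i
      using n(2) that by (auto simp: Q_def PiE_iff)
    have pw: "x i ^ k \<le> real (n i) ^ k + real k * (real N + 1) ^ (k - 1)" if i: "i \<in> {1..k}" for i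
    proof -
      have "x i ^ k - real (n i) ^ k = (x i - real (n i)) * (\<Sum>j<k. real (n i) ^ (k - Suc j) * x i ^ j)"
        by (rule power_diff_sumr2)
      also have "\<dots> \<le> 1 * (\<Sum>j<k. (real N + 1) ^ (k - 1))"
      proof (intro mult_mono sum_mono)
        fix j assume j: "j \<in> {..<k}"
        have "real (n i) ^ (k - Suc j) * x i ^ j \<le> (real N + 1) ^ (k - Suc j) * (real N + 1) ^ j"
          using xi[OF i] nN[OF i] by (intro mult_mono power_mono) auto
        also have "\<dots> = (real N + 1) ^ (k - 1)" using j by (simp flip: power_add)
        finally show "real (n i) ^ (k - Suc j) * x i ^ j \<le> (real N + 1) ^ (k - 1)" .
      qed (use xi[OF i] in \<open>auto intro!: sum_nonneg mult_nonneg_nonneg\<close>)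
      finally show ?thesis by simp
    qed
    have "F k \<alpha> x \<le> (real (n 1) ^ k + real k * (real N + 1) ^ (k - 1)) + (\<Sum>i=2..k. \<alpha> i * real (n i) ^ k + real k * (real N + 1) ^ (k - 1))"
      unfolding F_def
    proof (intro add_mono sum_mono pw)
      fix i assume i: "i \<in> {2..k}"
      have "\<alpha> i * x i ^ k \<le> \<alpha> i * (real (n i) ^ k + real k * (real N + 1) ^ (k - 1))"
        using pw[of i] i \<alpha>[OF i] by (intro mult_left_mono) auto
      also have "\<dots> \<le> \<alpha> i * real (n i) ^ k + 1 * (real k * (real N + 1) ^ (k - 1))"
        unfolding distrib_left using \<alpha>[OF i] by (intro add_left_mono mult_right_mono) auto
      finally show "\<alpha> i * x i ^ k \<le> \<alpha> i * real (n i) ^ k + real k * (real N + 1) ^ (k - 1)" by simp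
    qed (use k in auto)
    also have "\<dots> = F k \<alpha> (\<lambda>i. real (n i)) + real k * (real k * (real N + 1) ^ (k - 1))"
      using k by (simp add: F_def sum.distrib of_nat_diff algebra_simps)
    also have "\<dots> \<le> t + E" using n by (simp add: lattice_def E_def power2_eq_square)
    finally have "F k \<alpha> x \<le> t + E" .
    moreover have "0 \<le> x i" if "i \<in> {1..k}" for i using xi(1)[OF that] by linarith
    ultimately show "x \<in> solid k \<alpha> (t + E)" using n(2) by (auto simp: solid_def Q_def PiE_iff)
  qed
  then have "emeasure ?M (\<Union>n\<in>lattice k \<alpha> t. Q n) \<le> emeasure ?M (solid k \<alpha> (t + E))"
    using k by (intro emeasure_mono solid_sets)
  also have "\<dots> = ennreal (c k \<alpha> * (t + E))" using t E0 by (intro emeasure_solid k \<alpha>) auto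
  finally have "ennreal (real (card (lattice k \<alpha> t))) \<le> ennreal (c k \<alpha> * (t + E))" unfolding U .
  then show "real (card (lattice k \<alpha> t)) \<le> c k \<alpha> * (t + (real k)\<^sup>2 * (real N + 1) ^ (k - 1))"
    using c0 t E0 by (subst (asm) ennreal_le_iff) (auto simp: E_def)
qed

text \<open>For fixed \<open>m\<close> the number of \<open>n\<close> is the difference of the
  lattice counts at F m and at F m - L, that is c * L up to c * E. For F m < L the second argument
  is negative and the count bounds do not apply there, but at most c * (L + E) points
  \<open>m\<close> are of this kind, each with an error of that same size; hence the square.\<close>

lemma pair_count_large_scale:
  assumes k: "k \<ge> 1" and \<alpha>: "\<And>i. i \<in> {2..k} \<Longrightarrow> 1 / 2 \<le> \<alpha> i \<and> \<alpha> i \<le> 1"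
    and P: "P \<subseteq> lattice k \<alpha> (1 / 2 * real N ^ k)" and L: "0 < L" "L \<le> 1 / 2 * real N ^ k"
  defines "E \<equiv> (real k)\<^sup>2 * (real N + 1) ^ (k - 1)"
  shows "\<bar>(\<Sum>m\<in>P. real (card {n \<in> box k N. F k \<alpha> (\<lambda>i. real (m i)) - F k \<alpha> (\<lambda>i. real (n i)) \<in> {0..<L}})) - real (card P) * (c k \<alpha> * L)\<bar>
     \<le> real (card P) * (c k \<alpha> * E) + (c k \<alpha> * (L + E))\<^sup>2"
proof -
  have c0: "c k \<alpha> > 0" by (rule solid_1_finite(2)[OF k \<alpha>])
  have E0: "E \<ge> 0" by (simp add: E_def)
  define u where "u m = F k \<alpha> (\<lambda>i. real (m i))" for m :: "nat \<Rightarrow> nat"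
  have latbox: "lattice k \<alpha> s \<subseteq> box k N" if "s \<le> 1 / 2 * real N ^ k" for s
    using k \<alpha> that by (intro lattice_subset_box[of k "1 / 2"]) auto
  have finl: "finite (lattice k \<alpha> s)" if "s \<le> 1 / 2 * real N ^ k" for s
    using latbox[OF that] finite_box finite_subset by blast
  have fP: "finite P" using P finl[of "1 / 2 * real N ^ k"] finite_subset by auto
  have u0: "0 \<le> u m" for m unfolding u_def F_def using \<alpha> by (auto intro!: add_nonneg_nonneg sum_nonneg mult_nonneg_nonneg intro: order_trans[of 0 "1/2"])
  define g where "g m = real (card {n \<in> box k N. u m - u n \<in> {0..<L}})" for m
  have g: "g m = real (card (lattice k \<alpha> (u m))) - real (card (lattice k \<alpha> (u m - L)))" if m: "u m \<le> 1 / 2 * real N ^ k" for m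
  proof -
    have "{n \<in> box k N. u m - u n \<in> {0..<L}} = lattice k \<alpha> (u m) - lattice k \<alpha> (u m - L)"
      using latbox[OF m] by (auto simp: lattice_def u_def box_def PiE_iff)
    moreover have "lattice k \<alpha> (u m - L) \<subseteq> lattice k \<alpha> (u m)" using L by (auto simp: lattice_def)
    moreover have "finite (lattice k \<alpha> (u m))" by (rule finl[OF m])
    ultimately show ?thesis
      by (simp add: g_def card_Diff_subset finite_subset of_nat_diff card_mono)
  qed
  have um: "u m \<le> 1 / 2 * real N ^ k" if "m \<in> P" for m using P that by (auto simp: lattice_def u_def)
  have big: "\<bar>g m - c k \<alpha> * L\<bar> \<le> c k \<alpha> * E" if m: "m \<in> P" "L \<le> u m" for m
  proof -
    have 1: "c k \<alpha> * u m \<le> real (card (lattice k \<alpha> (u m)))" "real (card (lattice k \<alpha> (u m))) \<le> c k \<alpha> * (u m + E)"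
      unfolding E_def using k \<alpha> u0 um[OF m(1)] by (intro card_lattice_bounds; simp)+
    have h: "0 \<le> u m - L" "u m - L \<le> 1 / 2 * real N ^ k" using m um[OF m(1)] L by auto
    have 2: "c k \<alpha> * (u m - L) \<le> real (card (lattice k \<alpha> (u m - L)))" "real (card (lattice k \<alpha> (u m - L))) \<le> c k \<alpha> * (u m - L + E)"
      unfolding E_def using k \<alpha> h by (intro card_lattice_bounds; simp)+
    show ?thesis using 1 2 unfolding g[OF um[OF m(1)]] by (simp add: algebra_simps abs_le_iff)
  qed
  have small: "\<bar>g m - c k \<alpha> * L\<bar> \<le> c k \<alpha> * (L + E)" if m: "m \<in> P" "u m < L" for m
  proof -
    have "real (card (lattice k \<alpha> (u m))) \<le> c k \<alpha> * (u m + E)"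
      unfolding E_def using k \<alpha> u0 um[OF m(1)] by (intro card_lattice_bounds; simp)
    also have "\<dots> \<le> c k \<alpha> * (L + E)" using m c0 by (intro mult_left_mono) auto
    finally have "g m \<le> c k \<alpha> * (L + E)" unfolding g[OF um[OF m(1)]] by simp
    moreover have "0 \<le> g m" by (simp add: g_def)
    moreover have "0 \<le> c k \<alpha> * L" "c k \<alpha> * L \<le> c k \<alpha> * (L + E)" using c0 L E0 by (auto intro!: mult_left_mono)
    ultimately show ?thesis by linarith
  qed
  have cs: "real (card {m\<in>P. u m < L}) \<le> c k \<alpha> * (L + E)"
  proof -
    have "card {m\<in>P. u m < L} \<le> card (lattice k \<alpha> L)"
      using P finl[OF L(2)] by (intro card_mono) (auto simp: lattice_def u_def)
    also have "real \<dots> \<le> c k \<alpha> * (L + E)"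
      unfolding E_def using k \<alpha> L by (intro card_lattice_bounds; simp)
    finally show ?thesis by simp
  qed
  have "\<bar>(\<Sum>m\<in>P. g m) - real (card P) * (c k \<alpha> * L)\<bar> = \<bar>\<Sum>m\<in>P. (g m - c k \<alpha> * L)\<bar>"
    by (simp add: sum_subtractf)
  also have "\<dots> \<le> (\<Sum>m\<in>P. \<bar>g m - c k \<alpha> * L\<bar>)" by (rule sum_abs)
  also have "\<dots> \<le> (\<Sum>m\<in>P. c k \<alpha> * E + (if u m < L then c k \<alpha> * (L + E) else 0))"
  proof (rule sum_mono)
    fix m assume m: "m \<in> P"
    have "0 \<le> c k \<alpha> * E" using c0 E0 by simp
    then show "\<bar>g m - c k \<alpha> * L\<bar> \<le> c k \<alpha> * E + (if u m < L then c k \<alpha> * (L + E) else 0)"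
      using big[OF m] small[OF m] by (cases "u m < L") auto
  qed
  also have "\<dots> = real (card P) * (c k \<alpha> * E) + real (card {m\<in>P. u m < L}) * (c k \<alpha> * (L + E))"
  proof -
    have "(\<Sum>m\<in>P. if u m < L then c k \<alpha> * (L + E) else 0) = (\<Sum>m\<in>{m\<in>P. u m < L}. c k \<alpha> * (L + E))"
      using fP by (intro sum.inter_filter[symmetric])
    then show ?thesis by (simp add: sum.distrib)
  qed
  also have "\<dots> \<le> real (card P) * (c k \<alpha> * E) + c k \<alpha> * (L + E) * (c k \<alpha> * (L + E))"
    using cs c0 L E0 by (intro add_left_mono mult_right_mono) auto
  finally show ?thesis by (simp add: g_def u_def power2_eq_square)
qed

section \<open>Almost sure bounds\<close>

text \<open>Borel-Cantelli: a series of nonnegative functions with summable integrals converges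
  almost everywhere, so its terms tend to 0. The weight equals 1 on the parameter cube and
  disappears there.\<close>

lemma eventually_le_1_if_summable_integrals:
  fixes f :: "nat \<Rightarrow> (nat \<Rightarrow> real) \<Rightarrow> real"
  assumes f [measurable]: "\<And>j. f j \<in> borel_measurable (PiM {2..k} (\<lambda>_. lborel))" and f0: "\<And>j \<alpha>. 0 \<le> f j \<alpha>"
    and b: "\<And>j. j \<ge> j0 \<Longrightarrow> (\<integral>\<^sup>+\<alpha>. ennreal (wt {2..k} \<alpha> * f j \<alpha>) \<partial>PiM {2..k} (\<lambda>_. lborel)) \<le> ennreal (b j)"
    and b0: "\<And>j. 0 \<le> b j" and sb: "summable b"
  shows "AE \<alpha> in PiM {2..k} (\<lambda>_. lborel). \<alpha> \<in> ({2..k} \<rightarrow>\<^sub>E {1/2..1}) \<longrightarrow> (\<forall>\<^sub>F j in sequentially. f j \<alpha> \<le> 1)"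
proof -
  let ?M = "PiM {2..k} (\<lambda>_. lborel :: real measure)"
  define g where "g j \<alpha> = wt {2..k} \<alpha> * f (j + j0) \<alpha>" for j \<alpha>
  have g0: "0 \<le> g j \<alpha>" for j \<alpha> using f0 by (simp add: g_def)
  have gm [measurable]: "g j \<in> borel_measurable ?M" for j unfolding g_def by measurable
  have "(\<integral>\<^sup>+\<alpha>. (\<Sum>j. ennreal (g j \<alpha>)) \<partial>?M) = (\<Sum>j. \<integral>\<^sup>+\<alpha>. ennreal (g j \<alpha>) \<partial>?M)"
    by (rule nn_integral_suminf) measurable
  also have "\<dots> \<le> (\<Sum>j. ennreal (b (j + j0)))"
    unfolding g_def by (intro suminf_le b) auto
  also have "\<dots> = ennreal (\<Sum>j. b (j + j0))"
    using b0 sb by (intro suminf_ennreal2) (auto simp: summable_iff_shift)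
  also have "\<dots> < \<infinity>" by simp
  finally have "(\<integral>\<^sup>+\<alpha>. (\<Sum>j. ennreal (g j \<alpha>)) \<partial>?M) \<noteq> \<infinity>" by simp
  then have "AE \<alpha> in ?M. (\<Sum>j. ennreal (g j \<alpha>)) \<noteq> \<infinity>"
    by (intro nn_integral_PInf_AE) auto
  then show ?thesis
  proof (rule AE_mp, intro AE_I2 impI)
    fix \<alpha> assume fin: "(\<Sum>j. ennreal (g j \<alpha>)) \<noteq> \<infinity>" and \<alpha>: "\<alpha> \<in> ({2..k} \<rightarrow>\<^sub>E {1/2..1})"
    have "summable (\<lambda>j. g j \<alpha>)" using fin g0 by (intro summable_suminf_not_top) auto
    then have "(\<lambda>j. g j \<alpha>) \<longlonglongrightarrow> 0" by (rule summable_LIMSEQ_zero)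
    then have "\<forall>\<^sub>F j in sequentially. g j \<alpha> < 1" by (rule order_tendstoD) simp
    moreover have "wt {2..k} \<alpha> = 1" using \<alpha> by (auto simp: wt_def PiE_iff tent_eq_1)
    ultimately have "\<forall>\<^sub>F j in sequentially. f (j + j0) \<alpha> \<le> 1" by (auto simp: g_def elim: eventually_mono)
    then show "\<forall>\<^sub>F j in sequentially. f j \<alpha> \<le> 1" using eventually_sequentially_seg[of "\<lambda>j. f j \<alpha> \<le> 1" j0] by blast
  qed
qed

text \<open>About N powr (2 * r) cells of length N powr (-r) reach up to N powr r, which eventually
  exceeds any constant bound for \<open>b\<close>.\<close>

definition cells :: "nat \<Rightarrow> real \<Rightarrow> nat" where
  "cells N r = nat \<lceil>real N powr (2 * r)\<rceil> + 1"

definition cell :: "nat \<Rightarrow> real \<Rightarrow> nat \<Rightarrow> real set" where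
  "cell N r l = {real l * real N powr (- r)..<(real l + 1) * real N powr (- r)}"

definition hits :: "nat \<Rightarrow> ((nat \<Rightarrow> nat) \<times> (nat \<Rightarrow> nat)) set \<Rightarrow> real set \<Rightarrow> (nat \<Rightarrow> real) \<Rightarrow> real" where
  "hits k P I \<alpha> = (\<Sum>p\<in>P. indicator I (lin k (diff k p) \<alpha>))"

text \<open>
  The normalised error terms.  Where this quantity is at most \<open>1\<close>, the pairs in \<open>P\<close> are
  equidistributed on the scale of a single cell, and degenerate pairs are negligible.
\<close>

definition deviation :: "nat \<Rightarrow> nat \<Rightarrow> real \<Rightarrow> real \<Rightarrow> ((nat \<Rightarrow> nat) \<times> (nat \<Rightarrow> nat)) set \<Rightarrow> (nat \<Rightarrow> real) \<Rightarrow> real" where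
  "deviation k N e r P \<alpha> =
     (\<Sum>l<cells N r. (hits k P (cell N r l) \<alpha> / real N powr (- r) -
        hits k P {0..<real N powr (real k - 1 / 2)} \<alpha> / real N powr (real k - 1 / 2))\<^sup>2) / real N powr (2 * real k - 1 / 100)
     + hits k (offaxis k N e) {0..3 * real N powr r} \<alpha> / real N powr (real k - 4 * r)
     + hits k (onaxis k N) {0..3 * real N powr r} \<alpha> / real N powr (real k - 4 * r)
     + hits k (offaxis k N e) {0..real N powr (real k - 1 / 2)} \<alpha> / (real N powr (real k - 1 / 2) * real N powr (real k - 4 * r))"

lemma hits_nonneg [simp]: "0 \<le> hits k P I \<alpha>"
  by (simp add: hits_def sum_nonneg)

lemma hits_eq_card: "finite P \<Longrightarrow> hits k P I \<alpha> = real (card {p \<in> P. lin k (diff k p) \<alpha> \<in> I})"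
  unfolding hits_def indicator_def by (simp add: sum.If_cases Int_def)

lemma borel_measurable_hits [measurable]:
  assumes [measurable]: "I \<in> sets borel"
  shows "hits k P I \<in> borel_measurable (PiM {2..k} (\<lambda>_. lborel))"
  unfolding hits_def by measurable

lemma cell_sets [measurable]: "cell N r l \<in> sets borel"
  by (simp add: cell_def)

lemma borel_measurable_deviation [measurable]:
  "deviation k N e r P \<in> borel_measurable (PiM {2..k} (\<lambda>_. lborel))"
  unfolding deviation_def by measurable

lemma deviation_nonneg: "0 \<le> deviation k N e r P \<alpha>"
  unfolding deviation_def by (intro add_nonneg_nonneg divide_nonneg_nonneg sum_nonneg mult_nonneg_nonneg) auto

section \<open>Mean value of the deviation\<close>

lemma lg_power_le:
  assumes "N > 0" "r > 0" "k > 0"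
  shows "lg N ^ (2 * k) \<le> (1 + 2 * real k / r) ^ (2 * k) * real N powr r"
proof -
  define s where "s = r / (2 * real k)"
  have s: "s > 0" using assms by (simp add: s_def)
  have "ln (real N) \<le> real N powr s / s" using assms s by (intro ln_powr_bound) auto
  moreover have "1 \<le> real N powr s" using assms s by (intro ge_one_powr_ge_zero) auto
  ultimately have "lg N \<le> (1 + 1 / s) * real N powr s" by (simp add: lg_def algebra_simps)
  then have "lg N ^ (2 * k) \<le> ((1 + 1 / s) * real N powr s) ^ (2 * k)"
    using lg_ge_1[OF assms(1)] by (intro power_mono) auto
  also have "\<dots> = (1 + 1 / s) ^ (2 * k) * (real N powr s) ^ (2 * k)" by (rule power_mult_distrib)
  also have "(real N powr s) ^ (2 * k) = real N powr r"
  proof -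
    have "(real N powr s) ^ (2 * k) = (real N powr s) powr real (2 * k)"
      using assms by (intro powr_realpow[symmetric]) simp
    also have "\<dots> = real N powr r" using assms by (simp add: powr_powr s_def)
    finally show ?thesis .
  qed
  also have "1 / s = 2 * real k / r" by (simp add: s_def)
  finally show ?thesis .
qed

lemma nn_integral_wt_add4:
  fixes a b c d :: "(nat \<Rightarrow> real) \<Rightarrow> real"
  assumes [measurable]: "a \<in> borel_measurable (PiM {2..k} (\<lambda>_. lborel))" "b \<in> borel_measurable (PiM {2..k} (\<lambda>_. lborel))"
    "c \<in> borel_measurable (PiM {2..k} (\<lambda>_. lborel))" "d \<in> borel_measurable (PiM {2..k} (\<lambda>_. lborel))"
    and nn: "\<And>\<alpha>. 0 \<le> a \<alpha>" "\<And>\<alpha>. 0 \<le> b \<alpha>" "\<And>\<alpha>. 0 \<le> c \<alpha>" "\<And>\<alpha>. 0 \<le> d \<alpha>"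
  shows "(\<integral>\<^sup>+\<alpha>. ennreal (wt {2..k} \<alpha> * (a \<alpha> + b \<alpha> + c \<alpha> + d \<alpha>)) \<partial>PiM {2..k} (\<lambda>_. lborel))
    = (\<integral>\<^sup>+\<alpha>. ennreal (wt {2..k} \<alpha> * a \<alpha>) \<partial>PiM {2..k} (\<lambda>_. lborel)) + (\<integral>\<^sup>+\<alpha>. ennreal (wt {2..k} \<alpha> * b \<alpha>) \<partial>PiM {2..k} (\<lambda>_. lborel))
    + (\<integral>\<^sup>+\<alpha>. ennreal (wt {2..k} \<alpha> * c \<alpha>) \<partial>PiM {2..k} (\<lambda>_. lborel)) + (\<integral>\<^sup>+\<alpha>. ennreal (wt {2..k} \<alpha> * d \<alpha>) \<partial>PiM {2..k} (\<lambda>_. lborel))"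
  using nn by (simp add: distrib_left nn_integral_add)

lemma nn_integral_wt_divide:
  fixes a :: "(nat \<Rightarrow> real) \<Rightarrow> real"
  assumes [measurable]: "a \<in> borel_measurable (PiM {2..k} (\<lambda>_. lborel))" and nn: "\<And>\<alpha>. 0 \<le> a \<alpha>" and z: "z > 0"
    and B: "(\<integral>\<^sup>+\<alpha>. ennreal (wt {2..k} \<alpha> * a \<alpha>) \<partial>PiM {2..k} (\<lambda>_. lborel)) \<le> ennreal B" "B / z \<le> B'" "0 \<le> B"
  shows "(\<integral>\<^sup>+\<alpha>. ennreal (wt {2..k} \<alpha> * (a \<alpha> / z)) \<partial>PiM {2..k} (\<lambda>_. lborel)) \<le> ennreal B'"
proof -
  have "(\<integral>\<^sup>+\<alpha>. ennreal (wt {2..k} \<alpha> * (a \<alpha> / z)) \<partial>PiM {2..k} (\<lambda>_. lborel))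
     = (\<integral>\<^sup>+\<alpha>. ennreal (wt {2..k} \<alpha> * a \<alpha>) * ennreal (1 / z) \<partial>PiM {2..k} (\<lambda>_. lborel))"
    using nn z by (intro nn_integral_cong) (simp flip: ennreal_mult)
  also have "\<dots> = (\<integral>\<^sup>+\<alpha>. ennreal (wt {2..k} \<alpha> * a \<alpha>) \<partial>PiM {2..k} (\<lambda>_. lborel)) * ennreal (1 / z)"
    by (rule nn_integral_multc) measurable
  also have "\<dots> \<le> ennreal B * ennreal (1 / z)" using B by (intro mult_right_mono) auto
  also have "\<dots> = ennreal (B / z)" using B z by (simp flip: ennreal_mult)
  also have "\<dots> \<le> ennreal B'" using B by (intro ennreal_leI)
  finally show ?thesis .
qed

text \<open>Exponents of \<open>N\<close> after normalisation: 2r - 1/100 for the sum over the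
  cells, -2r and -3r for \<open>offaxis\<close> on the fine and the coarse scale, 7r - 1 for
  \<open>onaxis\<close>, where the last three include one \<open>r\<close> for the logarithms. All
  of them are at most -r.\<close>

lemma nn_integral_deviation_le:
  fixes k :: nat and e r :: real
  assumes k: "k \<ge> 3" and e: "0 < e" "e * real k \<le> 1 / 1000" and r: "r = e / (8 * (real k)\<^sup>2)"
  shows "\<exists>C>0. \<exists>N0. \<forall>N P. N \<ge> N0 \<longrightarrow> P \<subseteq> good k N e \<longrightarrow>
     (\<integral>\<^sup>+\<alpha>. ennreal (wt {2..k} \<alpha> * deviation k N e r P \<alpha>) \<partial>PiM {2..k} (\<lambda>_. lborel)) \<le> ennreal (C * real N powr (- r))"
proof -
  have r0: "r > 0" using e k by (simp add: r)
  have k3: "real k \<ge> 3" using k by simp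
  have e1: "e \<le> 1 / 1000" using k e by (rule exponent_small)
  have k9: "(real k)\<^sup>2 \<ge> 9" using power_mono[OF k3, of 2] by simp
  have r8: "e / (real k)\<^sup>2 = 8 * r" by (simp add: r)
  have re: "72 * r \<le> e"
  proof -
    have "r * 72 \<le> r * (8 * (real k)\<^sup>2)" using k9 r0 by (intro mult_left_mono) auto
    also have "\<dots> = e" using k by (simp add: r)
    finally show ?thesis by simp
  qed
  obtain C1 where C1: "C1 > 0" "\<And>N I l \<Lambda> P. real N \<ge> (8 * real k + 8) ^ 50 \<Longrightarrow> I \<in> sets borel \<Longrightarrow> emeasure lborel I = ennreal l \<Longrightarrow>
     I \<subseteq> {0..\<Lambda>} \<Longrightarrow> 1 \<le> \<Lambda> \<Longrightarrow> \<Lambda> \<le> real N powr (real k - 1 / 2) \<Longrightarrow> real N powr (- e) * \<Lambda> \<le> l \<Longrightarrow> P \<subseteq> good k N e \<Longrightarrow>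
     (\<integral>\<^sup>+\<alpha>. ennreal (wt {2..k} \<alpha> * ((\<Sum>p\<in>P. indicator I (lin k (diff k p) \<alpha>)) / l -
        (\<Sum>p\<in>P. indicator {0..<real N powr (real k - 1 / 2)} (lin k (diff k p) \<alpha>)) / real N powr (real k - 1 / 2))\<^sup>2)
       \<partial>PiM {2..k} (\<lambda>_. lborel)) \<le> ennreal (C1 * real N powr (2 * real k - 1 / 50))"
    using second_moment_le[OF k e] by blast
  obtain C2 where C2: "C2 > 0" "\<And>N \<Lambda>. N > 0 \<Longrightarrow> 0 \<le> \<Lambda> \<Longrightarrow>
     (\<integral>\<^sup>+\<alpha>. ennreal (wt {2..k} \<alpha> * hits k (offaxis k N e) {0..\<Lambda>} \<alpha>) \<partial>PiM {2..k} (\<lambda>_. lborel))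
      \<le> ennreal (C2 * \<Lambda> * lg N ^ (2 * k) * real N powr (real k - 8 * r))"
    using offaxis_first_moment_le[OF k e(1)] unfolding hits_def r8 by blast
  obtain C3 where C3: "C3 > 0" "\<And>N \<Lambda>. N > 0 \<Longrightarrow> 1 \<le> \<Lambda> \<Longrightarrow>
     (\<integral>\<^sup>+\<alpha>. ennreal (wt {2..k} \<alpha> * hits k (onaxis k N) {0..\<Lambda>} \<alpha>) \<partial>PiM {2..k} (\<lambda>_. lborel))
      \<le> ennreal (C3 * \<Lambda>\<^sup>2 * lg N ^ (2 * k) * real N powr (real k - 1))"
    using onaxis_first_moment_le[OF k] unfolding hits_def by blast
  define Cl where "Cl = (1 + 2 * real k / r) ^ (2 * k)"
  have Cl0: "Cl > 0" using r0 by (simp add: Cl_def add_pos_nonneg)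
  define C where "C = 3 * C1 + 3 * C2 * Cl + 9 * C3 * Cl + C2 * Cl"
  have C0: "C > 0" using C1 C2 C3 Cl0 by (simp add: C_def add_pos_pos)
  \<comment> \<open>The second summand makes 3 \<le> N powr (e - 2r), hence N powr (-e) * \<Lambda>
    \<le> N powr (-r) for \<Lambda> = 3 * N powr r: a cell is long enough for the second moment
    bound.\<close>
  define N0 where "N0 = nat \<lceil>(8 * real k + 8) ^ 50 + 3 powr (1 / (e - 2 * r))\<rceil>"
  have "(\<integral>\<^sup>+\<alpha>. ennreal (wt {2..k} \<alpha> * deviation k N e r P \<alpha>) \<partial>PiM {2..k} (\<lambda>_. lborel)) \<le> ennreal (C * real N powr (- r))"
    if N: "N \<ge> N0" and P: "P \<subseteq> good k N e" for N P
  proof -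
    let ?M = "PiM {2..k} (\<lambda>_. lborel :: real measure)"
    define x where "x = real N"
    have xb: "(8 * real k + 8) ^ 50 + 3 powr (1 / (e - 2 * r)) \<le> x" using N unfolding N0_def x_def by linarith
    have p1: "(1::real) \<le> (8 * real k + 8) ^ 50" by (intro one_le_power) simp
    have p3: "0 \<le> (3::real) powr (1 / (e - 2 * r))" by simp
    have x8: "(8 * real k + 8) ^ 50 \<le> x" and x3: "3 powr (1 / (e - 2 * r)) \<le> x" and x1: "1 \<le> x"
      using xb p1 p3 by linarith+
    have N0: "N > 0" using x1 by (auto simp: x_def)
    have mono: "x powr a \<le> x powr b" if "a \<le> b" for a b using x1 that by (intro powr_mono) auto
    have xe: "3 \<le> x powr (e - 2 * r)"
    proof -
      have "0 < e - 2 * r" using re r0 by linarith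
      then have "(3 powr (1 / (e - 2 * r))) powr (e - 2 * r) \<le> x powr (e - 2 * r)" using x3 by (intro powr_mono2) auto
      then show ?thesis using \<open>0 < e - 2 * r\<close> by (simp add: powr_powr)
    qed
    have ps: "0 < x powr a" for a using x1 by simp
    define L where "L = x powr (real k - 1 / 2)"
    define \<Lambda> where "\<Lambda> = 3 * x powr r"
    have xr: "1 \<le> x powr r" using mono[of 0 r] r0 x1 by simp
    have \<Lambda>1: "1 \<le> \<Lambda>" using xr by (simp add: \<Lambda>_def)
    have lgl: "lg N ^ (2 * k) \<le> Cl * x powr r" unfolding Cl_def x_def using N0 r0 k by (intro lg_power_le) auto
    have lg0: "0 \<le> lg N ^ (2 * k)" using lg_ge_1[OF N0] by simp
    have K: "real (cells N r) \<le> 3 * x powr (2 * r)"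
    proof -
      have "1 \<le> x powr (2 * r)" using mono[of 0 "2 * r"] r0 x1 by simp
      then show ?thesis unfolding cells_def x_def by linarith
    qed
    have T1: "(\<integral>\<^sup>+\<alpha>. ennreal (wt {2..k} \<alpha> * ((\<Sum>l<cells N r. (hits k P (cell N r l) \<alpha> / x powr (- r) - hits k P {0..<L} \<alpha> / L)\<^sup>2) / x powr (2 * real k - 1 / 100))) \<partial>?M)
        \<le> ennreal (3 * C1 * x powr (- r))"
    proof (rule nn_integral_wt_divide)
      have "(\<integral>\<^sup>+\<alpha>. ennreal (wt {2..k} \<alpha> * (\<Sum>l<cells N r. (hits k P (cell N r l) \<alpha> / x powr (- r) - hits k P {0..<L} \<alpha> / L)\<^sup>2)) \<partial>?M)
        = (\<integral>\<^sup>+\<alpha>. (\<Sum>l<cells N r. ennreal (wt {2..k} \<alpha> * (hits k P (cell N r l) \<alpha> / x powr (- r) - hits k P {0..<L} \<alpha> / L)\<^sup>2)) \<partial>?M)"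
        by (intro nn_integral_cong) (simp add: sum_distrib_left)
      also have "\<dots> = (\<Sum>l<cells N r. \<integral>\<^sup>+\<alpha>. ennreal (wt {2..k} \<alpha> * (hits k P (cell N r l) \<alpha> / x powr (- r) - hits k P {0..<L} \<alpha> / L)\<^sup>2) \<partial>?M)"
        by (rule nn_integral_sum) measurable
      also have "\<dots> \<le> (\<Sum>l<cells N r. ennreal (C1 * x powr (2 * real k - 1 / 50)))"
      proof (rule sum_mono)
        fix l assume l: "l \<in> {..<cells N r}"
        have cl: "cell N r l \<subseteq> {0..\<Lambda>}"
        proof -
          have "real l + 1 \<le> real (cells N r)" using l by auto
          then have "(real l + 1) * x powr (- r) \<le> (3 * x powr (2 * r)) * x powr (- r)"
            using K by (intro mult_right_mono) auto
          also have "\<dots> = \<Lambda>" by (simp add: \<Lambda>_def flip: powr_add)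
          finally have u: "(real l + 1) * x powr (- r) \<le> \<Lambda>" .
          have "0 \<le> real l * x powr (- r)" by simp
          then have "y \<in> {0..\<Lambda>}" if "y \<in> cell N r l" for y
          proof -
            have "real l * x powr (- r) \<le> y" "y < (real l + 1) * x powr (- r)"
              using that unfolding cell_def x_def by auto
            then show ?thesis using u \<open>0 \<le> real l * x powr (- r)\<close> unfolding atLeastAtMost_iff by linarith
          qed
          then show ?thesis by blast
        qed
        have em: "emeasure lborel (cell N r l) = ennreal (x powr (- r))"
          unfolding cell_def x_def by (simp add: algebra_simps)
        have \<Lambda>2: "\<Lambda> \<le> x powr (real k - 1 / 2)"
        proof -
          have "\<Lambda> \<le> x powr (e - 2 * r) * x powr r" unfolding \<Lambda>_def using xe by (intro mult_right_mono) auto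
          also have "\<dots> = x powr (e - r)" by (simp flip: powr_add)
          also have "\<dots> \<le> x powr (real k - 1 / 2)" using e1 k3 r0 by (intro mono) linarith
          finally show ?thesis .
        qed
        have \<Lambda>3: "x powr (- e) * \<Lambda> \<le> x powr (- r)"
        proof -
          have "x powr (- e) * \<Lambda> \<le> x powr (- e) * (x powr (e - 2 * r) * x powr r)"
            unfolding \<Lambda>_def using xe by (intro mult_left_mono mult_right_mono) auto
          also have "\<dots> = x powr (- r)" by (simp flip: powr_add)
          finally show ?thesis .
        qed
        show "(\<integral>\<^sup>+\<alpha>. ennreal (wt {2..k} \<alpha> * (hits k P (cell N r l) \<alpha> / x powr (- r) - hits k P {0..<L} \<alpha> / L)\<^sup>2) \<partial>?M) \<le> ennreal (C1 * x powr (2 * real k - 1 / 50))"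
          using C1(2)[OF x8[unfolded x_def] cell_sets em[unfolded x_def] cl \<Lambda>1 \<Lambda>2[unfolded x_def] \<Lambda>3[unfolded x_def] P]
          unfolding hits_def L_def x_def .
      qed
      also have "\<dots> = ennreal (real (cells N r) * (C1 * x powr (2 * real k - 1 / 50)))"
        using C1 by (simp add: ennreal_mult ennreal_of_nat_eq_real_of_nat)
      also have "\<dots> \<le> ennreal (3 * x powr (2 * r) * (C1 * x powr (2 * real k - 1 / 50)))"
        using K C1 by (intro ennreal_leI mult_right_mono) auto
      finally show "(\<integral>\<^sup>+\<alpha>. ennreal (wt {2..k} \<alpha> * (\<Sum>l<cells N r. (hits k P (cell N r l) \<alpha> / x powr (- r) - hits k P {0..<L} \<alpha> / L)\<^sup>2)) \<partial>?M)
        \<le> ennreal (3 * x powr (2 * r) * (C1 * x powr (2 * real k - 1 / 50)))" .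
      have "3 * x powr (2 * r) * (C1 * x powr (2 * real k - 1 / 50)) / x powr (2 * real k - 1 / 100)
         = 3 * C1 * (x powr (2 * r) * x powr (2 * real k - 1 / 50) / x powr (2 * real k - 1 / 100))" by simp
      also have "x powr (2 * r) * x powr (2 * real k - 1 / 50) / x powr (2 * real k - 1 / 100) = x powr (2 * r + (2 * real k - 1 / 50) - (2 * real k - 1 / 100))"
        by (simp only: powr_add powr_diff)
      also have "3 * C1 * \<dots> \<le> 3 * C1 * x powr (- r)"
        using C1 re e1 by (intro mult_left_mono mono) auto
      finally show "3 * x powr (2 * r) * (C1 * x powr (2 * real k - 1 / 50)) / x powr (2 * real k - 1 / 100) \<le> 3 * C1 * x powr (- r)" .
    qed (use C1 ps in \<open>auto intro!: sum_nonneg\<close>)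
    have T2: "(\<integral>\<^sup>+\<alpha>. ennreal (wt {2..k} \<alpha> * (hits k (offaxis k N e) {0..\<Lambda>} \<alpha> / x powr (real k - 4 * r))) \<partial>?M) \<le> ennreal (3 * C2 * Cl * x powr (- r))"
    proof (rule nn_integral_wt_divide)
      show "(\<integral>\<^sup>+\<alpha>. ennreal (wt {2..k} \<alpha> * hits k (offaxis k N e) {0..\<Lambda>} \<alpha>) \<partial>?M) \<le> ennreal (C2 * \<Lambda> * lg N ^ (2 * k) * x powr (real k - 8 * r))"
        unfolding x_def using N0 \<Lambda>1 by (intro C2(2)) auto
      have "C2 * \<Lambda> * lg N ^ (2 * k) * x powr (real k - 8 * r) / x powr (real k - 4 * r) \<le> C2 * \<Lambda> * (Cl * x powr r) * x powr (real k - 8 * r) / x powr (real k - 4 * r)"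
        using lgl C2 \<Lambda>1 by (intro divide_right_mono mult_right_mono mult_left_mono) auto
      also have "\<dots> = 3 * C2 * Cl * (x powr r * x powr r * x powr (real k - 8 * r) / x powr (real k - 4 * r))" by (simp add: \<Lambda>_def)
      also have "x powr r * x powr r * x powr (real k - 8 * r) / x powr (real k - 4 * r) = x powr (r + r + (real k - 8 * r) - (real k - 4 * r))"
        by (simp only: powr_add powr_diff)
      also have "3 * C2 * Cl * \<dots> \<le> 3 * C2 * Cl * x powr (- r)" using C2 Cl0 r0 by (intro mult_left_mono mono) auto
      finally show "C2 * \<Lambda> * lg N ^ (2 * k) * x powr (real k - 8 * r) / x powr (real k - 4 * r) \<le> 3 * C2 * Cl * x powr (- r)" .
    qed (use C2 ps lg0 \<Lambda>1 in auto)
    have T3: "(\<integral>\<^sup>+\<alpha>. ennreal (wt {2..k} \<alpha> * (hits k (onaxis k N) {0..\<Lambda>} \<alpha> / x powr (real k - 4 * r))) \<partial>?M) \<le> ennreal (9 * C3 * Cl * x powr (- r))"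
    proof (rule nn_integral_wt_divide)
      show "(\<integral>\<^sup>+\<alpha>. ennreal (wt {2..k} \<alpha> * hits k (onaxis k N) {0..\<Lambda>} \<alpha>) \<partial>?M) \<le> ennreal (C3 * \<Lambda>\<^sup>2 * lg N ^ (2 * k) * x powr (real k - 1))"
        unfolding x_def using N0 \<Lambda>1 by (intro C3(2)) auto
      have "C3 * \<Lambda>\<^sup>2 * lg N ^ (2 * k) * x powr (real k - 1) / x powr (real k - 4 * r) \<le> C3 * \<Lambda>\<^sup>2 * (Cl * x powr r) * x powr (real k - 1) / x powr (real k - 4 * r)"
        using lgl C3 \<Lambda>1 by (intro divide_right_mono mult_right_mono mult_left_mono) auto
      also have "\<dots> = 9 * C3 * Cl * (x powr r * x powr r * x powr r * x powr (real k - 1) / x powr (real k - 4 * r))" 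
        by (simp add: \<Lambda>_def power2_eq_square)
      also have "x powr r * x powr r * x powr r * x powr (real k - 1) / x powr (real k - 4 * r) = x powr (r + r + r + (real k - 1) - (real k - 4 * r))"
        by (simp only: powr_add powr_diff)
      also have "9 * C3 * Cl * \<dots> \<le> 9 * C3 * Cl * x powr (- r)" using C3 Cl0 re e1 by (intro mult_left_mono mono) auto
      finally show "C3 * \<Lambda>\<^sup>2 * lg N ^ (2 * k) * x powr (real k - 1) / x powr (real k - 4 * r) \<le> 9 * C3 * Cl * x powr (- r)" .
    qed (use C3 ps lg0 \<Lambda>1 in auto)
    have T4: "(\<integral>\<^sup>+\<alpha>. ennreal (wt {2..k} \<alpha> * (hits k (offaxis k N e) {0..L} \<alpha> / (L * x powr (real k - 4 * r)))) \<partial>?M) \<le> ennreal (C2 * Cl * x powr (- r))"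
    proof (rule nn_integral_wt_divide)
      have L0: "L > 0" using ps by (simp add: L_def)
      show "(\<integral>\<^sup>+\<alpha>. ennreal (wt {2..k} \<alpha> * hits k (offaxis k N e) {0..L} \<alpha>) \<partial>?M) \<le> ennreal (C2 * L * lg N ^ (2 * k) * x powr (real k - 8 * r))"
        unfolding x_def using N0 L0 by (intro C2(2)) auto
      have "C2 * L * lg N ^ (2 * k) * x powr (real k - 8 * r) / (L * x powr (real k - 4 * r)) \<le> C2 * L * (Cl * x powr r) * x powr (real k - 8 * r) / (L * x powr (real k - 4 * r))"
        using lgl C2 L0 by (intro divide_right_mono mult_right_mono mult_left_mono) auto
      also have "\<dots> = C2 * Cl * (x powr r * x powr (real k - 8 * r) / x powr (real k - 4 * r))" using L0 by simp
      also have "x powr r * x powr (real k - 8 * r) / x powr (real k - 4 * r) = x powr (r + (real k - 8 * r) - (real k - 4 * r))"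
        by (simp only: powr_add powr_diff)
      also have "C2 * Cl * \<dots> \<le> C2 * Cl * x powr (- r)" using C2 Cl0 r0 by (intro mult_left_mono mono) auto
      finally show "C2 * L * lg N ^ (2 * k) * x powr (real k - 8 * r) / (L * x powr (real k - 4 * r)) \<le> C2 * Cl * x powr (- r)" .
      show "0 < L * x powr (real k - 4 * r)" using L0 ps by simp
      show "0 \<le> C2 * L * lg N ^ (2 * k) * x powr (real k - 8 * r)" using L0 C2 lg0 by simp
    qed auto
    let ?J = "\<lambda>f. \<integral>\<^sup>+\<alpha>. ennreal (wt {2..k} \<alpha> * f \<alpha>) \<partial>?M"
    have "?J (deviation k N e r P) =
       ?J (\<lambda>\<alpha>. (\<Sum>l<cells N r. (hits k P (cell N r l) \<alpha> / x powr (- r) - hits k P {0..<L} \<alpha> / L)\<^sup>2) / x powr (2 * real k - 1 / 100))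
       + ?J (\<lambda>\<alpha>. hits k (offaxis k N e) {0..\<Lambda>} \<alpha> / x powr (real k - 4 * r))
       + ?J (\<lambda>\<alpha>. hits k (onaxis k N) {0..\<Lambda>} \<alpha> / x powr (real k - 4 * r))
       + ?J (\<lambda>\<alpha>. hits k (offaxis k N e) {0..L} \<alpha> / (L * x powr (real k - 4 * r)))"
      unfolding deviation_def x_def[symmetric] L_def[symmetric] \<Lambda>_def[symmetric]
      by (rule nn_integral_wt_add4, measurable, measurable, measurable, measurable)
        (auto intro!: divide_nonneg_nonneg sum_nonneg mult_nonneg_nonneg simp: L_def)
    also have "\<dots> \<le> ennreal (3 * C1 * x powr (- r)) + ennreal (3 * C2 * Cl * x powr (- r)) + ennreal (9 * C3 * Cl * x powr (- r)) + ennreal (C2 * Cl * x powr (- r))"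
      by (intro add_mono T1 T2 T3 T4)
    also have "\<dots> = ennreal (C * x powr (- r))"
      using C1 C2 C3 Cl0 by (simp add: C_def algebra_simps flip: ennreal_plus)
    finally show ?thesis by (simp add: x_def)
  qed
  then show ?thesis using C0 by blast
qed

section \<open>Equidistribution on the scale of a cell\<close>

text \<open>Union bound over the coinciding index, whose two-dimensional sum is N + 1 instead of (N
  + 1)^2.\<close>

lemma card_axis_le:
  "real (card {p \<in> box k N \<times> box k N. \<exists>i\<in>{1..k}. fst p i = snd p i}) \<le> real k * (real N + 1) ^ (2 * k - 1)"
proof -
  define f where "f i j a b = (if j = i \<and> a \<noteq> b then 0 else 1 :: real)" for i j a b :: nat
  have f0: "0 \<le> f i j a b" for i j a b by (simp add: f_def)
  have fin: "finite {p \<in> box k N \<times> box k N. \<exists>i\<in>{1..k}. fst p i = snd p i}" using finite_box by auto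
  have "real (card {p \<in> box k N \<times> box k N. \<exists>i\<in>{1..k}. fst p i = snd p i})
     = (\<Sum>p\<in>{p \<in> box k N \<times> box k N. \<exists>i\<in>{1..k}. fst p i = snd p i}. 1)" by simp
  also have "\<dots> \<le> (\<Sum>p\<in>{p \<in> box k N \<times> box k N. \<exists>i\<in>{1..k}. fst p i = snd p i}. \<Sum>i\<in>{1..k}. \<Prod>j\<in>{1..k}. f i j (fst p j) (snd p j))"
  proof (rule sum_mono)
    fix p assume "p \<in> {p \<in> box k N \<times> box k N. \<exists>i\<in>{1..k}. fst p i = snd p i}"
    then obtain i where i: "i \<in> {1..k}" "fst p i = snd p i" by auto
    have "(\<Prod>j\<in>{1..k}. f i j (fst p j) (snd p j)) = 1" using i by (intro prod.neutral) (auto simp: f_def)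
    moreover have "(\<Prod>j\<in>{1..k}. f i j (fst p j) (snd p j)) \<le> (\<Sum>i\<in>{1..k}. \<Prod>j\<in>{1..k}. f i j (fst p j) (snd p j))"
      by (rule member_le_sum[OF i(1), of "\<lambda>i. \<Prod>j\<in>{1..k}. f i j (fst p j) (snd p j)"]) (use f0 in \<open>auto intro: prod_nonneg\<close>)
    ultimately show "1 \<le> (\<Sum>i\<in>{1..k}. \<Prod>j\<in>{1..k}. f i j (fst p j) (snd p j))" by linarith
  qed
  also have "\<dots> \<le> (\<Sum>p\<in>box k N \<times> box k N. \<Sum>i\<in>{1..k}. \<Prod>j\<in>{1..k}. f i j (fst p j) (snd p j))"
    using finite_box f0 by (intro sum_mono2) (auto intro!: sum_nonneg prod_nonneg)
  also have "\<dots> = (\<Sum>i\<in>{1..k}. \<Sum>p\<in>box k N \<times> box k N. \<Prod>j\<in>{1..k}. f i j (fst p j) (snd p j))" by (rule sum.swap)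
  also have "\<dots> = (\<Sum>i\<in>{1..k}. \<Prod>j\<in>{1..k}. \<Sum>a\<le>N. \<Sum>b\<le>N. f i j a b)" by (intro sum.cong refl sum_box_prod)
  also have "\<dots> = (\<Sum>i\<in>{1..k}. (real N + 1) ^ (2 * k - 1))"
  proof (intro sum.cong refl)
    fix i assume i: "i \<in> {1..k}"
    have s: "(\<Sum>a\<le>N. \<Sum>b\<le>N. f i j a b) = (if j = i then real N + 1 else (real N + 1)\<^sup>2)" for j
    proof (cases "j = i")
      case True
      have "(\<Sum>b\<le>N. f i j a b) = 1" if "a \<le> N" for a
      proof -
        have "(\<Sum>b\<le>N. f i j a b) = (\<Sum>b\<le>N. if a = b then 1 else 0)" using True by (intro sum.cong) (auto simp: f_def)
        then show ?thesis using that by simp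
      qed
      then have "(\<Sum>a\<le>N. \<Sum>b\<le>N. f i j a b) = (\<Sum>a\<le>N. 1)" by (intro sum.cong) auto
      then show ?thesis using True by simp
    next
      case False
      then show ?thesis by (simp add: f_def power2_eq_square algebra_simps)
    qed
    have "(\<Prod>j\<in>{1..k}. \<Sum>a\<le>N. \<Sum>b\<le>N. f i j a b) = (real N + 1) * (\<Prod>j\<in>{1..k} - {i}. \<Sum>a\<le>N. \<Sum>b\<le>N. f i j a b)"
      using i by (subst prod.remove[of _ i]) (auto simp: s)
    also have "(\<Prod>j\<in>{1..k} - {i}. \<Sum>a\<le>N. \<Sum>b\<le>N. f i j a b) = (\<Prod>j\<in>{1..k} - {i}. (real N + 1)\<^sup>2)"
      by (intro prod.cong) (auto simp: s)
    also have "\<dots> = (real N + 1) ^ (2 * (k - 1))" using i by (simp add: power_mult card_Diff_subset)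
    also have "(real N + 1) * (real N + 1) ^ (2 * (k - 1)) = (real N + 1) ^ (2 * k - 1)"
    proof -
      have "2 * k - 1 = Suc (2 * (k - 1))" using i by auto
      then show ?thesis by simp
    qed
    finally show "(\<Prod>j\<in>{1..k}. \<Sum>a\<le>N. \<Sum>b\<le>N. f i j a b) = (real N + 1) ^ (2 * k - 1)" .
  qed
  finally show ?thesis by simp
qed

lemma lin_diff_diag: "fst p = snd p \<Longrightarrow> lin k (diff k p) \<alpha> = 0"
  by (simp add: lin_def diff_def)

lemma hits_mono:
  assumes "finite Q" "\<And>p. p \<in> P \<Longrightarrow> lin k (diff k p) \<alpha> \<in> I \<Longrightarrow> p \<in> Q \<and> lin k (diff k p) \<alpha> \<in> J" "finite P"
  shows "hits k P I \<alpha> \<le> hits k Q J \<alpha>"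
  unfolding hits_eq_card[OF assms(1)] hits_eq_card[OF assms(3)]
  using assms by (intro of_nat_mono card_mono) auto

text \<open>Passing from all pairs to good ones loses the \<open>offaxis\<close> pairs, bounded by
  hypothesis, and the O(N^(2k-1)) pairs with a coinciding entry. On this coarse scale the trivial
  count of the latter suffices, since N^(2k-1) = L * N powr (k - 1/2).\<close>

lemma hits_large_scale:
  fixes k N :: nat and \<alpha> :: "nat \<Rightarrow> real" and e r :: real
  assumes k: "k \<ge> 3" and \<alpha>: "\<And>i. i \<in> {2..k} \<Longrightarrow> 1 / 2 \<le> \<alpha> i \<and> \<alpha> i \<le> 1"
    and M: "M \<subseteq> lattice k \<alpha> (1 / 2 * real N ^ k)" and N: "N \<ge> 4"
  defines "L \<equiv> real N powr (real k - 1 / 2)" and "E1 \<equiv> (real k)\<^sup>2 * 2 ^ (k - 1)"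
    and "P \<equiv> good k N e \<inter> M \<times> box k N"
  assumes off: "hits k (offaxis k N e) {0..L} \<alpha> \<le> L * real N powr (real k - 4 * r)"
  shows "\<bar>hits k P {0..<L} \<alpha> / L - c k \<alpha> * real (card M)\<bar> \<le> real N powr (real k - 4 * r) +
     (real k * 2 ^ (2 * k - 1) + 2 ^ k * c k \<alpha> * E1 + (c k \<alpha> * (1 + E1))\<^sup>2) * real N powr (real k - 1 / 2)"
proof -
  define x where "x = real N"
  have x: "x \<ge> 4" using N by (simp add: x_def)
  have mono: "x powr a \<le> x powr b" if "a \<le> b" for a b using x that by (intro powr_mono) auto
  have ps: "0 < x powr a" for a using x by simp
  have c0: "c k \<alpha> > 0" using k \<alpha> by (intro solid_1_finite(2)) auto
  have L: "L = x powr (real k - 1 / 2)" by (simp add: L_def x_def)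
  have L0: "L > 0" using ps by (simp add: L)
  have xk: "x ^ k = x powr real k" using x by (intro powr_realpow[symmetric]) simp
  have xk1: "x ^ (k - 1) = x powr (real k - 1)" 
    using x k powr_realpow[of x "k - 1"] by (simp add: of_nat_diff)
  have LL: "L \<le> 1 / 2 * real N ^ k"
  proof -
    \<comment> \<open>N \<ge> 4 gives a square root of at least 2, and hence 2 * L \<le>
      N^k.\<close>
    have "2 * 2 \<le> x" using x by simp
    then have "2 \<le> x powr (1 / 2)" using real_le_rsqrt[of 2 x] x by (simp add: powr_half_sqrt)
    then have "2 * L \<le> x powr (1 / 2) * L" using L0 by (intro mult_right_mono) auto
    also have "\<dots> = x powr real k" unfolding L by (simp flip: powr_add)
    finally show ?thesis using xk by (simp add: x_def)
  qed
  have Msub: "M \<subseteq> box k N" using M lattice_subset_box[of k "1 / 2" \<alpha> "1 / 2 * real N ^ k" N] k \<alpha> by auto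
  have fM: "finite M" using Msub finite_box finite_subset by blast
  have cM: "real (card M) \<le> 2 ^ k * x ^ k"
  proof -
    have "real (card M) \<le> real ((N + 1) ^ k)" using card_mono[OF finite_box Msub] by (simp only: card_box of_nat_le_iff)
    also have "\<dots> = (x + 1) ^ k" by (simp add: x_def add.commute)
    also have "\<dots> \<le> (2 * x) ^ k" using x by (intro power_mono) auto
    finally show ?thesis by (simp add: power_mult_distrib)
  qed
  define S where "S = M \<times> box k N"
  have fS: "finite S" using fM finite_box by (simp add: S_def)
  have SP: "S \<subseteq> box k N \<times> box k N" using Msub by (auto simp: S_def)
  have fP: "finite P" by (simp add: P_def finite_good)
  \<comment> \<open>This includes the diagonal m = n, whose difference 0 does lie in [0, L).\<close>
  define A where "A = {p \<in> box k N \<times> box k N. \<exists>i\<in>{1..k}. fst p i = snd p i}"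
  have fA: "finite A" using finite_box by (auto simp: A_def)
  have tot: "hits k S {0..<L} \<alpha> = (\<Sum>m\<in>M. real (card {n \<in> box k N. F k \<alpha> (\<lambda>i. real (m i)) - F k \<alpha> (\<lambda>i. real (n i)) \<in> {0..<L}}))"
  proof -
    have "{p \<in> S. lin k (diff k p) \<alpha> \<in> {0..<L}} = (SIGMA m:M. {n \<in> box k N. F k \<alpha> (\<lambda>i. real (m i)) - F k \<alpha> (\<lambda>i. real (n i)) \<in> {0..<L}})"
      unfolding F_diff_eq_lin S_def by auto
    then show ?thesis using fS fM finite_box by (simp add: hits_eq_card card_SigmaI del: atLeastLessThan_iff)
  qed
  have E: "(real k)\<^sup>2 * (real N + 1) ^ (k - 1) \<le> E1 * x powr (real k - 1)"
  proof -
    have "(real N + 1) ^ (k - 1) \<le> (2 * x) ^ (k - 1)" using x by (intro power_mono) (auto simp: x_def)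
    also have "\<dots> = 2 ^ (k - 1) * x powr (real k - 1)" by (simp only: power_mult_distrib xk1)
    finally show ?thesis by (simp add: E1_def mult.assoc mult_left_mono)
  qed
  have E2: "x powr (real k - 1) \<le> L" unfolding L by (intro mono) simp
  have E10: "E1 \<ge> 0" by (simp add: E1_def)
  have "\<bar>hits k S {0..<L} \<alpha> - real (card M) * (c k \<alpha> * L)\<bar> \<le> real (card M) * (c k \<alpha> * ((real k)\<^sup>2 * (real N + 1) ^ (k - 1)))
     + (c k \<alpha> * (L + (real k)\<^sup>2 * (real N + 1) ^ (k - 1)))\<^sup>2"
    unfolding tot using k \<alpha> M L0 LL by (intro pair_count_large_scale) auto
  also have "\<dots> \<le> (2 ^ k * x ^ k) * (c k \<alpha> * (E1 * x powr (real k - 1))) + (c k \<alpha> * (L + E1 * L))\<^sup>2"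
  proof (rule add_mono)
    show "real (card M) * (c k \<alpha> * ((real k)\<^sup>2 * (real N + 1) ^ (k - 1))) \<le> (2 ^ k * x ^ k) * (c k \<alpha> * (E1 * x powr (real k - 1)))"
      using c0 x by (intro mult_mono[OF cM mult_left_mono[OF E]]) auto
    have "L + (real k)\<^sup>2 * (real N + 1) ^ (k - 1) \<le> L + E1 * L"
      using E mult_left_mono[OF E2 E10] by linarith
    then show "(c k \<alpha> * (L + (real k)\<^sup>2 * (real N + 1) ^ (k - 1)))\<^sup>2 \<le> (c k \<alpha> * (L + E1 * L))\<^sup>2"
      using c0 L0 by (intro power_mono mult_left_mono) (auto intro!: mult_nonneg_nonneg add_nonneg_nonneg)
  qed
  also have "\<dots> = L * (2 ^ k * c k \<alpha> * E1 * x powr (real k - 1 / 2) + (c k \<alpha> * (1 + E1))\<^sup>2 * x powr (real k - 1 / 2))"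
  proof -
    have "x ^ k * x powr (real k - 1) = L * x powr (real k - 1 / 2)"
      unfolding xk L powr_add[symmetric] by (rule arg_cong[where f = "\<lambda>a. x powr a"]) simp
    moreover have "(2 ^ k * x ^ k) * (c k \<alpha> * (E1 * x powr (real k - 1))) = 2 ^ k * c k \<alpha> * E1 * (x ^ k * x powr (real k - 1))" by simp
    moreover have "(c k \<alpha> * (L + E1 * L))\<^sup>2 = (c k \<alpha> * (1 + E1))\<^sup>2 * (L * L)" by (simp add: power2_eq_square algebra_simps)
    ultimately show ?thesis unfolding L by (simp add: algebra_simps)
  qed
  finally have 1: "\<bar>hits k S {0..<L} \<alpha> - real (card M) * (c k \<alpha> * L)\<bar> \<le> 
     L * (2 ^ k * c k \<alpha> * E1 * x powr (real k - 1 / 2) + (c k \<alpha> * (1 + E1))\<^sup>2 * x powr (real k - 1 / 2))" .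
  have le: "hits k P {0..<L} \<alpha> \<le> hits k S {0..<L} \<alpha>"
    using fS fP by (intro hits_mono) (auto simp: P_def S_def)
  have ge: "hits k S {0..<L} \<alpha> \<le> hits k P {0..<L} \<alpha> + hits k (offaxis k N e) {0..L} \<alpha> + real (card A)"
  proof -
    have "{p \<in> S. lin k (diff k p) \<alpha> \<in> {0..<L}} \<subseteq> {p \<in> P. lin k (diff k p) \<alpha> \<in> {0..<L}} \<union> ({p \<in> offaxis k N e. lin k (diff k p) \<alpha> \<in> {0..L}} \<union> A)"
      using SP by (auto simp: P_def S_def offaxis_def A_def)
    then have "card {p \<in> S. lin k (diff k p) \<alpha> \<in> {0..<L}} \<le> card ({p \<in> P. lin k (diff k p) \<alpha> \<in> {0..<L}} \<union> ({p \<in> offaxis k N e. lin k (diff k p) \<alpha> \<in> {0..L}} \<union> A))"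
      using fP fA finite_offaxis by (intro card_mono) auto
    also have "\<dots> \<le> card {p \<in> P. lin k (diff k p) \<alpha> \<in> {0..<L}} + (card {p \<in> offaxis k N e. lin k (diff k p) \<alpha> \<in> {0..L}} + card A)"
      by (meson add_left_mono card_Un_le order_trans)
    finally show ?thesis using fS fP finite_offaxis by (simp add: hits_eq_card del: atLeastLessThan_iff atLeastAtMost_iff)
  qed
  have Ab: "real (card A) \<le> L * (real k * 2 ^ (2 * k - 1) * x powr (real k - 1 / 2))"
  proof -
    have "real (card A) \<le> real k * (real N + 1) ^ (2 * k - 1)" unfolding A_def by (rule card_axis_le)
    also have "\<dots> \<le> real k * (2 * x) ^ (2 * k - 1)" using x by (intro mult_left_mono power_mono) (auto simp: x_def)
    also have "\<dots> = real k * 2 ^ (2 * k - 1) * x ^ (2 * k - 1)" by (simp add: power_mult_distrib)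
    also have "x ^ (2 * k - 1) = x powr (2 * real k - 1)"
      using x k powr_realpow[of x "2 * k - 1"] by (simp add: of_nat_diff)
    also have "\<dots> = L * x powr (real k - 1 / 2)"
      unfolding L powr_add[symmetric] by (rule arg_cong[where f = "\<lambda>a. x powr a"]) simp
    finally show ?thesis by (simp add: mult_ac)
  qed
  have "\<bar>hits k P {0..<L} \<alpha> - L * (c k \<alpha> * real (card M))\<bar> \<le> L * (2 ^ k * c k \<alpha> * E1 * x powr (real k - 1 / 2) + (c k \<alpha> * (1 + E1))\<^sup>2 * x powr (real k - 1 / 2))
     + L * x powr (real k - 4 * r) + L * (real k * 2 ^ (2 * k - 1) * x powr (real k - 1 / 2))"
  proof -
    have "real (card M) * (c k \<alpha> * L) = L * (c k \<alpha> * real (card M))" by simp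
    then show ?thesis using 1 le ge Ab off unfolding x_def[symmetric] by linarith
  qed
  also have "\<dots> = L * (x powr (real k - 4 * r) +
     (real k * 2 ^ (2 * k - 1) + 2 ^ k * c k \<alpha> * E1 + (c k \<alpha> * (1 + E1))\<^sup>2) * x powr (real k - 1 / 2))"
    by (simp add: algebra_simps)
  finally have "\<bar>hits k P {0..<L} \<alpha> - L * (c k \<alpha> * real (card M))\<bar> / L \<le> x powr (real k - 4 * r) +
     (real k * 2 ^ (2 * k - 1) + 2 ^ k * c k \<alpha> * E1 + (c k \<alpha> * (1 + E1))\<^sup>2) * x powr (real k - 1 / 2)"
    using L0 by (simp add: pos_divide_le_eq mult.commute)
  moreover have "\<bar>hits k P {0..<L} \<alpha> - L * (c k \<alpha> * real (card M))\<bar> / L = \<bar>hits k P {0..<L} \<alpha> / L - c k \<alpha> * real (card M)\<bar>"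
  proof -
    have "(hits k P {0..<L} \<alpha> - L * (c k \<alpha> * real (card M))) / L = hits k P {0..<L} \<alpha> / L - c k \<alpha> * real (card M)"
      using L0 by (simp add: diff_divide_distrib)
    then show ?thesis using L0 by (metis abs_divide abs_of_pos)
  qed
  ultimately show ?thesis by (simp add: x_def)
qed

text \<open>The interval lies in the union of the cells l1..l2 and contains those strictly in
  between; both unions have length within 2 * s of b - a. The condition 2 * s \<le> b - a ensures l1
  < l2.\<close>

lemma hits_interval:
  fixes k :: nat and a b s G \<delta> :: real
  assumes "finite P" and s: "0 < s" "2 * s \<le> b - a" and a: "0 < a" and G: "0 \<le> G" "0 \<le> \<delta>"
    and cells: "\<And>l. real l * s \<le> b \<Longrightarrow> \<bar>hits k P {real l * s..<(real l + 1) * s} \<alpha> / s - G\<bar> \<le> \<delta>"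
  shows "\<bar>hits k P {a..b} \<alpha> - (b - a) * G\<bar> \<le> 2 * s * G + (b - a + 2 * s) * \<delta>"
proof -
  define D where "D p = lin k (diff k p) \<alpha>" for p
  define C where "C l = {p \<in> P. D p \<in> {real l * s..<(real l + 1) * s}}" for l :: nat
  have fC: "finite (C l)" for l using assms(1) by (simp add: C_def)
  have hC: "real (card (C l)) = hits k P {real l * s..<(real l + 1) * s} \<alpha>" for l
    using assms(1) by (simp add: hits_eq_card C_def D_def del: atLeastLessThan_iff)
  have disj: "C l \<inter> C l' = {}" if "l \<noteq> l'" for l l'
  proof (rule ccontr)
    assume "C l \<inter> C l' \<noteq> {}"
    then obtain p where p: "real l * s \<le> D p" "D p < (real l + 1) * s" "real l' * s \<le> D p" "D p < (real l' + 1) * s"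
      by (auto simp: C_def)
    then have "real l * s < (real l' + 1) * s" "real l' * s < (real l + 1) * s" by linarith+
    then have "real l < real l' + 1" "real l' < real l + 1" using s by simp_all
    then show False using that by simp
  qed
  have b: "0 < b" using s a by linarith
  define l1 where "l1 = nat \<lfloor>a / s\<rfloor>"
  define l2 where "l2 = nat \<lfloor>b / s\<rfloor>"
  have fl: "real (nat \<lfloor>z / s\<rfloor>) * s \<le> z \<and> z < (real (nat \<lfloor>z / s\<rfloor>) + 1) * s" if "0 \<le> z" for z
  proof -
    have "0 \<le> z / s" using that s by simp
    then have "real (nat \<lfloor>z / s\<rfloor>) \<le> z / s" "z / s < real (nat \<lfloor>z / s\<rfloor>) + 1" by linarith+
    then show ?thesis using s by (simp add: pos_le_divide_eq pos_divide_less_eq)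
  qed
  have l1: "real l1 * s \<le> a" "a < (real l1 + 1) * s" using fl[of a] a by (auto simp: l1_def)
  have l2: "real l2 * s \<le> b" "b < (real l2 + 1) * s" using fl[of b] b by (auto simp: l2_def)
  have l12: "l1 + 1 \<le> l2"
  proof -
    have "(real l1 + 1) * s \<le> a + s" using l1 by (simp add: algebra_simps)
    also have "\<dots> \<le> b - s" using s by simp
    also have "\<dots> < real l2 * s" using l2(2) by (simp add: algebra_simps)
    finally have "real l1 + 1 < real l2" using s by simp
    then show ?thesis by linarith
  qed
  have cl: "s * (G - \<delta>) \<le> real (card (C l))" "real (card (C l)) \<le> s * (G + \<delta>)" if "real l * s \<le> b" for l
  proof -
    have "real (card (C l)) / s \<le> G + \<delta>" "G - \<delta> \<le> real (card (C l)) / s"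
      using cells[OF that] unfolding hC by linarith+
    then show "s * (G - \<delta>) \<le> real (card (C l))" "real (card (C l)) \<le> s * (G + \<delta>)"
      using s by (simp_all add: field_simps)
  qed
  have up: "hits k P {a..b} \<alpha> \<le> (b - a + 2 * s) * (G + \<delta>)"
  proof -
    have "{p \<in> P. D p \<in> {a..b}} \<subseteq> (\<Union>l\<in>{l1..l2}. C l)"
    proof
      fix p assume p: "p \<in> {p \<in> P. D p \<in> {a..b}}"
      define l where "l = nat \<lfloor>D p / s\<rfloor>"
      have "0 \<le> D p" using p a by auto
      then have l: "real l * s \<le> D p" "D p < (real l + 1) * s" using fl[of "D p"] by (auto simp: l_def)
      have "l1 \<le> l" unfolding l1_def l_def using p s by (intro nat_mono floor_mono divide_right_mono) auto
      moreover have "l \<le> l2" unfolding l2_def l_def using p s by (intro nat_mono floor_mono divide_right_mono) auto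
      ultimately show "p \<in> (\<Union>l\<in>{l1..l2}. C l)" using p l by (auto simp: C_def)
    qed
    then have "card {p \<in> P. D p \<in> {a..b}} \<le> card (\<Union>l\<in>{l1..l2}. C l)" using fC by (intro card_mono) auto
    also have "\<dots> \<le> (\<Sum>l\<in>{l1..l2}. card (C l))" by (rule card_UN_le) simp
    finally have "real (card {p \<in> P. D p \<in> {a..b}}) \<le> (\<Sum>l\<in>{l1..l2}. real (card (C l)))" by (rule real_le_sum_nat)
    also have "\<dots> \<le> (\<Sum>l\<in>{l1..l2}. s * (G + \<delta>))"
    proof (intro sum_mono cl)
      fix l assume "l \<in> {l1..l2}"
      then have "real l * s \<le> real l2 * s" using s by (intro mult_right_mono) auto
      then show "real l * s \<le> b" using l2 by linarith
    qed
    also have "\<dots> = (real l2 - real l1 + 1) * s * (G + \<delta>)" using l12 by (simp add: of_nat_diff)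
    also have "\<dots> \<le> (b - a + 2 * s) * (G + \<delta>)"
      using l1 l2 G by (intro mult_right_mono) (auto simp: algebra_simps)
    finally show ?thesis using assms(1) by (simp add: hits_eq_card D_def del: atLeastAtMost_iff)
  qed
  have lo: "(b - a - 2 * s) * G - (b - a) * \<delta> \<le> hits k P {a..b} \<alpha>"
  proof -
    have sub: "(\<Union>l\<in>{l1 + 1..<l2}. C l) \<subseteq> {p \<in> P. D p \<in> {a..b}}"
    proof
      fix p assume "p \<in> (\<Union>l\<in>{l1 + 1..<l2}. C l)"
      then obtain l where l: "l1 + 1 \<le> l" "l + 1 \<le> l2" "p \<in> P" "real l * s \<le> D p" "D p < (real l + 1) * s" by (auto simp: C_def)
      have "(real l1 + 1) * s \<le> real l * s" using l s by (intro mult_right_mono) auto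
      moreover have "(real l + 1) * s \<le> real l2 * s" using l s by (intro mult_right_mono) auto
      ultimately show "p \<in> {p \<in> P. D p \<in> {a..b}}" using l l1 l2 by auto
    qed
    define n where "n = real l2 - real l1 - 1"
    have "n * s = real l2 * s - (real l1 + 1) * s" by (simp add: n_def algebra_simps)
    moreover have "(real l1 + 1) * s = real l1 * s + s" "(real l2 + 1) * s = real l2 * s + s"
      by (simp_all add: algebra_simps)
    ultimately have n: "b - a - 2 * s \<le> n * s" "n * s \<le> b - a" using l1 l2 by linarith+
    have "(b - a - 2 * s) * G - (b - a) * \<delta> \<le> n * s * G - n * s * \<delta>"
      using n G by (intro diff_mono mult_right_mono) auto
    also have "\<dots> = (\<Sum>l\<in>{l1 + 1..<l2}. s * (G - \<delta>))" using l12 by (simp add: n_def of_nat_diff algebra_simps)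
    also have "\<dots> \<le> (\<Sum>l\<in>{l1 + 1..<l2}. real (card (C l)))"
    proof (intro sum_mono cl)
      fix l assume "l \<in> {l1 + 1..<l2}"
      then have "real l * s \<le> real l2 * s" using s by (intro mult_right_mono) auto
      then show "real l * s \<le> b" using l2 by linarith
    qed
    also have "\<dots> = real (card (\<Union>l\<in>{l1 + 1..<l2}. C l))"
      using fC disj by (subst card_UN_disjoint) auto
    also have "\<dots> \<le> real (card {p \<in> P. D p \<in> {a..b}})"
      using sub assms(1) by (intro of_nat_mono card_mono) auto
    finally show ?thesis using assms(1) by (simp add: hits_eq_card D_def del: atLeastAtMost_iff)
  qed
  have "0 \<le> 2 * s * \<delta>" using s G by simp
  then have "(b - a) * G - hits k P {a..b} \<alpha> \<le> 2 * s * G + (b - a + 2 * s) * \<delta>"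
    using lo by (simp add: algebra_simps)
  moreover have "hits k P {a..b} \<alpha> - (b - a) * G \<le> 2 * s * G + (b - a + 2 * s) * \<delta>"
    using up by (simp add: algebra_simps)
  ultimately show ?thesis by (simp only: abs_le_iff minus_diff_eq)
qed

text \<open>All errors are measured against (b - a) * N powr (k - r/2). As b - a \<ge> N powr
  (-r/4), this absorbs the two boundary cells, of length N powr (-r) and density O(N^k), the N powr
  (k - 4r) degenerate pairs, and b - a times the discrepancies of the densities, N powr (k - 1/200)
  for a cell and O(N powr (k - 4r)) for the coarse scale.\<close>

lemma hits_equidistributed:
  fixes k :: nat and \<alpha> :: "nat \<Rightarrow> real" and e r :: real
  assumes k: "k \<ge> 3" and \<alpha>: "\<And>i. i \<in> {2..k} \<Longrightarrow> 1 / 2 \<le> \<alpha> i \<and> \<alpha> i \<le> 1" and r: "0 < r" "r \<le> 1 / 100"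
  shows "\<exists>K>0. \<exists>N0. \<forall>N M a b. N \<ge> N0 \<longrightarrow> M \<subseteq> lattice k \<alpha> (1 / 2 * real N ^ k) \<longrightarrow>
     deviation k N e r (good k N e \<inter> M \<times> box k N) \<alpha> \<le> 1 \<longrightarrow> 0 < a \<longrightarrow> b \<le> real N powr r \<longrightarrow> real N powr (- (r / 4)) \<le> b - a \<longrightarrow>
     \<bar>hits k (M \<times> box k N) {a..b} \<alpha> - (b - a) * (c k \<alpha> * real (card M))\<bar> \<le> K * ((b - a) * real N powr (real k - r / 2))"
proof -
  define E1 where "E1 = (real k)\<^sup>2 * 2 ^ (k - 1)"
  define K1 where "K1 = real k * 2 ^ (2 * k - 1) + 2 ^ k * c k \<alpha> * E1 + (c k \<alpha> * (1 + E1))\<^sup>2"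
  define K2 where "K2 = 1 + K1"
  define K3 where "K3 = 2 ^ k * c k \<alpha> + K2"
  define K where "K = K2 + 2 * K3 + 4"
  have c0: "c k \<alpha> > 0" using k \<alpha> by (intro solid_1_finite(2)) auto
  have E10: "E1 \<ge> 0" by (simp add: E1_def)
  have K0: "K1 \<ge> 0" "K2 \<ge> 0" "K3 \<ge> 0" "K > 0" using c0 E10 by (auto simp: K1_def K2_def K3_def K_def intro!: add_nonneg_nonneg add_nonneg_pos)
  \<comment> \<open>Makes 2 \<le> N powr (3r/4), so that two cell lengths fit into the interval: 2 *
    s \<le> N powr (-r/4) \<le> b - a.\<close>
  define N0 where "N0 = 4 + nat \<lceil>2 powr (4 / (3 * r))\<rceil>"
  have "\<bar>hits k (M \<times> box k N) {a..b} \<alpha> - (b - a) * (c k \<alpha> * real (card M))\<bar> \<le> K * ((b - a) * real N powr (real k - r / 2))"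
    if N: "N \<ge> N0" and M: "M \<subseteq> lattice k \<alpha> (1 / 2 * real N ^ k)" and dev: "deviation k N e r (good k N e \<inter> M \<times> box k N) \<alpha> \<le> 1"
      and ab: "0 < a" "b \<le> real N powr r" "real N powr (- (r / 4)) \<le> b - a" for N M a b
  proof -
    define x where "x = real N"
    have x2: "2 powr (4 / (3 * r)) \<le> x" and N4: "N \<ge> 4" using N unfolding N0_def x_def by linarith+
    have x: "x \<ge> 4" using N4 by (simp add: x_def)
    have mono: "x powr a \<le> x powr b" if "a \<le> b" for a b using x that by (intro powr_mono) auto
    have ps: "0 < x powr a" for a using x by simp
    define L where "L = x powr (real k - 1 / 2)"
    define s where "s = x powr (- r)"
    define P where "P = good k N e \<inter> M \<times> box k N"
    define G where "G = hits k P {0..<L} \<alpha> / L"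
    define \<Delta> where "\<Delta> = b - a"
    have L0: "L > 0" "s > 0" using ps by (auto simp: L_def s_def)
    have fP: "finite P" by (simp add: P_def finite_good)
    have G0: "G \<ge> 0" using L0 by (simp add: G_def)
    define X where "X l = hits k P (cell N r l) \<alpha> / s - G" for l
    have dv: "(\<Sum>l<cells N r. (X l)\<^sup>2) / x powr (2 * real k - 1 / 100)
     + hits k (offaxis k N e) {0..3 * x powr r} \<alpha> / x powr (real k - 4 * r)
     + hits k (onaxis k N) {0..3 * x powr r} \<alpha> / x powr (real k - 4 * r)
     + hits k (offaxis k N e) {0..L} \<alpha> / (L * x powr (real k - 4 * r)) \<le> 1"
      using dev unfolding deviation_def X_def G_def P_def L_def s_def x_def .
    have nn: "0 \<le> (\<Sum>l<cells N r. (X l)\<^sup>2) / x powr (2 * real k - 1 / 100)" "0 \<le> hits k (offaxis k N e) {0..3 * x powr r} \<alpha> / x powr (real k - 4 * r)"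
      "0 \<le> hits k (onaxis k N) {0..3 * x powr r} \<alpha> / x powr (real k - 4 * r)" "0 \<le> hits k (offaxis k N e) {0..L} \<alpha> / (L * x powr (real k - 4 * r))"
      using L0 by (auto intro!: divide_nonneg_nonneg sum_nonneg mult_nonneg_nonneg)
    have "(\<Sum>l<cells N r. (X l)\<^sup>2) / x powr (2 * real k - 1 / 100) \<le> 1" "hits k (offaxis k N e) {0..3 * x powr r} \<alpha> / x powr (real k - 4 * r) \<le> 1"
      "hits k (onaxis k N) {0..3 * x powr r} \<alpha> / x powr (real k - 4 * r) \<le> 1" "hits k (offaxis k N e) {0..L} \<alpha> / (L * x powr (real k - 4 * r)) \<le> 1"
      using dv nn by linarith+
    then have d1: "(\<Sum>l<cells N r. (X l)\<^sup>2) \<le> x powr (2 * real k - 1 / 100)" and d2: "hits k (offaxis k N e) {0..3 * x powr r} \<alpha> \<le> x powr (real k - 4 * r)"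
      and d3: "hits k (onaxis k N) {0..3 * x powr r} \<alpha> \<le> x powr (real k - 4 * r)" and d4: "hits k (offaxis k N e) {0..L} \<alpha> \<le> L * x powr (real k - 4 * r)"
      using ps L0 by (simp_all add: divide_le_eq)
    \<comment> \<open>Square root of the bound for the whole sum of squares, which holds for every
      single cell.\<close>
    define \<delta> where "\<delta> = x powr (real k - 1 / 200)"
    have X: "\<bar>X l\<bar> \<le> \<delta>" if "l < cells N r" for l
    proof -
      have "(X l)\<^sup>2 \<le> (\<Sum>l<cells N r. (X l)\<^sup>2)" using that by (intro member_le_sum) auto
      also have "\<dots> \<le> x powr (2 * real k - 1 / 100)" by (rule d1)
      also have "\<dots> = \<delta>\<^sup>2" unfolding \<delta>_def power2_eq_square powr_add[symmetric] by (rule arg_cong[where f = "\<lambda>a. x powr a"]) simp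
      finally show ?thesis using ps[of "real k - 1 / 200"] abs_le_square_iff[of "X l" \<delta>] by (simp add: \<delta>_def)
    qed
    have GM: "\<bar>G - c k \<alpha> * real (card M)\<bar> \<le> K2 * x powr (real k - 4 * r)"
    proof -
      have "\<bar>G - c k \<alpha> * real (card M)\<bar> \<le> x powr (real k - 4 * r) + K1 * x powr (real k - 1 / 2)"
        unfolding G_def K1_def E1_def P_def L_def x_def
        using k \<alpha> M N4 d4 by (intro hits_large_scale) (auto simp: L_def x_def)
      also have "K1 * x powr (real k - 1 / 2) \<le> K1 * x powr (real k - 4 * r)"
        using K0 r by (intro mult_left_mono mono) auto
      finally show ?thesis by (simp add: K2_def algebra_simps)
    qed
    have Msub: "M \<subseteq> box k N" using M lattice_subset_box[of k "1 / 2" \<alpha> "1 / 2 * real N ^ k" N] k \<alpha> by auto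
    have fM: "finite M" using Msub finite_box finite_subset by blast
    have cM: "real (card M) \<le> 2 ^ k * x powr real k"
    proof -
      have "real (card M) \<le> real ((N + 1) ^ k)" using card_mono[OF finite_box Msub] by (simp only: card_box of_nat_le_iff)
      also have "\<dots> = (x + 1) ^ k" by (simp add: x_def add.commute)
      also have "\<dots> \<le> (2 * x) ^ k" using x by (intro power_mono) auto
      also have "\<dots> = 2 ^ k * x powr real k" using x by (simp add: power_mult_distrib powr_realpow)
      finally show ?thesis .
    qed
    have GK: "G \<le> K3 * x powr real k"
    proof -
      have "c k \<alpha> * real (card M) \<le> c k \<alpha> * (2 ^ k * x powr real k)" using c0 cM by (intro mult_left_mono) auto
      moreover have "K2 * x powr (real k - 4 * r) \<le> K2 * x powr real k" using K0 r by (intro mult_left_mono mono) auto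
      ultimately have "G \<le> c k \<alpha> * (2 ^ k * x powr real k) + K2 * x powr real k" using GM by linarith
      then show ?thesis by (simp add: K3_def algebra_simps)
    qed
    have \<Delta>: "x powr (- (r / 4)) \<le> \<Delta>" using ab by (simp add: \<Delta>_def x_def)
    then have \<Delta>0: "\<Delta> > 0" using ps[of "- (r / 4)"] by linarith
    have s\<Delta>: "s \<le> \<Delta> * x powr (- (r / 2))"
    proof -
      have "s = x powr (- (r / 4)) * x powr (- (3 * r / 4))" unfolding s_def powr_add[symmetric] by (rule arg_cong[where f = "\<lambda>a. x powr a"]) simp
      also have "\<dots> \<le> \<Delta> * x powr (- (r / 2))" using \<Delta> \<Delta>0 r by (intro mult_mono mono) auto
      finally show ?thesis .
    qed
    have s2: "2 * s \<le> \<Delta>"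
    proof -
      have "(2 powr (4 / (3 * r))) powr (3 * r / 4) \<le> x powr (3 * r / 4)" using x2 r by (intro powr_mono2) auto
      then have "2 \<le> x powr (3 * r / 4)" using r by (simp add: powr_powr)
      then have "2 * s \<le> x powr (3 * r / 4) * s" using L0 by (intro mult_right_mono) auto
      also have "\<dots> = x powr (- (r / 4))" unfolding s_def powr_add[symmetric] by (rule arg_cong[where f = "\<lambda>a. x powr a"]) simp
      finally show ?thesis using \<Delta> by linarith
    qed
    have main: "\<bar>hits k P {a..b} \<alpha> - \<Delta> * G\<bar> \<le> 2 * s * G + (\<Delta> + 2 * s) * \<delta>"
      unfolding \<Delta>_def
    proof (rule hits_interval[OF fP L0(2) s2[unfolded \<Delta>_def] ab(1) G0])
      show "0 \<le> \<delta>" by (simp add: \<delta>_def)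
      fix l assume l: "real l * s \<le> b"
      have "real l \<le> b / s" using l L0 by (simp add: pos_le_divide_eq)
      also have "\<dots> \<le> x powr r / s" using ab(2) L0 by (intro divide_right_mono) (auto simp: x_def)
      also have "\<dots> = x powr (2 * r)" unfolding s_def by (simp flip: powr_diff)
      finally have "l < cells N r" unfolding cells_def x_def by linarith
      then show "\<bar>hits k P {real l * s..<(real l + 1) * s} \<alpha> / s - G\<bar> \<le> \<delta>"
        using X[of l] unfolding X_def cell_def s_def x_def by simp
    qed
    define S where "S = M \<times> box k N"
    have fS: "finite S" using fM finite_box by (simp add: S_def)
    have lo: "hits k P {a..b} \<alpha> \<le> hits k S {a..b} \<alpha>" using fS fP by (intro hits_mono) (auto simp: P_def S_def)
    have up: "hits k S {a..b} \<alpha> \<le> hits k P {a..b} \<alpha> + hits k (offaxis k N e) {0..3 * x powr r} \<alpha> + hits k (onaxis k N) {0..3 * x powr r} \<alpha>"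
    proof -
      have b3: "b \<le> 3 * x powr r" using ab(2) ps[of r] unfolding x_def by linarith
      have "{p \<in> S. lin k (diff k p) \<alpha> \<in> {a..b}} \<subseteq> {p \<in> P. lin k (diff k p) \<alpha> \<in> {a..b}} \<union>
        ({p \<in> offaxis k N e. lin k (diff k p) \<alpha> \<in> {0..3 * x powr r}} \<union> {p \<in> onaxis k N. lin k (diff k p) \<alpha> \<in> {0..3 * x powr r}})"
      proof
        fix p assume p: "p \<in> {p \<in> S. lin k (diff k p) \<alpha> \<in> {a..b}}"
        \<comment> \<open>Since a > 0 the diagonal does not occur, so \<open>good\<close>,
          \<open>offaxis\<close> and \<open>onaxis\<close> cover everything.\<close>
        have ne: "fst p \<noteq> snd p" using lin_diff_diag[of p k \<alpha>] p ab(1) by auto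
        have bb: "p \<in> box k N \<times> box k N" using p Msub by (auto simp: S_def)
        have I: "lin k (diff k p) \<alpha> \<in> {0..3 * x powr r}" using p ab(1) b3 by auto
        show "p \<in> {p \<in> P. lin k (diff k p) \<alpha> \<in> {a..b}} \<union>
          ({p \<in> offaxis k N e. lin k (diff k p) \<alpha> \<in> {0..3 * x powr r}} \<union> {p \<in> onaxis k N. lin k (diff k p) \<alpha> \<in> {0..3 * x powr r}})"
          using p ne bb I unfolding P_def offaxis_def onaxis_def S_def by blast
      qed
      then have "card {p \<in> S. lin k (diff k p) \<alpha> \<in> {a..b}} \<le> card ({p \<in> P. lin k (diff k p) \<alpha> \<in> {a..b}} \<union>
        ({p \<in> offaxis k N e. lin k (diff k p) \<alpha> \<in> {0..3 * x powr r}} \<union> {p \<in> onaxis k N. lin k (diff k p) \<alpha> \<in> {0..3 * x powr r}}))"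
        using fP finite_offaxis finite_onaxis by (intro card_mono) auto
      also have "\<dots> \<le> card {p \<in> P. lin k (diff k p) \<alpha> \<in> {a..b}} +
        (card {p \<in> offaxis k N e. lin k (diff k p) \<alpha> \<in> {0..3 * x powr r}} + card {p \<in> onaxis k N. lin k (diff k p) \<alpha> \<in> {0..3 * x powr r}})"
        by (meson add_left_mono card_Un_le order_trans)
      finally show ?thesis using fS fP finite_offaxis finite_onaxis by (simp add: hits_eq_card del: atLeastAtMost_iff)
    qed
    define Z where "Z = \<Delta> * x powr (real k - r / 2)"
    have b1: "\<bar>\<Delta> * G - \<Delta> * (c k \<alpha> * real (card M))\<bar> \<le> K2 * Z"
    proof -
      have "\<bar>\<Delta> * G - \<Delta> * (c k \<alpha> * real (card M))\<bar> = \<Delta> * \<bar>G - c k \<alpha> * real (card M)\<bar>"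
        using \<Delta>0 by (simp add: abs_mult flip: right_diff_distrib)
      also have "\<dots> \<le> \<Delta> * (K2 * x powr (real k - r / 2))"
      proof (rule mult_left_mono)
        have "K2 * x powr (real k - 4 * r) \<le> K2 * x powr (real k - r / 2)" using K0 r by (intro mult_left_mono mono) auto
        then show "\<bar>G - c k \<alpha> * real (card M)\<bar> \<le> K2 * x powr (real k - r / 2)" using GM by linarith
      qed (use \<Delta>0 in auto)
      finally show ?thesis by (simp add: Z_def mult_ac)
    qed
    have b2: "2 * s * G \<le> 2 * K3 * Z"
    proof -
      have "s * G \<le> (\<Delta> * x powr (- (r / 2))) * (K3 * x powr real k)" using s\<Delta> GK G0 L0 \<Delta>0 by (intro mult_mono) auto
      also have "\<dots> = K3 * (\<Delta> * (x powr (- (r / 2)) * x powr real k))" by simp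
      also have "x powr (- (r / 2)) * x powr real k = x powr (real k - r / 2)" by (simp flip: powr_add)
      finally show ?thesis by (simp add: Z_def)
    qed
    have b3: "(\<Delta> + 2 * s) * \<delta> \<le> 2 * Z"
    proof -
      have "(\<Delta> + 2 * s) * \<delta> \<le> (2 * \<Delta>) * x powr (real k - r / 2)"
        unfolding \<delta>_def using s2 r L0 \<Delta>0 by (intro mult_mono mono) auto
      then show ?thesis by (simp add: Z_def)
    qed
    have b4: "x powr (real k - 4 * r) \<le> Z"
    proof -
      have "x powr (real k - 4 * r) = x powr (- (r / 4)) * x powr (real k - 15 * r / 4)" unfolding powr_add[symmetric] by (rule arg_cong[where f = "\<lambda>a. x powr a"]) simp
      also have "\<dots> \<le> \<Delta> * x powr (real k - r / 2)" using \<Delta> \<Delta>0 r by (intro mult_mono mono) auto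
      finally show ?thesis by (simp add: Z_def)
    qed
    have "\<bar>hits k S {a..b} \<alpha> - \<Delta> * (c k \<alpha> * real (card M))\<bar> \<le> K2 * Z + 2 * K3 * Z + 2 * Z + 2 * Z"
      using main lo up b1 b2 b3 b4 d2 d3 by linarith
    also have "\<dots> = K * Z" by (simp add: K_def algebra_simps)
    finally show ?thesis by (simp add: S_def \<Delta>_def Z_def x_def)
  qed
  then show ?thesis using K0 by blast
qed

section \<open>Comparison along a geometric progression\<close>

lemma F_scale_coeff_le:
  assumes "\<And>i. i \<in> {2..k} \<Longrightarrow> \<alpha> i \<le> (1 + h) * \<beta> i" "0 \<le> h" "\<And>i. i \<in> {1..k} \<Longrightarrow> 0 \<le> x i" "k \<ge> 1"
  shows "F k \<alpha> x \<le> (1 + h) * F k \<beta> x"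
proof -
  have "F k \<alpha> x \<le> (1 + h) * x 1 ^ k + (\<Sum>i=2..k. (1 + h) * \<beta> i * x i ^ k)"
    unfolding F_def
  proof (intro add_mono sum_mono mult_right_mono)
    have "0 \<le> h * x 1 ^ k" using assms by auto
    then show "x 1 ^ k \<le> (1 + h) * x 1 ^ k" by (simp add: algebra_simps)
  qed (use assms in auto)
  then show ?thesis by (simp add: F_def sum_distrib_left algebra_simps)
qed

definition pairs :: "nat \<Rightarrow> (nat \<Rightarrow> real) \<Rightarrow> real \<Rightarrow> real \<Rightarrow> real \<Rightarrow> ((nat \<Rightarrow> nat) \<times> (nat \<Rightarrow> nat)) set" where
  "pairs k \<alpha> a b T = {(m, n). m \<in> {1..k} \<rightarrow>\<^sub>E (UNIV :: nat set) \<and> n \<in> {1..k} \<rightarrow>\<^sub>E (UNIV :: nat set) \<and> m \<noteq> n \<and>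
        F k \<alpha> (\<lambda>i. real (m i)) \<le> T \<and> F k \<alpha> (\<lambda>i. real (n i)) \<le> T \<and>
        F k \<alpha> (\<lambda>i. real (m i)) - F k \<alpha> (\<lambda>i. real (n i)) \<in> {a..b}}"

lemma R_eq: "R k \<alpha> a b T = 1 / T * real (card (pairs k \<alpha> a b T))"
  by (simp add: R_def pairs_def)

text \<open>As \<beta> \<le> \<alpha>, every \<open>m\<close> with value at most T for \<alpha> has
  value at most t for \<beta>, so \<open>pairs\<close> embeds into the set counted by
  \<open>hits\<close>. Conversely, value at most t for \<beta> means value at most (1 + h) * t \<le>
  (1 + h)^2 * T for \<alpha>; this bounds the number of \<open>m\<close> and produces the factor (1
  + h)^2.\<close>

lemma R_upper:
  fixes k N :: nat and \<alpha> \<beta> :: "nat \<Rightarrow> real" and h t K a b r T :: real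
  assumes k: "k \<ge> 3" and \<alpha>: "\<And>i. i \<in> {2..k} \<Longrightarrow> 1 / 2 \<le> \<alpha> i \<and> \<alpha> i \<le> 1"
    and \<beta>: "\<And>i. i \<in> {2..k} \<Longrightarrow> 1 / 4 \<le> \<beta> i \<and> \<beta> i \<le> \<alpha> i \<and> \<alpha> i \<le> (1 + h) * \<beta> i" and h: "0 < h" "h \<le> 1"
    and t: "t \<ge> 1" "64 * t \<le> real N ^ k" "real N ^ k \<le> 5 ^ k * t" and T: "T \<le> t" "t \<le> (1 + h) * T" and r: "0 < r" "r \<le> 1" and K: "K > 0" and ab: "a < b"
    and eq: "\<bar>hits k (lattice k \<beta> t \<times> box k N) {a..b} \<alpha> - (b - a) * (c k \<alpha> * real (card (lattice k \<beta> t)))\<bar> \<le> K * ((b - a) * real N powr (real k - r / 2))"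
  shows "R k \<alpha> a b T / ((c k \<alpha>)\<^sup>2 * (b - a)) \<le> (1 + h)\<^sup>2 + ((real k)\<^sup>2 * 2 ^ k + K / (c k \<alpha>)\<^sup>2) * (2 * 5 ^ k) * real N powr (- (r / 2))"
proof -
  have c0: "c k \<alpha> > 0" using k \<alpha> by (intro solid_1_finite(2)) auto
  have N1: "real N \<ge> 1"
  proof (rule ccontr)
    assume "\<not> ?thesis"
    then have "real N ^ k = 0" using k by simp
    then show False using t by linarith
  qed
  have T0: "T > 0"
  proof (rule ccontr)
    assume "\<not> T > 0"
    then have "(1 + h) * T \<le> 0" using h by (intro mult_nonneg_nonpos) auto
    then show False using T t by linarith
  qed
  define M where "M = lattice k \<beta> t"
  have Mbox: "M \<subseteq> box k N" unfolding M_def using k \<beta> t by (intro lattice_subset_box[of k "1 / 4"]) auto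
  have fM: "finite M" using Mbox finite_box finite_subset by blast
  have sub: "pairs k \<alpha> a b T \<subseteq> {p \<in> M \<times> box k N. lin k (diff k p) \<alpha> \<in> {a..b}}"
  proof
    fix p assume p: "p \<in> pairs k \<alpha> a b T"
    obtain m n where mn: "p = (m, n)" by (cases p)
    have m: "m \<in> {1..k} \<rightarrow>\<^sub>E UNIV" "F k \<alpha> (\<lambda>i. real (m i)) \<le> T" and n: "n \<in> lattice k \<alpha> T" 
      and d: "lin k (diff k (m, n)) \<alpha> \<in> {a..b}"
      using p unfolding mn pairs_def F_diff_eq_lin by (auto simp: lattice_def)
    have "F k \<beta> (\<lambda>i. real (m i)) \<le> F k \<alpha> (\<lambda>i. real (m i))" using \<beta> by (intro F_mono_coeff) auto
    then have "m \<in> M" using m T by (simp add: M_def lattice_def)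
    moreover have "n \<in> box k N" using n lattice_subset_box[of k "1 / 2" \<alpha> T N] k \<alpha> T t by auto
    ultimately show "p \<in> {p \<in> M \<times> box k N. lin k (diff k p) \<alpha> \<in> {a..b}}" using d mn by simp
  qed
  have fin: "finite (M \<times> box k N)" using fM finite_box by simp
  have "real (card (pairs k \<alpha> a b T)) \<le> hits k (M \<times> box k N) {a..b} \<alpha>"
    unfolding hits_eq_card[OF fin] using sub fin by (intro of_nat_mono card_mono) auto
  also have "\<dots> \<le> (b - a) * (c k \<alpha> * real (card M)) + K * ((b - a) * real N powr (real k - r / 2))"
    using eq unfolding M_def[symmetric] by linarith
  also have "\<dots> \<le> (b - a) * (c k \<alpha> * (c k \<alpha> * ((1 + h)\<^sup>2 * T + (real k)\<^sup>2 * 2 ^ k * real N powr (real k - r / 2)))) + K * ((b - a) * real N powr (real k - r / 2))"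
  proof (intro add_right_mono mult_left_mono)
    have 2: "(1 + h) * t \<le> 1 / 2 * real N ^ k"
    proof -
      have "(1 + h) * t \<le> 2 * t" using h t by (intro mult_right_mono) auto
      then show ?thesis using t by linarith
    qed
    have "M \<subseteq> lattice k \<alpha> ((1 + h) * t)"
    proof
      fix m assume m: "m \<in> M"
      have "F k \<alpha> (\<lambda>i. real (m i)) \<le> (1 + h) * F k \<beta> (\<lambda>i. real (m i))" using \<beta> h k by (intro F_scale_coeff_le) auto
      also have "\<dots> \<le> (1 + h) * t" using m h by (intro mult_left_mono) (auto simp: M_def lattice_def)
      finally show "m \<in> lattice k \<alpha> ((1 + h) * t)" using m by (auto simp: M_def lattice_def)
    qed
    moreover have "finite (lattice k \<alpha> ((1 + h) * t))"
    proof (rule finite_subset[OF _ finite_box])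
      show "lattice k \<alpha> ((1 + h) * t) \<subseteq> box k N" using k \<alpha> 2 by (intro lattice_subset_box[of k "1 / 2"]) auto
    qed
    ultimately have "real (card M) \<le> real (card (lattice k \<alpha> ((1 + h) * t)))" by (intro of_nat_mono card_mono)
    also have "\<dots> \<le> c k \<alpha> * ((1 + h) * t + (real k)\<^sup>2 * (real N + 1) ^ (k - 1))"
      using k \<alpha> 2 h t by (intro card_lattice_bounds) auto
    also have "\<dots> \<le> c k \<alpha> * ((1 + h)\<^sup>2 * T + (real k)\<^sup>2 * 2 ^ k * real N powr (real k - r / 2))"
    proof (intro mult_left_mono add_mono)
      have "(1 + h) * t \<le> (1 + h) * ((1 + h) * T)" using T h by (intro mult_left_mono) auto
      then show "(1 + h) * t \<le> (1 + h)\<^sup>2 * T" by (simp add: power2_eq_square)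
      have "(real N + 1) ^ (k - 1) \<le> (2 * real N) ^ (k - 1)" using N1 by (intro power_mono) auto
      also have "\<dots> = 2 ^ (k - 1) * real N powr (real k - 1)"
        using N1 k powr_realpow[of "real N" "k - 1"] by (simp add: power_mult_distrib of_nat_diff)
      also have "\<dots> \<le> 2 ^ k * real N powr (real k - r / 2)"
        using N1 r by (intro mult_mono power_increasing powr_mono) auto
      finally show "(real k)\<^sup>2 * (real N + 1) ^ (k - 1) \<le> (real k)\<^sup>2 * 2 ^ k * real N powr (real k - r / 2)"
        by (simp add: mult.assoc mult_left_mono)
    qed (use c0 in auto)
    finally show "real (card M) \<le> c k \<alpha> * ((1 + h)\<^sup>2 * T + (real k)\<^sup>2 * 2 ^ k * real N powr (real k - r / 2))" .
  qed (use c0 ab in auto)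
  also have "\<dots> = ((c k \<alpha>)\<^sup>2 * (b - a)) * ((1 + h)\<^sup>2 * T + ((real k)\<^sup>2 * 2 ^ k + K / (c k \<alpha>)\<^sup>2) * real N powr (real k - r / 2))"
    using c0 by (simp add: power2_eq_square field_simps)
  also have "\<dots> \<le> ((c k \<alpha>)\<^sup>2 * (b - a)) * ((1 + h)\<^sup>2 * T + ((real k)\<^sup>2 * 2 ^ k + K / (c k \<alpha>)\<^sup>2) * ((2 * 5 ^ k) * real N powr (- (r / 2)) * T))"
  proof (intro mult_left_mono add_left_mono)
    have "real N powr (real k - r / 2) = real N ^ k * real N powr (- (r / 2))"
      using N1 powr_add[of "real N" "real k" "- (r / 2)"] by (simp add: powr_realpow)
    also have "\<dots> \<le> (5 ^ k * (2 * T)) * real N powr (- (r / 2))"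
    proof (rule mult_right_mono)
      have "(1 + h) * T \<le> 2 * T" using h T0 by (intro mult_right_mono) auto
      then have "5 ^ k * t \<le> 5 ^ k * (2 * T)" using T by (intro mult_left_mono) auto
      then show "real N ^ k \<le> 5 ^ k * (2 * T)" using t by linarith
    qed simp
    finally show "real N powr (real k - r / 2) \<le> (2 * 5 ^ k) * real N powr (- (r / 2)) * T" by (simp add: mult_ac)
  qed (use c0 K ab in auto)
  also have "\<dots> = T * (((c k \<alpha>)\<^sup>2 * (b - a)) * ((1 + h)\<^sup>2 + ((real k)\<^sup>2 * 2 ^ k + K / (c k \<alpha>)\<^sup>2) * (2 * 5 ^ k) * real N powr (- (r / 2))))"
    by (simp add: algebra_simps)
  finally have "R k \<alpha> a b T \<le> ((c k \<alpha>)\<^sup>2 * (b - a)) * ((1 + h)\<^sup>2 + ((real k)\<^sup>2 * 2 ^ k + K / (c k \<alpha>)\<^sup>2) * (2 * 5 ^ k) * real N powr (- (r / 2)))"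
    unfolding R_eq using T0 by (simp add: pos_divide_le_eq mult.commute)
  moreover have "0 < (c k \<alpha>)\<^sup>2 * (b - a)" using c0 ab by simp
  ultimately show ?thesis by (simp only: pos_divide_le_eq mult.commute)
qed

text \<open>Here t is smaller than T: value at most t for \<beta> gives value at most (1 + h) * t
  \<le> T for \<alpha>, and since a > 0 the point \<open>n\<close> has a smaller value than
  \<open>m\<close>, so the pair is counted by \<open>R\<close>. There are at least c * t such
  \<open>m\<close>, and t \<ge> T / (1 + h)^2.\<close>

lemma R_lower:
  fixes k N :: nat and \<alpha> \<beta> :: "nat \<Rightarrow> real" and h t K a b r T :: real
  assumes k: "k \<ge> 3" and \<alpha>: "\<And>i. i \<in> {2..k} \<Longrightarrow> 1 / 2 \<le> \<alpha> i \<and> \<alpha> i \<le> 1"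
    and \<beta>: "\<And>i. i \<in> {2..k} \<Longrightarrow> 1 / 4 \<le> \<beta> i \<and> \<beta> i \<le> \<alpha> i \<and> \<alpha> i \<le> (1 + h) * \<beta> i" and h: "0 < h" "h \<le> 1"
    and t: "t \<ge> 1" "64 * t \<le> real N ^ k" "real N ^ k \<le> 5 ^ k * t" and T: "(1 + h) * t \<le> T" "T \<le> (1 + h)\<^sup>2 * t" and K: "K > 0" and ab: "0 < a" "a < b"
    and eq: "\<bar>hits k (lattice k \<beta> t \<times> box k N) {a..b} \<alpha> - (b - a) * (c k \<alpha> * real (card (lattice k \<beta> t)))\<bar> \<le> K * ((b - a) * real N powr (real k - r / 2))"
  shows "1 / (1 + h)\<^sup>2 - ((real k)\<^sup>2 * 2 ^ k + K / (c k \<alpha>)\<^sup>2) * (2 * 5 ^ k) * real N powr (- (r / 2)) \<le> R k \<alpha> a b T / ((c k \<alpha>)\<^sup>2 * (b - a))"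
proof -
  have c0: "c k \<alpha> > 0" using k \<alpha> by (intro solid_1_finite(2)) auto
  have N1: "real N \<ge> 1"
  proof (rule ccontr)
    assume "\<not> ?thesis"
    then have "real N ^ k = 0" using k by simp
    then show False using t by linarith
  qed
  have tT: "t \<le> T"
  proof -
    have "1 * t \<le> (1 + h) * t" using h t by (intro mult_right_mono) auto
    then show ?thesis using T by linarith
  qed
  have T0: "T > 0" using tT t by linarith
  have T4: "T \<le> 1 / 2 * real N ^ k"
  proof -
    have "(1 + h)\<^sup>2 \<le> 2\<^sup>2" using h by (intro power_mono) auto
    then have "(1 + h)\<^sup>2 * t \<le> 4 * t" using t by (intro mult_right_mono) auto
    then show ?thesis using T t by linarith
  qed
  define M where "M = lattice k \<beta> t"
  have Mbox: "M \<subseteq> box k N" unfolding M_def using k \<beta> t by (intro lattice_subset_box[of k "1 / 4"]) auto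
  have fM: "finite M" using Mbox finite_box finite_subset by blast
  have fin: "finite (M \<times> box k N)" using fM finite_box by simp
  have latT: "lattice k \<alpha> T \<subseteq> box k N" using k \<alpha> T4 by (intro lattice_subset_box[of k "1 / 2"]) auto
  have fp: "finite (pairs k \<alpha> a b T)"
  proof (rule finite_subset)
    show "pairs k \<alpha> a b T \<subseteq> lattice k \<alpha> T \<times> lattice k \<alpha> T" by (auto simp: pairs_def lattice_def)
    show "finite (lattice k \<alpha> T \<times> lattice k \<alpha> T)" using latT finite_box finite_subset by blast
  qed
  have sub: "{p \<in> M \<times> box k N. lin k (diff k p) \<alpha> \<in> {a..b}} \<subseteq> pairs k \<alpha> a b T"
  proof
    fix p assume p: "p \<in> {p \<in> M \<times> box k N. lin k (diff k p) \<alpha> \<in> {a..b}}"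
    obtain m n where mn: "p = (m, n)" by (cases p)
    have m: "m \<in> M" and n: "n \<in> box k N" and d: "F k \<alpha> (\<lambda>i. real (m i)) - F k \<alpha> (\<lambda>i. real (n i)) \<in> {a..b}"
      using p unfolding mn F_diff_eq_lin by auto
    have "F k \<alpha> (\<lambda>i. real (m i)) \<le> (1 + h) * F k \<beta> (\<lambda>i. real (m i))" using \<beta> h k by (intro F_scale_coeff_le) auto
    also have "\<dots> \<le> (1 + h) * t" using m h by (intro mult_left_mono) (auto simp: M_def lattice_def)
    also have "\<dots> \<le> T" by (rule T)
    finally have mT: "F k \<alpha> (\<lambda>i. real (m i)) \<le> T" .
    then have nT: "F k \<alpha> (\<lambda>i. real (n i)) \<le> T" using d ab by auto
    have "m \<noteq> n" using d ab by auto
    then show "p \<in> pairs k \<alpha> a b T" using m n d mT nT unfolding mn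
      by (auto simp: pairs_def M_def lattice_def box_def PiE_iff)
  qed
  have cM: "c k \<alpha> * t \<le> real (card M)"
  proof -
    have "c k \<alpha> * t \<le> real (card (lattice k \<alpha> t))" using k \<alpha> t by (intro card_lattice_bounds(1)[of k \<alpha> t N]) auto
    also have "\<dots> \<le> real (card M)"
    proof (intro of_nat_mono card_mono fM)
      show "lattice k \<alpha> t \<subseteq> M"
      proof
        fix m assume m: "m \<in> lattice k \<alpha> t"
        have "F k \<beta> (\<lambda>i. real (m i)) \<le> F k \<alpha> (\<lambda>i. real (m i))" using \<beta> by (intro F_mono_coeff) auto
        then show "m \<in> M" using m by (auto simp: M_def lattice_def)
      qed
    qed
    finally show ?thesis .
  qed
  define W where "W = ((real k)\<^sup>2 * 2 ^ k + K / (c k \<alpha>)\<^sup>2) * (2 * 5 ^ k) * real N powr (- (r / 2))"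
  have "T * (((c k \<alpha>)\<^sup>2 * (b - a)) * (1 / (1 + h)\<^sup>2 - W)) \<le> (b - a) * (c k \<alpha> * (c k \<alpha> * t)) - K * ((b - a) * real N powr (real k - r / 2))"
  proof -
    have "T * (1 / (1 + h)\<^sup>2) \<le> t" using T h by (simp add: divide_le_eq mult.commute)
    then have "((c k \<alpha>)\<^sup>2 * (b - a)) * (T * (1 / (1 + h)\<^sup>2)) \<le> ((c k \<alpha>)\<^sup>2 * (b - a)) * t" using ab by (intro mult_left_mono) auto
    moreover have "K * ((b - a) * real N powr (real k - r / 2)) \<le> ((c k \<alpha>)\<^sup>2 * (b - a)) * (T * W)"
    proof -
      have "real N powr (real k - r / 2) = real N ^ k * real N powr (- (r / 2))"
        using N1 powr_add[of "real N" "real k" "- (r / 2)"] by (simp add: powr_realpow)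
      also have "\<dots> \<le> (5 ^ k * (2 * T)) * real N powr (- (r / 2))"
      proof (rule mult_right_mono)
        have "5 ^ k * t \<le> 5 ^ k * (2 * T)" using tT T0 by (intro mult_left_mono) auto
        then show "real N ^ k \<le> 5 ^ k * (2 * T)" using t by linarith
      qed simp
      finally have "K / (c k \<alpha>)\<^sup>2 * real N powr (real k - r / 2) \<le> ((real k)\<^sup>2 * 2 ^ k + K / (c k \<alpha>)\<^sup>2) * ((5 ^ k * (2 * T)) * real N powr (- (r / 2)))"
        using K by (intro mult_mono) auto
      also have "\<dots> = T * W" by (simp add: W_def)
      finally have "((c k \<alpha>)\<^sup>2 * (b - a)) * (K / (c k \<alpha>)\<^sup>2 * real N powr (real k - r / 2)) \<le> ((c k \<alpha>)\<^sup>2 * (b - a)) * (T * W)"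
        using ab by (intro mult_left_mono) auto
      then show ?thesis using c0 by (simp add: mult_ac)
    qed
    moreover have "T * (((c k \<alpha>)\<^sup>2 * (b - a)) * (1 / (1 + h)\<^sup>2 - W)) = ((c k \<alpha>)\<^sup>2 * (b - a)) * (T * (1 / (1 + h)\<^sup>2)) - ((c k \<alpha>)\<^sup>2 * (b - a)) * (T * W)"
      by (simp only: right_diff_distrib mult_ac)
    moreover have "(b - a) * (c k \<alpha> * (c k \<alpha> * t)) = ((c k \<alpha>)\<^sup>2 * (b - a)) * t" by (simp add: power2_eq_square)
    ultimately show ?thesis by linarith
  qed
  also have "\<dots> \<le> (b - a) * (c k \<alpha> * real (card M)) - K * ((b - a) * real N powr (real k - r / 2))"
    using cM c0 ab by (intro diff_right_mono mult_left_mono) auto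
  also have "\<dots> \<le> hits k (M \<times> box k N) {a..b} \<alpha>" using eq unfolding M_def[symmetric] by linarith
  also have "\<dots> \<le> real (card (pairs k \<alpha> a b T))"
    unfolding hits_eq_card[OF fin] using sub fp by (intro of_nat_mono card_mono) auto
  finally have "((c k \<alpha>)\<^sup>2 * (b - a)) * (1 / (1 + h)\<^sup>2 - W) \<le> R k \<alpha> a b T"
    unfolding R_eq using T0 by (simp add: pos_le_divide_eq mult.commute)
  moreover have "0 < (c k \<alpha>)\<^sup>2 * (b - a)" using c0 ab by simp
  ultimately show ?thesis unfolding W_def[symmetric] by (simp only: pos_le_divide_eq mult.commute)
qed

text \<open>Side of the box on the scale t = (1 + h)^j. The factor 4 gives N^k \<ge> 64 * t for k
  \<ge> 3, room for coefficients as small as 1/4 and for factors 1 + h; rounding up costs at most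
  the step from 4 to 5.\<close>

definition side :: "nat \<Rightarrow> real \<Rightarrow> nat \<Rightarrow> nat" where
  "side k h j = nat \<lceil>4 * ((1 + h) ^ j) powr (1 / real k)\<rceil>"

lemma side_bounds:
  assumes k: "k \<ge> 3" and h: "0 < h"
  shows "64 * (1 + h) ^ j \<le> real (side k h j) ^ k" "real (side k h j) ^ k \<le> 5 ^ k * (1 + h) ^ j"
    "4 * ((1 + h) ^ j) powr (1 / real k) \<le> real (side k h j)"
proof -
  define t where "t = (1 + h) ^ j"
  have t: "t \<ge> 1" using h by (simp add: t_def one_le_power)
  define z where "z = t powr (1 / real k)"
  have z: "z \<ge> 1" using t by (simp add: z_def ge_one_powr_ge_zero)
  have zk: "z ^ k = t"
  proof -
    have "z ^ k = z powr real k" using z by (intro powr_realpow[symmetric]) simp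
    then show ?thesis using t k by (simp add: z_def powr_powr)
  qed
  have s: "4 * z \<le> real (side k h j)" "real (side k h j) \<le> 5 * z"
    using z unfolding side_def t_def[symmetric] z_def[symmetric] by linarith+
  then show "4 * ((1 + h) ^ j) powr (1 / real k) \<le> real (side k h j)" by (simp add: z_def t_def)
  have "(4::real) ^ 3 \<le> 4 ^ k" using k by (intro power_increasing) auto
  then have "64 * t \<le> 4 ^ k * t" using t by (intro mult_right_mono) auto
  also have "\<dots> = (4 * z) ^ k" by (simp add: power_mult_distrib zk)
  also have "\<dots> \<le> real (side k h j) ^ k" using s z by (intro power_mono) auto
  finally show "64 * (1 + h) ^ j \<le> real (side k h j) ^ k" by (simp add: t_def)
  have "real (side k h j) ^ k \<le> (5 * z) ^ k" using s by (intro power_mono) auto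
  then show "real (side k h j) ^ k \<le> 5 ^ k * (1 + h) ^ j" by (simp add: power_mult_distrib zk t_def)
qed

lemma side_at_top:
  assumes k: "k \<ge> 3" and h: "0 < h"
  shows "filterlim (side k h) at_top sequentially"
proof -
  have "filterlim (\<lambda>j. ((1 + h) ^ j) powr (1 / real k)) at_top sequentially"
  proof -
    have "((1 + h) ^ j) powr (1 / real k) = exp (real j * (ln (1 + h) / real k))" for j
      using h by (simp add: powr_def ln_realpow)
    moreover have "filterlim (\<lambda>j. exp (real j * (ln (1 + h) / real k))) at_top sequentially"
    proof (rule filterlim_compose[OF exp_at_top])
      have "0 < ln (1 + h) / real k" using h k by simp
      then show "filterlim (\<lambda>j. real j * (ln (1 + h) / real k)) at_top sequentially"
        by (rule filterlim_at_top_mult_tendsto_pos[OF tendsto_const _ filterlim_real_sequentially])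
    qed
    ultimately show ?thesis by simp
  qed
  then have "filterlim (\<lambda>j. real (side k h j)) at_top sequentially"
  proof (rule filterlim_at_top_mono, intro always_eventually allI)
    fix j have "0 \<le> ((1 + h) ^ j) powr (1 / real k)" by simp
    then show "((1 + h) ^ j) powr (1 / real k) \<le> real (side k h j)" using side_bounds(3)[OF k h, of j] by linarith
  qed
  then show ?thesis by (simp add: filterlim_sequentially_iff_filterlim_real)
qed

text \<open>The mean deviation on scale \<open>j\<close> is O(N powr (-r)) with N \<ge> (1 +
  h)^(j/k), so it decays geometrically and Borel-Cantelli applies. The set of pairs involves \<beta>
  but not \<alpha>, as the moment bounds require.\<close>

lemma AE_deviation_le_1:
  fixes k :: nat and e r h :: real
  assumes k: "k \<ge> 3" and e: "0 < e" "e * real k \<le> 1 / 1000" and r: "r = e / (8 * (real k)\<^sup>2)" and h: "0 < h"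
  shows "AE \<alpha> in PiM {2..k} (\<lambda>_. lborel). \<alpha> \<in> ({2..k} \<rightarrow>\<^sub>E {1/2..1}) \<longrightarrow> 
    (\<forall>\<^sub>F j in sequentially. deviation k (side k h j) e r (good k (side k h j) e \<inter> lattice k \<beta> ((1 + h) ^ j) \<times> box k (side k h j)) \<alpha> \<le> 1)"
proof -
  have r0: "r > 0" using e k by (simp add: r)
  obtain C N0 where C: "C > 0" "\<And>N P. N \<ge> N0 \<Longrightarrow> P \<subseteq> good k N e \<Longrightarrow>
     (\<integral>\<^sup>+\<alpha>. ennreal (wt {2..k} \<alpha> * deviation k N e r P \<alpha>) \<partial>PiM {2..k} (\<lambda>_. lborel)) \<le> ennreal (C * real N powr (- r))"
    using nn_integral_deviation_le[OF k e r] by blast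
  obtain j0 where j0: "\<And>j. j \<ge> j0 \<Longrightarrow> N0 \<le> side k h j"
    using side_at_top[OF k h] by (auto simp: filterlim_at_top eventually_sequentially)
  have "summable (\<lambda>j. C * real (side k h j) powr (- r))"
  proof (rule summable_mult, rule summable_comparison_test')
    define q where "q = (1 + h) powr (- (r / real k))"
    have "(1 + h) powr (- (r / real k)) < (1 + h) powr 0" using h r0 k by (intro powr_less_mono) auto
    then have "\<bar>q\<bar> < 1" using h by (simp add: q_def)
    then show "summable (\<lambda>j. q ^ j)" by (simp add: summable_geometric)
    fix j :: nat
    have p: "0 < ((1 + h) ^ j) powr (1 / real k)" using h by simp
    then have "((1 + h) ^ j) powr (1 / real k) \<le> real (side k h j)" using side_bounds(3)[OF k h, of j] by linarith
    then have "real (side k h j) powr (- r) \<le> (((1 + h) ^ j) powr (1 / real k)) powr (- r)"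
      using p r0 by (intro powr_mono2') auto
    also have "\<dots> = q ^ j" using h by (simp add: q_def powr_powr powr_realpow[symmetric] mult.commute)
    finally show "norm (real (side k h j) powr (- r)) \<le> q ^ j" by simp
  qed
  then show ?thesis
    using C j0 by (intro eventually_le_1_if_summable_integrals[where b = "\<lambda>j. C * real (side k h j) powr (- r)" and ?j0.0 = j0])
      (auto simp: deviation_nonneg)
qed

text \<open>For given \<epsilon> first \<open>h\<close> and then a rational \<beta> slightly below
  \<alpha> are fixed. A large T lies between (1 + h)^j and (1 + h)^(j+1); the upper bound uses the
  scale j + 1 and the lower bound j - 1. The choice of \<rho> makes T powr (-\<rho>) equal to N powr
  (-r/4) at T = N^k.\<close>

lemma R_uniform_asymptotic:
  fixes k :: nat and e r \<rho> :: real and \<alpha> :: "nat \<Rightarrow> real"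
  assumes k: "k \<ge> 3" and r: "0 < r" "r \<le> 1 / 100" and \<rho>: "\<rho> = r / (4 * real k)"
    and \<alpha>: "\<alpha> \<in> ({2..k} \<rightarrow>\<^sub>E {1/2..1})"
    and ev: "\<And>i \<beta>. \<beta> \<in> ({2..k} \<rightarrow>\<^sub>E \<rat>) \<Longrightarrow> \<forall>\<^sub>F j in sequentially.
       deviation k (side k (1 / real (Suc i)) j) e r (good k (side k (1 / real (Suc i)) j) e \<inter>
         lattice k \<beta> ((1 + 1 / real (Suc i)) ^ j) \<times> box k (side k (1 / real (Suc i)) j)) \<alpha> \<le> 1"
    and C: "C > 0" and \<epsilon>: "\<epsilon> > 0"
  shows "\<forall>\<^sub>F T in at_top. \<forall>a b. 0 < a \<longrightarrow> a < b \<longrightarrow> b \<le> C \<longrightarrow> b - a > T powr (-\<rho>) \<longrightarrow>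
     \<bar>R k \<alpha> a b T / ((c k \<alpha>)\<^sup>2 * (b - a)) - 1\<bar> \<le> \<epsilon>"
proof -
  have \<alpha>b: "1 / 2 \<le> \<alpha> i \<and> \<alpha> i \<le> 1" if "i \<in> {2..k}" for i using \<alpha> that by (auto simp: PiE_iff)
  have c0: "c k \<alpha> > 0" using k \<alpha>b by (intro solid_1_finite(2)) auto
  \<comment> \<open>Both (1 + h)^2 and its inverse will differ from 1 by at most 3 * h \<le>
    \<epsilon>/2; the other half of \<epsilon> is for the power-saving error.\<close>
  obtain i where i: "1 / real (Suc i) < \<epsilon> / 6"
    using reals_Archimedean[of "\<epsilon> / 6"] \<epsilon> by (auto simp: inverse_eq_divide)
  define h where "h = 1 / real (Suc i)"
  have h: "0 < h" "h \<le> 1" "3 * h \<le> \<epsilon> / 2" using i by (auto simp: h_def)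
  have "\<exists>q\<in>\<rat>. \<alpha> i / (1 + h) < q \<and> q < \<alpha> i" if "i \<in> {2..k}" for i
  proof (rule Rats_dense_in_real)
    show "\<alpha> i / (1 + h) < \<alpha> i" using \<alpha>b[OF that] h by (simp add: divide_less_eq algebra_simps)
  qed
  then obtain q where q: "\<And>i. i \<in> {2..k} \<Longrightarrow> q i \<in> \<rat> \<and> \<alpha> i / (1 + h) < q i \<and> q i < \<alpha> i" by metis
  define \<beta> where "\<beta> = (\<lambda>i\<in>{2..k}. q i)"
  have \<beta>Q: "\<beta> \<in> ({2..k} \<rightarrow>\<^sub>E \<rat>)" using q by (auto simp: \<beta>_def)
  have \<beta>: "1 / 4 \<le> \<beta> i \<and> \<beta> i \<le> \<alpha> i \<and> \<alpha> i \<le> (1 + h) * \<beta> i" if i: "i \<in> {2..k}" for i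
  proof -
    have b: "\<beta> i = q i" using i by (simp add: \<beta>_def)
    have "\<alpha> i < (1 + h) * q i" using q[OF i] h by (simp add: divide_less_eq mult.commute)
    moreover have "(1 + h) * (1 / 4) \<le> 2 * (1 / 4)" using h by (intro mult_right_mono) auto
    ultimately have "(1 + h) * (1 / 4) < (1 + h) * q i" using \<alpha>b[OF i] by linarith
    then have "1 / 4 < q i" using h by simp
    then show ?thesis using q[OF i] \<open>\<alpha> i < (1 + h) * q i\<close> b by simp
  qed
  obtain K N0 where K: "K > 0" and equi: "\<And>N M a b. N \<ge> N0 \<Longrightarrow> M \<subseteq> lattice k \<alpha> (1 / 2 * real N ^ k) \<Longrightarrow>
     deviation k N e r (good k N e \<inter> M \<times> box k N) \<alpha> \<le> 1 \<Longrightarrow> 0 < a \<Longrightarrow> b \<le> real N powr r \<Longrightarrow> real N powr (- (r / 4)) \<le> b - a \<Longrightarrow>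
     \<bar>hits k (M \<times> box k N) {a..b} \<alpha> - (b - a) * (c k \<alpha> * real (card M))\<bar> \<le> K * ((b - a) * real N powr (real k - r / 2))"
    using hits_equidistributed[of k \<alpha> r e] k \<alpha>b r by metis
  define A where "A = ((real k)\<^sup>2 * 2 ^ k + K / (c k \<alpha>)\<^sup>2) * (2 * 5 ^ k)"
  have A0: "A > 0" using K c0 by (auto simp: A_def intro!: mult_pos_pos add_nonneg_pos)
  \<comment> \<open>From here on N powr r \<ge> C, which admits every b \<le> C, and the error A * N
    powr (-r/2) is at most \<epsilon>/2.\<close>
  define N1 where "N1 = max N0 (nat \<lceil>max (C powr (1 / r)) ((2 * A / \<epsilon>) powr (2 / r))\<rceil> + 1)"
  have "\<forall>\<^sub>F j in sequentially. N1 \<le> side k h j" using side_at_top[OF k h(1)] by (simp add: filterlim_at_top)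
  moreover have "\<forall>\<^sub>F j in sequentially. deviation k (side k h j) e r (good k (side k h j) e \<inter> lattice k \<beta> ((1 + h) ^ j) \<times> box k (side k h j)) \<alpha> \<le> 1"
    unfolding h_def by (rule ev[OF \<beta>Q])
  ultimately have "\<forall>\<^sub>F j in sequentially. N1 \<le> side k h j \<and> deviation k (side k h j) e r (good k (side k h j) e \<inter> lattice k \<beta> ((1 + h) ^ j) \<times> box k (side k h j)) \<alpha> \<le> 1"
    by (rule eventually_conj)
  then obtain J0 where J0: "\<And>j. j \<ge> J0 \<Longrightarrow> N1 \<le> side k h j"
    "\<And>j. j \<ge> J0 \<Longrightarrow> deviation k (side k h j) e r (good k (side k h j) e \<inter> lattice k \<beta> ((1 + h) ^ j) \<times> box k (side k h j)) \<alpha> \<le> 1"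
    by (auto simp: eventually_sequentially)
  have big: "C \<le> real N powr r" "A * real N powr (- (r / 2)) \<le> \<epsilon> / 2" "N0 \<le> N" if "N1 \<le> N" for N
  proof -
    have x: "C powr (1 / r) \<le> real N" "(2 * A / \<epsilon>) powr (2 / r) \<le> real N" "N0 \<le> N" "1 \<le> N"
      using that unfolding N1_def by (simp_all) linarith+
    have "(C powr (1 / r)) powr r \<le> real N powr r" using x r by (intro powr_mono2) auto
    then show "C \<le> real N powr r" using C r by (simp add: powr_powr)
    have "((2 * A / \<epsilon>) powr (2 / r)) powr (r / 2) \<le> real N powr (r / 2)" using x r by (intro powr_mono2) auto
    then have "2 * A / \<epsilon> \<le> real N powr (r / 2)" using A0 \<epsilon> r by (simp add: powr_powr)
    then have "2 * A \<le> real N powr (r / 2) * \<epsilon>" using \<epsilon> by (simp add: divide_le_eq)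
    moreover have "0 < real N powr (r / 2)" using x by simp
    ultimately have "A / real N powr (r / 2) \<le> \<epsilon> / 2" by (simp add: divide_le_eq mult.commute)
    then show "A * real N powr (- (r / 2)) \<le> \<epsilon> / 2" by (simp only: powr_minus_divide times_divide_eq_right mult_1_right)
    show "N0 \<le> N" by (rule x(3))
  qed
  \<comment> \<open>The 2 in the exponent keeps the scale j - 1, used for the lower bound, beyond
    \<open>J0\<close>.\<close>
  have main: "\<bar>R k \<alpha> a b T / ((c k \<alpha>)\<^sup>2 * (b - a)) - 1\<bar> \<le> \<epsilon>"
    if T: "(1 + h) ^ (J0 + 2) \<le> T" and ab: "0 < a" "a < b" "b \<le> C" "b - a > T powr (-\<rho>)" for T a b
  proof -
    have h1: "1 < 1 + h" using h by simp
    have T1: "1 \<le> T" using T one_le_power[of "1 + h" "J0 + 2"] h by linarith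
    define j where "j = nat \<lfloor>log (1 + h) T\<rfloor>"
    have l: "real (J0 + 2) \<le> log (1 + h) T"
    proof -
      have "log (1 + h) ((1 + h) ^ (J0 + 2)) \<le> log (1 + h) T" using T T1 h1 by (intro log_mono) auto
      moreover have "log (1 + h) ((1 + h) ^ (J0 + 2)) = real (J0 + 2)"
        using h1 by (subst log_pow_cancel) auto
      ultimately show ?thesis by simp
    qed
    then have j: "real j \<le> log (1 + h) T" "log (1 + h) T < real (j + 1)" "J0 + 2 \<le> j" unfolding j_def by linarith+
    have "(1 + h) powr real j \<le> (1 + h) powr (log (1 + h) T)" "(1 + h) powr (log (1 + h) T) < (1 + h) powr real (j + 1)"
      using j h1 by (auto simp del: of_nat_add intro: powr_mono powr_less_mono)
    then have jT: "(1 + h) ^ j \<le> T" "T < (1 + h) ^ (j + 1)"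
    proof -
      have pw: "(1 + h) powr real n = (1 + h) ^ n" for n using h1 by (simp add: powr_realpow)
      have pl: "(1 + h) powr (log (1 + h) T) = T" using h1 T1 by simp
      assume "(1 + h) powr real j \<le> (1 + h) powr (log (1 + h) T)" "(1 + h) powr (log (1 + h) T) < (1 + h) powr real (j + 1)"
      then show "(1 + h) ^ j \<le> T" "T < (1 + h) ^ (j + 1)" by (simp_all only: pw pl)
    qed
    have eqd: "\<bar>hits k (lattice k \<beta> ((1 + h) ^ J) \<times> box k (side k h J)) {a..b} \<alpha> - (b - a) * (c k \<alpha> * real (card (lattice k \<beta> ((1 + h) ^ J))))\<bar>
       \<le> K * ((b - a) * real (side k h J) powr (real k - r / 2))"
      if J: "J0 \<le> J" "T \<le> (1 + h)\<^sup>2 * (1 + h) ^ J" for J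
    proof (rule equi)
      note sb = side_bounds[OF k h(1), of J]
      have t1: "1 \<le> (1 + h) ^ J" using h by (simp add: one_le_power)
      show "N0 \<le> side k h J" by (rule big(3)[OF J0(1)[OF J(1)]])
      show "deviation k (side k h J) e r (good k (side k h J) e \<inter> lattice k \<beta> ((1 + h) ^ J) \<times> box k (side k h J)) \<alpha> \<le> 1"
        by (rule J0(2)[OF J(1)])
      show "b \<le> real (side k h J) powr r" using big(1)[OF J0(1)[OF J(1)]] ab by linarith
      show "lattice k \<beta> ((1 + h) ^ J) \<subseteq> lattice k \<alpha> (1 / 2 * real (side k h J) ^ k)"
      proof
        fix m assume m: "m \<in> lattice k \<beta> ((1 + h) ^ J)"
        have "F k \<alpha> (\<lambda>i. real (m i)) \<le> (1 + h) * F k \<beta> (\<lambda>i. real (m i))" using \<beta> h k by (intro F_scale_coeff_le) auto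
        also have "\<dots> \<le> (1 + h) * (1 + h) ^ J" using m h by (intro mult_left_mono) (auto simp: lattice_def)
        also have "\<dots> \<le> 2 * (1 + h) ^ J" using h t1 by (intro mult_right_mono) auto
        also have "\<dots> \<le> 1 / 2 * real (side k h J) ^ k" using sb(1) t1 by linarith
        finally show "m \<in> lattice k \<alpha> (1 / 2 * real (side k h J) ^ k)" using m by (auto simp: lattice_def)
      qed
      have "(1 + h)\<^sup>2 \<le> 2\<^sup>2" using h by (intro power_mono) auto
      then have "(1 + h)\<^sup>2 * (1 + h) ^ J \<le> 4 * (1 + h) ^ J" using t1 by (intro mult_right_mono) auto
      \<comment> \<open>On either scale T \<le> N^k, hence T powr (-\<rho>) \<ge> N powr (-k *
        \<rho>) = N powr (-r/4), and the hypothesis on b - a carries over to N.\<close>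
      then have TN: "T \<le> real (side k h J) ^ k" using J(2) sb(1) t1 by linarith
      then have "(real (side k h J) ^ k) powr (-\<rho>) \<le> T powr (-\<rho>)" using T1 r k unfolding \<rho> by (intro powr_mono2') auto
      moreover have "(real (side k h J) ^ k) powr (-\<rho>) = real (side k h J) powr (- (r / 4))"
      proof -
        have "side k h J > 0" using TN T1 k by (cases "side k h J = 0") (auto simp: power_0_left)
        then have "real (side k h J) ^ k = real (side k h J) powr real k" by (intro powr_realpow[symmetric]) simp
        then show ?thesis using k by (simp add: powr_powr \<rho>)
      qed
      ultimately show "real (side k h J) powr (- (r / 4)) \<le> b - a" using ab by linarith
    qed (use ab in auto)
    define W where "W J = A * real (side k h J) powr (- (r / 2))" for J
    have up: "R k \<alpha> a b T / ((c k \<alpha>)\<^sup>2 * (b - a)) \<le> (1 + h)\<^sup>2 + W (j + 1)"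
      unfolding W_def A_def
    proof (rule R_upper[OF k _ _ h(1,2) _ side_bounds(1,2)[OF k h(1)] _ _ r(1) _ K ab(2)])
      show "1 \<le> (1 + h) ^ (j + 1)" using h by (intro one_le_power) auto
      show "T \<le> (1 + h) ^ (j + 1)" using jT by simp
      have "(1 + h) * (1 + h) ^ j \<le> (1 + h) * T" using jT h by (intro mult_left_mono) auto
      then show "(1 + h) ^ (j + 1) \<le> (1 + h) * T" by simp
      have "1 * (1 + h) ^ (j + 1) \<le> (1 + h)\<^sup>2 * (1 + h) ^ (j + 1)" using h by (intro mult_right_mono one_le_power) auto
      then show "\<bar>hits k (lattice k \<beta> ((1 + h) ^ (j + 1)) \<times> box k (side k h (j + 1))) {a..b} \<alpha> - (b - a) * (c k \<alpha> * real (card (lattice k \<beta> ((1 + h) ^ (j + 1)))))\<bar>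
       \<le> K * ((b - a) * real (side k h (j + 1)) powr (real k - r / 2))"
        using jT j by (intro eqd) auto
      show "r \<le> 1" using r by simp
    qed (use \<alpha>b \<beta> in auto)
    have j1: "(1 + h) * (1 + h) ^ (j - 1) = (1 + h) ^ j" "(1 + h)\<^sup>2 * (1 + h) ^ (j - 1) = (1 + h) ^ (j + 1)"
    proof -
      have "j = Suc (j - 1)" using j by simp
      then show "(1 + h) * (1 + h) ^ (j - 1) = (1 + h) ^ j" by (metis power_Suc)
      then show "(1 + h)\<^sup>2 * (1 + h) ^ (j - 1) = (1 + h) ^ (j + 1)" by (simp add: power2_eq_square)
    qed
    have lo: "1 / (1 + h)\<^sup>2 - W (j - 1) \<le> R k \<alpha> a b T / ((c k \<alpha>)\<^sup>2 * (b - a))"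
      unfolding W_def A_def
    proof (rule R_lower[OF k _ _ h(1,2) _ side_bounds(1,2)[OF k h(1)] _ _ K ab(1,2)])
      show "1 \<le> (1 + h) ^ (j - 1)" using h by (intro one_le_power) auto
      show "(1 + h) * (1 + h) ^ (j - 1) \<le> T" "T \<le> (1 + h)\<^sup>2 * (1 + h) ^ (j - 1)" unfolding j1 using jT by auto
      then show "\<bar>hits k (lattice k \<beta> ((1 + h) ^ (j - 1)) \<times> box k (side k h (j - 1))) {a..b} \<alpha> - (b - a) * (c k \<alpha> * real (card (lattice k \<beta> ((1 + h) ^ (j - 1)))))\<bar>
       \<le> K * ((b - a) * real (side k h (j - 1)) powr (real k - r / 2))"
        using j by (intro eqd) auto
    qed (use \<alpha>b \<beta> in auto)
    have W: "W (j + 1) \<le> \<epsilon> / 2" "W (j - 1) \<le> \<epsilon> / 2"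
    proof -
      have "J0 \<le> j + 1" "J0 \<le> j - 1" using j by auto
      then show "W (j + 1) \<le> \<epsilon> / 2" "W (j - 1) \<le> \<epsilon> / 2"
        unfolding W_def by (blast intro: big(2) J0(1))+
    qed
    have hh: "(1 + h)\<^sup>2 \<le> 1 + 3 * h" "1 - 3 * h \<le> 1 / (1 + h)\<^sup>2"
    proof -
      have "h * h \<le> h * 1" using h by (intro mult_left_mono) auto
      then show "(1 + h)\<^sup>2 \<le> 1 + 3 * h" by (simp add: power2_eq_square algebra_simps)
      have "(1 - 3 * h) * (1 + h)\<^sup>2 = 1 - (h + 5 * (h * h) + 3 * (h * h * h))" by (simp add: power2_eq_square algebra_simps)
      moreover have "0 \<le> h * h" "0 \<le> h * h * h" using h by simp_all
      ultimately have "(1 - 3 * h) * (1 + h)\<^sup>2 \<le> 1" using h by linarith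
      then show "1 - 3 * h \<le> 1 / (1 + h)\<^sup>2" using h by (simp add: le_divide_eq)
    qed
    show ?thesis using up lo W hh h(3) by linarith
  qed
  show ?thesis
    using eventually_ge_at_top[of "(1 + h) ^ (J0 + 2)"] by (rule eventually_mono) (use main in blast)
qed

theorem theorem2:
  fixes k :: nat
  assumes "k \<ge> 3"
  shows "\<exists>\<rho>>0. AE \<alpha>\<in>({2..k} \<rightarrow>\<^sub>E {1/2..1}) in PiM {2..k} (\<lambda>_. lborel).
    \<forall>C>0. ((\<lambda>T. SUP (a, b)\<in>{(a, b). 0 < a \<and> a < b \<and> b \<le> C \<and> b - a > T powr (-\<rho>)}.
              ennreal \<bar>R k \<alpha> a b T / ((c k \<alpha>)\<^sup>2 * (b - a)) - 1\<bar>) \<longlongrightarrow> 0) at_top"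
proof -
  \<comment> \<open>The largest value with e * k \<le> 1/1000; \<open>r\<close> is tied to the
    saving e / k^2 over degenerate pairs, and \<rho> to \<open>r\<close> through T ~ N^k.\<close>
  define e where "e = 1 / (1000 * real k)"
  define r where "r = e / (8 * (real k)\<^sup>2)"
  define \<rho> where "\<rho> = r / (4 * real k)"
  have e: "0 < e" "e * real k \<le> 1 / 1000" using assms by (simp_all add: e_def)
  have r: "0 < r" "r \<le> 1 / 100"
  proof -
    show "0 < r" using e assms by (simp add: r_def)
    have e1: "e \<le> 1 / 1000" using assms by (simp add: e_def divide_simps)
    have "1 \<le> (real k)\<^sup>2" using assms by (intro one_le_power) auto
    then have "1 \<le> 8 * (real k)\<^sup>2" by linarith
    then have "r \<le> e / 1" unfolding r_def using e assms by (intro divide_left_mono) auto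
    then show "r \<le> 1 / 100" using e1 by simp
  qed
  have \<rho>: "\<rho> > 0" using r assms by (simp add: \<rho>_def)
  \<comment> \<open>Only countably many \<open>h\<close> and rational \<beta> occur, so one null set
    serves them all, and with them every C and every precision.\<close>
  have "AE \<alpha> in PiM {2..k} (\<lambda>_. lborel). \<forall>i. \<forall>\<beta>\<in>({2..k} \<rightarrow>\<^sub>E \<rat>). \<alpha> \<in> ({2..k} \<rightarrow>\<^sub>E {1/2..1}) \<longrightarrow>
     (\<forall>\<^sub>F j in sequentially. deviation k (side k (1 / real (Suc i)) j) e r (good k (side k (1 / real (Suc i)) j) e \<inter>
         lattice k \<beta> ((1 + 1 / real (Suc i)) ^ j) \<times> box k (side k (1 / real (Suc i)) j)) \<alpha> \<le> 1)"
  proof -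
    have "countable ({2..k} \<rightarrow>\<^sub>E (\<rat> :: real set))" by (intro countable_PiE countable_rat) auto
    then show ?thesis
      unfolding AE_all_countable by (intro allI) (subst AE_ball_countable, simp, intro ballI AE_deviation_le_1[OF assms e r_def], simp)
  qed
  then have "AE \<alpha>\<in>({2..k} \<rightarrow>\<^sub>E {1/2..1}) in PiM {2..k} (\<lambda>_. lborel).
    \<forall>C>0. ((\<lambda>T. SUP (a, b)\<in>{(a, b). 0 < a \<and> a < b \<and> b \<le> C \<and> b - a > T powr (-\<rho>)}.
              ennreal \<bar>R k \<alpha> a b T / ((c k \<alpha>)\<^sup>2 * (b - a)) - 1\<bar>) \<longlongrightarrow> 0) at_top"
  proof (rule AE_mp, intro AE_I2 impI allI)
    fix \<alpha> and C :: real
    assume ev: "\<forall>i. \<forall>\<beta>\<in>({2..k} \<rightarrow>\<^sub>E \<rat>). \<alpha> \<in> ({2..k} \<rightarrow>\<^sub>E {1/2..1}) \<longrightarrow>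
     (\<forall>\<^sub>F j in sequentially. deviation k (side k (1 / real (Suc i)) j) e r (good k (side k (1 / real (Suc i)) j) e \<inter>
         lattice k \<beta> ((1 + 1 / real (Suc i)) ^ j) \<times> box k (side k (1 / real (Suc i)) j)) \<alpha> \<le> 1)"
      and \<alpha>: "\<alpha> \<in> ({2..k} \<rightarrow>\<^sub>E {1/2..1})" and C: "C > 0"
    show "((\<lambda>T. SUP (a, b)\<in>{(a, b). 0 < a \<and> a < b \<and> b \<le> C \<and> b - a > T powr (-\<rho>)}.
              ennreal \<bar>R k \<alpha> a b T / ((c k \<alpha>)\<^sup>2 * (b - a)) - 1\<bar>) \<longlongrightarrow> 0) at_top"
    proof (rule order_tendstoI)
      fix u :: ennreal assume "0 < u"
      then obtain z where z: "0 < z" "z < u" using dense by blast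
      then obtain \<epsilon> where \<epsilon>: "z = ennreal \<epsilon>" "0 \<le> \<epsilon>" by (cases z) auto
      then have "\<epsilon> > 0" using z by simp
      from R_uniform_asymptotic[OF assms r \<rho>_def \<alpha> _ C this, of e] ev \<alpha>
      have "\<forall>\<^sub>F T in at_top. \<forall>a b. 0 < a \<longrightarrow> a < b \<longrightarrow> b \<le> C \<longrightarrow> b - a > T powr (-\<rho>) \<longrightarrow>
         \<bar>R k \<alpha> a b T / ((c k \<alpha>)\<^sup>2 * (b - a)) - 1\<bar> \<le> \<epsilon>" by blast
      then show "\<forall>\<^sub>F T in at_top. (SUP (a, b)\<in>{(a, b). 0 < a \<and> a < b \<and> b \<le> C \<and> b - a > T powr (-\<rho>)}.
              ennreal \<bar>R k \<alpha> a b T / ((c k \<alpha>)\<^sup>2 * (b - a)) - 1\<bar>) < u"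
      proof (rule eventually_mono)
        fix T assume b: "\<forall>a b. 0 < a \<longrightarrow> a < b \<longrightarrow> b \<le> C \<longrightarrow> b - a > T powr (-\<rho>) \<longrightarrow>
         \<bar>R k \<alpha> a b T / ((c k \<alpha>)\<^sup>2 * (b - a)) - 1\<bar> \<le> \<epsilon>"
        have "(SUP (a, b)\<in>{(a, b). 0 < a \<and> a < b \<and> b \<le> C \<and> b - a > T powr (-\<rho>)}.
              ennreal \<bar>R k \<alpha> a b T / ((c k \<alpha>)\<^sup>2 * (b - a)) - 1\<bar>) \<le> ennreal \<epsilon>"
          using b by (intro SUP_least) (auto intro: ennreal_leI)
        then show "(SUP (a, b)\<in>{(a, b). 0 < a \<and> a < b \<and> b \<le> C \<and> b - a > T powr (-\<rho>)}.
              ennreal \<bar>R k \<alpha> a b T / ((c k \<alpha>)\<^sup>2 * (b - a)) - 1\<bar>) < u"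
          using z(2) unfolding \<epsilon>(1) by (rule le_less_trans)
      qed
    qed simp
  qed
  then show ?thesis using \<rho> by blast
qed

end
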